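(* The following is a complete list of the free and nearly free line arrangements with $d=5$ lines (i.e. every free or nearly free arrangement in $A(5)$ belongs to one of the sets below). (1) The set $A(5,11)$ is irreducible, 9-dimensional, and consists only of nearly free arrangements with exponents $d_1=2, d_2=3$. Any $f \in A(5,11)$ satisfies $st(f)=6$ and $reg(f)=5.$ (2) The set $A(5, 12)$ is irreducible, 8-dimensional, and consists only of free arrangements with exponents $d_1=d_2=2$. Any $f \in A(5,12)$ satisfies $st(f)=reg(f)=4.$ (3) The set $A(5, 13)$ is irreducible, 8-dimensional, and consists only of free arrangements with exponents $d_1=1, d_2=3$. Any $f \in A(5,13)$ satisfies $st(f)=reg(f)=5.$ (4) The set $A(5, 16)$ is irreducible, 7-dimensional, and consists only of free arrangements with exponents $d_1=0, d_2=4$. Any $f \in A(5,16)$ satisfies $st(f)=reg(f)=6.$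
   Context: $S=\mathbb{C}[x,y,z]$. $A(d)\subset\mathbb{P}(S_d)$ is the space of arrangements $\mathcal{A}:f=0$ of $d$ distinct lines in the complex projective plane ($f$ a product of $d$ pairwise non-proportional linear forms), with the Zariski topology; $A(d,\tau)$ is the subset of arrangements with total Tjurina number $\tau$, where for a line arrangement $\tau(f)=\sum_p(m_p-1)^2$, sum over the multiple points $p$, of multiplicity $m_p\ge 2$. $M(f)=S/(f_x,f_y,f_z)$ is the Milnor algebra, $st(f)=\min\{q:\dim M(f)_k=\tau(f)\text{ for all }k\ge q\}$, and $reg(f)$ is the Castelnuovo–Mumford regularity of $M(f)$ as a graded $S$-module. $AR(f)$ is the graded $S$-module of triples $(a,b,c)\in S^3$ with $af_x+bf_y+cf_z=0$. The arrangement is free with exponents $d_1\le d_2$ if $AR(f)\cong S(-d_1)\oplus S(-d_2)$, $0\le d_1\le d_2$. It is nearly free with exponents $d_1\le d_2$ if $M(f)$ has a minimal graded free resolution $$0 \to S(-d-d_2) \to S(-d-d_1+1) \oplus S^2(-d-d_2+1) \to S^3(-d+1) \xrightarrow{(f_x,f_y,f_z)} S$$ with $1\le d_1\le d_2$. *)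

theory Defs
  imports
    "HOL-Analysis.Analysis"
    "HOL-Library.Poly_Mapping"
    "HOL-Library.Extended_Nat"
    "HOL-Algebra.Module"
    "HOL-Algebra.QuotRing"
    "HOL-Algebra.Embedded_Algebras"
begin

section \<open>Polynomials\<close>

text \<open>Complex polynomials in variables indexed by \<open>'i\<close>: a monomial is its finitely supported
  exponent function, and the product of \<^theory>\<open>HOL-Library.Poly_Mapping\<close> is the polynomial product.
  The ring \<open>S = \<complex>[x,y,z]\<close> has the variables \<open>x = Var 1\<close>, \<open>y = Var 2\<close>, \<open>z = Var 3\<close>,
  matching the coordinates of \<^typ>\<open>complex^3\<close>.\<close>

type_synonym 'i mpoly = "('i \<Rightarrow>\<^sub>0 nat) \<Rightarrow>\<^sub>0 complex"
type_synonym S = "3 mpoly"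

definition Const :: "complex \<Rightarrow> 'i mpoly" where
  "Const c = Poly_Mapping.single 0 c"

definition Var :: "'i \<Rightarrow> 'i mpoly" where
  "Var i = Poly_Mapping.single (Poly_Mapping.single i 1) 1"

definition monom_eval :: "('i \<Rightarrow>\<^sub>0 nat) \<Rightarrow> ('i \<Rightarrow> complex) \<Rightarrow> complex" where
  "monom_eval m x = (\<Prod>i\<in>Poly_Mapping.keys m. x i ^ Poly_Mapping.lookup m i)"

definition mpoly_eval :: "'i mpoly \<Rightarrow> ('i \<Rightarrow> complex) \<Rightarrow> complex" where
  "mpoly_eval p x = (\<Sum>m\<in>Poly_Mapping.keys p. Poly_Mapping.lookup p m * monom_eval m x)"

text \<open>Partial derivative. The exponent subtraction is truncated only in terms with zero coefficient.\<close>

definition pd :: "'i \<Rightarrow> 'i mpoly \<Rightarrow> 'i mpoly" where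
  "pd i p = (\<Sum>m\<in>Poly_Mapping.keys p.
     Poly_Mapping.single (m - Poly_Mapping.single i 1)
       (of_nat (Poly_Mapping.lookup m i) * Poly_Mapping.lookup p m))"

definition monom_degree :: "('i \<Rightarrow>\<^sub>0 nat) \<Rightarrow> nat" where
  "monom_degree m = (\<Sum>i\<in>Poly_Mapping.keys m. Poly_Mapping.lookup m i)"

text \<open>The graded pieces, indexed by integers because of degree shifts; they are zero in negative
  degrees.\<close>

definition homogeneous :: "int \<Rightarrow> 'i mpoly set" where
  "homogeneous k = {p. \<forall>m\<in>Poly_Mapping.keys p. int (monom_degree m) = k}"


section \<open>Irreducibility and Krull dimension of topological spaces\<close>

definition irreducible_space :: "'a topology \<Rightarrow> bool" where
  "irreducible_space X \<longleftrightarrow> topspace X \<noteq> {} \<and>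
     (\<forall>A B. closedin X A \<and> closedin X B \<and> A \<union> B = topspace X \<longrightarrow> A = topspace X \<or> B = topspace X)"

text \<open>Supremum of the lengths \<open>n\<close> of chains \<open>Z\<^sub>0 \<subset> \<dots> \<subset> Z\<^sub>n\<close> of irreducible closed subsets
  (so the empty space gets the value 0).\<close>

definition krull_dim :: "'a topology \<Rightarrow> enat" where
  "krull_dim X = Sup {enat n | n. \<exists>Z :: nat \<Rightarrow> 'a set.
     (\<forall>i\<le>n. closedin X (Z i) \<and> irreducible_space (subtopology X (Z i))) \<and>
     (\<forall>i<n. Z i \<subset> Z (Suc i))}"


section \<open>The projective space of forms of degree d and its Zariski topology\<close>

definition proj_class :: "S \<Rightarrow> S set" where
  "proj_class f = {Const c * f | c. c \<noteq> 0}"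

definition proj_forms :: "nat \<Rightarrow> S set set" where
  "proj_forms d = proj_class ` (homogeneous (int d) - {0})"

text \<open>The homogeneous coordinates of a form are its coefficients, so equations on
  \<^term>\<open>proj_forms d\<close> are homogeneous polynomials in variables indexed by the monomials of \<open>S\<close>.
  Variables belonging to monomials of degree other than \<open>d\<close> evaluate to 0.\<close>

definition zero_locus :: "nat \<Rightarrow> (3 \<Rightarrow>\<^sub>0 nat) mpoly set \<Rightarrow> S set set" where
  "zero_locus d T = {P \<in> proj_forms d. \<forall>F\<in>T. \<forall>f\<in>P. mpoly_eval F (Poly_Mapping.lookup f) = 0}"

definition zariski :: "nat \<Rightarrow> S set topology" where
  "zariski d = topology (\<lambda>U. U \<subseteq> proj_forms d \<and>
     (\<exists>T. T \<subseteq> (\<Union>n. homogeneous n) \<and> proj_forms d - U = zero_locus d T))"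

text \<open>The predicate in \<open>zariski_def\<close> is indeed a topology, with the zero loci as closed sets.\<close>

lemma monom_eval_superset:
  assumes "finite A" "Poly_Mapping.keys m \<subseteq> A"
  shows "monom_eval m x = (\<Prod>i\<in>A. x i ^ Poly_Mapping.lookup m i)"
  unfolding monom_eval_def
  by (rule prod.mono_neutral_left) (use assms in \<open>auto simp: in_keys_iff\<close>)

lemma monom_eval_add: "monom_eval (m + n) x = monom_eval m x * monom_eval n x"
proof -
  let ?A = "Poly_Mapping.keys m \<union> Poly_Mapping.keys n"
  have "monom_eval (m + n) x = (\<Prod>i\<in>?A. x i ^ Poly_Mapping.lookup (m + n) i)"
    by (rule monom_eval_superset) (use Poly_Mapping.keys_add[of m n] in auto)
  also have "\<dots> = (\<Prod>i\<in>?A. x i ^ Poly_Mapping.lookup m i) * (\<Prod>i\<in>?A. x i ^ Poly_Mapping.lookup n i)"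
    by (simp add: lookup_add power_add prod.distrib)
  finally show ?thesis
    by (simp add: monom_eval_superset[of ?A])
qed

lemma mpoly_eval_zero [simp]: "mpoly_eval 0 x = 0"
  by (simp add: mpoly_eval_def)

lemma mpoly_eval_add: "mpoly_eval (p + q) x = mpoly_eval p x + mpoly_eval q x"
  unfolding mpoly_eval_def
  by (rule setsum_keys_plus_distrib[where f = "\<lambda>m c. c * monom_eval m x"])
    (simp_all add: distrib_right)

lemma mpoly_eval_sum: "mpoly_eval (sum p A) x = (\<Sum>a\<in>A. mpoly_eval (p a) x)"
  by (induction A rule: infinite_finite_induct) (simp_all add: mpoly_eval_add)

lemma mpoly_eval_single: "mpoly_eval (Poly_Mapping.single m c) x = c * monom_eval m x"
  by (simp add: mpoly_eval_def)

lemma mpoly_sum_monomials: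
  "p = (\<Sum>m\<in>Poly_Mapping.keys p. Poly_Mapping.single m (Poly_Mapping.lookup p m))"
  by (rule poly_mapping_eqI)
    (simp add: lookup_sum lookup_single when_def sum.delta in_keys_iff)

lemma mpoly_eval_mult: "mpoly_eval (p * q) x = mpoly_eval p x * mpoly_eval q x"
proof -
  have "p * q = (\<Sum>m\<in>Poly_Mapping.keys p. \<Sum>n\<in>Poly_Mapping.keys q.
      Poly_Mapping.single (m + n) (Poly_Mapping.lookup p m * Poly_Mapping.lookup q n))"
    using arg_cong2[OF mpoly_sum_monomials[of p] mpoly_sum_monomials[of q], of "(*)"]
    by (simp only: sum_product mult_single)
  then show ?thesis
    by (simp add: mpoly_eval_sum mpoly_eval_single monom_eval_add)
      (simp add: mpoly_eval_def sum_product ac_simps)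
qed

lemma monom_degree_superset:
  assumes "finite A" "Poly_Mapping.keys m \<subseteq> A"
  shows "monom_degree m = (\<Sum>i\<in>A. Poly_Mapping.lookup m i)"
  unfolding monom_degree_def
  by (rule sum.mono_neutral_left) (use assms in \<open>auto simp: in_keys_iff\<close>)

lemma monom_degree_add: "monom_degree (m + n) = monom_degree m + monom_degree n"
proof -
  let ?A = "Poly_Mapping.keys m \<union> Poly_Mapping.keys n"
  have "monom_degree (m + n) = (\<Sum>i\<in>?A. Poly_Mapping.lookup (m + n) i)"
    by (rule monom_degree_superset) (use Poly_Mapping.keys_add[of m n] in auto)
  then show ?thesis
    by (simp add: lookup_add sum.distrib monom_degree_superset[of ?A])
qed

lemma homogeneous_mult:
  assumes "p \<in> homogeneous k" "q \<in> homogeneous l"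
  shows "p * q \<in> homogeneous (k + l)"
  unfolding homogeneous_def
proof clarify
  fix m assume "m \<in> Poly_Mapping.keys (p * q)"
  then obtain a b where "m = a + b" "a \<in> Poly_Mapping.keys p" "b \<in> Poly_Mapping.keys q"
    using keys_mult[of p q] by auto
  then show "int (monom_degree m) = k + l"
    using assms by (auto simp: homogeneous_def monom_degree_add)
qed

lemma monom_eval_scale: "monom_eval m (\<lambda>i. c * x i) = c ^ monom_degree m * monom_eval m x"
  by (simp add: monom_eval_def monom_degree_def power_mult_distrib prod.distrib power_sum)

lemma mpoly_eval_scale:
  assumes "F \<in> homogeneous k"
  shows "mpoly_eval F (\<lambda>i. c * x i) = c ^ nat k * mpoly_eval F x"
proof -
  have "monom_degree m = nat k" if "m \<in> Poly_Mapping.keys F" for m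
    using that assms by (auto simp: homogeneous_def)
  then show ?thesis
    by (auto simp: mpoly_eval_def monom_eval_scale sum_distrib_left intro!: sum.cong)
qed

lemma lookup_Const_mult:
  "Poly_Mapping.lookup (Const c * f) = (\<lambda>m. c * Poly_Mapping.lookup f m)"
proof
  fix m
  have "Const c * f =
      (\<Sum>n\<in>Poly_Mapping.keys f. Poly_Mapping.single n (c * Poly_Mapping.lookup f n))"
    using arg_cong[OF mpoly_sum_monomials[of f], of "(*) (Const c)"]
    by (simp only: Const_def sum_distrib_left mult_single add_0_left)
  then show "Poly_Mapping.lookup (Const c * f) m = c * Poly_Mapping.lookup f m"
    by (simp add: lookup_sum lookup_single when_def sum.delta in_keys_iff)
qed

lemma mpoly_eval_proj_class:
  assumes "F \<in> homogeneous k"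
  shows "(\<forall>g\<in>proj_class f. mpoly_eval F (Poly_Mapping.lookup g) = 0) \<longleftrightarrow>
    mpoly_eval F (Poly_Mapping.lookup f) = 0"
proof -
  have *: "mpoly_eval F (Poly_Mapping.lookup (Const c * f)) =
      c ^ nat k * mpoly_eval F (Poly_Mapping.lookup f)" for c
    using mpoly_eval_scale[OF assms, of c "Poly_Mapping.lookup f"] by (simp add: lookup_Const_mult)
  have "mpoly_eval F (Poly_Mapping.lookup f) = 0"
    if "\<forall>g\<in>proj_class f. mpoly_eval F (Poly_Mapping.lookup g) = 0"
    using that *[of 1] by (auto simp: proj_class_def dest!: spec[of _ "Const 1 * f"])
  then show ?thesis
    using * by (auto simp: proj_class_def)
qed

lemma homogeneous_products:
  assumes "T \<subseteq> (\<Union>n. homogeneous n)" "T' \<subseteq> (\<Union>n. homogeneous n)"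
  shows "{F * G | F G. F \<in> T \<and> G \<in> T'} \<subseteq> (\<Union>n. homogeneous n)"
proof clarify
  fix F G assume "F \<in> T" "G \<in> T'"
  then have "F \<in> (\<Union>n. homogeneous n)" "G \<in> (\<Union>n. homogeneous n)"
    using assms by (auto dest: subsetD)
  then obtain k l where "F \<in> homogeneous k" "G \<in> homogeneous l"
    by (auto elim!: UN_E)
  then show "F * G \<in> (\<Union>n. homogeneous n)"
    using homogeneous_mult by blast
qed

lemma zero_locus_Un:
  assumes "T \<subseteq> (\<Union>n. homogeneous n)" "T' \<subseteq> (\<Union>n. homogeneous n)"
  shows "zero_locus d T \<union> zero_locus d T' = zero_locus d {F * G | F G. F \<in> T \<and> G \<in> T'}"
proof -
  have *: "proj_class f \<in> zero_locus d T \<union> zero_locus d T' \<longleftrightarrow>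
      proj_class f \<in> zero_locus d {F * G | F G. F \<in> T \<and> G \<in> T'}"
    if "proj_class f \<in> proj_forms d" for f
  proof -
    let ?Z = "\<lambda>F. mpoly_eval F (Poly_Mapping.lookup f) = 0"
    have char: "proj_class f \<in> zero_locus d U \<longleftrightarrow> (\<forall>F\<in>U. ?Z F)"
      if "U \<subseteq> (\<Union>n. homogeneous n)" for U
    proof -
      have "(\<forall>g\<in>proj_class f. mpoly_eval F (Poly_Mapping.lookup g) = 0) \<longleftrightarrow> ?Z F" if "F \<in> U" for F
        using that \<open>U \<subseteq> _\<close> mpoly_eval_proj_class by blast
      then show ?thesis
        using \<open>proj_class f \<in> proj_forms d\<close> by (auto simp: zero_locus_def)
    qed
    have "{F * G | F G. F \<in> T \<and> G \<in> T'} \<subseteq> (\<Union>n. homogeneous n)"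
      using assms by (rule homogeneous_products)
    note c = char[OF assms(1)] char[OF assms(2)] char[OF this]
    have "(\<forall>H\<in>{F * G | F G. F \<in> T \<and> G \<in> T'}. ?Z H) \<longleftrightarrow> (\<forall>F\<in>T. \<forall>G\<in>T'. ?Z (F * G))"
      by blast
    then show ?thesis
      unfolding Un_iff c by (auto simp: mpoly_eval_mult)
  qed
  show ?thesis
  proof (rule Set.set_eqI)
    fix P
    have "P \<in> zero_locus d U \<Longrightarrow> P \<in> proj_class ` UNIV \<inter> proj_forms d" for U
      by (auto simp: zero_locus_def proj_forms_def)
    then show "P \<in> zero_locus d T \<union> zero_locus d T' \<longleftrightarrow>
        P \<in> zero_locus d {F * G | F G. F \<in> T \<and> G \<in> T'}"
      using * by blast
  qed
qed

lemma istopology_zariski: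
  "istopology (\<lambda>U. U \<subseteq> proj_forms d \<and>
     (\<exists>T. T \<subseteq> (\<Union>n. homogeneous n) \<and> proj_forms d - U = zero_locus d T))"
  (is "istopology ?open")
  unfolding istopology_def
proof (intro conjI allI impI)
  fix U V assume U: "?open U" and V: "?open V"
  obtain T T' where T: "T \<subseteq> (\<Union>n. homogeneous n)" "proj_forms d - U = zero_locus d T"
    and T': "T' \<subseteq> (\<Union>n. homogeneous n)" "proj_forms d - V = zero_locus d T'"
    using U V by blast
  have "proj_forms d - U \<inter> V = zero_locus d {F * G | F G. F \<in> T \<and> G \<in> T'}"
    using zero_locus_Un[OF T(1) T'(1), of d] T(2) T'(2) by blast
  moreover have "{F * G | F G. F \<in> T \<and> G \<in> T'} \<subseteq> (\<Union>n. homogeneous n)"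
    using T(1) T'(1) by (rule homogeneous_products)
  ultimately show "\<exists>T. T \<subseteq> (\<Union>n. homogeneous n) \<and> proj_forms d - U \<inter> V = zero_locus d T"
    by blast
  show "U \<inter> V \<subseteq> proj_forms d"
    using U by blast
next
  fix \<U> assume \<U>: "\<forall>U\<in>\<U>. ?open U"
  show "\<Union>\<U> \<subseteq> proj_forms d"
    using \<U> by blast
  obtain T where T: "\<And>U. U \<in> \<U> \<Longrightarrow> T U \<subseteq> (\<Union>n. homogeneous n) \<and> proj_forms d - U = zero_locus d (T U)"
    using \<U> by metis
  have "zero_locus d (\<Union>(T ` \<U>)) = proj_forms d \<inter> (\<Inter>U\<in>\<U>. zero_locus d (T U))"
    by (auto simp: zero_locus_def)
  also have "\<dots> = proj_forms d \<inter> (\<Inter>U\<in>\<U>. proj_forms d - U)"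
    using T by simp
  also have "\<dots> = proj_forms d - \<Union>\<U>"
    by auto
  finally have "proj_forms d - \<Union>\<U> = zero_locus d (\<Union>(T ` \<U>))"
    by (rule sym)
  moreover have "\<Union>(T ` \<U>) \<subseteq> (\<Union>n. homogeneous n)"
    by (rule UN_least) (use T in blast)
  ultimately show "\<exists>T. T \<subseteq> (\<Union>n. homogeneous n) \<and> proj_forms d - \<Union>\<U> = zero_locus d T"
    by blast
qed

lemma openin_zariski:
  "openin (zariski d) U \<longleftrightarrow> U \<subseteq> proj_forms d \<and>
     (\<exists>T. T \<subseteq> (\<Union>n. homogeneous n) \<and> proj_forms d - U = zero_locus d T)"
  unfolding zariski_def by (subst topology_inverse'[OF istopology_zariski]) (rule refl)

lemma topspace_zariski: "topspace (zariski d) = proj_forms d"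
proof -
  have "openin (zariski d) (proj_forms d)"
  proof -
    have "1 \<in> (homogeneous 0 :: (3 \<Rightarrow>\<^sub>0 nat) mpoly set)"
      by (simp add: homogeneous_def monom_degree_def)
    moreover have "zero_locus d {1} = {}"
      by (auto simp: zero_locus_def proj_forms_def proj_class_def mpoly_eval_def monom_eval_def
          intro: exI[of _ 1])
    ultimately have "{1} \<subseteq> (\<Union>n. homogeneous n :: (3 \<Rightarrow>\<^sub>0 nat) mpoly set) \<and>
        proj_forms d - proj_forms d = zero_locus d {1}"
      by auto
    then show ?thesis
      unfolding openin_zariski by (meson order_refl)
  qed
  then have "proj_forms d \<subseteq> topspace (zariski d)"
    by (rule openin_subset)
  moreover have "topspace (zariski d) \<subseteq> proj_forms d"
    using openin_zariski[of d "topspace (zariski d)"] by simp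
  ultimately show ?thesis
    by simp
qed


section \<open>Line arrangements\<close>

definition linear_form :: "complex^3 \<Rightarrow> S" where
  "linear_form a = (\<Sum>i\<in>UNIV. Const (a $ i) * Var i)"

text \<open>\<open>f\<close> is a product of \<open>d\<close> nonzero pairwise non-proportional linear forms.\<close>

definition arrangement_poly :: "nat \<Rightarrow> S \<Rightarrow> bool" where
  "arrangement_poly d f \<longleftrightarrow> (\<exists>a :: nat \<Rightarrow> complex^3.
     f = (\<Prod>i<d. linear_form (a i)) \<and> (\<forall>i<d. a i \<noteq> 0) \<and>
     (\<forall>i<d. \<forall>j<d. i \<noteq> j \<longrightarrow> (\<forall>c. a i \<noteq> c *s a j)))"

definition points :: "(complex^3) set set" where
  "points = {{c *s v | c. c \<noteq> 0} | v. v \<noteq> 0}"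

definition line :: "complex^3 \<Rightarrow> (complex^3) set set" where
  "line a = {P \<in> points. \<forall>v\<in>P. mpoly_eval (linear_form a) (($) v) = 0}"

definition lines_of :: "S \<Rightarrow> (complex^3) set set set" where
  "lines_of f = {line a | a. a \<noteq> 0 \<and> linear_form a dvd f}"

definition multiplicity_at :: "S \<Rightarrow> (complex^3) set \<Rightarrow> nat" where
  "multiplicity_at f P = card {L \<in> lines_of f. P \<in> L}"

definition tjurina :: "S \<Rightarrow> nat" where
  "tjurina f = (\<Sum>P\<in>{P \<in> points. 2 \<le> multiplicity_at f P}. (multiplicity_at f P - 1)\<^sup>2)"

definition arrangements :: "nat \<Rightarrow> S set set" where
  "arrangements d = {proj_class f | f. arrangement_poly d f}"

definition arrangements_tau :: "nat \<Rightarrow> nat \<Rightarrow> S set set" where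
  "arrangements_tau d \<tau> = {proj_class f | f. arrangement_poly d f \<and> tjurina f = \<tau>}"


section \<open>Graded modules over S\<close>

definition S_ring :: "S ring" where
  "S_ring = \<lparr>carrier = UNIV, mult = (*), one = 1, zero = 0, add = (+)\<rparr>"

record 'b graded_module = "(S, 'b) module" +
  piece :: "int \<Rightarrow> 'b set"

text \<open>Homomorphisms are homogeneous of degree 0.\<close>

definition graded_hom :: "'b graded_module \<Rightarrow> 'c graded_module \<Rightarrow> ('b \<Rightarrow> 'c) set" where
  "graded_hom M N = {\<phi> \<in> carrier M \<rightarrow> carrier N.
     (\<forall>u\<in>carrier M. \<forall>v\<in>carrier M. \<phi> (u \<oplus>\<^bsub>M\<^esub> v) = \<phi> u \<oplus>\<^bsub>N\<^esub> \<phi> v) \<and>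
     (\<forall>r. \<forall>v\<in>carrier M. \<phi> (r \<odot>\<^bsub>M\<^esub> v) = r \<odot>\<^bsub>N\<^esub> \<phi> v) \<and>
     (\<forall>k. \<phi> ` piece M k \<subseteq> piece N k)}"

definition graded_iso :: "'b graded_module \<Rightarrow> 'c graded_module \<Rightarrow> bool" where
  "graded_iso M N \<longleftrightarrow> (\<exists>\<phi>\<in>graded_hom M N. bij_betw \<phi> (carrier M) (carrier N))"

text \<open>\<open>free_mod [b\<^sub>1, \<dots>, b\<^sub>n]\<close> is \<open>S(-b\<^sub>1) \<oplus> \<dots> \<oplus> S(-b\<^sub>n)\<close>, where \<open>S(-b)\<^sub>k = S\<^bsub>k-b\<^esub>\<close>. Vectors are
  functions vanishing from index \<open>n\<close> on. The ring multiplication and unit that the record type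
  inherits play no role for modules and are left undefined.\<close>

definition free_mod :: "int list \<Rightarrow> (nat \<Rightarrow> S) graded_module" where
  "free_mod bs =
    \<lparr>carrier = {v. \<forall>i\<ge>length bs. v i = 0}, mult = undefined, one = undefined,
     zero = (\<lambda>_. 0), add = (\<lambda>u v i. u i + v i), smult = (\<lambda>r v i. r * v i),
     piece = (\<lambda>k. {v. (\<forall>i\<ge>length bs. v i = 0) \<and>
       (\<forall>i<length bs. v i \<in> homogeneous (k - bs ! i))})\<rparr>"

text \<open>A resolution \<open>\<dots> \<rightarrow> F\<^sub>1 \<rightarrow> F\<^sub>0 \<rightarrow> M \<rightarrow> 0\<close> by finitely generated graded free modules, where \<open>F\<^sub>i\<close> is
  given by its list of shifts \<open>F i\<close>, the map \<open>F\<^sub>i\<^sub>+\<^sub>1 \<rightarrow> F\<^sub>i\<close> is \<open>\<phi> i\<close> and the augmentation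
  \<open>F\<^sub>0 \<rightarrow> M\<close> is \<open>\<epsilon>\<close>. Finite length is no restriction on minimal resolutions, by Hilbert's syzygy
  theorem.\<close>

definition graded_free_resolution ::
  "'b graded_module \<Rightarrow> (nat \<Rightarrow> int list) \<Rightarrow> (nat \<Rightarrow> (nat \<Rightarrow> S) \<Rightarrow> (nat \<Rightarrow> S)) \<Rightarrow>
   ((nat \<Rightarrow> S) \<Rightarrow> 'b) \<Rightarrow> bool" where
  "graded_free_resolution M F \<phi> \<epsilon> \<longleftrightarrow>
     (\<exists>n. \<forall>i>n. F i = []) \<and>
     \<epsilon> \<in> graded_hom (free_mod (F 0)) M \<and>
     (\<forall>i. \<phi> i \<in> graded_hom (free_mod (F (Suc i))) (free_mod (F i))) \<and>
     \<epsilon> ` carrier (free_mod (F 0)) = carrier M \<and>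
     {v \<in> carrier (free_mod (F 0)). \<epsilon> v = \<zero>\<^bsub>M\<^esub>} = \<phi> 0 ` carrier (free_mod (F 1)) \<and>
     (\<forall>i. {v \<in> carrier (free_mod (F (Suc i))). \<phi> i v = \<zero>\<^bsub>free_mod (F i)\<^esub>} =
        \<phi> (Suc i) ` carrier (free_mod (F (Suc (Suc i)))))"

text \<open>Minimality: the image of each \<open>\<phi> i\<close> lies in \<open>(x,y,z) F\<^sub>i\<close>, i.e. its vectors have entries without
  constant term.\<close>

definition minimal_resolution ::
  "'b graded_module \<Rightarrow> (nat \<Rightarrow> int list) \<Rightarrow> (nat \<Rightarrow> (nat \<Rightarrow> S) \<Rightarrow> (nat \<Rightarrow> S)) \<Rightarrow>
   ((nat \<Rightarrow> S) \<Rightarrow> 'b) \<Rightarrow> bool" where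
  "minimal_resolution M F \<phi> \<epsilon> \<longleftrightarrow> graded_free_resolution M F \<phi> \<epsilon> \<and>
     (\<forall>i. \<forall>v\<in>carrier (free_mod (F (Suc i))). \<forall>j. Poly_Mapping.lookup (\<phi> i v j) 0 = 0)"

text \<open>Castelnuovo--Mumford regularity of a nonzero finitely generated graded module: the maximum of
  \<open>b\<^sub>i\<^sub>j - i\<close> over the shifts \<open>b\<^sub>i\<^sub>j\<close> of its minimal graded free resolution, which is unique up to
  isomorphism.\<close>

definition cm_regularity :: "'b graded_module \<Rightarrow> int" where
  "cm_regularity M = (THE r. \<exists>F \<phi> \<epsilon>. minimal_resolution M F \<phi> \<epsilon> \<and>
     r = Max {b - int i | i b. b \<in> set (F i)})"


section \<open>Milnor algebra and Jacobian syzygies\<close>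

definition jacobian_ideal :: "S \<Rightarrow> S set" where
  "jacobian_ideal f = Idl\<^bsub>S_ring\<^esub> {pd 1 f, pd 2 f, pd 3 f}"

text \<open>The quotient ring, viewed also as a graded \<open>S\<close>-module.\<close>

definition milnor :: "S \<Rightarrow> S set graded_module" where
  "milnor f = (let J = jacobian_ideal f; Q = S_ring Quot J in
    \<lparr>carrier = carrier Q, mult = mult Q, one = one Q, zero = zero Q, add = add Q,
     smult = (\<lambda>r X. (J +>\<^bsub>S_ring\<^esub> r) \<otimes>\<^bsub>Q\<^esub> X),
     piece = (\<lambda>k. (\<lambda>p. J +>\<^bsub>S_ring\<^esub> p) ` homogeneous k)\<rparr>)"

definition milnor_proj :: "S \<Rightarrow> S \<Rightarrow> S set" where
  "milnor_proj f p = jacobian_ideal f +>\<^bsub>S_ring\<^esub> p"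

text \<open>The dimension is taken over the copy of \<open>\<complex>\<close> inside the Milnor algebra.\<close>

definition milnor_st :: "S \<Rightarrow> nat" where
  "milnor_st f = (LEAST q. \<forall>k\<ge>q. ring.dimension (milnor f) (tjurina f)
     (milnor_proj f ` range Const) (piece (milnor f) (int k)))"

definition milnor_reg :: "S \<Rightarrow> int" where
  "milnor_reg f = cm_regularity (milnor f)"

definition AR :: "S \<Rightarrow> (S^3) graded_module" where
  "AR f =
    \<lparr>carrier = {r. r $ 1 * pd 1 f + r $ 2 * pd 2 f + r $ 3 * pd 3 f = 0},
     mult = undefined, one = undefined, zero = 0, add = (+), smult = (*s),
     piece = (\<lambda>k. {r. r $ 1 * pd 1 f + r $ 2 * pd 2 f + r $ 3 * pd 3 f = 0 \<and>
       (\<forall>i. r $ i \<in> homogeneous k)})\<rparr>"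

definition free_arrangement :: "nat \<Rightarrow> nat \<Rightarrow> S \<Rightarrow> bool" where
  "free_arrangement d1 d2 f \<longleftrightarrow> d1 \<le> d2 \<and> graded_iso (AR f) (free_mod [int d1, int d2])"

definition nearly_free_shifts :: "int \<Rightarrow> int \<Rightarrow> int \<Rightarrow> nat \<Rightarrow> int list" where
  "nearly_free_shifts d d1 d2 i =
    (if i = 0 then [0]
     else if i = 1 then [d - 1, d - 1, d - 1]
     else if i = 2 then [d + d1 - 1, d + d2 - 1, d + d2 - 1]
     else if i = 3 then [d + d2]
     else [])"

text \<open>The first argument is the degree \<open>d\<close> of \<open>f\<close>. The maps \<open>S\<^sup>3(-d+1) \<rightarrow> S \<rightarrow> M(f)\<close> are prescribed to
  be \<open>(f\<^sub>x, f\<^sub>y, f\<^sub>z)\<close> and the projection.\<close>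

definition nearly_free_arrangement :: "nat \<Rightarrow> nat \<Rightarrow> nat \<Rightarrow> S \<Rightarrow> bool" where
  "nearly_free_arrangement d d1 d2 f \<longleftrightarrow> 1 \<le> d1 \<and> d1 \<le> d2 \<and>
     (\<exists>\<phi>. minimal_resolution (milnor f) (nearly_free_shifts (int d) (int d1) (int d2)) \<phi>
            (\<lambda>v. milnor_proj f (v 0)) \<and>
          (\<forall>v\<in>carrier (free_mod [int d - 1, int d - 1, int d - 1]).
             \<phi> 0 v 0 = v 0 * pd 1 f + v 1 * pd 2 f + v 2 * pd 3 f))"

end

theory Submission
	imports Defs "HOL-Library.Function_Algebras"
begin

text \<open>Let \<open>f\<close> be a product of five linear forms. A triple \<open>r\<close> of polynomials is a Jacobian syzygy iff the
	derivation with these components annihilates \<open>f\<close>, and by \<open>Der_prod_eq_0_iff\<close> this means that the derivation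
	multiplies every one of the five forms by a polynomial and that the five factors add up to zero. Concurrent
	lines are linearly dependent covectors, and each dependence restricts the factors through a Koszul
	relation (\<open>concurrent_syzygy\<close>).

	Up to the numbering there are only five combinatorial types of five lines (\<open>classification\<close>), and counting
	each point with \<open>(m - 1)\<^sup>2\<close> gives them the distinct total Tjurina numbers 16 (pencil), 13 (quadruple point),
	12 (two triple points), 11 (one triple point) and 10 (double points only). For the first three, solving the
	conditions on the factors produces a basis of the syzygies with exponents 0 and 4, 1 and 3, 2 and 2; for
	one triple point it produces generators of degrees 2, 3, 3 with one relation. With only double points
	there is no syzygy of degree less than three, but four independent ones of degree three
	(\<open>generic_low\<close>, \<open>generic_cubics\<close>). A free or nearly free arrangement has at most three generating syzygies, so
	this type is excluded, and the list is complete.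

	In the other types the syzygies give an explicit minimal free resolution of the Milnor algebra. The regularity
	is read off from its shifts, which are well defined because minimal resolutions are unique up to isomorphism
	(\<open>minimal_shifts_subset\<close>), and the Hilbert function is an alternating sum of binomial coefficients, which
	yields the stability threshold.

	Each type is the image of an open set of a space of covectors and coefficients. Hence it is irreducible
	(\<open>irreducible_image\<close>). Normalising the covectors leaves \<open>n\<close> affine parameters with \<open>n\<close> = 7, 8, 8, 9, and \<open>n\<close> is the
	dimension: a longer chain of irreducible sets would give more algebraically independent polynomials than
	there are parameters (\<open>chain_independent\<close>, \<open>krull_dim_upper\<close>), and releasing the parameters one by one gives a
	chain of length \<open>n\<close> (\<open>krull_dim_lower\<close>).\<close>

section \<open>The polynomial ring\<close>

abbreviation lk :: "('a \<Rightarrow>\<^sub>0 'b::zero) => 'a => 'b" where "lk \<equiv> Poly_Mapping.lookup"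

abbreviation psingle :: "'a => 'b => 'a \<Rightarrow>\<^sub>0 'b::zero" where
	"psingle \<equiv> Poly_Mapping.single"

abbreviation homog :: "int => 'i mpoly set" where
	"homog \<equiv> homogeneous"

abbreviation FM :: "int list => (nat => S) set" where
	"FM bs \<equiv> carrier (free_mod bs)"

abbreviation zar :: "nat => S set set => S set topology" where
	"zar d \<equiv> subtopology (zariski d)"

lemma lookup_Const: "lk (Const c) m = (if m = 0 then c else 0)"
	by (auto simp: Const_def lookup_single when_def)

lemma Const_0 [simp]: "Const 0 = 0" and Const_1 [simp]: "Const 1 = 1"
	by (auto simp: Const_def)

lemma Const_add: "Const (a + b) = Const a + Const b"
	and Const_diff: "Const (a - b) = Const a - Const b"
	and Const_uminus: "Const (- a) = - Const a"
	by (auto simp: Const_def single_add single_diff single_uminus)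

lemma Const_mult: "Const (a * b) = Const a * Const b"
	by (simp add: Const_def mult_single)

lemma Const_eq_iff [simp]: "Const a = Const b \<longleftrightarrow> a = b"
	by (metis lookup_Const)

lemma Const_eq_0_iff [simp]: "Const a = 0 \<longleftrightarrow> a = 0"
	using Const_eq_iff[of a 0] by simp

lemma Const_inverse_mult [simp]: "a \<noteq> 0 ==> Const a * (Const (inverse a) * p) = p"
	"a \<noteq> 0 ==> Const (inverse a) * (Const a * p) = p"
	by (simp_all flip: mult.assoc Const_mult)

lemma Const_mult_cancel: "a \<noteq> 0 ==> Const a * p = Const a * q \<longleftrightarrow> p = q"
	by (metis Const_inverse_mult(2))

lemma Const_numeral: "Const (numeral k) = numeral k"
	by (induction k) (simp_all only: numeral.simps Const_add Const_1)

lemma lookup_single_mult: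
	"lk (psingle k (c::complex) * p) n = (if \<exists>m. n = k + m then c * lk p (n - k) else 0)"
	for k :: "'i \<Rightarrow>\<^sub>0 nat"
proof -
	have "psingle k c * p = (\<Sum>m\<in>Poly_Mapping.keys p. psingle (k + m) (c * lk p m))"
		using arg_cong[OF mpoly_sum_monomials[of p], of "(*) (psingle k c)"]
		by (simp only: sum_distrib_left mult_single)
	then have *: "lk (psingle k c * p) n = (\<Sum>m\<in>Poly_Mapping.keys p. if k + m = n then c * lk p m else 0)"
		by (simp add: lookup_sum lookup_single when_def)
	show ?thesis
	proof (cases "\<exists>m. n = k + m")
		case True
		then obtain m0 where m0: "n = k + m0" by blast
		have "(\<Sum>m\<in>Poly_Mapping.keys p. if k + m = n then c * lk p m else 0)
			= (\<Sum>m\<in>Poly_Mapping.keys p. if m0 = m then c * lk p m else 0)"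
			by (rule sum.cong) (auto simp: m0)
		then show ?thesis using True unfolding *
			by (auto simp: m0 sum.delta in_keys_iff)
	qed (auto simp: * intro!: sum.neutral)
qed

lemma monom_split:
	fixes n :: "'i \<Rightarrow>\<^sub>0 nat"
	shows "(\<exists>m. n = psingle i 1 + m) \<longleftrightarrow> lk n i \<noteq> 0"
proof
	assume "lk n i \<noteq> 0"
	then have "n = psingle i 1 + (n - psingle i 1)"
		by (intro poly_mapping_eqI) (auto simp: lookup_add lookup_minus lookup_single when_def)
	then show "\<exists>m. n = psingle i 1 + m" by blast
qed (auto simp: lookup_add)

lemma lookup_Var_mult:
	"lk (Var i * p) n = (if lk n i = 0 then 0 else lk p (n - psingle i 1))"
	unfolding Var_def lookup_single_mult monom_split by auto

lemma mpoly_induct [case_names Const add Var]: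
	assumes C: "\<And>c. P (Const c)" and A: "\<And>p q. P p ==> P q ==> P (p + q)"
		and V: "\<And>i p. P p ==> P (Var i * p)"
	shows "P p"
proof -
	have mon: "P (psingle m c)" for m c
	proof (induction "monom_degree m" arbitrary: m)
		case 0
		then have "m = 0"
			by (intro poly_mapping_eqI) (auto simp: monom_degree_def in_keys_iff)
		then show ?case using C by (simp add: Const_def)
	next
		case (Suc d)
		then have "\<exists>i\<in>Poly_Mapping.keys m. lk m i \<noteq> 0"
			unfolding monom_degree_def by (metis Zero_not_Suc sum.neutral)
		then obtain i where i: "lk m i \<noteq> 0" by blast
		obtain n where n: "m = psingle i 1 + n" using iffD2[OF monom_split i] ..
		have "monom_degree (psingle i 1) = 1" by (simp add: monom_degree_def)
		then have "d = monom_degree n" using Suc(2) unfolding n monom_degree_add by linarith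
		then have "P (Var i * psingle n c)" using Suc(1) V by blast
		then show ?case unfolding n Var_def mult_single by simp
	qed
	have "P (\<Sum>m\<in>A. psingle m (lk p m))" if "finite A" for A
		using that by induction (use C[of 0] mon A in auto)
	then show ?thesis using mpoly_sum_monomials[of p] by (metis finite_keys)
qed

lemma mpoly_eval_Const [simp]: "mpoly_eval (Const c) x = c"
	by (simp add: Const_def mpoly_eval_single monom_eval_def)

lemma mpoly_eval_1 [simp]: "mpoly_eval 1 x = 1"
	using mpoly_eval_Const[of 1 x] by simp

lemma mpoly_eval_Var [simp]: "mpoly_eval (Var i) x = x i"
	by (simp add: Var_def mpoly_eval_single monom_eval_def)

lemma mpoly_eval_uminus: "mpoly_eval (- p) x = - mpoly_eval p x"
	using mpoly_eval_add[of p "- p" x] by (simp add: eq_neg_iff_add_eq_0 add.commute)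

lemma mpoly_eval_diff: "mpoly_eval (p - q) x = mpoly_eval p x - mpoly_eval q x"
	using mpoly_eval_add[of p "- q" x] by (simp add: mpoly_eval_uminus)

lemma mpoly_eval_prod: "mpoly_eval (prod p A) x = (\<Prod>a\<in>A. mpoly_eval (p a) x)"
	by (induction A rule: infinite_finite_induct) (simp_all add: mpoly_eval_mult)

lemma mpoly_eval_power: "mpoly_eval (p ^ n) x = mpoly_eval p x ^ n"
	by (induction n) (simp_all add: mpoly_eval_mult)

lemmas mpoly_eval_simps = mpoly_eval_add mpoly_eval_mult mpoly_eval_uminus mpoly_eval_diff

subsection \<open>Homogeneous components\<close>

lemma homogeneous_iff: "p \<in> homog k \<longleftrightarrow> (\<forall>m. lk p m \<noteq> 0 --> int (monom_degree m) = k)"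
	by (auto simp: homogeneous_def in_keys_iff)

lemma homogeneous_0 [simp]: "0 \<in> homog k"
	by (simp add: homogeneous_iff)

lemma homogeneous_add: "p \<in> homog k ==> q \<in> homog k ==> p + q \<in> homog k"
	unfolding homogeneous_iff lookup_add by (metis add.right_neutral)

lemma homogeneous_uminus: "p \<in> homog k ==> - p \<in> homog k"
	by (auto simp: homogeneous_iff)

lemma homogeneous_diff: "p \<in> homog k ==> q \<in> homog k ==> p - q \<in> homog k"
	unfolding homogeneous_iff lookup_minus by (metis diff_0_right)

lemma homogeneous_sum: "(\<And>x. x \<in> A ==> p x \<in> homog k) ==> sum p A \<in> homog k"
	by (induction A rule: infinite_finite_induct) (auto intro: homogeneous_add)

lemma homogeneous_Const [simp]: "Const c \<in> homog 0"
	by (auto simp: homogeneous_iff lookup_Const monom_degree_def)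

lemma homogeneous_Const_mult: "p \<in> homog k ==> Const c * p \<in> homog k"
	using homogeneous_mult[OF homogeneous_Const, of p k c] by simp

lemma homogeneous_Var [simp]: "Var i \<in> homog 1"
	by (auto simp: homogeneous_iff Var_def lookup_single when_def monom_degree_def split: if_splits)

lemma homogeneous_neg: "p \<in> homog k ==> k < 0 ==> p = 0"
	by (rule poly_mapping_eqI) (auto simp: homogeneous_iff)

lemma monom_degree_0: "monom_degree m = 0 \<longleftrightarrow> m = 0"
	by (auto simp: monom_degree_def in_keys_iff intro!: poly_mapping_eqI)

lemma homogeneous_0_Const: "p \<in> homog 0 ==> p = Const (lk p 0)"
	by (rule poly_mapping_eqI) (auto simp: homogeneous_iff lookup_Const monom_degree_0)

lemma homogeneous_lookup_0: "p \<in> homog k ==> k \<noteq> 0 ==> lk p 0 = 0"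
	by (auto simp: homogeneous_iff monom_degree_def)

lemma homogeneous_lookup_0_pos: "p \<in> homog k ==> 0 < k ==> lk p 0 = 0"
	by (auto simp: homogeneous_iff monom_degree_def)

definition hcomp :: "int => 'i mpoly => 'i mpoly" where
	"hcomp k p = (\<Sum>m\<in>{m \<in> Poly_Mapping.keys p. int (monom_degree m) = k}. psingle m (lk p m))"

lemma lookup_hcomp: "lk (hcomp k p) m = (if int (monom_degree m) = k then lk p m else 0)"
	by (auto simp: hcomp_def lookup_sum lookup_single when_def sum.delta in_keys_iff)

lemma hcomp_homogeneous [simp]: "hcomp k p \<in> homog k"
	by (auto simp: homogeneous_iff lookup_hcomp)

lemma hcomp_add: "hcomp k (p + q) = hcomp k p + hcomp k q"
	by (rule poly_mapping_eqI) (auto simp: lookup_hcomp lookup_add)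

lemma hcomp_0 [simp]: "hcomp k 0 = 0"
	by (rule poly_mapping_eqI) (auto simp: lookup_hcomp)

lemma hcomp_of_homogeneous: "p \<in> homog j ==> hcomp k p = (if j = k then p else 0)"
	by (rule poly_mapping_eqI) (auto simp: lookup_hcomp homogeneous_iff)

lemma homogeneousI_hcomp:
	assumes "\<And>j. j \<noteq> k ==> hcomp j p = 0"
	shows "p \<in> homog k"
	unfolding homogeneous_iff by (metis assms lookup_hcomp lookup_zero)

definition hdegs :: "'i mpoly => int set" where
	"hdegs p = (\<lambda>m. int (monom_degree m)) ` Poly_Mapping.keys p"

lemma finite_hdegs [simp]: "finite (hdegs p)" by (simp add: hdegs_def)

lemma hcomp_sum: "finite K ==> hdegs p \<subseteq> K ==> p = (\<Sum>k\<in>K. hcomp k p)"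
	by (rule poly_mapping_eqI) (auto simp: lookup_sum lookup_hcomp hdegs_def image_subset_iff in_keys_iff sum.delta)

lemma hcomp_induct [case_names zero add hom]:
	assumes Z: "P 0" and A: "\<And>p q. P p ==> P q ==> P (p + q)" and H: "\<And>k p. p \<in> homog k ==> P p"
	shows "P p"
proof -
	have "P (\<Sum>k\<in>A. hcomp k p)" if "finite A" for A
		using that by induction (simp_all add: Z A H[OF hcomp_homogeneous])
	then show ?thesis using hcomp_sum[of "hdegs p" p] by (metis finite_hdegs order_refl)
qed

lemma hcomp_mult:
	assumes "g \<in> homog j"
	shows "hcomp k (g * p) = g * hcomp (k - j) p"
proof (induction p rule: hcomp_induct)
	case (hom i p)
	then show ?case
		using homogeneous_mult[OF assms hom] by (auto simp: hcomp_of_homogeneous)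
qed (auto simp: distrib_left hcomp_add)

lemma homogeneous_cancel:
	fixes g :: S
	assumes "g \<in> homog j" "g \<noteq> 0" "g * p \<in> homog k"
	shows "p \<in> homog (k - j)"
proof (rule homogeneousI_hcomp)
	fix i assume "i \<noteq> k - j"
	then have "hcomp (i + j) (g * p) = 0" using assms(3) by (subst hcomp_of_homogeneous[of _ k]) auto
	then show "hcomp i p = 0" using assms(1,2) by (simp add: hcomp_mult)
qed

subsection \<open>Polynomials as functions\<close>

lemma univ_3: "(UNIV :: 3 set) = {1, 2, 3}"
	using exhaust_3 by auto

lemma monom_eval_3: "monom_eval m x = x 1 ^ lk m 1 * x 2 ^ lk m 2 * x 3 ^ lk m 3"
	for m :: "3 \<Rightarrow>\<^sub>0 nat"
	by (subst monom_eval_superset[of UNIV]) (simp, simp, unfold univ_3, simp)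

text \<open>A polynomial function determines its polynomial: substituting \<open>t\<close>, \<open>t ^ N\<close>, \<open>t ^ N\<^sup>2\<close> with \<open>N\<close> larger than all
	exponents makes the monomials distinct powers of one variable.\<close>

lemma mpoly3_eq_0I:
	fixes p :: S
	assumes zero: "\<And>x. mpoly_eval p x = 0"
	shows "p = 0"
proof -
	define N where "N = Suc (Max (insert 0 ((\<lambda>(m,i). lk m i) ` (Poly_Mapping.keys p \<times> UNIV))))"
	have N: "lk m i < N" if "m \<in> Poly_Mapping.keys p" for m i
		unfolding N_def less_Suc_eq_le by (rule Max_ge) (use that in force)+
	define e where "e m = lk m 1 + N * (lk m 2 + N * lk m 3)" for m :: "3 \<Rightarrow>\<^sub>0 nat"
	have inj: "m = n" if mn: "m \<in> Poly_Mapping.keys p" "n \<in> Poly_Mapping.keys p" "e m = e n" for m n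
	proof -
		have "e m mod N = e n mod N" "e m div N = e n div N" using that by simp_all
		then have a: "lk m 1 = lk n 1" "lk m 2 + N * lk m 3 = lk n 2 + N * lk n 3"
			using N[of m 1] N[of n 1] mn by (auto simp: e_def)
		from a(2) have "(lk m 2 + N * lk m 3) mod N = (lk n 2 + N * lk n 3) mod N"
			"(lk m 2 + N * lk m 3) div N = (lk n 2 + N * lk n 3) div N" by simp_all
		then have "lk m 2 = lk n 2" "lk m 3 = lk n 3" using N[of m 2] N[of n 2] mn by auto
		then have "lk m k = lk n k" for k using a exhaust_3[of k] by auto
		then show "m = n" by (rule poly_mapping_eqI)
	qed
	define q where "q = (\<Sum>m\<in>Poly_Mapping.keys p. Polynomial.monom (lk p m) (e m))"
	have "poly q t = 0" for t
	proof -
		have "monom_eval m (\<lambda>i. if i = 1 then t else if i = 2 then t ^ N else t ^ (N * N)) = t ^ e m" for m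
			by (simp add: monom_eval_3 e_def power_add distrib_left mult.assoc flip: power_mult)
		then have "poly q t = mpoly_eval p (\<lambda>i. if i = 1 then t else if i = 2 then t ^ N else t ^ (N * N))"
			by (simp add: q_def mpoly_eval_def poly_sum poly_monom)
		then show ?thesis using zero by simp
	qed
	then have "q = 0" using poly_all_0_iff_0 by blast
	show "p = 0"
	proof (rule poly_mapping_eqI)
		fix m
		show "lk p m = lk 0 m"
		proof (cases "m \<in> Poly_Mapping.keys p")
			case True
			have "Polynomial.coeff q (e m) = (\<Sum>n\<in>Poly_Mapping.keys p. if n = m then lk p n else 0)"
				unfolding q_def coeff_sum by (rule sum.cong) (use inj True in auto)
			then show ?thesis using True \<open>q = 0\<close> by simp
		qed (simp add: in_keys_iff)
	qed
qed

subsection \<open>Partial derivatives\<close>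

lemma lookup_pd: "lk (pd i p) n = of_nat (Suc (lk n i)) * lk p (n + psingle i 1)"
proof -
	have "lk (pd i p) n = (\<Sum>m\<in>Poly_Mapping.keys p. if m = n + psingle i 1 then of_nat (lk m i) * lk p m else 0)"
		unfolding pd_def lookup_sum lookup_single
	proof (rule sum.cong[OF refl])
		fix m
		show "(of_nat (lk m i) * lk p m when m - psingle i 1 = n) =
			(if m = n + psingle i 1 then of_nat (lk m i) * lk p m else 0)"
		proof (cases "lk m i = 0")
			case True
			then show ?thesis by (auto simp: when_def)
		next
			case False
			obtain k where k: "m = psingle i 1 + k" using iffD2[OF monom_split False] ..
			have "m - psingle i 1 = k" unfolding k by (rule add_diff_cancel_left')
			moreover have "m = n + psingle i 1 \<longleftrightarrow> k = n"
				unfolding k add.commute[of n] by (rule add_left_cancel)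
			ultimately show ?thesis by (simp add: when_def)
		qed
	qed
	then show ?thesis by (auto simp: sum.delta in_keys_iff lookup_add)
qed

lemma pd_add: "pd i (p + q) = pd i p + pd i q"
	by (rule poly_mapping_eqI) (simp add: lookup_pd lookup_add algebra_simps)

lemma pd_Const [simp]: "pd i (Const c) = 0"
proof (rule poly_mapping_eqI)
	fix n :: "'a \<Rightarrow>\<^sub>0 nat"
	have "n + psingle i 1 \<noteq> 0"
		by (metis lookup_add lookup_single_eq lookup_zero add_is_0 one_neq_zero)
	then show "lk (pd i (Const c)) n = lk 0 n" by (simp add: lookup_pd lookup_Const)
qed

lemma pd_Var_mult: "pd i (Var j * p) = (if i = j then p else 0) + Var j * pd i p"
proof (rule poly_mapping_eqI)
	fix n
	show "lk (pd i (Var j * p)) n = lk ((if i = j then p else 0) + Var j * pd i p) n"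
	proof (cases "lk n j = 0")
		case True
		have "n + psingle j 1 - psingle j 1 = n" by simp
		with True show ?thesis by (auto simp: lookup_pd lookup_Var_mult lookup_add lookup_single when_def)
	next
		case False
		obtain k where n: "n = psingle j 1 + k" using iffD2[OF monom_split False] ..
		have e: "n + psingle i 1 - psingle j 1 = k + psingle i 1"
			"n - psingle j 1 = k" unfolding n add.assoc by (rule add_diff_cancel_left')+
		have "lk (pd i (Var j * p)) n = of_nat (Suc (lk n i)) * lk p (k + psingle i 1)"
			using False unfolding lookup_pd lookup_Var_mult e by (simp add: lookup_add)
		moreover have "lk (Var j * pd i p) n = of_nat (Suc (lk k i)) * lk p (k + psingle i 1)"
			using False unfolding lookup_pd lookup_Var_mult e by simp
		moreover have "lk n i = (if i = j then Suc (lk k i) else lk k i)"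
			unfolding n by (simp add: lookup_add lookup_single when_def)
		moreover have "n = k + psingle i 1" if "i = j"
			unfolding n that by (rule add.commute)
		ultimately show ?thesis by (simp add: lookup_add distrib_right)
	qed
qed

lemma pd_Const_mult: "pd i (Const c * p) = Const c * pd i p"
	by (rule poly_mapping_eqI) (simp add: lookup_pd lookup_Const_mult)

lemma pd_mult: "pd i (p * q) = pd i p * q + p * pd i q"
proof (induction p rule: mpoly_induct)
	case (Var j p)
	have "pd i (Var j * p * q) = (if i = j then p * q else 0) + Var j * pd i (p * q)"
		by (simp add: pd_Var_mult mult.assoc)
	then show ?case unfolding Var pd_Var_mult by (simp add: algebra_simps)
next
	case (add p p')
	then show ?case by (simp only: pd_add distrib_right add.assoc add.left_commute)
qed (simp add: pd_Const_mult)

lemma pd_homogeneous: "p \<in> homog k ==> pd i p \<in> homog (k - 1)"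
proof -
	assume p: "p \<in> homog k"
	have "monom_degree (psingle i 1) = 1" by (simp add: monom_degree_def)
	then have d: "monom_degree (m + psingle i 1) = Suc (monom_degree m)" for m
		by (simp only: monom_degree_add)
	show ?thesis
		unfolding homogeneous_iff
	proof (intro allI impI)
		fix m assume "lk (pd i p) m \<noteq> 0"
		then have "lk p (m + psingle i 1) \<noteq> 0" unfolding lookup_pd by (metis mult_zero_right)
		then have "int (monom_degree (m + psingle i 1)) = k"
			using p unfolding homogeneous_iff by blast
		then show "int (monom_degree m) = k - 1" unfolding d by simp
	qed
qed

lemma pd_0 [simp]: "pd i 0 = 0"
	using pd_Const[of i 0] by simp

section \<open>Linear forms\<close>

abbreviation L :: "complex^3 => S" where "L \<equiv> linear_form"

text \<open>\<open>ev\<close>, \<open>cr\<close> and \<open>dt\<close> are the bilinear pairing, the cross product and the determinant over the complex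
	numbers. A covector \<open>a\<close> stands for the line \<open>L a = 0\<close>, so \<open>cr a b\<close> is the common point of two lines and
	\<open>dt a b c = 0\<close> says that three lines are concurrent.\<close>

definition ev :: "complex^3 => complex^3 => complex" where
	"ev a v = a $ 1 * v $ 1 + a $ 2 * v $ 2 + a $ 3 * v $ 3"

definition cr :: "complex^3 => complex^3 => complex^3" where
	"cr a b = vector [a $ 2 * b $ 3 - a $ 3 * b $ 2, a $ 3 * b $ 1 - a $ 1 * b $ 3, a $ 1 * b $ 2 - a $ 2 * b $ 1]"

definition dt :: "complex^3 => complex^3 => complex^3 => complex" where
	"dt a b c = ev (cr a b) c"

lemma cr_nth [simp]:
	"cr a b $ 1 = a $ 2 * b $ 3 - a $ 3 * b $ 2"
	"cr a b $ 2 = a $ 3 * b $ 1 - a $ 1 * b $ 3"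
	"cr a b $ 3 = a $ 1 * b $ 2 - a $ 2 * b $ 1"
	by (simp_all add: cr_def)

lemma vec3_eq_iff: "a = b \<longleftrightarrow> a $ 1 = b $ 1 \<and> a $ 2 = b $ 2 \<and> a $ 3 = b $ 3" for a b :: "'a^3"
	by (auto simp: vec_eq_iff forall_3)

abbreviation tri :: "(nat => complex^3) => nat => nat => nat => complex" where
	"tri a i j k \<equiv> dt (a i) (a j) (a k)"

lemma dt_expand: "dt a b c = (a $ 2 * b $ 3 - a $ 3 * b $ 2) * c $ 1 + (a $ 3 * b $ 1 - a $ 1 * b $ 3) * c $ 2
	 + (a $ 1 * b $ 2 - a $ 2 * b $ 1) * c $ 3"
	by (simp add: dt_def ev_def)

lemma dt_perm: "dt b a c = - dt a b c" "dt a c b = - dt a b c" "dt b c a = dt a b c" "dt c a b = dt a b c"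
	"dt c b a = - dt a b c"
	by (simp_all add: dt_expand algebra_simps)

lemma dt_refl [simp]: "dt a a b = 0" "dt a b a = 0" "dt a b b = 0"
	by (simp_all add: dt_expand algebra_simps)

lemma cr_swap: "cr b a = - cr a b" and cr_self [simp]: "cr a a = 0"
	by (simp_all add: vec3_eq_iff algebra_simps)

lemma ev_0 [simp]: "ev 0 v = 0"
	by (simp add: ev_def)

lemma dt_cr: "dt a b c \<noteq> 0 ==> cr a b \<noteq> 0" "dt a b c \<noteq> 0 ==> cr a c \<noteq> 0" "dt a b c \<noteq> 0 ==> cr b c \<noteq> 0"
	by (metis dt_def ev_0, metis dt_def dt_perm(2) ev_0 neg_equal_0_iff_equal, metis dt_def dt_perm(3) ev_0)

lemma ev_cr: "ev a (cr a b) = 0" "ev b (cr a b) = 0" "ev a (cr b c) = dt a b c" "ev c (cr a b) = dt a b c"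
	by (simp_all add: ev_def dt_expand algebra_simps)

lemma ev_cr': "ev b (cr c a) = dt a b c"
	by (simp add: ev_def dt_expand algebra_simps)

lemma ev_linear: "ev (a + b) v = ev a v + ev b v" "ev (s *s a) v = s * ev a v"
	"ev a (v + w) = ev a v + ev a w" "ev a (s *s v) = s * ev a v" "ev a 0 = 0" "ev 0 v = 0" "ev a (v - w) = ev a v - ev a w"
	by (simp_all add: ev_def algebra_simps)

lemma cramer: "dt a b c *s x = ev a x *s cr b c + ev b x *s cr c a + ev c x *s cr a b"
	unfolding vec3_eq_iff by (simp add: ev_def dt_expand algebra_simps)

lemma cramer_dual: "dt a b d *s c = dt c b d *s a + dt a c d *s b + dt a b c *s d"
	unfolding vec3_eq_iff by (simp add: dt_expand algebra_simps)

lemma dt_completion: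
	assumes "cr a b \<noteq> 0" obtains d where "dt a b d \<noteq> 0"
proof -
	have "\<exists>i. cr a b $ i \<noteq> 0" using assms by (auto simp: vec_eq_iff)
	then obtain i where i: "cr a b $ i \<noteq> 0" ..
	have "dt a b (axis i 1) = cr a b $ i"
		using exhaust_3[of i] by (auto simp: dt_def ev_def axis_def)
	then show thesis using that i by metis
qed

lemma dependent_span:
	assumes "cr a b \<noteq> 0" "dt a b c = 0" obtains s t where "c = s *s a + t *s b"
proof -
	obtain d where d: "dt a b d \<noteq> 0" using dt_completion assms(1) by blast
	have "c = (1 / dt a b d) *s (dt a b d *s c)" using d by simp
	also have "\<dots> = (dt c b d / dt a b d) *s a + (dt a c d / dt a b d) *s b"
		unfolding cramer_dual[of a b d c] assms(2) by (simp add: vec.scale_right_distrib)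
	finally show thesis using that by blast
qed

lemma cr_0_iff: "cr a b = 0 \<longleftrightarrow> a = 0 \<or> b = 0 \<or> (\<exists>c. a = c *s b)"
proof
	assume *: "cr a b = 0"
	have "\<exists>c. a = c *s b" if b: "b \<noteq> 0"
	proof -
		obtain i where i: "b $ i \<noteq> 0" using b by (auto simp: vec_eq_iff)
		have "a = (a $ i / b $ i) *s b"
			using * i exhaust_3[of i] unfolding vec3_eq_iff by (auto simp: field_simps)
		then show ?thesis by blast
	qed
	then show "a = 0 \<or> b = 0 \<or> (\<exists>c. a = c *s b)" by blast
qed (auto simp: vec3_eq_iff)

lemma ev_kernel_cr:
	assumes "cr a b \<noteq> 0" "ev a v = 0" "ev b v = 0"
	obtains s where "v = s *s cr a b"
proof -
	obtain d where d: "dt a b d \<noteq> 0" using dt_completion assms(1) by blast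
	have "v = (1 / dt a b d) *s (dt a b d *s v)" using d by simp
	also have "\<dots> = (ev d v / dt a b d) *s cr a b" unfolding cramer[of a b d v] using assms by simp
	finally have "v = (ev d v / dt a b d) *s cr a b" .
	then show thesis using that by blast
qed

lemma L_expand: "L a = Const (a $ 1) * Var 1 + Const (a $ 2) * Var 2 + Const (a $ 3) * Var 3"
	by (simp add: linear_form_def sum_3)

lemma L_add: "L (a + b) = L a + L b" and L_scale: "L (c *s a) = Const c * L a" and L_0 [simp]: "L 0 = 0"
	by (simp_all add: L_expand Const_add Const_mult algebra_simps)

lemma L_homogeneous [simp]: "L a \<in> homog 1"
	unfolding L_expand by (intro homogeneous_add homogeneous_Const_mult homogeneous_Var)

lemma eval_L: "mpoly_eval (L a) x = a $ 1 * x 1 + a $ 2 * x 2 + a $ 3 * x 3"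
	by (simp add: L_expand mpoly_eval_simps)

lemma eval_L_vec [simp]: "mpoly_eval (L a) (($) v) = ev a v"
	by (simp add: eval_L ev_def)

lemma pd_L [simp]: "pd 1 (L a) = Const (a $ 1)" "pd 2 (L a) = Const (a $ 2)" "pd 3 (L a) = Const (a $ 3)"
proof -
	have "pd i 1 = 0" for i :: 3 using pd_Const[of i 1] by simp
	then have "pd i (Var j) = (if i = j then 1 else 0)" for i j :: 3
		using pd_Var_mult[of i j 1] by simp
	then show "pd 1 (L a) = Const (a $ 1)" "pd 2 (L a) = Const (a $ 2)" "pd 3 (L a) = Const (a $ 3)"
		by (simp_all add: L_expand pd_add pd_Const_mult)
qed

lemma S_eq_0I:
	fixes p :: S
	assumes "\<And>v. mpoly_eval p (($) v) = 0" shows "p = 0"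
proof (rule mpoly3_eq_0I)
	fix x :: "3 => complex"
	have "($) (\<chi> i. x i) = x" by (simp add: fun_eq_iff)
	then show "mpoly_eval p x = 0" using assms by metis
qed

lemma L_eq_0_iff [simp]: "L a = 0 \<longleftrightarrow> a = 0"
proof
	assume "L a = 0"
	then have "ev a v = 0" for v by (metis eval_L_vec mpoly_eval_zero)
	from this[of "axis 1 1"] this[of "axis 2 1"] this[of "axis 3 1"]
	show "a = 0" by (simp add: ev_def axis_def vec3_eq_iff)
qed simp

subsection \<open>Divisibility by linear forms\<close>

lemma mpoly_eval_line: "\<exists>q. \<forall>t. mpoly_eval p (\<lambda>i. x i + t * y i) = poly q t"
	proof (induction p rule: mpoly_induct)
		case (Const c)
		then show ?case by (intro exI[of _ "[:c:]"]) simp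
	next
		case (add p q)
		then obtain q1 q2 where "\<forall>t. mpoly_eval p (\<lambda>i. x i + t * y i) = poly q1 t"
			"\<forall>t. mpoly_eval q (\<lambda>i. x i + t * y i) = poly q2 t" by blast
		then show ?case by (intro exI[of _ "q1 + q2"]) (simp add: mpoly_eval_add)
	next
		case (Var i p)
		then obtain q where "\<forall>t. mpoly_eval p (\<lambda>i. x i + t * y i) = poly q t" by blast
		then show ?case by (intro exI[of _ "[:x i, y i:] * q"]) (simp add: mpoly_eval_mult algebra_simps)
	qed

text \<open>Restriction to the plane \<open>a = 0\<close> along the projection in the direction \<open>e\<close> changes a
	polynomial by a multiple of the form.\<close>

lemma L_division:
	"\<exists>q. \<forall>v. mpoly_eval g (($) v) = ev a v * mpoly_eval q (($) v) + mpoly_eval g (($) (v - ev a v *s e))"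
	proof (induction g rule: mpoly_induct)
		case (Const c)
		show ?case by (intro exI[of _ 0]) simp
	next
		case (add g h)
		from add(1) obtain q where q: "\<forall>v. mpoly_eval g (($) v) = ev a v * mpoly_eval q (($) v) + mpoly_eval g (($) (v - ev a v *s e))" ..
		from add(2) obtain q' where q': "\<forall>v. mpoly_eval h (($) v) = ev a v * mpoly_eval q' (($) v) + mpoly_eval h (($) (v - ev a v *s e))" ..
		have "mpoly_eval (g + h) (($) v) = ev a v * mpoly_eval (q + q') (($) v)
				+ mpoly_eval (g + h) (($) (v - ev a v *s e))" for v
			using spec[OF q, of v] spec[OF q', of v] by (simp only: mpoly_eval_add distrib_left add.assoc add.left_commute)
		then show ?case by (intro exI[of _ "q + q'"] allI)
	next
		case (Var i g)
		then obtain q where q: "\<forall>v. mpoly_eval g (($) v) = ev a v * mpoly_eval q (($) v) + mpoly_eval g (($) (v - ev a v *s e))" ..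
		have q': "mpoly_eval g (($) (v - ev a v *s e)) = mpoly_eval g (($) v) - ev a v * mpoly_eval q (($) v)" for v
			using spec[OF q, of v] by (metis add_diff_cancel_left')
		have *: "x * G = A * (x * Q + y * (G - A * Q)) + (x - A * y) * G'" if "G' = G - A * Q" for x y A G G' Q :: complex
			unfolding that by (simp add: algebra_simps)
		show ?case
		proof (intro exI allI)
			fix v
			have c: "(v - ev a v *s e) $ i = v $ i - ev a v * e $ i" by simp
			show "mpoly_eval (Var i * g) (($) v) = ev a v * mpoly_eval (Var i * q + Const (e $ i) * (g - L a * q)) (($) v)
					+ mpoly_eval (Var i * g) (($) (v - ev a v *s e))"
				unfolding mpoly_eval_simps mpoly_eval_Var mpoly_eval_Const eval_L_vec c
				by (rule *[OF q'])
		qed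
	qed

lemma L_dvd_iff:
	assumes "a \<noteq> 0"
	shows "L a dvd g \<longleftrightarrow> (\<forall>v. ev a v = 0 --> mpoly_eval g (($) v) = 0)"
proof
	assume "L a dvd g"
	then show "\<forall>v. ev a v = 0 --> mpoly_eval g (($) v) = 0"
		by (auto simp: dvd_def mpoly_eval_mult)
next
	assume *: "\<forall>v. ev a v = 0 --> mpoly_eval g (($) v) = 0"
	obtain i where i: "a $ i \<noteq> 0" using assms by (auto simp: vec_eq_iff)
	define e where "e = axis i (1 / a $ i)"
	have e: "ev a e = 1" using i exhaust_3[of i] by (auto simp: e_def ev_def axis_def)
	obtain q where q: "\<And>v. mpoly_eval g (($) v) = ev a v * mpoly_eval q (($) v) + mpoly_eval g (($) (v - ev a v *s e))"
		using L_division by blast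
	have "g - L a * q = 0"
		by (rule S_eq_0I) (use q * in \<open>simp add: mpoly_eval_simps ev_linear e\<close>)
	then show "L a dvd g" by simp
qed

text \<open>If neither factor vanishes on the plane \<open>a = 0\<close>, take a point for each where it does not; along the
	line joining them both are nonzero polynomials in one variable, so their product is not zero.\<close>

lemma L_prime:
	assumes a: "a \<noteq> 0" and dvd: "L a dvd g * h" shows "L a dvd g \<or> L a dvd h"
proof (rule ccontr)
	assume *: "\<not> (L a dvd g \<or> L a dvd h)"
	obtain v where v: "ev a v = 0" "mpoly_eval g (($) v) \<noteq> 0" using * L_dvd_iff[OF a, of g] by blast
	obtain w where w: "ev a w = 0" "mpoly_eval h (($) w) \<noteq> 0" using * L_dvd_iff[OF a, of h] by blast
	obtain p where p: "\<And>t. mpoly_eval g (\<lambda>i. v $ i + t * (w - v) $ i) = poly p t" using mpoly_eval_line by blast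
	obtain q where q: "\<And>t. mpoly_eval h (\<lambda>i. v $ i + t * (w - v) $ i) = poly q t" using mpoly_eval_line by blast
	have "poly (p * q) t = 0" for t
	proof -
		have *: "(\<lambda>i. v $ i + t * (w - v) $ i) = ($) (v + t *s (w - v))"
			by (simp add: fun_eq_iff algebra_simps)
		have "ev a (v + t *s (w - v)) = 0" using v w by (simp add: ev_linear)
		then have "mpoly_eval (g * h) (($) (v + t *s (w - v))) = 0" using dvd unfolding L_dvd_iff[OF a] by blast
		then show ?thesis using p[of t] q[of t] unfolding * mpoly_eval_mult poly_mult by metis
	qed
	then have "p * q = 0" using poly_all_0_iff_0 by blast
	moreover have "p \<noteq> 0" using p[of 0] v(2) by auto
	moreover have "q \<noteq> 0" using q[of 1] w(2) by auto
	ultimately show False by simp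
qed

lemma L_dvd_L: "a \<noteq> 0 ==> cr a b \<noteq> 0 ==> \<not> L a dvd L b"
proof
	assume a: "a \<noteq> 0" "cr a b \<noteq> 0" "L a dvd L b"
	obtain d where d: "dt a b d \<noteq> 0" using dt_completion a(2) by blast
	have "ev a (cr d a) = 0" "ev b (cr d a) = dt a b d" using ev_cr'[of b d a] by (simp_all add: ev_cr)
	then show False using L_dvd_iff[OF a(1)] a(3) d eval_L_vec by metis
qed

lemma cr_nonzero: "cr a b \<noteq> 0 ==> a \<noteq> 0" "cr a b \<noteq> 0 ==> b \<noteq> 0"
	by (auto simp: cr_0_iff)

text \<open>Koszul relations: two non-proportional linear forms are coprime, and three independent ones form
	a regular sequence.\<close>

lemma pair_syzygy:
	assumes ab: "cr a b \<noteq> 0" and eq: "L a * u = L b * v"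
	obtains w where "u = L b * w" "v = L a * w"
proof -
	have a: "a \<noteq> 0" using ab cr_nonzero by blast
	have "L a dvd L b * v" using eq by (metis dvd_triv_left)
	then have "L a dvd v" using L_prime[OF a] L_dvd_L[OF a ab] by blast
	then obtain w where w: "v = L a * w" by (auto simp: dvd_def)
	with eq have "L a * u = L a * (L b * w)" by (simp add: ac_simps)
	then show thesis using that w a by simp
qed

lemma triple_syzygy:
	assumes abc: "dt a b c \<noteq> 0" and eq: "L c * k = L a * u + L b * v"
	obtains u' v' where "k = L a * u' + L b * v'"
proof -
	define ea where "ea = (1 / dt a b c) *s cr b c"
	define eb where "eb = (1 / dt a b c) *s cr c a"
	have n: "ev a (cr b c) = dt a b c" "ev b (cr c a) = dt a b c" by (rule ev_cr, rule ev_cr')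
	have e: "ev a ea = 1" "ev b ea = 0" "ev a eb = 0" "ev b eb = 1"
		using abc by (simp_all add: ea_def eb_def ev_linear ev_cr(1,2) n)
	have van: "mpoly_eval k (($) x) = 0" if x: "ev a x = 0" "ev b x = 0" for x
	proof -
		define y where "y = cr a b"
		have y: "ev a y = 0" "ev b y = 0" "ev c y \<noteq> 0" using abc by (simp_all add: y_def ev_cr(1,2,4))
		obtain p where p: "\<And>t. mpoly_eval k (\<lambda>i. x $ i + t * y $ i) = poly p t" using mpoly_eval_line by blast
		have "poly (p * [:ev c x, ev c y:]) t = 0" for t
		proof -
			have *: "(\<lambda>i. x $ i + t * y $ i) = ($) (x + t *s y)" by (simp add: fun_eq_iff)
			have k: "mpoly_eval k (($) (x + t *s y)) = poly p t" using p[of t] unfolding * .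
			have "mpoly_eval (L c * k) (($) (x + t *s y)) = 0"
				unfolding eq by (simp add: mpoly_eval_simps ev_linear x y)
			then have "(ev c x + t * ev c y) * poly p t = 0" unfolding mpoly_eval_mult eval_L_vec k ev_linear .
			moreover have "poly (p * [:ev c x, ev c y:]) t = (ev c x + t * ev c y) * poly p t" by (simp add: algebra_simps)
			ultimately show ?thesis by metis
		qed
		then have "p * [:ev c x, ev c y:] = 0" using poly_all_0_iff_0 by blast
		moreover have "[:ev c x, ev c y:] \<noteq> 0" using y(3) by simp
		ultimately have "p = 0" by (simp only: mult_eq_0_iff simp_thms)
		then show ?thesis using p[of 0] by simp
	qed
	obtain q where q: "\<And>x. mpoly_eval k (($) x) = ev a x * mpoly_eval q (($) x) + mpoly_eval k (($) (x - ev a x *s ea))"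
		using L_division by blast
	obtain q' where q': "\<And>x. mpoly_eval (k - L a * q) (($) x) = ev b x * mpoly_eval q' (($) x) + mpoly_eval (k - L a * q) (($) (x - ev b x *s eb))"
		using L_division by blast
	have "k - (L a * q + L b * q') = 0"
	proof (rule S_eq_0I)
		fix x
		have "mpoly_eval (k - L a * q) (($) (x - ev b x *s eb)) = 0"
			using q[of "x - ev b x *s eb"] by (simp add: mpoly_eval_simps ev_linear e van)
		then show "mpoly_eval (k - (L a * q + L b * q')) (($) x) = 0"
			using q'[of x] by (simp add: mpoly_eval_simps algebra_simps)
	qed
	then show thesis using that by simp
qed

section \<open>Derivations annihilating a product of linear forms\<close>

definition Der :: "S^3 => S => S" where
	"Der r p = r $ 1 * pd 1 p + r $ 2 * pd 2 p + r $ 3 * pd 3 p"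

definition ldot :: "complex^3 => S^3 => S" where
	"ldot a r = Const (a $ 1) * r $ 1 + Const (a $ 2) * r $ 2 + Const (a $ 3) * r $ 3"

lemma Der_mult: "Der r (p * q) = Der r p * q + p * Der r q"
	by (simp add: Der_def pd_mult algebra_simps)

lemma Der_Const_mult: "Der r (Const c * p) = Const c * Der r p"
	unfolding Der_def pd_Const_mult by (simp add: algebra_simps)

lemma Der_L: "Der r (L a) = ldot a r"
	by (simp add: Der_def ldot_def mult.commute)

lemma Der_prod:
	assumes "finite I"
	shows "Der r (\<Prod>i\<in>I. L (a i)) = (\<Sum>i\<in>I. ldot (a i) r * (\<Prod>j\<in>I - {i}. L (a j)))"
	using assms
proof induction
	case empty
	have "pd i 1 = 0" for i :: 3 using pd_Const[of i 1] by simp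
	then show ?case by (simp add: Der_def)
next
	case (insert k I)
	have "(\<Sum>i\<in>I. ldot (a i) r * (\<Prod>j\<in>insert k I - {i}. L (a j)))
			= (\<Sum>i\<in>I. ldot (a i) r * (L (a k) * (\<Prod>j\<in>I - {i}. L (a j))))"
	proof (rule sum.cong[OF refl])
		fix i assume "i \<in> I"
		then have "insert k I - {i} = insert k (I - {i})" "k \<notin> I - {i}" using insert by auto
		then show "ldot (a i) r * (\<Prod>j\<in>insert k I - {i}. L (a j)) = ldot (a i) r * (L (a k) * (\<Prod>j\<in>I - {i}. L (a j)))"
			using insert by simp
	qed
	also have "\<dots> = L (a k) * (\<Sum>i\<in>I. ldot (a i) r * (\<Prod>j\<in>I - {i}. L (a j)))"
		by (simp add: sum_distrib_left ac_simps)
	finally show ?case using insert by (simp add: Der_mult Der_L)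
qed

text \<open>By the product rule each \<open>L (a i)\<close> divides the \<open>i\<close>-th term of the sum, hence, being coprime to the
	other factors, the derivative of \<open>L (a i)\<close>. Logarithmic derivatives then add up to zero. All
	computations of Jacobian syzygies below start from these quotients \<open>h i\<close>.\<close>

lemma Der_prod_eq_0_iff:
	assumes I: "finite I" and c: "c \<noteq> 0" and nz: "\<And>i. i \<in> I ==> a i \<noteq> 0"
		and np: "\<And>i j. i \<in> I ==> j \<in> I ==> i \<noteq> j ==> cr (a i) (a j) \<noteq> 0"
	shows "Der r (Const c * (\<Prod>i\<in>I. L (a i))) = 0 \<longleftrightarrow>
		(\<exists>h. (\<forall>i\<in>I. ldot (a i) r = L (a i) * h i) \<and> (\<Sum>i\<in>I. h i) = 0)" (is "?lhs \<longleftrightarrow> ?rhs")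
proof -
	have pr: "L (a i) * (\<Prod>j\<in>I - {i}. L (a j)) = (\<Prod>j\<in>I. L (a j))" if "i \<in> I" for i
		using I that by (simp add: prod.remove)
	have sum: "(\<Sum>i\<in>I. ldot (a i) r * (\<Prod>j\<in>I - {i}. L (a j))) = (\<Sum>i\<in>I. h i) * (\<Prod>j\<in>I. L (a j))"
		if "\<forall>i\<in>I. ldot (a i) r = L (a i) * h i" for h
		unfolding sum_distrib_right by (rule sum.cong) (use that pr in \<open>auto simp: mult.assoc mult.left_commute\<close>)
	have lhs: "?lhs \<longleftrightarrow> (\<Sum>i\<in>I. ldot (a i) r * (\<Prod>j\<in>I - {i}. L (a j))) = 0"
		using c by (simp add: Der_Const_mult Der_prod[OF I])
	have nz': "(\<Prod>j\<in>I. L (a j)) \<noteq> 0" using nz I by simp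
	show ?thesis
	proof
		assume ?lhs
		have "\<exists>h. ldot (a i) r = L (a i) * h" if i: "i \<in> I" for i
		proof -
			have "L (a i) dvd (\<Sum>k\<in>I - {i}. ldot (a k) r * (\<Prod>j\<in>I - {k}. L (a j)))"
				by (rule dvd_sum) (use i I in \<open>auto intro!: dvd_mult dvd_prodI\<close>)
			moreover have "ldot (a i) r * (\<Prod>j\<in>I - {i}. L (a j)) + (\<Sum>k\<in>I - {i}. ldot (a k) r * (\<Prod>j\<in>I - {k}. L (a j))) = 0"
				using iffD1[OF lhs \<open>?lhs\<close>] unfolding sum.remove[OF I i] .
			ultimately have "L (a i) dvd ldot (a i) r * (\<Prod>j\<in>I - {i}. L (a j))"
				by (simp only: add_eq_0_iff2 dvd_minus_iff)
			moreover have nd: "\<not> L (a i) dvd (\<Prod>j\<in>J. L (a j))" if "finite J" "J \<subseteq> I - {i}" for J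
				using that
			proof (induction J)
				case empty
				have "\<not> L (a i) dvd 1"
					unfolding L_dvd_iff[OF nz[OF i]] using ev_linear(5)[of "a i"] by force
				then show ?case by simp
			next
				case (insert j J)
				then have "\<not> L (a i) dvd L (a j)" by (intro L_dvd_L nz np i) auto
				moreover have "\<not> L (a i) dvd (\<Prod>j\<in>J. L (a j))" using insert by simp
				ultimately have "\<not> L (a i) dvd L (a j) * (\<Prod>j\<in>J. L (a j))" using L_prime[OF nz[OF i]] by blast
				then show ?case using insert by simp
			qed
			moreover have "\<not> L (a i) dvd (\<Prod>j\<in>I - {i}. L (a j))" using I nd[of "I - {i}"] by blast
			ultimately have "L (a i) dvd ldot (a i) r" using L_prime[OF nz[OF i]] by blast
			then show ?thesis by (auto simp: dvd_def)
		qed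
		then have "\<forall>i\<in>I. \<exists>h. ldot (a i) r = L (a i) * h" by blast
		from bchoice[OF this] obtain h where h: "\<forall>i\<in>I. ldot (a i) r = L (a i) * h i" ..
		have "(\<Sum>i\<in>I. h i) * (\<Prod>j\<in>I. L (a j)) = 0"
			using iffD1[OF lhs \<open>?lhs\<close>] unfolding sum[OF h] .
		then have "(\<Sum>i\<in>I. h i) = 0" using nz' by (simp only: mult_eq_0_iff simp_thms)
		then show ?rhs using h by blast
	next
		assume ?rhs
		then obtain h where h: "\<forall>i\<in>I. ldot (a i) r = L (a i) * h i" and "(\<Sum>i\<in>I. h i) = 0" by blast
		then show ?lhs unfolding lhs sum[OF h] by simp
	qed
qed

lemma AR_carrier: "carrier (AR f) = {r. Der r f = 0}"
	by (simp add: AR_def Der_def)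

section \<open>Graded homomorphisms between free modules\<close>

lemma free_mod_simps [simp]:
	"FM bs = {v. \<forall>i\<ge>length bs. v i = 0}"
	"u \<oplus>\<^bsub>free_mod bs\<^esub> v = (\<lambda>i. u i + v i)"
	"r \<odot>\<^bsub>free_mod bs\<^esub> v = (\<lambda>i. r * v i)"
	"\<zero>\<^bsub>free_mod bs\<^esub> = (\<lambda>_. 0)"
	by (simp_all add: free_mod_def)

lemma free_mod_piece: "piece (free_mod bs) k =
		{v. (\<forall>i\<ge>length bs. v i = 0) \<and> (\<forall>i<length bs. v i \<in> homog (k - bs ! i))}"
	by (simp add: free_mod_def)

definition single_vec :: "nat => S => nat => S" where
	"single_vec j p = (\<lambda>i. if i = j then p else 0)"

lemma graded_homD:
	assumes "\<phi> \<in> graded_hom M N"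
	shows "v \<in> carrier M ==> \<phi> v \<in> carrier N"
		"u \<in> carrier M ==> v \<in> carrier M ==> \<phi> (u \<oplus>\<^bsub>M\<^esub> v) = \<phi> u \<oplus>\<^bsub>N\<^esub> \<phi> v"
		"v \<in> carrier M ==> \<phi> (r \<odot>\<^bsub>M\<^esub> v) = r \<odot>\<^bsub>N\<^esub> \<phi> v"
		"v \<in> piece M k ==> \<phi> v \<in> piece N k"
	using assms unfolding graded_hom_def by blast+

lemma graded_homI:
	assumes "\<And>v. v \<in> carrier M ==> \<phi> v \<in> carrier N"
		"\<And>u v. u \<in> carrier M ==> v \<in> carrier M ==> \<phi> (u \<oplus>\<^bsub>M\<^esub> v) = \<phi> u \<oplus>\<^bsub>N\<^esub> \<phi> v"
		"\<And>r v. v \<in> carrier M ==> \<phi> (r \<odot>\<^bsub>M\<^esub> v) = r \<odot>\<^bsub>N\<^esub> \<phi> v"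
		"\<And>v k. v \<in> piece M k ==> \<phi> v \<in> piece N k"
	shows "\<phi> \<in> graded_hom M N"
	using assms unfolding graded_hom_def by blast

lemma free_mod_induct [consumes 1, case_names zero add single]:
	assumes v: "v \<in> FM bs" and Z: "P (\<lambda>_. 0)"
		and A: "\<And>u v. u \<in> FM bs ==> v \<in> FM bs ==> P u ==> P v ==> P (\<lambda>i. u i + v i)"
		and H: "\<And>j k p. j < length bs ==> p \<in> homog k ==> P (single_vec j p)"
	shows "P v"
proof -
	have single: "P (single_vec j p)" if j: "j < length bs" for j p
	proof (induction p rule: hcomp_induct)
		case zero
		have "single_vec j 0 = (\<lambda>_. 0)" by (auto simp: single_vec_def)
		then show ?case using Z by simp
	next
		case (add p q)
		have "single_vec j (p + q) = (\<lambda>i. single_vec j p i + single_vec j q i)" by (auto simp: single_vec_def)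
		then show ?case using A[OF _ _ add] j by (simp add: single_vec_def)
	next
		case (hom k p)
		then show ?case using H j by blast
	qed
	have "P (\<lambda>i. if i < n then v i else 0)" if "n \<le> length bs" for n
		using that
	proof (induction n)
		case 0
		then show ?case using Z by simp
	next
		case (Suc n)
		have "(\<lambda>i. if i < Suc n then v i else 0) = (\<lambda>i. (if i < n then v i else 0) + single_vec n (v n) i)"
			by (auto simp: single_vec_def)
		moreover have "P (\<lambda>i. (if i < n then v i else 0) + single_vec n (v n) i)"
			by (rule A) (use Suc single in \<open>auto simp: single_vec_def\<close>)
		ultimately show ?case by simp
	qed
	from this[of "length bs"] have "P (\<lambda>i. if i < length bs then v i else 0)" by simp
	moreover have "(\<lambda>i. if i < length bs then v i else 0) = v" using v by (auto simp: not_less)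
	ultimately show ?thesis by simp
qed

text \<open>What is needed of a graded module in order to lift maps along maps into it: homogeneous
	components make sense in it.\<close>

definition comp_module :: "'b graded_module => bool" where
	"comp_module N \<longleftrightarrow> (\<forall>n\<in>carrier N. 0 \<odot>\<^bsub>N\<^esub> n = \<zero>\<^bsub>N\<^esub>) \<and> \<zero>\<^bsub>N\<^esub> \<oplus>\<^bsub>N\<^esub> \<zero>\<^bsub>N\<^esub> = \<zero>\<^bsub>N\<^esub> \<and>
		 (\<forall>u\<in>carrier N. \<forall>v\<in>carrier N. u \<oplus>\<^bsub>N\<^esub> v = v --> u = \<zero>\<^bsub>N\<^esub>) \<and>
		 (\<forall>u\<in>carrier N. u \<oplus>\<^bsub>N\<^esub> \<zero>\<^bsub>N\<^esub> = u \<and> \<zero>\<^bsub>N\<^esub> \<oplus>\<^bsub>N\<^esub> u = u) \<and>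
		 (\<forall>k. piece N k \<subseteq> carrier N) \<and>
		 (\<exists>C. \<forall>k. (\<forall>u\<in>carrier N. \<forall>v\<in>carrier N. C k (u \<oplus>\<^bsub>N\<^esub> v) = C k u \<oplus>\<^bsub>N\<^esub> C k v) \<and>
				(\<forall>n\<in>piece N k. C k n = n) \<and> (\<forall>j. j \<noteq> k --> (\<forall>n\<in>piece N j. C k n = \<zero>\<^bsub>N\<^esub>)))"

lemma comp_module_cancel:
	assumes "comp_module N" "u \<in> carrier N" "v \<in> carrier N" "u \<oplus>\<^bsub>N\<^esub> v = v"
	shows "u = \<zero>\<^bsub>N\<^esub>"
proof -
	have "\<forall>u\<in>carrier N. \<forall>v\<in>carrier N. u \<oplus>\<^bsub>N\<^esub> v = v --> u = \<zero>\<^bsub>N\<^esub>"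
		using assms(1) unfolding comp_module_def by (elim conjE)
	then show ?thesis using assms(2-4) by blast
qed

definition vcomp :: "int list => int => (nat => S) => nat => S" where
	"vcomp bs k v = (\<lambda>i. if i < length bs then hcomp (k - bs ! i) (v i) else 0)"

lemma vcomp_piece: "vcomp bs k v \<in> piece (free_mod bs) k"
	by (simp add: free_mod_piece vcomp_def)

lemma vcomp_of_piece: "v \<in> piece (free_mod bs) j ==> vcomp bs k v = (if j = k then v else (\<lambda>_. 0))"
	by (auto simp: free_mod_piece vcomp_def hcomp_of_homogeneous fun_eq_iff)

lemma vcomp_add: "vcomp bs k (\<lambda>i. u i + v i) = (\<lambda>i. vcomp bs k u i + vcomp bs k v i)"
	by (auto simp: vcomp_def hcomp_add)

lemma piece_carrier: "v \<in> piece (free_mod bs) k ==> v \<in> FM bs"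
	by (simp add: free_mod_piece)

lemma vcomp_carrier: "vcomp bs k v \<in> FM bs"
	using vcomp_piece piece_carrier by blast

lemma single_vec_piece: "j < length bs ==> p \<in> homog k ==> single_vec j p \<in> piece (free_mod bs) (k + bs ! j)"
	by (auto simp: single_vec_def free_mod_piece)

lemma comp_module_free: "comp_module (free_mod bs)"
	unfolding comp_module_def
proof (intro conjI)
	show "\<exists>C. \<forall>k. (\<forall>u\<in>FM bs. \<forall>v\<in>FM bs.
					C k (u \<oplus>\<^bsub>free_mod bs\<^esub> v) = C k u \<oplus>\<^bsub>free_mod bs\<^esub> C k v) \<and>
				(\<forall>n\<in>piece (free_mod bs) k. C k n = n) \<and>
				(\<forall>j. j \<noteq> k --> (\<forall>n\<in>piece (free_mod bs) j. C k n = \<zero>\<^bsub>free_mod bs\<^esub>))"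
		by (rule exI[of _ "vcomp bs"]) (simp add: vcomp_add vcomp_of_piece)
qed (auto simp: free_mod_piece fun_eq_iff)

lemma hom_zero: "\<phi> \<in> graded_hom (free_mod bs) N ==> comp_module N ==> \<phi> (\<lambda>_. 0) = \<zero>\<^bsub>N\<^esub>"
proof -
	assume *: "\<phi> \<in> graded_hom (free_mod bs) N" "comp_module N"
	have z: "(\<lambda>_. 0) \<in> FM bs" by simp
	have "\<phi> (\<lambda>_. 0) = 0 \<odot>\<^bsub>N\<^esub> \<phi> (\<lambda>_. 0)" using graded_homD(3)[OF *(1) z, of 0] by simp
	also have "\<dots> = \<zero>\<^bsub>N\<^esub>" using *(2) graded_homD(1)[OF *(1) z] by (simp add: comp_module_def)
	finally show ?thesis .
qed

lemma homogeneous_preimage: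
	assumes \<phi>: "\<phi> \<in> graded_hom (free_mod bs) N" and N: "comp_module N"
		and v: "v \<in> FM bs" and k: "\<phi> v \<in> piece N k"
	shows "\<phi> (vcomp bs k v) = \<phi> v"
proof -
	obtain C where C: "\<forall>k. (\<forall>u\<in>carrier N. \<forall>v\<in>carrier N. C k (u \<oplus>\<^bsub>N\<^esub> v) = C k u \<oplus>\<^bsub>N\<^esub> C k v) \<and>
				(\<forall>n\<in>piece N k. C k n = n) \<and> (\<forall>j. j \<noteq> k --> (\<forall>n\<in>piece N j. C k n = \<zero>\<^bsub>N\<^esub>))"
		using N unfolding comp_module_def by (elim conjE exE)
	have piece0: "C k (\<phi> w) = \<phi> (vcomp bs k w)" if w: "w \<in> piece (free_mod bs) j" for w j
	proof (cases "j = k")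
		case True
		then show ?thesis using C graded_homD(4)[OF \<phi> w] vcomp_of_piece[OF w] by simp
	next
		case False
		then show ?thesis using C graded_homD(4)[OF \<phi> w] vcomp_of_piece[OF w] hom_zero[OF \<phi> N] by simp
	qed
	have "C k (\<phi> v) = \<phi> (vcomp bs k v)"
		using v
	proof (induction v rule: free_mod_induct)
		case zero
		have "(\<lambda>_. 0) \<in> piece (free_mod bs) k" by (simp add: free_mod_piece)
		then show ?case by (rule piece0)
	next
		case (add u v)
		have "\<phi> (\<lambda>i. u i + v i) = \<phi> u \<oplus>\<^bsub>N\<^esub> \<phi> v" using graded_homD(2)[OF \<phi> add(1,2)] by simp
		moreover have "\<phi> (vcomp bs k (\<lambda>i. u i + v i)) = \<phi> (vcomp bs k u) \<oplus>\<^bsub>N\<^esub> \<phi> (vcomp bs k v)"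
			using graded_homD(2)[OF \<phi> vcomp_carrier vcomp_carrier] by (simp add: vcomp_add)
		moreover have "C k (\<phi> u \<oplus>\<^bsub>N\<^esub> \<phi> v) = C k (\<phi> u) \<oplus>\<^bsub>N\<^esub> C k (\<phi> v)"
			using C graded_homD(1)[OF \<phi> add(1)] graded_homD(1)[OF \<phi> add(2)] by blast
		ultimately show ?case using add(3,4) by simp
	next
		case (single j l p)
		then show ?case using piece0 single_vec_piece by blast
	qed
	moreover have "C k (\<phi> v) = \<phi> v" using C k by blast
	ultimately show ?thesis by simp
qed

lemma hom_ext:
	assumes \<phi>: "\<phi> \<in> graded_hom (free_mod bs) N" and \<psi>: "\<psi> \<in> graded_hom (free_mod bs) N" and N: "comp_module N"
		and eq: "\<And>j. j < length bs ==> \<phi> (single_vec j 1) = \<psi> (single_vec j 1)"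
		and v: "v \<in> FM bs"
	shows "\<phi> v = \<psi> v"
	using v
proof (induction v rule: free_mod_induct)
	case zero
	then show ?case using hom_zero[OF \<phi> N] hom_zero[OF \<psi> N] by simp
next
	case (add u v)
	then show ?case using graded_homD(2)[OF \<phi> add(1,2)] graded_homD(2)[OF \<psi> add(1,2)] by simp
next
	case (single j k p)
	have e: "single_vec j 1 \<in> FM bs" using single by (simp add: single_vec_def)
	have "p \<odot>\<^bsub>free_mod bs\<^esub> single_vec j 1 = single_vec j p" by (auto simp: single_vec_def)
	then show ?case using graded_homD(3)[OF \<phi> e, of p] graded_homD(3)[OF \<psi> e, of p] eq[OF single(1)] by simp
qed

text \<open>The map with prescribed images \<open>R j\<close> of the basis vectors.\<close>

definition matrix_map :: "nat => (nat => nat => S) => (nat => S) => nat => S" where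
	"matrix_map n R v = (\<lambda>i. \<Sum>j<n. v j * R j i)"

lemma matrix_map_hom:
	assumes R: "\<And>j. j < length bs ==> R j \<in> piece (free_mod cs) (bs ! j)"
	shows "matrix_map (length bs) R \<in> graded_hom (free_mod bs) (free_mod cs)"
proof (rule graded_homI)
	fix v assume "v \<in> FM bs"
	show "matrix_map (length bs) R v \<in> FM cs"
		using piece_carrier[OF R] by (auto simp: matrix_map_def intro!: sum.neutral)
next
	fix v k assume v: "v \<in> piece (free_mod bs) k"
	have "v j * R j i \<in> homog (k - cs ! i)" if "j < length bs" "i < length cs" for i j
	proof -
		have "v j \<in> homog (k - bs ! j)" "R j i \<in> homog (bs ! j - cs ! i)"
			using v R[OF that(1)] that by (auto simp: free_mod_piece)
		from homogeneous_mult[OF this] show ?thesis by simp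
	qed
	then show "matrix_map (length bs) R v \<in> piece (free_mod cs) k"
		using piece_carrier[OF R]
		by (auto simp: free_mod_piece matrix_map_def intro!: sum.neutral homogeneous_sum)
qed (auto simp: matrix_map_def sum.distrib algebra_simps sum_distrib_left)

lemma matrix_map_single: "j < n ==> matrix_map n R (single_vec j 1) = R j"
	by (auto simp: matrix_map_def single_vec_def if_distrib if_distribR sum.delta cong: if_cong)

lemma hom_matrix:
	assumes \<phi>: "\<phi> \<in> graded_hom (free_mod bs) (free_mod cs)" and v: "v \<in> FM bs"
	shows "\<phi> v = matrix_map (length bs) (\<lambda>j. \<phi> (single_vec j 1)) v"
proof (rule hom_ext[OF \<phi> _ comp_module_free _ v])
	show "matrix_map (length bs) (\<lambda>j. \<phi> (single_vec j 1)) \<in> graded_hom (free_mod bs) (free_mod cs)"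
		by (rule matrix_map_hom) (use graded_homD(4)[OF \<phi>] single_vec_piece[of _ bs 1 0] in \<open>simp flip: Const_1\<close>)
qed (simp add: matrix_map_single)

lemma graded_hom_comp:
	"\<phi> \<in> graded_hom M N ==> \<psi> \<in> graded_hom N K ==> (\<lambda>v. \<psi> (\<phi> v)) \<in> graded_hom M K"
	by (rule graded_homI) (simp_all add: graded_homD)

lemma graded_hom_diff:
	assumes "\<phi> \<in> graded_hom (free_mod bs) (free_mod cs)" "\<psi> \<in> graded_hom (free_mod bs) (free_mod cs)"
	shows "(\<lambda>v i. \<phi> v i - \<psi> v i) \<in> graded_hom (free_mod bs) (free_mod cs)"
proof (rule graded_homI)
	fix v assume "v \<in> FM bs"
	then show "(\<lambda>i. \<phi> v i - \<psi> v i) \<in> FM cs"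
		using graded_homD(1)[OF assms(1)] graded_homD(1)[OF assms(2)] by simp
next
	fix v k assume "v \<in> piece (free_mod bs) k"
	then have "\<phi> v \<in> piece (free_mod cs) k" "\<psi> v \<in> piece (free_mod cs) k"
		using graded_homD(4)[OF assms(1)] graded_homD(4)[OF assms(2)] by blast+
	then show "(\<lambda>i. \<phi> v i - \<psi> v i) \<in> piece (free_mod cs) k"
		by (simp add: free_mod_piece homogeneous_diff)
next
	fix u v assume "u \<in> FM bs" "v \<in> FM bs"
	then show "(\<lambda>i. \<phi> (u \<oplus>\<^bsub>free_mod bs\<^esub> v) i - \<psi> (u \<oplus>\<^bsub>free_mod bs\<^esub> v) i)
			= (\<lambda>i. \<phi> u i - \<psi> u i) \<oplus>\<^bsub>free_mod cs\<^esub> (\<lambda>i. \<phi> v i - \<psi> v i)"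
		using graded_homD(2)[OF assms(1)] graded_homD(2)[OF assms(2)] by (simp add: algebra_simps)
next
	fix r v assume "v \<in> FM bs"
	then show "(\<lambda>i. \<phi> (r \<odot>\<^bsub>free_mod bs\<^esub> v) i - \<psi> (r \<odot>\<^bsub>free_mod bs\<^esub> v) i)
			= r \<odot>\<^bsub>free_mod cs\<^esub> (\<lambda>i. \<phi> v i - \<psi> v i)"
		using graded_homD(3)[OF assms(1)] graded_homD(3)[OF assms(2)] by (simp add: right_diff_distrib)
qed

lemma graded_hom_id: "(\<lambda>v. v) \<in> graded_hom M M"
	by (rule graded_homI) auto

text \<open>Free modules are projective: the images of the basis vectors are lifted within their degree and
	extended linearly.\<close>

lemma lift_hom:
	assumes \<psi>: "\<psi> \<in> graded_hom (free_mod bs) N" and \<pi>: "\<pi> \<in> graded_hom (free_mod cs) N" and N: "comp_module N"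
		and im: "\<And>v. v \<in> FM bs ==> \<psi> v \<in> \<pi> ` FM cs"
	shows "\<exists>\<alpha>. \<alpha> \<in> graded_hom (free_mod bs) (free_mod cs) \<and> (\<forall>v\<in>FM bs. \<pi> (\<alpha> v) = \<psi> v)"
proof -
	have "\<exists>w. w \<in> piece (free_mod cs) (bs ! j) \<and> \<pi> w = \<psi> (single_vec j 1)" if j: "j < length bs" for j
	proof -
		have p: "single_vec j 1 \<in> piece (free_mod bs) (bs ! j)"
			using single_vec_piece[OF j homogeneous_Const[of 1]] by simp
		obtain w where w: "w \<in> FM cs" "\<psi> (single_vec j 1) = \<pi> w"
			using im[OF piece_carrier[OF p]] by blast
		have "\<pi> w \<in> piece N (bs ! j)" using graded_homD(4)[OF \<psi> p] w(2) by simp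
		then have "\<pi> (vcomp cs (bs ! j) w) = \<psi> (single_vec j 1)"
			using homogeneous_preimage[OF \<pi> N w(1)] w(2) by simp
		then show ?thesis using vcomp_piece by blast
	qed
	then have "\<forall>j. \<exists>w. j < length bs --> w \<in> piece (free_mod cs) (bs ! j) \<and> \<pi> w = \<psi> (single_vec j 1)" by blast
	from choice[OF this] obtain R where R: "\<And>j. j < length bs ==> R j \<in> piece (free_mod cs) (bs ! j)"
		"\<And>j. j < length bs ==> \<pi> (R j) = \<psi> (single_vec j 1)" by blast
	let ?\<alpha> = "matrix_map (length bs) R"
	have h: "?\<alpha> \<in> graded_hom (free_mod bs) (free_mod cs)" by (rule matrix_map_hom) (rule R)
	show ?thesis
	proof (intro exI conjI ballI, rule h)
		fix v assume v: "v \<in> FM bs"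
		show "\<pi> (?\<alpha> v) = \<psi> v"
			by (rule hom_ext[OF graded_hom_comp[OF h \<pi>] \<psi> N _ v]) (simp add: matrix_map_single R(2))
	qed
qed

section \<open>Uniqueness of minimal resolutions\<close>

lemma resolutionD:
	assumes "graded_free_resolution M F \<phi> \<epsilon>"
	shows "\<epsilon> \<in> graded_hom (free_mod (F 0)) M"
		"\<phi> i \<in> graded_hom (free_mod (F (Suc i))) (free_mod (F i))"
		"\<epsilon> ` FM (F 0) = carrier M"
		"{v \<in> FM (F 0). \<epsilon> v = \<zero>\<^bsub>M\<^esub>} = \<phi> 0 ` FM (F (Suc 0))"
		"{v \<in> FM (F (Suc i)). \<phi> i v = (\<lambda>_. 0)} = \<phi> (Suc i) ` carrier (free_mod (F (Suc (Suc i))))"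
		"\<exists>n. \<forall>i>n. F i = []"
	using assms unfolding graded_free_resolution_def by simp_all

lemma resolution_complex:
	assumes res: "graded_free_resolution M F \<phi> \<epsilon>"
	shows "v \<in> FM (F (Suc 0)) ==> \<epsilon> (\<phi> 0 v) = \<zero>\<^bsub>M\<^esub>"
		"v \<in> carrier (free_mod (F (Suc (Suc i)))) ==> \<phi> i (\<phi> (Suc i) v) = (\<lambda>_. 0)"
	using resolutionD(4)[OF res] resolutionD(5)[OF res, of i] by blast+

lemma chain_lift:
	assumes F: "graded_free_resolution M F \<phi> \<epsilon>" and G: "graded_free_resolution M G \<phi>' \<epsilon>'" and M: "comp_module M"
	shows "\<exists>\<alpha>. (\<forall>i. \<alpha> i \<in> graded_hom (free_mod (F i)) (free_mod (G i))) \<and>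
		(\<forall>v\<in>FM (F 0). \<epsilon>' (\<alpha> 0 v) = \<epsilon> v) \<and>
		(\<forall>i. \<forall>v\<in>FM (F (Suc i)). \<phi>' i (\<alpha> (Suc i) v) = \<alpha> i (\<phi> i v))"
proof -
	let ?P = "\<lambda>i \<alpha>. \<alpha> \<in> graded_hom (free_mod (F i)) (free_mod (G i)) \<and>
		 (i = 0 --> (\<forall>v\<in>FM (F 0). \<epsilon>' (\<alpha> v) = \<epsilon> v)) \<and>
		 (\<forall>v\<in>FM (F (Suc i)). \<alpha> (\<phi> i v) \<in> \<phi>' i ` FM (G (Suc i)))"
	let ?Q = "\<lambda>i \<alpha> \<beta>. \<forall>v\<in>FM (F (Suc i)). \<phi>' i (\<beta> v) = \<alpha> (\<phi> i v)"
	have "\<exists>\<alpha>. \<forall>i. ?P i (\<alpha> i) \<and> ?Q i (\<alpha> i) (\<alpha> (Suc i))"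
	proof (rule dependent_nat_choice)
		have "\<epsilon> v \<in> \<epsilon>' ` FM (G 0)" if "v \<in> FM (F 0)" for v
			unfolding resolutionD(3)[OF G] using graded_homD(1)[OF resolutionD(1)[OF F] that] .
		from lift_hom[OF resolutionD(1)[OF F] resolutionD(1)[OF G] M this]
		obtain \<alpha> where \<alpha>': "\<alpha> \<in> graded_hom (free_mod (F 0)) (free_mod (G 0)) \<and>
			(\<forall>v\<in>FM (F 0). \<epsilon>' (\<alpha> v) = \<epsilon> v)" ..
		note \<alpha> = conjunct1[OF \<alpha>'] bspec[OF conjunct2[OF \<alpha>']]
		have "\<alpha> (\<phi> 0 v) \<in> \<phi>' 0 ` FM (G (Suc 0))" if v: "v \<in> FM (F (Suc 0))" for v
		proof -
			have w: "\<phi> 0 v \<in> FM (F 0)" using graded_homD(1)[OF resolutionD(2)[OF F] v] .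
			have "\<epsilon>' (\<alpha> (\<phi> 0 v)) = \<zero>\<^bsub>M\<^esub>" using \<alpha>(2)[OF w] resolution_complex(1)[OF F v] by simp
			then have "\<alpha> (\<phi> 0 v) \<in> {v \<in> FM (G 0). \<epsilon>' v = \<zero>\<^bsub>M\<^esub>}"
				using graded_homD(1)[OF \<alpha>(1) w] by simp
			then show ?thesis unfolding resolutionD(4)[OF G] .
		qed
		then show "\<exists>\<alpha>. ?P 0 \<alpha>" using \<alpha>' by (intro exI[of _ \<alpha>]) simp
	next
		fix \<alpha> i assume P: "?P i \<alpha>"
		have "(\<lambda>v. \<alpha> (\<phi> i v)) \<in> graded_hom (free_mod (F (Suc i))) (free_mod (G i))"
			by (rule graded_hom_comp[OF resolutionD(2)[OF F] conjunct1[OF P]])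
		from lift_hom[OF this resolutionD(2)[OF G] comp_module_free bspec[OF conjunct2[OF conjunct2[OF P]]]]
		obtain \<beta> where \<beta>': "\<beta> \<in> graded_hom (free_mod (F (Suc i))) (free_mod (G (Suc i))) \<and>
			(\<forall>v\<in>FM (F (Suc i)). \<phi>' i (\<beta> v) = \<alpha> (\<phi> i v))" ..
		note \<beta> = conjunct1[OF \<beta>'] bspec[OF conjunct2[OF \<beta>']]
		have "\<beta> (\<phi> (Suc i) v) \<in> \<phi>' (Suc i) ` carrier (free_mod (G (Suc (Suc i))))"
			if v: "v \<in> carrier (free_mod (F (Suc (Suc i))))" for v
		proof -
			have w: "\<phi> (Suc i) v \<in> FM (F (Suc i))" using graded_homD(1)[OF resolutionD(2)[OF F] v] .
			have "\<phi>' i (\<beta> (\<phi> (Suc i) v)) = (\<lambda>_. 0)"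
				using \<beta>(2)[OF w] resolution_complex(2)[OF F v] hom_zero[OF conjunct1[OF P] comp_module_free] by simp
			then have "\<beta> (\<phi> (Suc i) v) \<in> {v \<in> FM (G (Suc i)). \<phi>' i v = (\<lambda>_. 0)}"
				using graded_homD(1)[OF \<beta>(1) w] by simp
			then show ?thesis unfolding resolutionD(5)[OF G] .
		qed
		then have "?P (Suc i) \<beta> \<and> ?Q i \<alpha> \<beta>" using \<beta>' by simp
		then show "\<exists>\<beta>. ?P (Suc i) \<beta> \<and> ?Q i \<alpha> \<beta>" by (rule exI[where x = \<beta>])
	qed
	then obtain \<alpha> where \<alpha>: "\<forall>i. ?P i (\<alpha> i) \<and> ?Q i (\<alpha> i) (\<alpha> (Suc i))" ..
	from spec[OF this, of 0] have "\<forall>v\<in>FM (F 0). \<epsilon>' (\<alpha> 0 v) = \<epsilon> v" by simp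
	moreover have "\<alpha> i \<in> graded_hom (free_mod (F i)) (free_mod (G i))" for i
		using spec[OF \<alpha>, of i] by simp
	moreover have "\<forall>v\<in>FM (F (Suc i)). \<phi>' i (\<alpha> (Suc i) v) = \<alpha> i (\<phi> i v)" for i
		using spec[OF \<alpha>, of i] by simp
	ultimately show ?thesis by (intro exI[of _ \<alpha>]) simp
qed

lemma lookup_0_eval: "lk p 0 = mpoly_eval p (\<lambda>_. 0)"
proof -
	have "monom_eval m (\<lambda>_. 0) = (if m = 0 then 1 else 0)" for m :: "'a \<Rightarrow>\<^sub>0 nat"
	proof (cases "m = 0")
		case False
		then have "\<exists>i. i \<in> Poly_Mapping.keys m" by (metis ex_in_conv keys_eq_empty)
		then show ?thesis using False by (auto simp: monom_eval_def in_keys_iff intro!: prod_zero)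
	qed (simp add: monom_eval_def)
	then show ?thesis
		by (simp add: mpoly_eval_def if_distrib[of "(*) _"] sum.delta in_keys_iff cong: if_cong)
qed

lemma lookup_0_mult: "lk (p * q) 0 = lk p 0 * lk (q :: 'i mpoly) 0"
	by (simp add: lookup_0_eval mpoly_eval_mult)

lemma lookup_0_sum: "lk (sum p A) 0 = (\<Sum>a\<in>A. lk (p a :: 'i mpoly) 0)"
	by (simp add: lookup_0_eval mpoly_eval_sum)

lemma hom_minimal:
	assumes s: "s \<in> graded_hom (free_mod bs) (free_mod cs)" and v: "v \<in> FM bs"
		and z: "\<And>j. lk (v j) 0 = 0"
	shows "lk (s v i) 0 = 0"
	unfolding hom_matrix[OF s v] matrix_map_def by (simp add: lookup_0_sum lookup_0_mult z)

text \<open>A chain endomorphism of a minimal resolution over the identity is homotopic to the identity,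
	so it is the identity modulo the maximal ideal.\<close>

lemma endomorphism_minimal:
	assumes F: "minimal_resolution M F \<phi> \<epsilon>" and M: "comp_module M"
		and \<gamma>: "\<And>i. \<gamma> i \<in> graded_hom (free_mod (F i)) (free_mod (F i))"
		and \<gamma>0: "\<And>v. v \<in> FM (F 0) ==> \<epsilon> (\<gamma> 0 v) = \<epsilon> v"
		and \<gamma>S: "\<And>i v. v \<in> FM (F (Suc i)) ==> \<phi> i (\<gamma> (Suc i) v) = \<gamma> i (\<phi> i v)"
		and v: "v \<in> FM (F i)"
	shows "lk (\<gamma> i v j) 0 = lk (v j) 0"
proof -
	have res: "graded_free_resolution M F \<phi> \<epsilon>" using F by (simp add: minimal_resolution_def)
	have min: "lk (\<phi> i v j) 0 = 0" if "v \<in> FM (F (Suc i))" for i v j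
		using F that unfolding minimal_resolution_def by blast
	note \<phi> = resolutionD(2)[OF res]
	let ?\<delta> = "\<lambda>i v j. \<gamma> i v j - v j"
	have \<delta>: "?\<delta> i \<in> graded_hom (free_mod (F i)) (free_mod (F i))" for i
		by (rule graded_hom_diff[OF \<gamma> graded_hom_id])
	let ?P = "\<lambda>i s. s \<in> graded_hom (free_mod (F i)) (free_mod (F (Suc i))) \<and>
		 (i = 0 --> (\<forall>v\<in>FM (F 0). \<phi> 0 (s v) = ?\<delta> 0 v)) \<and>
		 (\<forall>v\<in>FM (F (Suc i)). \<phi> i (s (\<phi> i v)) = ?\<delta> i (\<phi> i v))"
	let ?Q = "\<lambda>i s s'. \<forall>v\<in>FM (F (Suc i)). \<phi> (Suc i) (s' v) = (\<lambda>j. ?\<delta> (Suc i) v j - s (\<phi> i v) j)"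
	have "\<exists>s. \<forall>i. ?P i (s i) \<and> ?Q i (s i) (s (Suc i))"
	proof (rule dependent_nat_choice)
		have "?\<delta> 0 v \<in> \<phi> 0 ` FM (F (Suc 0))" if v: "v \<in> FM (F 0)" for v
		proof -
			note \<epsilon> = resolutionD(1)[OF res]
			have w: "?\<delta> 0 v \<in> FM (F 0)" using graded_homD(1)[OF \<delta> v] .
			have "\<epsilon> (\<gamma> 0 v) = \<epsilon> (?\<delta> 0 v) \<oplus>\<^bsub>M\<^esub> \<epsilon> v" using graded_homD(2)[OF \<epsilon> w v] by simp
			then have "\<epsilon> (?\<delta> 0 v) \<oplus>\<^bsub>M\<^esub> \<epsilon> v = \<epsilon> v" using \<gamma>0[OF v] by simp
			then have "\<epsilon> (?\<delta> 0 v) = \<zero>\<^bsub>M\<^esub>"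
				by (rule comp_module_cancel[OF M graded_homD(1)[OF \<epsilon> w] graded_homD(1)[OF \<epsilon> v]])
			then have "?\<delta> 0 v \<in> {v \<in> FM (F 0). \<epsilon> v = \<zero>\<^bsub>M\<^esub>}" using w by simp
			then show ?thesis unfolding resolutionD(4)[OF res] .
		qed
		from lift_hom[OF \<delta>[of 0] \<phi>[of 0] comp_module_free this]
		obtain s where s: "s \<in> graded_hom (free_mod (F 0)) (free_mod (F (Suc 0))) \<and>
			(\<forall>v\<in>FM (F 0). \<phi> 0 (s v) = ?\<delta> 0 v)" ..
		have "\<forall>v\<in>FM (F (Suc 0)). \<phi> 0 (s (\<phi> 0 v)) = ?\<delta> 0 (\<phi> 0 v)"
			using bspec[OF conjunct2[OF s] graded_homD(1)[OF \<phi>[of 0]]] by (rule ballI)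
		with s have "?P 0 s" by simp
		then show "\<exists>s. ?P 0 s" by (rule exI[where x = s])
	next
		fix s i assume P: "?P i s"
		have h: "(\<lambda>v j. ?\<delta> (Suc i) v j - s (\<phi> i v) j) \<in> graded_hom (free_mod (F (Suc i))) (free_mod (F (Suc i)))"
			by (rule graded_hom_diff[OF \<delta> graded_hom_comp[OF \<phi> conjunct1[OF P]]])
		have "(\<lambda>j. ?\<delta> (Suc i) v j - s (\<phi> i v) j) \<in> \<phi> (Suc i) ` carrier (free_mod (F (Suc (Suc i))))"
			if v: "v \<in> FM (F (Suc i))" for v
		proof -
			have w: "\<phi> i v \<in> FM (F i)" using graded_homD(1)[OF \<phi> v] .
			have sw: "s (\<phi> i v) \<in> FM (F (Suc i))" using graded_homD(1)[OF conjunct1[OF P] w] .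
			have c: "(\<lambda>j. ?\<delta> (Suc i) v j - s (\<phi> i v) j) \<in> FM (F (Suc i))" using graded_homD(1)[OF h v] .
			have "\<phi> i (?\<delta> (Suc i) v) = \<phi> i ((\<lambda>j. ?\<delta> (Suc i) v j - s (\<phi> i v) j) \<oplus>\<^bsub>free_mod (F (Suc i))\<^esub> s (\<phi> i v))" by simp
			also have "\<dots> = \<phi> i (\<lambda>j. ?\<delta> (Suc i) v j - s (\<phi> i v) j) \<oplus>\<^bsub>free_mod (F i)\<^esub> \<phi> i (s (\<phi> i v))"
				by (rule graded_homD(2)[OF \<phi> c sw])
			finally have 1: "\<phi> i (?\<delta> (Suc i) v) = (\<lambda>j. \<phi> i (\<lambda>j. ?\<delta> (Suc i) v j - s (\<phi> i v) j) j + ?\<delta> i (\<phi> i v) j)"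
				using P v by simp
			have "\<phi> i (\<gamma> (Suc i) v) = \<phi> i (?\<delta> (Suc i) v \<oplus>\<^bsub>free_mod (F (Suc i))\<^esub> v)" by simp
			also have "\<dots> = \<phi> i (?\<delta> (Suc i) v) \<oplus>\<^bsub>free_mod (F i)\<^esub> \<phi> i v"
				by (rule graded_homD(2)[OF \<phi> graded_homD(1)[OF \<delta> v] v])
			finally have "\<phi> i (?\<delta> (Suc i) v) = ?\<delta> i (\<phi> i v)" using \<gamma>S[OF v] by (simp add: fun_eq_iff)
			then have "\<phi> i (\<lambda>j. ?\<delta> (Suc i) v j - s (\<phi> i v) j) = (\<lambda>_. 0)" using 1 by (simp add: fun_eq_iff)
			then have "(\<lambda>j. ?\<delta> (Suc i) v j - s (\<phi> i v) j) \<in> {v \<in> FM (F (Suc i)). \<phi> i v = (\<lambda>_. 0)}"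
				using c by simp
			then show ?thesis unfolding resolutionD(5)[OF res] .
		qed
		from lift_hom[OF h \<phi>[of "Suc i"] comp_module_free this]
		obtain s' where s'': "s' \<in> graded_hom (free_mod (F (Suc i))) (free_mod (F (Suc (Suc i)))) \<and>
			(\<forall>v\<in>FM (F (Suc i)). \<phi> (Suc i) (s' v) = (\<lambda>j. ?\<delta> (Suc i) v j - s (\<phi> i v) j))" ..
		note s' = conjunct1[OF s''] bspec[OF conjunct2[OF s'']]
		have "\<phi> (Suc i) (s' (\<phi> (Suc i) v)) = ?\<delta> (Suc i) (\<phi> (Suc i) v)" if v: "v \<in> carrier (free_mod (F (Suc (Suc i))))" for v
		proof -
			have w: "\<phi> (Suc i) v \<in> FM (F (Suc i))" using graded_homD(1)[OF \<phi> v] .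
			show ?thesis using s'(2)[OF w] resolution_complex(2)[OF res v] hom_zero[OF conjunct1[OF P] comp_module_free]
				by simp
		qed
		then have "?P (Suc i) s' \<and> ?Q i s s'" using s'' by simp
		then show "\<exists>s'. ?P (Suc i) s' \<and> ?Q i s s'" by (rule exI[where x = s'])
	qed
	then obtain s where s': "\<forall>i. ?P i (s i) \<and> ?Q i (s i) (s (Suc i))" ..
	note s = conjunct1[OF spec[OF s']] conjunct2[OF spec[OF s']]
	have "lk (?\<delta> i v j) 0 = 0"
	proof (cases i)
		case 0
		have "s 0 v \<in> FM (F (Suc 0))" using graded_homD(1)[OF conjunct1[OF s(1)] v] 0 by simp
		then have "lk (\<phi> 0 (s 0 v) j) 0 = 0" by (rule min)
		then show ?thesis using s(1)[of 0] v 0 by simp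
	next
		case (Suc k)
		have v': "v \<in> FM (F (Suc k))" using v Suc by simp
		have "s (Suc k) v \<in> carrier (free_mod (F (Suc (Suc k))))"
			using graded_homD(1)[OF conjunct1[OF s(1)] v'] .
		then have "lk (\<phi> (Suc k) (s (Suc k) v) j) 0 = 0" by (rule min)
		moreover have "lk (s k (\<phi> k v) j) 0 = 0"
			by (rule hom_minimal[OF conjunct1[OF s(1)] graded_homD(1)[OF \<phi> v'] min[OF v']])
		moreover have "\<phi> (Suc k) (s (Suc k) v) = (\<lambda>j. ?\<delta> (Suc k) v j - s k (\<phi> k v) j)" using bspec[OF s(2) v'] .
		ultimately show ?thesis using Suc by (simp add: lookup_minus)
	qed
	then show ?thesis by (simp add: lookup_minus)
qed

text \<open>Comparison maps in both directions compose to an endomorphism lifting the identity, and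
	modulo the maximal ideal that is the identity. Hence a shift of the one resolution cannot be
	missing from the other.\<close>

lemma minimal_shifts_subset:
	assumes F: "minimal_resolution M F \<phi> \<epsilon>" and G: "minimal_resolution M G \<phi>' \<epsilon>'" and M: "comp_module M"
	shows "set (F i) \<subseteq> set (G i)"
proof
	have rF: "graded_free_resolution M F \<phi> \<epsilon>" and rG: "graded_free_resolution M G \<phi>' \<epsilon>'"
		using F G by (simp_all add: minimal_resolution_def)
	from chain_lift[OF rF rG M] obtain \<alpha> where \<alpha>':
		"(\<forall>i. \<alpha> i \<in> graded_hom (free_mod (F i)) (free_mod (G i))) \<and>
		(\<forall>v\<in>FM (F 0). \<epsilon>' (\<alpha> 0 v) = \<epsilon> v) \<and>
		(\<forall>i. \<forall>v\<in>FM (F (Suc i)). \<phi>' i (\<alpha> (Suc i) v) = \<alpha> i (\<phi> i v))" ..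
	note \<alpha> = spec[OF conjunct1[OF \<alpha>']] bspec[OF conjunct1[OF conjunct2[OF \<alpha>']]]
		bspec[OF spec[OF conjunct2[OF conjunct2[OF \<alpha>']]]]
	from chain_lift[OF rG rF M] obtain \<beta> where \<beta>':
		"(\<forall>i. \<beta> i \<in> graded_hom (free_mod (G i)) (free_mod (F i))) \<and>
		(\<forall>v\<in>FM (G 0). \<epsilon> (\<beta> 0 v) = \<epsilon>' v) \<and>
		(\<forall>i. \<forall>v\<in>FM (G (Suc i)). \<phi> i (\<beta> (Suc i) v) = \<beta> i (\<phi>' i v))" ..
	note \<beta> = spec[OF conjunct1[OF \<beta>']] bspec[OF conjunct1[OF conjunct2[OF \<beta>']]]
		bspec[OF spec[OF conjunct2[OF conjunct2[OF \<beta>']]]]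
	have \<gamma>: "lk (\<beta> i (\<alpha> i v) j) 0 = lk (v j) 0" if "v \<in> FM (F i)" for v j
	proof (rule endomorphism_minimal[OF F M, of "\<lambda>i v. \<beta> i (\<alpha> i v)", OF _ _ _ that])
		show "(\<lambda>v. \<beta> i (\<alpha> i v)) \<in> graded_hom (free_mod (F i)) (free_mod (F i))" for i
			by (rule graded_hom_comp[OF \<alpha>(1) \<beta>(1)])
		show "\<epsilon> (\<beta> 0 (\<alpha> 0 v)) = \<epsilon> v" if "v \<in> FM (F 0)" for v
			using \<beta>(2)[OF graded_homD(1)[OF \<alpha>(1) that]] \<alpha>(2)[OF that] by simp
		show "\<phi> i (\<beta> (Suc i) (\<alpha> (Suc i) v)) = \<beta> i (\<alpha> i (\<phi> i v))" if "v \<in> FM (F (Suc i))" for i v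
			using \<beta>(3)[OF graded_homD(1)[OF \<alpha>(1) that]] \<alpha>(3)[OF that] by simp
	qed
	fix b assume "b \<in> set (F i)"
	then obtain j where j: "j < length (F i)" "b = F i ! j" by (auto simp: in_set_conv_nth)
	have p: "single_vec j 1 \<in> piece (free_mod (F i)) b"
		using single_vec_piece[OF j(1) homogeneous_Const[of 1]] j(2) by simp
	define w where "w = \<alpha> i (single_vec j 1)"
	have wp: "w \<in> piece (free_mod (G i)) b" unfolding w_def using graded_homD(4)[OF \<alpha>(1) p] .
	have "lk (\<beta> i w j) 0 = 1"
		using \<gamma>[OF piece_carrier[OF p], of j] unfolding w_def by (simp add: single_vec_def lookup_Const flip: Const_1)
	then have "(\<Sum>l<length (G i). lk (w l) 0 * lk (\<beta> i (single_vec l 1) j) 0) = 1"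
		unfolding hom_matrix[OF \<beta>(1) piece_carrier[OF wp]] matrix_map_def lookup_0_sum lookup_0_mult .
	then obtain l where l: "l < length (G i)" "lk (w l) 0 \<noteq> 0"
		by (metis (no_types, lifting) lessThan_iff mult_zero_left sum.neutral zero_neq_one)
	have "w l \<in> homog (b - G i ! l)" using wp l by (simp add: free_mod_piece)
	then have "b - G i ! l = 0" using l(2) homogeneous_lookup_0 by blast
	then show "b \<in> set (G i)" using l(1) by simp
qed

theorem cm_regularity_eq:
	assumes F: "minimal_resolution M F \<phi> \<epsilon>" and M: "comp_module M"
	shows "cm_regularity M = Max {b - int i | i b. b \<in> set (F i)}"
	unfolding cm_regularity_def
proof (rule the_equality)
	show "\<exists>F' \<phi> \<epsilon>. minimal_resolution M F' \<phi> \<epsilon> \<and> Max {b - int i |i b. b \<in> set (F i)} = Max {b - int i |i b. b \<in> set (F' i)}"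
		using F by blast
	fix r assume "\<exists>F \<phi> \<epsilon>. minimal_resolution M F \<phi> \<epsilon> \<and> r = Max {b - int i |i b. b \<in> set (F i)}"
	then obtain G \<phi>' \<epsilon>' where G: "minimal_resolution M G \<phi>' \<epsilon>'" "r = Max {b - int i |i b. b \<in> set (G i)}" by blast
	have "set (F i) = set (G i)" for i
		using minimal_shifts_subset[OF F G(1) M] minimal_shifts_subset[OF G(1) F M] by blast
	then show "r = Max {b - int i |i b. b \<in> set (F i)}" using G(2) by simp
qed

section \<open>The Milnor algebra as a graded module\<close>

lemma S_ring_simps [simp]:
	"carrier S_ring = UNIV" "x \<oplus>\<^bsub>S_ring\<^esub> y = x + y" "x \<otimes>\<^bsub>S_ring\<^esub> y = x * y" "\<zero>\<^bsub>S_ring\<^esub> = 0" "\<one>\<^bsub>S_ring\<^esub> = 1"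
	by (simp_all add: S_ring_def)

lemma S_ring_cring: "cring S_ring"
proof (rule cringI)
	show "abelian_group S_ring"
	proof (rule abelian_groupI)
		show "\<exists>y\<in>carrier S_ring. y \<oplus>\<^bsub>S_ring\<^esub> x = \<zero>\<^bsub>S_ring\<^esub>" for x by (rule bexI[of _ "- x"]) simp_all
	qed (simp_all add: ac_simps)
	show "Group.comm_monoid S_ring" by (rule comm_monoidI) (simp_all add: ac_simps)
qed (simp add: distrib_right)

definition jac :: "S => S set" where
	"jac f = {u * pd 1 f + v * pd 2 f + w * pd 3 f | u v w. True}"

lemma jacI: "u * pd 1 f + v * pd 2 f + w * pd 3 f \<in> jac f"
	unfolding jac_def by blast

lemma jac_add: "p \<in> jac f ==> q \<in> jac f ==> p + q \<in> jac f"
proof -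
	assume "p \<in> jac f" "q \<in> jac f"
	then obtain u v w u' v' w' where "p = u * pd 1 f + v * pd 2 f + w * pd 3 f"
		"q = u' * pd 1 f + v' * pd 2 f + w' * pd 3 f" unfolding jac_def by blast
	then have "p + q = (u + u') * pd 1 f + (v + v') * pd 2 f + (w + w') * pd 3 f" by (simp add: algebra_simps)
	then show ?thesis using jacI by metis
qed

lemma jac_mult: "p \<in> jac f ==> r * p \<in> jac f"
proof -
	assume "p \<in> jac f"
	then obtain u v w where "p = u * pd 1 f + v * pd 2 f + w * pd 3 f" unfolding jac_def by blast
	then have "r * p = (r * u) * pd 1 f + (r * v) * pd 2 f + (r * w) * pd 3 f" by (simp add: algebra_simps)
	then show ?thesis using jacI by metis
qed

lemma jac_mult': "p \<in> jac f ==> p * r \<in> jac f"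
	using jac_mult[of p f r] by (simp add: mult.commute)

lemma jac_0: "0 \<in> jac f"
	using jacI[of 0 f 0 0] by simp

lemma jac_uminus: "p \<in> jac f ==> - p \<in> jac f"
	using jac_mult[of p f "- 1"] by simp

lemma jacobian_ideal_eq: "jacobian_ideal f = jac f"
proof -
	interpret S: cring S_ring by (rule S_ring_cring)
	have ideal: "ideal (jac f) S_ring"
	proof (rule idealI)
		show "ring S_ring" by (rule S.ring_axioms)
		show "subgroup (jac f) (add_monoid S_ring)"
		proof
			show "inv\<^bsub>add_monoid S_ring\<^esub> x \<in> jac f" if "x \<in> jac f" for x
			proof -
				have "\<ominus>\<^bsub>S_ring\<^esub> x = - x"
					by (rule S.minus_equality) simp_all
				then show ?thesis using jac_uminus[OF that] by (simp add: a_inv_def)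
			qed
		qed (simp_all add: jac_add jac_0)
	qed (simp_all add: jac_mult jac_mult')
	have sub: "{pd 1 f, pd 2 f, pd 3 f} \<subseteq> jac f"
		using jacI[of 1 f 0 0] jacI[of 0 f 1 0] jacI[of 0 f 0 1] by simp
	show ?thesis unfolding jacobian_ideal_def
	proof
		show "Idl\<^bsub>S_ring\<^esub> {pd 1 f, pd 2 f, pd 3 f} \<subseteq> jac f" by (rule S.genideal_minimal[OF ideal sub])
		interpret I: ideal "Idl\<^bsub>S_ring\<^esub> {pd 1 f, pd 2 f, pd 3 f}" S_ring by (rule S.genideal_ideal) simp
		have self: "{pd 1 f, pd 2 f, pd 3 f} \<subseteq> Idl\<^bsub>S_ring\<^esub> {pd 1 f, pd 2 f, pd 3 f}" by (rule S.genideal_self) simp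
		show "jac f \<subseteq> Idl\<^bsub>S_ring\<^esub> {pd 1 f, pd 2 f, pd 3 f}"
		proof
			fix p assume "p \<in> jac f"
			then obtain u v w where p: "p = u * pd 1 f + v * pd 2 f + w * pd 3 f" unfolding jac_def by blast
			have "u * pd 1 f \<in> Idl\<^bsub>S_ring\<^esub> {pd 1 f, pd 2 f, pd 3 f}" "v * pd 2 f \<in> Idl\<^bsub>S_ring\<^esub> {pd 1 f, pd 2 f, pd 3 f}"
				"w * pd 3 f \<in> Idl\<^bsub>S_ring\<^esub> {pd 1 f, pd 2 f, pd 3 f}"
				using I.I_l_closed[of "pd 1 f" u] I.I_l_closed[of "pd 2 f" v] I.I_l_closed[of "pd 3 f" w] self by simp_all
			then show "p \<in> Idl\<^bsub>S_ring\<^esub> {pd 1 f, pd 2 f, pd 3 f}"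
				unfolding p using I.a_closed by simp
		qed
	qed
qed

lemma jac_ideal: "ideal (jac f) S_ring"
	using ring.genideal_ideal[OF cring.axioms(1)[OF S_ring_cring]] unfolding jacobian_ideal_eq[symmetric] jacobian_ideal_def
	by simp

lemma milnor_proj_set: "milnor_proj f p = {j + p | j. j \<in> jac f}"
	unfolding milnor_proj_def jacobian_ideal_eq a_r_coset_def r_coset_def by auto

lemma milnor_proj_eq: "milnor_proj f p = milnor_proj f q \<longleftrightarrow> p - q \<in> jac f"
proof
	assume "milnor_proj f p = milnor_proj f q"
	moreover have "p \<in> milnor_proj f p" unfolding milnor_proj_set using jac_0 by force
	ultimately obtain j where "p = j + q" "j \<in> jac f" unfolding milnor_proj_set by blast
	then show "p - q \<in> jac f" by simp
next
	have *: "x \<in> milnor_proj f q" if pq: "p - q \<in> jac f" and x: "x \<in> milnor_proj f p" for p q x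
	proof -
		obtain j where "x = j + p" "j \<in> jac f" using x unfolding milnor_proj_set by blast
		then have "x = (j + (p - q)) + q" "j + (p - q) \<in> jac f" using jac_add pq by auto
		then show ?thesis unfolding milnor_proj_set by blast
	qed
	assume pq: "p - q \<in> jac f"
	then have "q - p \<in> jac f" using jac_uminus by fastforce
	then show "milnor_proj f p = milnor_proj f q" using * pq by blast
qed

lemma milnor_carrier: "carrier (milnor f) = range (milnor_proj f)"
proof -
	have "carrier (milnor f) = a_rcosets\<^bsub>S_ring\<^esub> (jacobian_ideal f)"
		by (simp add: milnor_def Let_def FactRing_def)
	also have "\<dots> = range (milnor_proj f)"
		unfolding A_RCOSETS_def' milnor_proj_def by auto
	finally show ?thesis .
qed

lemma milnor_ops:
	"milnor_proj f p \<oplus>\<^bsub>milnor f\<^esub> milnor_proj f q = milnor_proj f (p + q)"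
	"milnor_proj f p \<otimes>\<^bsub>milnor f\<^esub> milnor_proj f q = milnor_proj f (p * q)"
	"\<zero>\<^bsub>milnor f\<^esub> = milnor_proj f 0"
	"\<one>\<^bsub>milnor f\<^esub> = milnor_proj f 1"
	"r \<odot>\<^bsub>milnor f\<^esub> milnor_proj f p = milnor_proj f (r * p)"
	"piece (milnor f) k = milnor_proj f ` homog k"
proof -
	interpret I: ideal "jac f" S_ring by (rule jac_ideal)
	show "milnor_proj f p \<oplus>\<^bsub>milnor f\<^esub> milnor_proj f q = milnor_proj f (p + q)"
		using I.a_rcos_sum[of p q] by (simp add: milnor_def milnor_proj_def Let_def FactRing_def jacobian_ideal_eq)
	show "milnor_proj f p \<otimes>\<^bsub>milnor f\<^esub> milnor_proj f q = milnor_proj f (p * q)"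
		"r \<odot>\<^bsub>milnor f\<^esub> milnor_proj f p = milnor_proj f (r * p)"
		using I.rcoset_mult_add[of p q] I.rcoset_mult_add[of r p]
		by (simp_all add: milnor_def milnor_proj_def Let_def FactRing_def jacobian_ideal_eq)
	show "\<zero>\<^bsub>milnor f\<^esub> = milnor_proj f 0"
		unfolding milnor_proj_set by (simp add: milnor_def Let_def FactRing_def jacobian_ideal_eq)
	show "\<one>\<^bsub>milnor f\<^esub> = milnor_proj f 1"
		by (simp add: milnor_def milnor_proj_def Let_def FactRing_def jacobian_ideal_eq)
	show "piece (milnor f) k = milnor_proj f ` homog k"
		by (simp add: milnor_def milnor_proj_def Let_def)
qed

lemma milnor_ring: "ring (milnor f)"
proof (rule ringI)
	show "abelian_group (milnor f)"
	proof (rule abelian_groupI)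
		fix x assume "x \<in> carrier (milnor f)"
		then obtain p where p: "x = milnor_proj f p" unfolding milnor_carrier by blast
		show "\<exists>y\<in>carrier (milnor f). y \<oplus>\<^bsub>milnor f\<^esub> x = \<zero>\<^bsub>milnor f\<^esub>"
			by (rule bexI[of _ "milnor_proj f (- p)"]) (simp_all add: p milnor_ops milnor_carrier)
	qed (auto simp: milnor_carrier milnor_ops ac_simps)
	show "monoid (milnor f)"
		by (rule monoidI) (auto simp: milnor_carrier milnor_ops ac_simps)
qed (auto simp: milnor_carrier milnor_ops algebra_simps)

lemma hcomp_diff: "hcomp k (p - q) = hcomp k p - hcomp k q"
	by (rule poly_mapping_eqI) (auto simp: lookup_hcomp lookup_minus)

lemma jac_hcomp:
	assumes f: "f \<in> homog d" and p: "p \<in> jac f" shows "hcomp k p \<in> jac f"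
proof -
	obtain u v w where "p = u * pd 1 f + v * pd 2 f + w * pd 3 f" using p unfolding jac_def by blast
	then have "p = pd 1 f * u + pd 2 f * v + pd 3 f * w" by (simp add: mult.commute)
	then have "hcomp k p = pd 1 f * hcomp (k - (d - 1)) u + pd 2 f * hcomp (k - (d - 1)) v + pd 3 f * hcomp (k - (d - 1)) w"
		by (simp add: hcomp_add hcomp_mult[OF pd_homogeneous[OF f]])
	then show ?thesis
		using jacI[of "hcomp (k - (d - 1)) u" f "hcomp (k - (d - 1)) v" "hcomp (k - (d - 1)) w"] by (simp add: mult.commute)
qed

lemma comp_module_milnor:
	assumes f: "f \<in> homog d"
	shows "comp_module (milnor f)"
proof -
	define C where "C k X = milnor_proj f (hcomp k (SOME p. X = milnor_proj f p))" for k X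
	have C: "C k (milnor_proj f p) = milnor_proj f (hcomp k p)" for k p
	proof -
		have "milnor_proj f p = milnor_proj f (SOME q. milnor_proj f p = milnor_proj f q)" by (rule someI[of _ p]) simp
		then have "p - (SOME q. milnor_proj f p = milnor_proj f q) \<in> jac f" unfolding milnor_proj_eq[symmetric] .
		from jac_hcomp[OF f this] show ?thesis
			unfolding C_def milnor_proj_eq hcomp_diff using jac_uminus by fastforce
	qed
	show ?thesis
		unfolding comp_module_def
	proof (intro conjI)
		show "\<exists>C. \<forall>k. (\<forall>u\<in>carrier (milnor f). \<forall>v\<in>carrier (milnor f).
					C k (u \<oplus>\<^bsub>milnor f\<^esub> v) = C k u \<oplus>\<^bsub>milnor f\<^esub> C k v) \<and>
				(\<forall>n\<in>piece (milnor f) k. C k n = n) \<and>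
				(\<forall>j. j \<noteq> k --> (\<forall>n\<in>piece (milnor f) j. C k n = \<zero>\<^bsub>milnor f\<^esub>))"
		proof (intro exI[of _ C] allI conjI impI ballI)
			fix k u v assume "u \<in> carrier (milnor f)" "v \<in> carrier (milnor f)"
			then obtain p q where "u = milnor_proj f p" "v = milnor_proj f q" unfolding milnor_carrier by blast
			then show "C k (u \<oplus>\<^bsub>milnor f\<^esub> v) = C k u \<oplus>\<^bsub>milnor f\<^esub> C k v"
				by (simp add: milnor_ops C hcomp_add)
		next
			fix k n assume "n \<in> piece (milnor f) k"
			then obtain p where "n = milnor_proj f p" "p \<in> homog k" unfolding milnor_ops by blast
			then show "C k n = n" by (simp add: C hcomp_of_homogeneous)
		next
			fix k j :: int and n assume "j \<noteq> k" "n \<in> piece (milnor f) j"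
			then obtain p where "n = milnor_proj f p" "p \<in> homog j" unfolding milnor_ops by blast
			then show "C k n = \<zero>\<^bsub>milnor f\<^esub>" using \<open>j \<noteq> k\<close> by (simp add: C hcomp_of_homogeneous milnor_ops)
		qed
		show "\<forall>u\<in>carrier (milnor f). \<forall>v\<in>carrier (milnor f). u \<oplus>\<^bsub>milnor f\<^esub> v = v --> u = \<zero>\<^bsub>milnor f\<^esub>"
			by (auto simp: milnor_carrier milnor_ops milnor_proj_eq)
	qed (auto simp: milnor_carrier milnor_ops)
qed

section \<open>Dimensions of graded pieces\<close>

definition vscale :: "complex => (nat => S) => nat => S" where
	"vscale c v = (\<lambda>i. Const c * v i)"

interpretation vs: vector_space vscale
	by unfold_locales (auto simp: vscale_def fun_eq_iff distrib_left distrib_right Const_add Const_mult mult.assoc)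

text \<open>The maps between graded pieces are linear only as restrictions to the pieces, which is why the
	subspace \<open>V\<close> is explicit.\<close>

lemma rank_nullity:
	assumes V: "vs.subspace V" and B: "finite B" "V \<subseteq> vs.span B"
		and add: "\<And>u v. u \<in> V ==> v \<in> V ==> T (u + v) = T u + T v"
		and scale: "\<And>c v. v \<in> V ==> T (vscale c v) = vscale c (T v)"
	shows "vs.dim V = vs.dim {v \<in> V. T v = 0} + vs.dim (T ` V)"
		"\<exists>B'. finite B' \<and> T ` V \<subseteq> vs.span B'"
proof -
	let ?K = "{v \<in> V. T v = 0}"
	have T0: "T 0 = 0" using scale[of 0 0] vs.subspace_0[OF V] by simp
	have K: "vs.subspace ?K"
		by (rule vs.subspaceI) (use V add scale T0 in \<open>auto simp: vs.subspace_0 vs.subspace_add vs.subspace_scale\<close>)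
	obtain C where C: "C \<subseteq> ?K" "vs.independent C" "?K \<subseteq> vs.span C"
		using vs.maximal_independent_subset[of ?K] by blast
	have CV: "C \<subseteq> V" using C(1) by blast
	obtain D where D: "C \<subseteq> D" "D \<subseteq> V" "vs.independent D" "V \<subseteq> vs.span D"
		using vs.maximal_independent_subset_extend[OF CV C(2)] by blast
	have D_sub: "D \<subseteq> vs.span B" using D(2) B(2) by (rule subset_trans)
	have finD: "finite D" using vs.independent_span_bound[OF B(1) D(3) D_sub] by blast
	have finC: "finite C" using finD D(1) finite_subset by blast
	have TS: "T (\<Sum>x\<in>X. vscale (u x) x) = (\<Sum>x\<in>X. vscale (u x) (T x))" if "finite X" "X \<subseteq> V" for X u
		using that
	proof induction
		case empty
		then show ?case using T0 by (simp add: zero_fun_def)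
	next
		case (insert x X)
		have "(\<Sum>x\<in>X. vscale (u x) x) \<in> V" using insert by (intro vs.subspace_sum[OF V] vs.subspace_scale[OF V]) auto
		moreover have "vscale (u x) x \<in> V" "x \<in> V" using insert vs.subspace_scale[OF V] by auto
		moreover have "T (\<Sum>x\<in>X. vscale (u x) x) = (\<Sum>x\<in>X. vscale (u x) (T x))" using insert by simp
		ultimately show ?case unfolding sum.insert[OF insert(1,2)] by (simp only: add scale)
	qed
	let ?E = "D - C"
	have E: "finite ?E" "?E \<subseteq> V" using finD D(2) by auto
	have zero: "\<forall>x\<in>?E. u x = 0" if u: "(\<Sum>x\<in>?E. vscale (u x) (T x)) = 0" for u
	proof -
		have "(\<Sum>x\<in>?E. vscale (u x) x) \<in> V" by (intro vs.subspace_sum[OF V] vs.subspace_scale[OF V]) (use E in auto)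
		then have "(\<Sum>x\<in>?E. vscale (u x) x) \<in> vs.span C" using C(3) TS[OF E] u by auto
		then obtain w where w: "(\<Sum>x\<in>?E. vscale (u x) x) = (\<Sum>x\<in>C. vscale (w x) x)"
			using vs.span_finite[OF finC] by auto
		define z where "z x = (if x \<in> C then - w x else u x)" for x
		have "(\<Sum>x\<in>D. vscale (z x) x) = (\<Sum>x\<in>?E. vscale (z x) x) + (\<Sum>x\<in>C. vscale (z x) x)"
			using finD D(1) by (simp add: sum.subset_diff)
		also have "\<dots> = (\<Sum>x\<in>?E. vscale (u x) x) - (\<Sum>x\<in>C. vscale (w x) x)"
			by (simp add: z_def sum_negf)
		finally have "(\<Sum>x\<in>D. vscale (z x) x) = 0" using w by simp
		then have "\<forall>x\<in>D. z x = 0" using D(3) finD vs.dependent_finite by blast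
		then show ?thesis by (auto simp: z_def)
	qed
	have inj: "inj_on T ?E"
	proof (rule inj_onI, rule ccontr)
		fix x y assume xy: "x \<in> ?E" "y \<in> ?E" "T x = T y" "x \<noteq> y"
		define u :: "(nat => S) => complex" where "u z = (if z = x then 1 else if z = y then - 1 else 0)" for z
		have "(\<Sum>z\<in>?E. vscale (u z) (T z)) = (\<Sum>z\<in>{x, y}. vscale (u z) (T z))"
			by (rule sum.mono_neutral_right) (use E xy in \<open>auto simp: u_def\<close>)
		also have "\<dots> = 0" using xy by (simp add: u_def)
		finally have "u x = 0" using zero xy(1) by blast
		then show False by (simp add: u_def)
	qed
	have indep: "vs.independent (T ` ?E)"
	proof
		assume "vs.dependent (T ` ?E)"
		then obtain u where u: "\<exists>v\<in>T ` ?E. u v \<noteq> 0" "(\<Sum>v\<in>T ` ?E. vscale (u v) v) = 0"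
			using vs.dependent_finite[of "T ` ?E"] E by auto
		have "(\<Sum>x\<in>?E. vscale (u (T x)) (T x)) = 0" using u(2) by (simp add: sum.reindex[OF inj])
		then show False using zero[of "\<lambda>x. u (T x)"] u(1) by blast
	qed
	have span: "T ` V \<subseteq> vs.span (T ` ?E)"
	proof
		fix y assume "y \<in> T ` V"
		then obtain v where v: "v \<in> V" "y = T v" by blast
		then obtain u where "v = (\<Sum>x\<in>D. vscale (u x) x)" using D(4) vs.span_finite[OF finD] by auto
		then have "y = (\<Sum>x\<in>D. vscale (u x) (T x))" using TS[OF finD D(2)] v by simp
		also have "\<dots> = (\<Sum>x\<in>?E. vscale (u x) (T x)) + (\<Sum>x\<in>C. vscale (u x) (T x))"
			using finD D(1) by (simp add: sum.subset_diff)
		also have "(\<Sum>x\<in>C. vscale (u x) (T x)) = 0" using C(1) by (intro sum.neutral) auto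
		finally have y: "y = (\<Sum>x\<in>?E. vscale (u x) (T x))" by simp
		show "y \<in> vs.span (T ` ?E)" unfolding y by (intro vs.span_sum vs.span_scale vs.span_base imageI)
	qed
	have "vs.dim (T ` V) = card (T ` ?E)"
		by (rule vs.basis_card_eq_dim[symmetric]) (use E span indep in auto)
	also have "\<dots> = card ?E" by (rule card_image[OF inj])
	finally have 1: "vs.dim (T ` V) = card ?E" .
	have 2: "vs.dim ?K = card C" by (rule vs.basis_card_eq_dim[symmetric, OF C(1) C(3) C(2)])
	have 3: "vs.dim V = card D" by (rule vs.basis_card_eq_dim[symmetric, OF D(2) D(4) D(3)])
	have "card D = card C + card ?E" using finD D(1) by (metis add.commute card_Diff_subset card_mono finC le_add_diff_inverse2)
	then show "vs.dim V = vs.dim ?K + vs.dim (T ` V)" using 1 2 3 by simp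
	show "\<exists>B'. finite B' \<and> T ` V \<subseteq> vs.span B'" using span E by blast
qed

text \<open>The dimension of \<open>S\<close> in degree \<open>k\<close>. The quadratic formula for it is valid from \<open>k = - 2\<close> on, which
	is where the sharp thresholds below come from.\<close>

definition hilb :: "int => nat" where
	"hilb k = (if k < 0 then 0 else (nat k + 2) choose 2)"

lemma hilb_double: "- 2 \<le> k ==> 2 * int (hilb k) = (k + 1) * (k + 2)"
proof -
	assume k: "- 2 \<le> k"
	show ?thesis
	proof (cases "k < 0")
		case True
		then have "k = - 1 \<or> k = - 2" using k by linarith
		then show ?thesis by (auto simp: hilb_def)
	next
		case False
		have "2 * ((nat k + 2) choose 2) = (nat k + 2) * (nat k + 1)" by (simp add: choose_two)
		then have "2 * int ((nat k + 2) choose 2) = int ((nat k + 2) * (nat k + 1))" by (metis of_nat_mult of_nat_numeral)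
		also have "\<dots> = (k + 2) * (k + 1)" using False by (simp add: algebra_simps)
		finally show ?thesis using False by (simp add: hilb_def mult.commute)
	qed
qed

lemma card_monomials: "finite {m :: 3 \<Rightarrow>\<^sub>0 nat. monom_degree m = n}"
	"card {m :: 3 \<Rightarrow>\<^sub>0 nat. monom_degree m = n} = (n + 2) choose 2"
proof -
	have deg: "monom_degree m = lk m 1 + lk m 2 + lk m 3" for m :: "3 \<Rightarrow>\<^sub>0 nat"
	proof -
		have "monom_degree m = (\<Sum>i\<in>UNIV. lk m i)" by (rule monom_degree_superset) simp_all
		then show ?thesis by (simp add: sum_3)
	qed
	let ?T = "SIGMA a:{..n}. {..n - a}"
	have bij: "bij_betw (\<lambda>m. (lk m 1, lk m 2)) {m :: 3 \<Rightarrow>\<^sub>0 nat. monom_degree m = n} ?T"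
	proof (rule bij_betwI')
		fix m m' :: "3 \<Rightarrow>\<^sub>0 nat"
		assume m: "m \<in> {m. monom_degree m = n}" "m' \<in> {m. monom_degree m = n}"
		show "((lk m 1, lk m 2) = (lk m' 1, lk m' 2)) = (m = m')"
		proof
			assume "(lk m 1, lk m 2) = (lk m' 1, lk m' 2)"
			then have "lk m i = lk m' i" for i using m exhaust_3[of i] by (auto simp: deg)
			then show "m = m'" by (rule poly_mapping_eqI)
		qed simp
	next
		fix m :: "3 \<Rightarrow>\<^sub>0 nat" assume "m \<in> {m. monom_degree m = n}"
		then show "(lk m 1, lk m 2) \<in> ?T" by (auto simp: deg)
	next
		fix y assume "y \<in> ?T"
		then obtain a b where y: "y = (a, b)" "a + b \<le> n" by fastforce
		let ?m = "psingle (1::3) a + psingle 2 b + psingle 3 (n - a - b)"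
		have "lk ?m 1 = a" "lk ?m 2 = b" "lk ?m 3 = n - a - b" by (simp_all add: lookup_add lookup_single)
		then show "\<exists>m\<in>{m :: 3 \<Rightarrow>\<^sub>0 nat. monom_degree m = n}. y = (lk m 1, lk m 2)"
			using y by (intro bexI[of _ ?m]) (simp_all add: deg)
	qed
	show "finite {m :: 3 \<Rightarrow>\<^sub>0 nat. monom_degree m = n}" using bij bij_betw_finite by fastforce
	have "card {m :: 3 \<Rightarrow>\<^sub>0 nat. monom_degree m = n} = (\<Sum>a\<le>n. Suc (n - a))"
		using bij_betw_same_card[OF bij] by simp
	also have "\<dots> = (n + 2) choose 2"
	proof -
		have "(\<Sum>a\<le>n. Suc (n - a)) = (\<Sum>a\<le>n. Suc a)" by (rule sum.reindex_bij_witness[of _ "\<lambda>a. n - a" "\<lambda>a. n - a"]) auto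
		also have "\<dots> = (n + 2) choose 2" by (induction n) (simp_all add: numeral_2_eq_2)
		finally show ?thesis .
	qed
	finally show "card {m :: 3 \<Rightarrow>\<^sub>0 nat. monom_degree m = n} = (n + 2) choose 2" .
qed

lemma piece_subspace: "vs.subspace (piece (free_mod bs) k)"
	by (rule vs.subspaceI) (auto simp: free_mod_piece vscale_def intro: homogeneous_add homogeneous_Const_mult)

lemma piece_dim:
	"vs.dim (piece (free_mod bs) k) = (\<Sum>b\<leftarrow>bs. hilb (k - b))"
	"\<exists>B. finite B \<and> piece (free_mod bs) k \<subseteq> vs.span B"
proof -
	let ?X = "SIGMA j:{..<length bs}. {m :: 3 \<Rightarrow>\<^sub>0 nat. int (monom_degree m) = k - bs ! j}"
	let ?e = "\<lambda>(j, m). single_vec j (psingle m (1::complex))"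
	have mons: "finite {m :: 3 \<Rightarrow>\<^sub>0 nat. int (monom_degree m) = i} \<and> card {m :: 3 \<Rightarrow>\<^sub>0 nat. int (monom_degree m) = i} = hilb i" for i
	proof (cases "i < 0")
		case True
		then have "{m :: 3 \<Rightarrow>\<^sub>0 nat. int (monom_degree m) = i} = {}" by auto
		then show ?thesis using True by (simp add: hilb_def)
	next
		case False
		then have "{m :: 3 \<Rightarrow>\<^sub>0 nat. int (monom_degree m) = i} = {m. monom_degree m = nat i}" by auto
		then show ?thesis using False card_monomials[of "nat i"] by (simp add: hilb_def)
	qed
	have finX: "finite ?X" using mons by auto
	have coord: "lk (?e (j, m) i) n = (if i = j \<and> m = n then 1 else 0)" for i j m n
		by (auto simp: single_vec_def lookup_single when_def)
	have inj: "inj_on ?e ?X"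
	proof (rule inj_onI)
		fix x y assume "?e x = ?e y"
		then have "lk (?e x (fst y)) (snd y) = lk (?e y (fst y)) (snd y)" by simp
		then show "x = y" using coord[of "fst x" "snd x" "fst y" "snd y"] coord[of "fst y" "snd y" "fst y" "snd y"]
			by (auto simp: prod_eq_iff split: if_splits)
	qed
	have sub: "?e ` ?X \<subseteq> piece (free_mod bs) k"
	proof clarify
		fix j and m :: "3 \<Rightarrow>\<^sub>0 nat" assume jm: "j < length bs" "int (monom_degree m) = k - bs ! j"
		then have "psingle m (1::complex) \<in> homog (k - bs ! j)"
			by (auto simp: homogeneous_iff lookup_single when_def)
		then show "single_vec j (psingle m (1::complex)) \<in> piece (free_mod bs) k"
			using single_vec_piece[OF jm(1), of "psingle m 1" "k - bs ! j"] by simp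
	qed
	have sum_coord: "lk ((\<Sum>x\<in>?X. vscale (u x) (?e x)) j) n = (if (j, n) \<in> ?X then u (j, n) else 0)" for u j n
	proof -
		have "(\<Sum>x\<in>A. vscale (u x) (?e x)) j = (\<Sum>x\<in>A. vscale (u x) (?e x) j)" if "finite A" for A
			using that by induction auto
		then have "lk ((\<Sum>x\<in>?X. vscale (u x) (?e x)) j) n = (\<Sum>x\<in>?X. u x * lk (?e x j) n)"
			using finX by (simp add: lookup_sum vscale_def lookup_Const_mult)
		also have "\<dots> = (\<Sum>x\<in>?X. if x = (j, n) then u x else 0)"
		proof (rule sum.cong[OF refl])
			fix x show "u x * lk (?e x j) n = (if x = (j, n) then u x else 0)"
				using coord[of "fst x" "snd x" j n] by (cases x) auto
		qed
		finally show ?thesis using finX by simp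
	qed
	have span: "piece (free_mod bs) k \<subseteq> vs.span (?e ` ?X)"
	proof
		fix v assume v: "v \<in> piece (free_mod bs) k"
		have "v = (\<Sum>x\<in>?X. vscale (lk (v (fst x)) (snd x)) (?e x))"
		proof (rule ext, rule poly_mapping_eqI)
			fix j n
			have "(j, n) \<notin> ?X ==> lk (v j) n = 0"
			proof (cases "j < length bs")
				case True
				then have "v j \<in> homog (k - bs ! j)" using v by (simp add: free_mod_piece)
				moreover assume "(j, n) \<notin> ?X"
				ultimately show ?thesis using True by (auto simp: homogeneous_iff)
			qed (use v in \<open>simp add: free_mod_piece\<close>)
			then show "lk (v j) n = lk ((\<Sum>x\<in>?X. vscale (lk (v (fst x)) (snd x)) (?e x)) j) n"
				using sum_coord[of "\<lambda>x. lk (v (fst x)) (snd x)" j n] by auto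
		qed
		moreover have "(\<Sum>x\<in>?X. vscale (lk (v (fst x)) (snd x)) (?e x)) \<in> vs.span (?e ` ?X)"
			by (intro vs.span_sum vs.span_scale vs.span_base imageI)
		ultimately show "v \<in> vs.span (?e ` ?X)" by simp
	qed
	have indep: "vs.independent (?e ` ?X)"
	proof
		assume "vs.dependent (?e ` ?X)"
		then obtain u where u: "\<exists>v\<in>?e ` ?X. u v \<noteq> 0" "(\<Sum>v\<in>?e ` ?X. vscale (u v) v) = 0"
			using vs.dependent_finite[of "?e ` ?X"] finX by auto
		have "(\<Sum>x\<in>?X. vscale (u (?e x)) (?e x)) = 0" using u(2) by (simp add: sum.reindex[OF inj])
		then have "u (?e x) = 0" if "x \<in> ?X" for x
			using sum_coord[of "\<lambda>x. u (?e x)" "fst x" "snd x"] that by simp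
		then show False using u(1) by blast
	qed
	have "vs.dim (piece (free_mod bs) k) = card (?e ` ?X)"
		by (rule vs.basis_card_eq_dim[symmetric, OF sub span indep])
	also have "\<dots> = card ?X" by (rule card_image[OF inj])
	also have "\<dots> = (\<Sum>j<length bs. hilb (k - bs ! j))" using mons by simp
	also have "\<dots> = (\<Sum>b\<leftarrow>bs. hilb (k - b))" by (simp add: sum_list_sum_nth atLeast0LessThan)
	finally show "vs.dim (piece (free_mod bs) k) = (\<Sum>b\<leftarrow>bs. hilb (k - b))" .
	show "\<exists>B. finite B \<and> piece (free_mod bs) k \<subseteq> vs.span B" using span finX by blast
qed

section \<open>Invariants of a Milnor algebra read off from a resolution\<close>

definition res_shifts :: "int list => int list => int list => nat => int list" where
	"res_shifts b1 b2 b3 i = (if i = 0 then [0] else if i = 1 then b1 else if i = 2 then b2 else if i = 3 then b3 else [])"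

text \<open>A resolution of length at most three of the Milnor algebra, given by generators \<open>g\<close> of the Jacobian
	ideal, the columns \<open>R2\<close> of their relations and the columns \<open>R3\<close> of the second relations. The
	generators need not be the partial derivatives, which are dependent for a pencil. Strictly
	increasing shifts make the resolution minimal.\<close>

locale milnor_resolution =
	fixes f :: S and d :: int and b1 b2 b3 :: "int list"
		and g :: "nat => S" and R2 R3 :: "nat => nat => S"
	assumes f: "f \<in> homog d"
		and g: "\<And>j. j < length b1 ==> g j \<in> homog (b1 ! j)"
		and jac: "jac f = {(\<Sum>j<length b1. v j * g j) | v. True}"
		and R2: "\<And>j. j < length b2 ==> R2 j \<in> piece (free_mod b1) (b2 ! j)"
		and R3: "\<And>j. j < length b3 ==> R3 j \<in> piece (free_mod b2) (b3 ! j)"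
		and exact1: "\<And>v. v \<in> FM b1 ==>
			(\<Sum>j<length b1. v j * g j) = 0 \<longleftrightarrow> v \<in> matrix_map (length b2) R2 ` FM b2"
		and exact2: "\<And>v. v \<in> FM b2 ==>
			matrix_map (length b2) R2 v = (\<lambda>_. 0) \<longleftrightarrow> v \<in> matrix_map (length b3) R3 ` FM b3"
		and exact3: "\<And>v. v \<in> FM b3 ==> matrix_map (length b3) R3 v = (\<lambda>_. 0) ==> v = (\<lambda>_. 0)"
		and pos1: "\<And>b. b \<in> set b1 ==> 0 < b"
		and pos2: "\<And>b c. b \<in> set b1 ==> c \<in> set b2 ==> b < c"
		and pos3: "\<And>b c. b \<in> set b2 ==> c \<in> set b3 ==> b < c"
begin

abbreviation "\<phi>0 \<equiv> matrix_map (length b1) (\<lambda>j. single_vec 0 (g j))"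
abbreviation "\<phi>1 \<equiv> matrix_map (length b2) R2"
abbreviation "\<phi>2 \<equiv> matrix_map (length b3) R3"

definition maps :: "nat => (nat => S) => nat => S" where
	"maps i = (if i = 0 then \<phi>0 else if i = 1 then \<phi>1 else if i = 2 then \<phi>2 else (\<lambda>_ _. 0))"

lemma \<phi>0_eq: "\<phi>0 v = single_vec 0 (\<Sum>j<length b1. v j * g j)"
	by (auto simp: matrix_map_def single_vec_def)

lemma \<phi>0_eq_0: "\<phi>0 v = (\<lambda>_. 0) \<longleftrightarrow> (\<Sum>j<length b1. v j * g j) = 0"
	unfolding \<phi>0_eq by (auto simp: single_vec_def fun_eq_iff)

lemma hom0: "\<phi>0 \<in> graded_hom (free_mod b1) (free_mod [0])"
proof (rule matrix_map_hom)
	fix j assume "j < length b1"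
	then show "single_vec 0 (g j) \<in> piece (free_mod [0]) (b1 ! j)"
		using single_vec_piece[of 0 "[0]" "g j" "b1 ! j"] g by simp
qed

lemma hom1: "\<phi>1 \<in> graded_hom (free_mod b2) (free_mod b1)"
	by (rule matrix_map_hom) (rule R2)

lemma hom2: "\<phi>2 \<in> graded_hom (free_mod b3) (free_mod b2)"
	by (rule matrix_map_hom) (rule R3)

lemma hom_aug: "(\<lambda>v. milnor_proj f (v 0)) \<in> graded_hom (free_mod [0]) (milnor f)"
	by (rule graded_homI) (auto simp: milnor_carrier milnor_ops free_mod_piece)

lemma hom_maps: "maps i \<in> graded_hom (free_mod (res_shifts b1 b2 b3 (Suc i))) (free_mod (res_shifts b1 b2 b3 i))"
proof -
	have z: "(\<lambda>_ _. 0) \<in> graded_hom (free_mod []) (free_mod bs)" for bs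
		by (rule graded_homI) (auto simp: free_mod_piece)
	consider "i = 0" | "i = 1" | "i = 2" | "i \<ge> 3" by linarith
	then show ?thesis
		by cases (use hom0 hom1 hom2 z in \<open>simp_all add: maps_def res_shifts_def numeral_eq_Suc\<close>)
qed

lemma single_0: "v \<in> FM [0] ==> v = single_vec 0 (v 0)"
	by (auto simp: single_vec_def fun_eq_iff Suc_le_eq)

lemma zero_carrier_nil: "FM [] = {\<lambda>_. 0}"
	by auto

lemma matrix_map_zero: "matrix_map n R (\<lambda>_. 0) = (\<lambda>_. 0)"
	by (simp add: matrix_map_def)

lemma resolution: "graded_free_resolution (milnor f) (res_shifts b1 b2 b3) maps (\<lambda>v. milnor_proj f (v 0))"
	unfolding graded_free_resolution_def
proof (intro conjI allI)
	show "\<exists>n. \<forall>i>n. res_shifts b1 b2 b3 i = []" by (rule exI[of _ 3]) (simp add: res_shifts_def)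
	show "(\<lambda>v. milnor_proj f (v 0)) \<in> graded_hom (free_mod (res_shifts b1 b2 b3 0)) (milnor f)"
		using hom_aug by (simp add: res_shifts_def)
	show "maps i \<in> graded_hom (free_mod (res_shifts b1 b2 b3 (Suc i))) (free_mod (res_shifts b1 b2 b3 i))" for i
		by (rule hom_maps)
	show "(\<lambda>v. milnor_proj f (v 0)) ` FM (res_shifts b1 b2 b3 0) = carrier (milnor f)"
	proof -
		have "single_vec 0 p \<in> FM [0]" "single_vec 0 p 0 = p" for p by (auto simp: single_vec_def)
		then have "milnor_proj f p \<in> (\<lambda>v. milnor_proj f (v 0)) ` FM [0]" for p
			by (metis (no_types, lifting) image_eqI)
		then show ?thesis by (auto simp: res_shifts_def milnor_carrier)
	qed
	show "{v \<in> FM (res_shifts b1 b2 b3 0). milnor_proj f (v 0) = \<zero>\<^bsub>milnor f\<^esub>} =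
			maps 0 ` FM (res_shifts b1 b2 b3 1)"
	proof (intro subset_antisym subsetI)
		fix v assume v: "v \<in> {v \<in> FM (res_shifts b1 b2 b3 0). milnor_proj f (v 0) = \<zero>\<^bsub>milnor f\<^esub>}"
		then have "v 0 \<in> jac f" using milnor_proj_eq[of f "v 0" 0] by (simp add: milnor_ops)
		then obtain w where w: "v 0 = (\<Sum>j<length b1. w j * g j)" unfolding jac by blast
		let ?w = "\<lambda>j. if j < length b1 then w j else 0"
		have "(\<Sum>j<length b1. ?w j * g j) = v 0" unfolding w by (rule sum.cong) auto
		then have "\<phi>0 ?w = v" using single_0[of v] v by (simp add: \<phi>0_eq res_shifts_def)
		moreover have "?w \<in> FM b1" by simp
		ultimately have "v \<in> \<phi>0 ` FM b1" by blast
		then show "v \<in> maps 0 ` FM (res_shifts b1 b2 b3 1)" by (simp add: maps_def res_shifts_def)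
	next
		fix v assume "v \<in> maps 0 ` FM (res_shifts b1 b2 b3 1)"
		then obtain w where w: "v = \<phi>0 w" by (auto simp: maps_def)
		then have "v 0 \<in> jac f" unfolding jac \<phi>0_eq by (auto simp: single_vec_def)
		have tail: "\<forall>i\<ge>Suc 0. v i = 0" unfolding w \<phi>0_eq by (simp add: single_vec_def)
		from \<open>v 0 \<in> jac f\<close> show "v \<in> {v \<in> FM (res_shifts b1 b2 b3 0). milnor_proj f (v 0) = \<zero>\<^bsub>milnor f\<^esub>}"
			using milnor_proj_eq[of f "v 0" 0] tail by (simp add: milnor_ops res_shifts_def)
	qed
	fix i :: nat
	consider "i = 0" | "i = 1" | "i = 2" | "i \<ge> 3" by linarith
	then show "{v \<in> FM (res_shifts b1 b2 b3 (Suc i)). maps i v = \<zero>\<^bsub>free_mod (res_shifts b1 b2 b3 i)\<^esub>} =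
			maps (Suc i) ` carrier (free_mod (res_shifts b1 b2 b3 (Suc (Suc i))))"
	proof cases
		case 1
		have "{v \<in> FM b1. \<phi>0 v = (\<lambda>_. 0)} = \<phi>1 ` FM b2"
			unfolding \<phi>0_eq_0 using exact1 graded_homD(1)[OF hom1] by blast
		then show ?thesis using 1 by (simp add: maps_def res_shifts_def numeral_eq_Suc)
	next
		case 2
		have "{v \<in> FM b2. \<phi>1 v = (\<lambda>_. 0)} = \<phi>2 ` FM b3"
			using exact2 graded_homD(1)[OF hom2] by blast
		then show ?thesis using 2 by (simp add: maps_def res_shifts_def numeral_eq_Suc)
	next
		case 3
		have "{v \<in> FM b3. \<phi>2 v = (\<lambda>_. 0)} = {\<lambda>_. 0}"
			using exact3 matrix_map_zero by fastforce
		then show ?thesis using 3 zero_carrier_nil by (simp add: maps_def res_shifts_def numeral_eq_Suc)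
	next
		case 4
		then show ?thesis using zero_carrier_nil by (simp add: maps_def res_shifts_def)
	qed
qed

lemma minimal: "minimal_resolution (milnor f) (res_shifts b1 b2 b3) maps (\<lambda>v. milnor_proj f (v 0))"
	unfolding minimal_resolution_def
proof (intro conjI allI ballI resolution)
	have M: "lk (matrix_map n R v j) 0 = 0" if "\<And>l. l < n ==> lk (R l j) 0 = 0" for n R v j
		unfolding matrix_map_def by (simp add: lookup_0_sum lookup_0_mult that)
	fix i j :: nat and v
	consider "i = 0" | "i = 1" | "i = 2" | "i \<ge> 3" by linarith
	then show "lk (maps i v j) 0 = 0"
	proof cases
		case 1
		have "lk (single_vec 0 (g l) j) 0 = 0" if "l < length b1" for l
			using homogeneous_lookup_0_pos[OF g[OF that]] pos1 that by (simp add: single_vec_def)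
		then show ?thesis using M 1 by (simp add: maps_def)
	next
		case 2
		have "lk (R2 l j) 0 = 0" if l: "l < length b2" for l
		proof (cases "j < length b1")
			case True
			then have "R2 l j \<in> homog (b2 ! l - b1 ! j)" using R2[OF l] by (simp add: free_mod_piece)
			moreover have "b1 ! j < b2 ! l" using pos2 True l by simp
			ultimately show ?thesis using homogeneous_lookup_0_pos by fastforce
		qed (use R2[OF l] in \<open>simp add: free_mod_piece\<close>)
		then show ?thesis using M 2 by (simp add: maps_def)
	next
		case 3
		have "lk (R3 l j) 0 = 0" if l: "l < length b3" for l
		proof (cases "j < length b2")
			case True
			then have "R3 l j \<in> homog (b3 ! l - b2 ! j)" using R3[OF l] by (simp add: free_mod_piece)
			moreover have "b2 ! j < b3 ! l" using pos3 True l by simp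
			ultimately show ?thesis using homogeneous_lookup_0_pos by fastforce
		qed (use R3[OF l] in \<open>simp add: free_mod_piece\<close>)
		then show ?thesis using M 3 by (simp add: maps_def)
	qed (simp add: maps_def)
qed

lemma regularity: "milnor_reg f = Max ({0} \<union> (\<lambda>b. b - 1) ` set b1 \<union> (\<lambda>b. b - 2) ` set b2 \<union> (\<lambda>b. b - 3) ` set b3)"
proof -
	have "{b - int i | i b. b \<in> set (res_shifts b1 b2 b3 i)}
			= {0} \<union> (\<lambda>b. b - 1) ` set b1 \<union> (\<lambda>b. b - 2) ` set b2 \<union> (\<lambda>b. b - 3) ` set b3" (is "?A = ?B")
	proof (intro subset_antisym subsetI)
		fix x assume "x \<in> ?A"
		then obtain i b where "x = b - int i" "b \<in> set (res_shifts b1 b2 b3 i)" by blast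
		then show "x \<in> ?B" by (auto simp: res_shifts_def split: if_splits)
	next
		fix x assume "x \<in> ?B"
		then consider "x = 0" | b where "b \<in> set b1" "x = b - 1" | b where "b \<in> set b2" "x = b - 2"
			| b where "b \<in> set b3" "x = b - 3" by blast
		then show "x \<in> ?A"
		proof cases
			case 1
			then show ?thesis by (intro CollectI exI[of _ 0] exI[of _ 0]) (simp add: res_shifts_def)
		next
			case (2 b)
			then show ?thesis by (intro CollectI exI[of _ 1] exI[of _ b]) (simp add: res_shifts_def)
		next
			case (3 b)
			then show ?thesis by (intro CollectI exI[of _ 2] exI[of _ b]) (simp add: res_shifts_def)
		next
			case (4 b)
			then show ?thesis by (intro CollectI exI[of _ 3] exI[of _ b]) (simp add: res_shifts_def)
		qed
	qed
	then show ?thesis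
		unfolding milnor_reg_def using cm_regularity_eq[OF minimal comp_module_milnor[OF f]] by simp
qed

lemma matrix_map_linear:
	"matrix_map n R (u + v) = matrix_map n R u + matrix_map n R v"
	"matrix_map n R (vscale c v) = vscale c (matrix_map n R v)"
	by (auto simp: matrix_map_def vscale_def fun_eq_iff distrib_right sum.distrib sum_distrib_left mult.assoc)

lemma piece_kernel:
	assumes \<phi>: "\<phi> \<in> graded_hom (free_mod bs) (free_mod cs)" and \<psi>: "\<psi> \<in> graded_hom (free_mod cs) (free_mod ds)"
		and ex: "\<And>v. v \<in> FM cs ==> \<psi> v = (\<lambda>_. 0) \<longleftrightarrow> v \<in> \<phi> ` FM bs"
	shows "{v \<in> piece (free_mod cs) k. \<psi> v = 0} = \<phi> ` piece (free_mod bs) k"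
proof (intro subset_antisym subsetI)
	fix v assume v: "v \<in> {v \<in> piece (free_mod cs) k. \<psi> v = 0}"
	then obtain w where w: "w \<in> FM bs" "v = \<phi> w"
		using ex[OF piece_carrier] by (auto simp: zero_fun_def)
	then have "\<phi> (vcomp bs k w) = v" using homogeneous_preimage[OF \<phi> comp_module_free w(1)] v by auto
	then show "v \<in> \<phi> ` piece (free_mod bs) k" using vcomp_piece by blast
next
	fix v assume "v \<in> \<phi> ` piece (free_mod bs) k"
	then obtain w where w: "w \<in> piece (free_mod bs) k" "v = \<phi> w" by blast
	have "v \<in> piece (free_mod cs) k" using graded_homD(4)[OF \<phi> w(1)] w(2) by simp
	moreover have "\<psi> v = (\<lambda>_. 0)" using ex[OF piece_carrier[OF calculation]] w piece_carrier by blast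
	ultimately show "v \<in> {v \<in> piece (free_mod cs) k. \<psi> v = 0}" by (simp add: zero_fun_def)
qed

lemma jac_piece_dim:
	"int (vs.dim (\<phi>0 ` piece (free_mod b1) k)) = int (\<Sum>b\<leftarrow>b1. hilb (k - b)) - int (\<Sum>b\<leftarrow>b2. hilb (k - b)) + int (\<Sum>b\<leftarrow>b3. hilb (k - b))"
proof -
	have rn: "vs.dim (piece (free_mod bs) k) = vs.dim {v \<in> piece (free_mod bs) k. matrix_map n R v = 0}
			+ vs.dim (matrix_map n R ` piece (free_mod bs) k)" for bs n R
		using rank_nullity(1)[OF piece_subspace, of _ bs k "matrix_map n R"] piece_dim(2)[of bs k] matrix_map_linear by metis
	have ker2: "{v \<in> piece (free_mod b3) k. \<phi>2 v = 0} = {0}"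
		using exact3[OF piece_carrier] vs.subspace_0[OF piece_subspace] matrix_map_zero
		by (auto simp: zero_fun_def)
	have z: "vs.dim {0} = 0" using vs.dim_eq_card_independent[OF vs.independent_empty] vs.dim_span[of "{}"] by simp
	have e0: "\<phi>0 v = (\<lambda>_. 0) \<longleftrightarrow> v \<in> \<phi>1 ` FM b2" if "v \<in> FM b1" for v
		unfolding \<phi>0_eq_0 by (rule exact1[OF that])
	have "vs.dim (piece (free_mod b3) k) = vs.dim (\<phi>2 ` piece (free_mod b3) k)"
		using rn[of b3 "length b3" R3] z unfolding ker2 by linarith
	moreover have "vs.dim (piece (free_mod b2) k) = vs.dim (\<phi>2 ` piece (free_mod b3) k) + vs.dim (\<phi>1 ` piece (free_mod b2) k)"
	proof -
		have "{v \<in> piece (free_mod b2) k. \<phi>1 v = 0} = \<phi>2 ` piece (free_mod b3) k"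
			by (rule piece_kernel[OF hom2 hom1]) (rule exact2)
		then show ?thesis using rn[of b2 "length b2" R2] by simp
	qed
	moreover have "vs.dim (piece (free_mod b1) k) = vs.dim (\<phi>1 ` piece (free_mod b2) k) + vs.dim (\<phi>0 ` piece (free_mod b1) k)"
	proof -
		have "{v \<in> piece (free_mod b1) k. \<phi>0 v = 0} = \<phi>1 ` piece (free_mod b2) k"
			by (rule piece_kernel[OF hom1 hom0]) (rule e0)
		then show ?thesis using rn[of b1 "length b1" "\<lambda>j. single_vec 0 (g j)"] by simp
	qed
	ultimately show ?thesis unfolding piece_dim(1) by linarith
qed

lemma jac_piece: "(\<lambda>v. v 0) ` \<phi>0 ` piece (free_mod b1) k = homog k \<inter> jac f"
proof (intro subset_antisym subsetI)
	fix p assume "p \<in> (\<lambda>v. v 0) ` \<phi>0 ` piece (free_mod b1) k"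
	then obtain v where v: "v \<in> piece (free_mod b1) k" "p = \<phi>0 v 0" by blast
	have "\<phi>0 v \<in> piece (free_mod [0]) k" by (rule graded_homD(4)[OF hom0 v(1)])
	then have "p \<in> homog k" using v(2) by (simp add: free_mod_piece)
	then show "p \<in> homog k \<inter> jac f" using v(2) unfolding jac \<phi>0_eq by (auto simp: single_vec_def)
next
	fix p assume p: "p \<in> homog k \<inter> jac f"
	then obtain w where w: "p = (\<Sum>j<length b1. w j * g j)" unfolding jac by blast
	let ?w = "\<lambda>j. if j < length b1 then w j else 0"
	have "(\<Sum>j<length b1. ?w j * g j) = p" unfolding w by (rule sum.cong) auto
	then have \<phi>w: "\<phi>0 ?w = single_vec 0 p" by (simp add: \<phi>0_eq)
	have "single_vec 0 p \<in> piece (free_mod [0]) k" using p by (simp add: free_mod_piece single_vec_def)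
	then have "\<phi>0 (vcomp b1 k ?w) = single_vec 0 p"
		using homogeneous_preimage[OF hom0 comp_module_free, of ?w k] \<phi>w by simp
	then have "p = \<phi>0 (vcomp b1 k ?w) 0" by (simp add: single_vec_def)
	then show "p \<in> (\<lambda>v. v 0) ` \<phi>0 ` piece (free_mod b1) k" using vcomp_piece by blast
qed

end

lemma dimension_from_basis:
	assumes "finite B" "vs.independent B" "B \<subseteq> {v. \<forall>i\<ge>1. v i = 0}"
	shows "ring.dimension S_ring (card B) (range Const) ((\<lambda>v. v 0) ` vs.span B)"
	using assms
proof (induction B)
	interpret S: cring S_ring by (rule S_ring_cring)
	case empty
	then show ?case using S.zero_dim[of "range Const"] by simp
next
	interpret S: cring S_ring by (rule S_ring_cring)
	case (insert b B)
	have sub: "vs.subspace {v. \<forall>i\<ge>1. v i = 0}"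
		by (rule vs.subspaceI) (auto simp: vscale_def)
	have ind: "vs.independent B" "b \<notin> vs.span B"
		using insert.prems(1) insert.hyps(2) by (simp_all add: vs.independent_insert)
	have span: "vs.span B \<subseteq> {v. \<forall>i\<ge>1. v i = 0}" using vs.span_minimal[OF _ sub] insert.prems(2) by simp
	have b0: "b 0 \<notin> (\<lambda>v. v 0) ` vs.span B"
	proof
		assume "b 0 \<in> (\<lambda>v. v 0) ` vs.span B"
		then obtain w where w: "w \<in> vs.span B" "b 0 = w 0" by blast
		have "b i = w i" for i using w span insert.prems(2) by (cases "i = 0") auto
		then show False using w(1) ind(2) by (metis ext)
	qed
	have "S.line_extension (range Const) (b 0) ((\<lambda>v. v 0) ` vs.span B) = (\<lambda>v. v 0) ` vs.span (insert b B)"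
	proof (intro subset_antisym subsetI)
		fix x assume "x \<in> S.line_extension (range Const) (b 0) ((\<lambda>v. v 0) ` vs.span B)"
		then obtain c w where x: "x = Const c * b 0 + w 0" "w \<in> vs.span B"
			unfolding S.line_extension_def set_add_def set_mult_def r_coset_def by auto
		have "vscale c b + w \<in> vs.span (insert b B)"
			by (rule vs.span_add[OF vs.span_scale[OF vs.span_base[OF insertI1]] subsetD[OF vs.span_mono[OF subset_insertI] x(2)]])
		moreover have "x = (vscale c b + w) 0" using x by (simp add: vscale_def)
		ultimately show "x \<in> (\<lambda>v. v 0) ` vs.span (insert b B)" by blast
	next
		fix x assume "x \<in> (\<lambda>v. v 0) ` vs.span (insert b B)"
		then obtain v c where v: "x = v 0" "v - vscale c b \<in> vs.span B"
			using vs.span_breakdown_eq by blast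
		define w where "w = v - vscale c b"
		have "x = Const c * b 0 + w 0" "w \<in> vs.span B" using v by (simp_all add: w_def vscale_def)
		then show "x \<in> S.line_extension (range Const) (b 0) ((\<lambda>v. v 0) ` vs.span B)"
			unfolding S.line_extension_def set_add_def set_mult_def r_coset_def by auto
	qed
	then show ?case using S.Suc_dim[OF _ b0 insert.IH] ind insert by simp
qed

lemma dimension_subspace:
	assumes W: "vs.subspace W" "W \<subseteq> vs.span B" "finite B" "W \<subseteq> {v. \<forall>i\<ge>1. v i = 0}"
	shows "ring.dimension S_ring (vs.dim W) (range Const) ((\<lambda>v. v 0) ` W)"
proof -
	obtain C where C: "C \<subseteq> W" "vs.independent C" "W \<subseteq> vs.span C" "card C = vs.dim W"
		using vs.basis_exists by blast
	have "finite C" using vs.independent_span_bound[OF W(3) C(2)] C(1) W(2) by blast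
	moreover have "vs.span C = W" using vs.span_subspace[OF C(1,3) W(1)] .
	ultimately show ?thesis using dimension_from_basis[of C] C W(4) by auto
qed

lemma subfield_Const: "subfield (range Const) S_ring"
proof -
	interpret S: cring S_ring by (rule S_ring_cring)
	have ominus: "\<ominus>\<^bsub>S_ring\<^esub> x = - x" for x by (rule S.minus_equality) simp_all
	have "subring (range Const) S_ring"
	proof (rule S.subringI)
		show "\<one>\<^bsub>S_ring\<^esub> \<in> range Const" using Const_1 by (metis S_ring_simps(5) rangeI)
	qed (auto simp: ominus simp flip: Const_uminus Const_add Const_mult)
	then have sub: "subcring (range Const) S_ring" by (rule S.subcringI')
	show ?thesis
	proof (rule S.subfieldI[OF sub])
		show "Units (S_ring\<lparr>carrier := range Const\<rparr>) = range Const - {\<zero>\<^bsub>S_ring\<^esub>}"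
		proof (intro subset_antisym subsetI)
			fix x assume "x \<in> Units (S_ring\<lparr>carrier := range Const\<rparr>)"
			then show "x \<in> range Const - {\<zero>\<^bsub>S_ring\<^esub>}" by (auto simp: Units_def)
		next
			fix x assume "x \<in> range Const - {\<zero>\<^bsub>S_ring\<^esub>}"
			then obtain c where c: "x = Const c" "c \<noteq> 0" by auto
			then have "Const (inverse c) * x = 1" "x * Const (inverse c) = 1" by (simp_all flip: Const_mult)
			then show "x \<in> Units (S_ring\<lparr>carrier := range Const\<rparr>)" using c unfolding Units_def by auto
		qed
	qed
qed

context milnor_resolution
begin

lemma one_notin_jac: "1 \<notin> jac f"
proof
	assume "1 \<in> jac f"
	then obtain v where "1 = (\<Sum>j<length b1. v j * g j)" unfolding jac by blast
	then have "lk 1 0 = lk (\<Sum>j<length b1. v j * g j) 0" by simp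
	also have "\<dots> = 0" unfolding lookup_0_sum lookup_0_mult
		by (rule sum.neutral) (use homogeneous_lookup_0_pos[OF g] pos1 in auto)
	finally show False by (simp add: lookup_Const flip: Const_1)
qed

lemma milnor_hom: "ring_hom_ring S_ring (milnor f) (milnor_proj f)"
proof (rule ring_hom_ringI2[OF cring.axioms(1)[OF S_ring_cring] milnor_ring])
	show "milnor_proj f \<in> ring_hom S_ring (milnor f)"
		by (rule ring_hom_memI) (auto simp: milnor_carrier milnor_ops)
qed

definition hdim :: "int => int" where
	"hdim k = int (hilb k) - (int (\<Sum>b\<leftarrow>b1. hilb (k - b)) - int (\<Sum>b\<leftarrow>b2. hilb (k - b)) + int (\<Sum>b\<leftarrow>b3. hilb (k - b)))"

text \<open>The Hilbert function is the alternating sum over the resolution: rank and nullity of \<open>\<phi>0\<close> and \<open>\<phi>1\<close>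
	in degree \<open>k\<close>.\<close>

lemma milnor_dimension: "ring.dimension (milnor f) (nat (hdim k)) (milnor_proj f ` range Const) (piece (milnor f) k)"
proof -
	have one: "\<one>\<^bsub>milnor f\<^esub> \<noteq> \<zero>\<^bsub>milnor f\<^esub>"
		using one_notin_jac milnor_proj_eq[of f 1 0] by (simp add: milnor_ops)
	have sup: "piece (free_mod [0]) k \<subseteq> {v. \<forall>i\<ge>1. v i = 0}" by (auto simp: free_mod_piece)
	obtain B where B: "finite B" "piece (free_mod [0]) k \<subseteq> vs.span B" using piece_dim(2) by blast
	have img: "\<phi>0 ` piece (free_mod b1) k \<subseteq> piece (free_mod [0]) k" using graded_homD(4)[OF hom0] by blast
	have sub: "vs.subspace (\<phi>0 ` piece (free_mod b1) k)"
	proof (rule vs.subspaceI)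
		show "0 \<in> \<phi>0 ` piece (free_mod b1) k"
			by (rule rev_image_eqI[OF vs.subspace_0[OF piece_subspace]]) (simp add: zero_fun_def matrix_map_zero)
		fix x y assume "x \<in> \<phi>0 ` piece (free_mod b1) k" "y \<in> \<phi>0 ` piece (free_mod b1) k"
		then show "x + y \<in> \<phi>0 ` piece (free_mod b1) k"
			using vs.subspace_add[OF piece_subspace] by (auto simp flip: matrix_map_linear)
	next
		fix c x assume "x \<in> \<phi>0 ` piece (free_mod b1) k"
		then show "vscale c x \<in> \<phi>0 ` piece (free_mod b1) k"
			using vs.subspace_scale[OF piece_subspace] by (auto simp flip: matrix_map_linear)
	qed
	have hk: "(\<lambda>v. v 0) ` piece (free_mod [0]) k = homog k"
	proof (intro subset_antisym subsetI)
		fix p :: S assume "p \<in> homog k"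
		then have "single_vec 0 p \<in> piece (free_mod [0]) k" "p = single_vec 0 p 0"
			by (auto simp: free_mod_piece single_vec_def)
		then show "p \<in> (\<lambda>v. v 0) ` piece (free_mod [0]) k" by blast
	qed (auto simp: free_mod_piece)
	have d1: "ring.dimension S_ring (hilb k) (range Const) (homog k)"
		using dimension_subspace[OF piece_subspace B(2,1) sup] unfolding hk piece_dim(1) by simp
	have d2: "ring.dimension S_ring (vs.dim (\<phi>0 ` piece (free_mod b1) k)) (range Const) (homog k \<inter> jac f)"
		using dimension_subspace[OF sub _ B(1)] img B(2) sup unfolding jac_piece by blast
	have ker: "a_kernel (S_ring\<lparr>carrier := homog k\<rparr>) (milnor f) (milnor_proj f) = homog k \<inter> jac f"
		using milnor_proj_eq[of f _ 0] by (auto simp: a_kernel_def' milnor_ops)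
	have "ring.dimension (milnor f) (hilb k - vs.dim (\<phi>0 ` piece (free_mod b1) k)) (milnor_proj f ` range Const)
			(milnor_proj f ` homog k)"
		by (rule ring_hom_ring.rank_nullity_theorem[OF milnor_hom subfield_Const one d1]) (use d2 ker in simp)
	moreover have "hilb k - vs.dim (\<phi>0 ` piece (free_mod b1) k) = nat (hdim k)"
		unfolding hdim_def using jac_piece_dim[of k] by linarith
	ultimately show ?thesis by (simp add: milnor_ops)
qed

lemma milnor_dimension_iff:
	"ring.dimension (milnor f) n (milnor_proj f ` range Const) (piece (milnor f) k) \<longleftrightarrow> n = nat (hdim k)"
proof -
	have one: "\<one>\<^bsub>milnor f\<^esub> \<noteq> \<zero>\<^bsub>milnor f\<^esub>"
		using one_notin_jac milnor_proj_eq[of f 1 0] by (simp add: milnor_ops)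
	have "subfield (milnor_proj f ` range Const) (milnor f)"
		by (rule ring_hom_ring.img_is_subfield(2)[OF milnor_hom subfield_Const one])
	then show ?thesis using ring.dimension_is_inj[OF milnor_ring] milnor_dimension by blast
qed

lemma st_eq:
	assumes "\<And>k. int q \<le> k ==> hdim k = int (tjurina f)" and "0 < q" and "hdim (int q - 1) \<noteq> int (tjurina f)"
		and "0 \<le> hdim (int q - 1)"
	shows "milnor_st f = q"
	unfolding milnor_st_def milnor_dimension_iff
proof (rule Least_equality)
	show "\<forall>k\<ge>q. tjurina f = nat (hdim (int k))" using assms(1) by simp
	fix y assume y: "\<forall>k\<ge>y. tjurina f = nat (hdim (int k))"
	show "q \<le> y"
	proof (rule ccontr)
		assume "\<not> q \<le> y"
		then have "y \<le> q - 1" "int (q - 1) = int q - 1" using assms(2) by auto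
		then have "tjurina f = nat (hdim (int q - 1))" using y by metis
		then show False using assms(3,4) by simp
	qed
qed

end

section \<open>Combinatorics of line arrangements\<close>

abbreviation quintic :: "complex => (nat => complex^3) => S" where
	"quintic c a \<equiv> Const c * (\<Prod>i<5. L (a i))"

definition arr :: "nat => (nat => complex^3) => bool" where
	"arr d a \<longleftrightarrow> (\<forall>i<d. a i \<noteq> 0) \<and> (\<forall>i<d. \<forall>j<d. i \<noteq> j --> cr (a i) (a j) \<noteq> 0)"

definition cls :: "complex^3 => (complex^3) set" where
	"cls v = {c *s v | c. c \<noteq> 0}"

lemma cls_self: "v \<in> cls v"
	unfolding cls_def by (rule CollectI, rule exI[of _ 1]) simp

lemma cls_scale: "c \<noteq> 0 ==> cls (c *s v) = cls v"
proof -
	assume c: "c \<noteq> 0"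
	have "x \<in> cls v" if x: "x \<in> cls (c *s v)" for x
	proof -
		obtain e where "x = e *s (c *s v)" "e \<noteq> 0" using x by (auto simp: cls_def)
		then show ?thesis unfolding cls_def using c by (intro CollectI exI[of _ "e * c"]) simp
	qed
	moreover have "x \<in> cls (c *s v)" if x: "x \<in> cls v" for x
	proof -
		obtain e where "x = e *s v" "e \<noteq> 0" using x by (auto simp: cls_def)
		then show ?thesis unfolding cls_def using c by (intro CollectI exI[of _ "e / c"]) simp
	qed
	ultimately show ?thesis by blast
qed

lemma points_eq: "points = {cls v | v. v \<noteq> 0}"
	by (simp add: points_def cls_def)

lemma cls_in_line: "v \<noteq> 0 ==> cls v \<in> line a \<longleftrightarrow> ev a v = 0"
proof
	assume "v \<noteq> 0" "cls v \<in> line a"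
	then show "ev a v = 0" using cls_self[of v] unfolding line_def by auto
next
	assume "v \<noteq> 0" "ev a v = 0"
	then show "cls v \<in> line a" unfolding line_def points_eq by (auto simp: cls_def ev_linear)
qed

lemma exists_point_off:
	assumes "finite I" "\<And>i. i \<in> I ==> cr a (b i) \<noteq> 0"
	obtains v where "v \<noteq> 0" "ev a v = 0" "\<And>i. i \<in> I ==> ev (b i) v \<noteq> 0"
proof (cases "I = {}")
	case True
	have "\<exists>v. v \<noteq> 0 \<and> ev a v = 0"
	proof (cases "cr a (axis 1 1) = 0")
		case True
		then have "a $ 2 = 0" "a $ 3 = 0" by (auto simp: vec3_eq_iff axis_def)
		then show ?thesis by (intro exI[of _ "axis 2 1"]) (auto simp: ev_def axis_def vec3_eq_iff)
	next
		case False
		then show ?thesis using ev_cr(1) by blast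
	qed
	then show thesis using that True by blast
next
	case False
	then obtain k where k: "k \<in> I" by blast
	then have a: "a \<noteq> 0" using assms(2) cr_nonzero by blast
	have "\<not> L a dvd (\<Prod>i\<in>J. L (b i))" if "J \<subseteq> I" "finite J" for J
		using that(2,1)
	proof induction
		case empty
		then show ?case unfolding L_dvd_iff[OF a] using ev_linear(5)[of a] by force
	next
		case (insert i J)
		then have "\<not> L a dvd L (b i)" using L_dvd_L[OF a] assms(2) by blast
		moreover have "\<not> L a dvd (\<Prod>i\<in>J. L (b i))" using insert by simp
		ultimately have "\<not> L a dvd L (b i) * (\<Prod>i\<in>J. L (b i))" using L_prime[OF a] by blast
		then show ?case using insert by simp
	qed
	from this[OF order_refl assms(1)] obtain v where v: "ev a v = 0" "mpoly_eval (\<Prod>i\<in>I. L (b i)) (($) v) \<noteq> 0"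
		unfolding L_dvd_iff[OF a] by blast
	then have "\<forall>i\<in>I. ev (b i) v \<noteq> 0" using assms(1) by (simp add: mpoly_eval_prod)
	moreover have "v \<noteq> 0" using calculation k ev_linear(5) by blast
	ultimately show thesis using that v(1) by blast
qed

lemma line_eq_iff:
	assumes "a \<noteq> 0" "b \<noteq> 0" shows "line a = line b \<longleftrightarrow> cr a b = 0"
proof
	assume eq: "line a = line b"
	show "cr a b = 0"
	proof (rule ccontr)
		assume "cr a b \<noteq> 0"
		then obtain v where v: "v \<noteq> 0" "ev a v = 0" "ev b v \<noteq> 0"
			using exists_point_off[of "{0::nat}" a "\<lambda>_. b"] by auto
		then show False using eq cls_in_line by blast
	qed
next
	assume "cr a b = 0"
	then obtain c where c: "a = c *s b" using assms cr_0_iff by blast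
	then have "c \<noteq> 0" using assms(1) by auto
	then show "line a = line b" unfolding line_def c by (simp add: ev_linear)
qed

lemma lines_of_prod:
	assumes a: "arr d a" and c: "c \<noteq> 0"
	shows "lines_of (Const c * (\<Prod>i<d. L (a i))) = line ` a ` {..<d}"
proof (intro subset_antisym subsetI)
	fix l assume "l \<in> lines_of (Const c * (\<Prod>i<d. L (a i)))"
	then obtain b where b: "b \<noteq> 0" "l = line b" "L b dvd Const c * (\<Prod>i<d. L (a i))"
		by (auto simp: lines_of_def)
	have "\<exists>i<d. cr b (a i) = 0"
	proof (rule ccontr)
		assume "\<not> (\<exists>i<d. cr b (a i) = 0)"
		then have "cr b (a i) \<noteq> 0" if "i \<in> {..<d}" for i using that by blast
		then obtain v where v: "ev b v = 0" "\<And>i. i \<in> {..<d} ==> ev (a i) v \<noteq> 0"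
			using exists_point_off[of "{..<d}" b a] by blast
		have "mpoly_eval (Const c * (\<Prod>i<d. L (a i))) (($) v) = 0"
			using b(3) v(1) L_dvd_iff[OF b(1)] by blast
		then show False using v(2) c by (simp add: mpoly_eval_mult mpoly_eval_prod)
	qed
	then obtain i where i: "i < d" "cr b (a i) = 0" by blast
	then have "line b = line (a i)" using line_eq_iff[OF b(1)] a by (auto simp: arr_def)
	then show "l \<in> line ` a ` {..<d}" using i b(2) by blast
next
	fix l assume "l \<in> line ` a ` {..<d}"
	then obtain i where i: "i < d" "l = line (a i)" by blast
	then have "L (a i) dvd (\<Prod>i<d. L (a i))" by (intro dvd_prodI) auto
	then show "l \<in> lines_of (Const c * (\<Prod>i<d. L (a i)))"
		unfolding lines_of_def using i a by (auto simp: arr_def)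
qed

lemma multiplicity_prod:
	assumes a: "arr d a" and c: "c \<noteq> 0" and v: "v \<noteq> 0"
	shows "multiplicity_at (Const c * (\<Prod>i<d. L (a i))) (cls v) = card {i. i < d \<and> ev (a i) v = 0}"
proof -
	have inj: "inj_on (\<lambda>i. line (a i)) {..<d}"
	proof (rule inj_onI)
		fix i j assume "i \<in> {..<d}" "j \<in> {..<d}" "line (a i) = line (a j)"
		then show "i = j" using a line_eq_iff[of "a i" "a j"] unfolding arr_def by auto
	qed
	have "{l \<in> line ` a ` {..<d}. cls v \<in> l} = (\<lambda>i. line (a i)) ` {i. i < d \<and> ev (a i) v = 0}"
		using cls_in_line[OF v] by auto
	then show ?thesis unfolding multiplicity_at_def lines_of_prod[OF a c]
		using card_image[OF inj_on_subset[OF inj]] by (metis (no_types, lifting) lessThan_iff mem_Collect_eq subsetI)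
qed

definition on_node :: "nat => (nat => complex^3) => nat => nat => nat set" where
	"on_node d a i j = {k. k < d \<and> tri a i j k = 0}"

definition pairs :: "nat set => (nat \<times> nat) set" where
	"pairs K = {(i, j). i \<in> K \<and> j \<in> K \<and> i < j}"

lemma card_pairs: "finite K ==> card (pairs K) = card K choose 2"
proof -
	assume K: "finite K"
	have "bij_betw (\<lambda>(i, j). {i, j}) (pairs K) {P. P \<subseteq> K \<and> card P = 2}"
	proof (rule bij_betwI')
		fix x y assume "x \<in> pairs K" "y \<in> pairs K"
		then show "((case x of (i, j) => {i, j}) = (case y of (i, j) => {i, j})) = (x = y)"
			by (auto simp: pairs_def doubleton_eq_iff)
	next
		fix x assume "x \<in> pairs K"
		then show "(case x of (i, j) => {i, j}) \<in> {P. P \<subseteq> K \<and> card P = 2}" by (auto simp: pairs_def)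
	next
		fix P assume "P \<in> {P. P \<subseteq> K \<and> card P = 2}"
		then obtain i j where P: "P = {i, j}" "i \<noteq> j" "i \<in> K" "j \<in> K" by (auto simp: card_2_iff)
		show "\<exists>x\<in>pairs K. P = (case x of (i, j) => {i, j})"
		proof (cases "i < j")
			case True
			then show ?thesis using P by (intro bexI[of _ "(i, j)"]) (auto simp: pairs_def)
		next
			case False
			then show ?thesis using P by (intro bexI[of _ "(j, i)"]) (auto simp: pairs_def)
		qed
	qed
	then show ?thesis using n_subsets[OF K, of 2] by (simp add: bij_betw_same_card)
qed

text \<open>The contribution of a point of multiplicity \<open>m\<close> is distributed over the pairs of lines
	meeting there.\<close>

definition node_weight :: "nat => real" where
	"node_weight m = (real m - 1)\<^sup>2 / real (m choose 2)"

text \<open>Points are reached through the pairs of lines meeting in them, which replaces the sum over the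
	points of the plane by a finite sum over indices. A point of multiplicity \<open>m\<close> is reached from
	\<open>m choose 2\<close> pairs.\<close>

lemma tjurina_prod:
	assumes a: "arr d a" and c: "c \<noteq> 0"
	shows "real (tjurina (Const c * (\<Prod>i<d. L (a i)))) = (\<Sum>(i, j)\<in>pairs {..<d}. node_weight (card (on_node d a i j)))"
proof -
	define f where "f = Const c * (\<Prod>i<d. L (a i))"
	define p where "p = (\<lambda>(i, j). cls (cr (a i) (a j)))"
	define m where "m P = multiplicity_at f P" for P
	let ?I = "pairs {..<d}"
	have fin: "finite ?I" by (rule finite_subset[of _ "{..<d} \<times> {..<d}"]) (auto simp: pairs_def)
	have np: "cr (a i) (a j) \<noteq> 0" if "(i, j) \<in> ?I" for i j
		using a that by (auto simp: pairs_def arr_def)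
	have mult: "m (p (i, j)) = card (on_node d a i j)" if "(i, j) \<in> ?I" for i j
		unfolding m_def p_def f_def on_node_def dt_def using multiplicity_prod[OF a c np[OF that]]
		by (simp add: ev_def mult.commute)
	have same: "p (k, l) = p (i, j) \<longleftrightarrow> k \<in> on_node d a i j \<and> l \<in> on_node d a i j"
		if ij: "(i, j) \<in> ?I" and kl: "(k, l) \<in> ?I" for i j k l
	proof
		assume "p (k, l) = p (i, j)"
		then have "cr (a k) (a l) \<in> cls (cr (a i) (a j))" using cls_self unfolding p_def by auto
		then obtain s where s: "s \<noteq> 0" "cr (a k) (a l) = s *s cr (a i) (a j)" by (auto simp: cls_def)
		have "tri a i j x = 0" if "x = k \<or> x = l" for x
		proof -
			have "ev (a x) (cr (a k) (a l)) = 0" using that ev_cr(1,2) by blast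
			then have "ev (a x) (cr (a i) (a j)) = 0" using s by (simp add: ev_linear)
			then show ?thesis by (simp add: ev_cr(4))
		qed
		then show "k \<in> on_node d a i j \<and> l \<in> on_node d a i j" using kl by (auto simp: on_node_def pairs_def)
	next
		assume *: "k \<in> on_node d a i j \<and> l \<in> on_node d a i j"
		have "ev (a k) (cr (a i) (a j)) = 0" "ev (a l) (cr (a i) (a j)) = 0"
			using * by (simp_all add: on_node_def ev_cr(4))
		then obtain s where s: "cr (a i) (a j) = s *s cr (a k) (a l)" using ev_kernel_cr[OF np[OF kl]] by metis
		then have "s \<noteq> 0" using np[OF ij] by auto
		then show "p (k, l) = p (i, j)" unfolding p_def by (simp add: s cls_scale)
	qed
	have fib: "card {x \<in> ?I. p x = p y} = m (p y) choose 2" if y: "y \<in> ?I" for y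
	proof -
		obtain i j where ij: "y = (i, j)" by (cases y)
		have "{x \<in> ?I. p x = p y} = pairs (on_node d a i j)"
			using same[OF y[unfolded ij]] unfolding ij by (auto simp: pairs_def on_node_def)
		then show ?thesis using mult[OF y[unfolded ij]] ij by (simp add: card_pairs on_node_def)
	qed
	have pts: "{P \<in> points. 2 \<le> m P} = p ` ?I"
	proof (intro subset_antisym subsetI)
		fix P assume "P \<in> {P \<in> points. 2 \<le> m P}"
		then obtain v where v: "v \<noteq> 0" "P = cls v" "2 \<le> m (cls v)" by (auto simp: points_eq)
		then have "2 \<le> card {i. i < d \<and> ev (a i) v = 0}"
			using multiplicity_prod[OF a c v(1)] by (simp add: m_def f_def)
		then obtain i j where ij: "i < d" "j < d" "ev (a i) v = 0" "ev (a j) v = 0" "i < j"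
		proof -
			obtain T where T: "T \<subseteq> {i. i < d \<and> ev (a i) v = 0}" "card T = 2"
				using obtain_subset_with_card_n[OF \<open>2 \<le> card _\<close>] by blast
			then obtain i j where "T = {i, j}" "i \<noteq> j" by (auto simp: card_2_iff)
			then show thesis using T(1) that[of i j] that[of j i] by (cases "i < j") auto
		qed
		have I: "(i, j) \<in> ?I" using ij by (auto simp: pairs_def)
		obtain s where s: "v = s *s cr (a i) (a j)" using ev_kernel_cr[OF np[OF I] ij(3,4)] by blast
		then have "P = p (i, j)" using v cls_scale[of s "cr (a i) (a j)"] by (auto simp: p_def)
		then show "P \<in> p ` ?I" using I by blast
	next
		fix P assume "P \<in> p ` ?I"
		then obtain i j where ij: "(i, j) \<in> ?I" "P = p (i, j)" by auto
		have "{i, j} \<subseteq> on_node d a i j" using ij by (auto simp: on_node_def pairs_def)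
		then have "card {i, j} \<le> card (on_node d a i j)" by (rule card_mono[rotated]) (simp add: on_node_def)
		moreover have "card {i, j} = 2" using ij by (auto simp: pairs_def)
		ultimately show "P \<in> {P \<in> points. 2 \<le> m P}"
			using mult[OF ij(1)] ij np[OF ij(1)] by (auto simp: points_eq p_def)
	qed
	have "real (tjurina f) = (\<Sum>P\<in>p ` ?I. (real (m P) - 1)\<^sup>2)"
		unfolding tjurina_def m_def[symmetric] pts of_nat_sum
	proof (rule sum.cong[OF refl])
		fix P assume "P \<in> p ` ?I"
		then have "2 \<le> m P" using pts by blast
		then show "real ((m P - 1)\<^sup>2) = (real (m P) - 1)\<^sup>2" by (simp add: of_nat_diff)
	qed
	also have "\<dots> = (\<Sum>P\<in>p ` ?I. \<Sum>x\<in>{x \<in> ?I. p x = P}. node_weight (m (p x)))"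
	proof (rule sum.cong[OF refl])
		fix P assume P: "P \<in> p ` ?I"
		then obtain y where y: "y \<in> ?I" "P = p y" by blast
		have "2 \<le> m P" using P pts by blast
		then have "m P choose 2 \<noteq> 0" by (simp add: binomial_eq_0_iff)
		have "(\<Sum>x\<in>{x \<in> ?I. p x = P}. node_weight (m (p x))) = (\<Sum>x\<in>{x \<in> ?I. p x = P}. node_weight (m P))"
			by (rule sum.cong) auto
		also have "\<dots> = real (m P choose 2) * node_weight (m P)" using fib[OF y(1)] y(2) by simp
		also have "\<dots> = (real (m P) - 1)\<^sup>2" using \<open>m P choose 2 \<noteq> 0\<close> by (simp add: node_weight_def)
		finally show "(real (m P) - 1)\<^sup>2 = (\<Sum>x\<in>{x \<in> ?I. p x = P}. node_weight (m (p x)))" by simp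
	qed
	also have "\<dots> = (\<Sum>x\<in>?I. node_weight (m (p x)))"
		using sum.image_gen[OF fin, of "\<lambda>x. node_weight (m (p x))" p] by simp
	also have "\<dots> = (\<Sum>(i, j)\<in>?I. node_weight (card (on_node d a i j)))"
		by (rule sum.cong) (use mult in auto)
	finally show ?thesis by (simp add: f_def)
qed

section \<open>Modules of Jacobian syzygies\<close>

lemma ldot_linear:
	"ldot (a + b) r = ldot a r + ldot b r" "ldot (s *s a) r = Const s * ldot a r"
	"ldot a (r + r') = ldot a r + ldot a r'" "ldot a (p *s r) = p * ldot a r" "ldot a 0 = 0"
	by (simp_all add: ldot_def Const_add Const_mult algebra_simps)

text \<open>The derivation with prescribed values on three independent linear forms; see \<open>ldot_recon\<close> and
	\<open>recon_ldot\<close>.\<close>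

definition recon :: "complex^3 => complex^3 => complex^3 => S => S => S => S^3" where
	"recon b1 b2 b3 g1 g2 g3 = (\<chi> i. Const (1 / dt b1 b2 b3) *
		 (Const (cr b2 b3 $ i) * g1 + Const (cr b3 b1 $ i) * g2 + Const (cr b1 b2 $ i) * g3))"

lemma ldot_recon_aux:
	"ldot b (recon b1 b2 b3 g1 g2 g3) = Const (1 / dt b1 b2 b3) *
		 (Const (ev b (cr b2 b3)) * g1 + Const (ev b (cr b3 b1)) * g2 + Const (ev b (cr b1 b2)) * g3)"
	unfolding ldot_def recon_def ev_def vec_lambda_beta Const_add Const_mult by (simp only: algebra_simps)

lemma ldot_recon:
	assumes "dt b1 b2 b3 \<noteq> 0"
	shows "ldot b1 (recon b1 b2 b3 g1 g2 g3) = g1" "ldot b2 (recon b1 b2 b3 g1 g2 g3) = g2"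
		"ldot b3 (recon b1 b2 b3 g1 g2 g3) = g3"
proof -
	have c: "Const (1 / dt b1 b2 b3) * (Const (dt b1 b2 b3) * g) = g" for g
		using assms Const_inverse_mult(2)[OF assms, of g] by (simp add: inverse_eq_divide)
	have n: "ev b1 (cr b2 b3) = dt b1 b2 b3" "ev b2 (cr b3 b1) = dt b1 b2 b3" "ev b3 (cr b1 b2) = dt b1 b2 b3"
		by (rule ev_cr, rule ev_cr', rule ev_cr)
	have z: "ev b1 (cr b3 b1) = 0" "ev b1 (cr b1 b2) = 0" "ev b2 (cr b2 b3) = 0" "ev b2 (cr b1 b2) = 0"
		"ev b3 (cr b2 b3) = 0" "ev b3 (cr b3 b1) = 0" by (rule ev_cr)+
	show "ldot b1 (recon b1 b2 b3 g1 g2 g3) = g1" "ldot b2 (recon b1 b2 b3 g1 g2 g3) = g2"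
		"ldot b3 (recon b1 b2 b3 g1 g2 g3) = g3"
		unfolding ldot_recon_aux n z by (simp_all add: c)
qed

lemma recon_ldot:
	assumes D: "dt b1 b2 b3 \<noteq> 0"
	shows "recon b1 b2 b3 (ldot b1 r) (ldot b2 r) (ldot b3 r) = r"
proof -
	have "Const (cr b2 b3 $ i) * ldot b1 r + Const (cr b3 b1 $ i) * ldot b2 r + Const (cr b1 b2 $ i) * ldot b3 r
			= Const (dt b1 b2 b3) * r $ i" for i
	proof -
		have "i = 1 \<or> i = 2 \<or> i = 3" using exhaust_3 by blast
		then show ?thesis
			by (elim disjE; simp only: ldot_def dt_expand cr_nth Const_add Const_diff Const_mult)
				(simp_all add: algebra_simps)
	qed
	note 1 = this
	have 2: "Const (1 / dt b1 b2 b3) * (Const (dt b1 b2 b3) * g) = g" for g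
		using D Const_inverse_mult(2)[OF D, of g] by (simp add: inverse_eq_divide)
	show ?thesis unfolding recon_def vec_eq_iff vec_lambda_beta 1 2 by simp
qed

lemma recon_linear:
	"recon b1 b2 b3 (p * g1 + q * k1) (p * g2 + q * k2) (p * g3 + q * k3) =
		p *s recon b1 b2 b3 g1 g2 g3 + q *s recon b1 b2 b3 k1 k2 k3"
	unfolding recon_def vec_eq_iff by (simp add: algebra_simps)

lemma recon_linear3:
	"recon b1 b2 b3 (p * g1 + q * k1 + s * l1) (p * g2 + q * k2 + s * l2) (p * g3 + q * k3 + s * l3) =
		p *s recon b1 b2 b3 g1 g2 g3 + q *s recon b1 b2 b3 k1 k2 k3 + s *s recon b1 b2 b3 l1 l2 l3"
	unfolding recon_def vec_eq_iff by (simp add: algebra_simps)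

lemma recon_homogeneous:
	"g1 \<in> homog k ==> g2 \<in> homog k ==> g3 \<in> homog k ==> recon b1 b2 b3 g1 g2 g3 $ i \<in> homog k"
	unfolding recon_def vec_lambda_beta by (intro homogeneous_Const_mult homogeneous_add)

lemma recon_0: "recon b1 b2 b3 0 0 0 = 0"
	by (simp add: recon_def vec_eq_iff)

lemma lessThan_5: "{..<5::nat} = {0, 1, 2, 3, 4}"
	by auto

lemma Der_five_eq_0_iff:
	assumes a: "arr 5 a" and c: "c \<noteq> 0"
	shows "Der r (quintic c a) = 0 \<longleftrightarrow>
		(\<exists>h0 h1 h2 h3 h4. ldot (a 0) r = L (a 0) * h0 \<and> ldot (a 1) r = L (a 1) * h1 \<and> ldot (a 2) r = L (a 2) * h2 \<and>
			ldot (a 3) r = L (a 3) * h3 \<and> ldot (a 4) r = L (a 4) * h4 \<and> h0 + h1 + h2 + h3 + h4 = 0)" (is "?A \<longleftrightarrow> ?B")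
proof -
	have *: "?A \<longleftrightarrow> (\<exists>h. (\<forall>i\<in>{..<5}. ldot (a i) r = L (a i) * h i) \<and> (\<Sum>i\<in>{..<5}. h i) = 0)"
		by (rule Der_prod_eq_0_iff[OF _ c]) (use a in \<open>auto simp: arr_def\<close>)
	show ?thesis
	proof
		assume ?A
		then obtain h where h: "\<forall>i\<in>{..<5}. ldot (a i) r = L (a i) * h i" "(\<Sum>i\<in>{..<5}. h i) = 0" using * by blast
		then show ?B unfolding lessThan_5
			by (intro exI[of _ "h 0"] exI[of _ "h 1"] exI[of _ "h 2"] exI[of _ "h 3"] exI[of _ "h 4"]) (simp add: add.assoc)
	next
		assume ?B
		then obtain h0 h1 h2 h3 h4 where h: "ldot (a 0) r = L (a 0) * h0" "ldot (a 1) r = L (a 1) * h1"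
			"ldot (a 2) r = L (a 2) * h2" "ldot (a 3) r = L (a 3) * h3" "ldot (a 4) r = L (a 4) * h4"
			"h0 + h1 + h2 + h3 + h4 = 0" by blast
		define h where "h i = (if i = 0 then h0 else if i = 1 then h1 else if i = 2 then h2 else if i = 3 then h3 else h4)" for i :: nat
		have "(\<forall>i\<in>{..<5}. ldot (a i) r = L (a i) * h i) \<and> (\<Sum>i\<in>{..<5}. h i) = 0"
			unfolding lessThan_5 using h by (simp add: h_def add.assoc)
		then show ?A unfolding * by blast
	qed
qed

subsection \<open>Bases of syzygies, freeness and resolutions\<close>

definition AR_basis :: "S => nat => S^3 => nat => S^3 => bool" where
	"AR_basis f d1 \<rho>1 d2 \<rho>2 \<longleftrightarrow> (\<forall>i. \<rho>1 $ i \<in> homog (int d1)) \<and> (\<forall>i. \<rho>2 $ i \<in> homog (int d2)) \<and>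
		 (\<forall>r. Der r f = 0 \<longleftrightarrow> (\<exists>p q. r = p *s \<rho>1 + q *s \<rho>2)) \<and>
		 (\<forall>p q. p *s \<rho>1 + q *s \<rho>2 = 0 --> p = 0 \<and> q = 0)"

lemma AR_basisD:
	assumes "AR_basis f d1 \<rho>1 d2 \<rho>2"
	shows "\<rho>1 $ i \<in> homog (int d1)" "\<rho>2 $ i \<in> homog (int d2)"
		"Der r f = 0 \<longleftrightarrow> (\<exists>p q. r = p *s \<rho>1 + q *s \<rho>2)"
		"p *s \<rho>1 + q *s \<rho>2 = 0 ==> p = 0 \<and> q = 0"
proof -
	note A = assms[unfolded AR_basis_def]
	show "\<rho>1 $ i \<in> homog (int d1)" by (rule spec[OF conjunct1[OF A]])
	show "\<rho>2 $ i \<in> homog (int d2)" by (rule spec[OF conjunct1[OF conjunct2[OF A]]])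
	show "Der r f = 0 \<longleftrightarrow> (\<exists>p q. r = p *s \<rho>1 + q *s \<rho>2)"
		by (rule spec[OF conjunct1[OF conjunct2[OF conjunct2[OF A]]]])
	show "p *s \<rho>1 + q *s \<rho>2 = 0 ==> p = 0 \<and> q = 0"
		by (rule mp[OF spec[OF spec[OF conjunct2[OF conjunct2[OF conjunct2[OF A]]]]]])
qed

lemma fun_eq_2: fixes u v :: "nat => 'a" shows "u 0 = v 0 ==> u 1 = v 1 ==> (\<And>i::nat. 2 \<le> i ==> u i = v i) ==> u = v"
proof
	fix i :: nat assume *: "u 0 = v 0" "u 1 = v 1" "\<And>i. 2 \<le> i ==> u i = v i"
	consider "i = 0" | "i = 1" | "2 \<le> i" by linarith
	then show "u i = v i" using * by cases auto
qed

lemma hcomp_mult_right: "g \<in> homog j ==> hcomp k (p * g) = hcomp (k - j) p * g"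
	using hcomp_mult[of g j k p] by (simp add: mult.commute)

text \<open>The coordinates with respect to the basis form the graded isomorphism onto the free module.\<close>

lemma AR_basis_free:
	assumes B: "AR_basis f d1 \<rho>1 d2 \<rho>2" and "d1 \<le> d2"
	shows "free_arrangement d1 d2 f"
proof -
	have hom: "\<rho>1 $ i \<in> homog (int d1)" "\<rho>2 $ i \<in> homog (int d2)" for i
		by (rule AR_basisD[OF B])+
	note gen = AR_basisD(3)[OF B] and ind = AR_basisD(4)[OF B]
	let ?F = "free_mod [int d1, int d2]"
	define \<psi> where "\<psi> v = v 0 *s \<rho>1 + v 1 *s \<rho>2" for v :: "nat => S"
	have carF: "carrier ?F = {v. \<forall>i\<ge>2. v i = 0}" by (simp add: numeral_2_eq_2)
	have inj: "inj_on \<psi> (carrier ?F)"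
	proof (rule inj_onI)
		fix u v assume uv: "u \<in> carrier ?F" "v \<in> carrier ?F" "\<psi> u = \<psi> v"
		then have "(u 0 - v 0) *s \<rho>1 + (u 1 - v 1) *s \<rho>2 = 0"
			unfolding \<psi>_def vec_eq_iff by (simp add: algebra_simps)
		then have "u 0 - v 0 = 0 \<and> u 1 - v 1 = 0" by (rule ind)
		then have "u 0 = v 0" "u 1 = v 1" by simp_all
		moreover have "u i = v i" if "i \<ge> 2" for i using uv(1,2) that unfolding carF by simp
		ultimately show "u = v" by (rule fun_eq_2)
	qed
	have surj: "\<psi> ` carrier ?F = carrier (AR f)"
	proof (intro subset_antisym subsetI)
		fix r assume "r \<in> carrier (AR f)"
		then have "Der r f = 0" by (simp add: AR_carrier)
		then obtain p q where r: "r = p *s \<rho>1 + q *s \<rho>2" unfolding gen by (elim exE)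
		let ?v = "\<lambda>i::nat. if i = 0 then p else if i = 1 then q else 0"
		have v: "?v \<in> carrier ?F" "r = \<psi> ?v" unfolding carF by (auto simp: r \<psi>_def)
		show "r \<in> \<psi> ` carrier ?F" using v(2,1) by (rule image_eqI)
	next
		fix r assume "r \<in> \<psi> ` carrier ?F"
		then obtain v where "r = \<psi> v" by (elim imageE)
		then have "Der r f = 0" unfolding gen \<psi>_def by (intro exI)
		then show "r \<in> carrier (AR f)" by (simp add: AR_carrier)
	qed
	define \<phi> where "\<phi> = the_inv_into (carrier ?F) \<psi>"
	have \<phi>\<psi>: "\<phi> (\<psi> v) = v" if "v \<in> carrier ?F" for v unfolding \<phi>_def by (rule the_inv_into_f_f[OF inj that])
	have ex: "\<exists>v. v \<in> carrier ?F \<and> r = \<psi> v" if "r \<in> carrier (AR f)" for r using that surj by blast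
	have "\<phi> \<in> graded_hom (AR f) ?F"
	proof (rule graded_homI)
		fix r assume "r \<in> carrier (AR f)"
		then obtain u where "u \<in> carrier ?F" "r = \<psi> u" using ex by blast
		then show "\<phi> r \<in> carrier ?F" using \<phi>\<psi>[of u] by simp
	next
		fix r s assume "r \<in> carrier (AR f)" "s \<in> carrier (AR f)"
		then obtain u v where uv: "u \<in> carrier ?F" "r = \<psi> u" "v \<in> carrier ?F" "s = \<psi> v" using ex by blast
		have "r \<oplus>\<^bsub>AR f\<^esub> s = \<psi> (\<lambda>i. u i + v i)" unfolding uv \<psi>_def vec_eq_iff by (simp add: AR_def algebra_simps)
		then show "\<phi> (r \<oplus>\<^bsub>AR f\<^esub> s) = \<phi> r \<oplus>\<^bsub>?F\<^esub> \<phi> s" using \<phi>\<psi>[of "\<lambda>i. u i + v i"] uv \<phi>\<psi>[OF uv(1)] \<phi>\<psi>[OF uv(3)] by simp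
	next
		fix p r assume "r \<in> carrier (AR f)"
		then obtain u where u: "u \<in> carrier ?F" "r = \<psi> u" using ex by blast
		have "p \<odot>\<^bsub>AR f\<^esub> r = \<psi> (\<lambda>i. p * u i)" unfolding u \<psi>_def vec_eq_iff by (simp add: AR_def algebra_simps)
		then show "\<phi> (p \<odot>\<^bsub>AR f\<^esub> r) = p \<odot>\<^bsub>?F\<^esub> \<phi> r" using \<phi>\<psi>[of "\<lambda>i. p * u i"] u \<phi>\<psi>[OF u(1)] by simp
	next
		fix r k assume r: "r \<in> piece (AR f) k"
		then have "r \<in> carrier (AR f)" and rk: "\<And>i. r $ i \<in> homog k" by (auto simp: AR_def)
		then obtain u where u: "u \<in> carrier ?F" "r = \<psi> u" using ex by blast
		have "\<psi> (vcomp [int d1, int d2] k u) $ i = hcomp k (r $ i)" for i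
			by (simp add: u \<psi>_def vcomp_def hcomp_add hcomp_mult_right[OF hom(1)] hcomp_mult_right[OF hom(2)])
		then have "\<psi> (vcomp [int d1, int d2] k u) = \<psi> u"
			using hcomp_of_homogeneous[OF rk, of k] unfolding u(2) vec_eq_iff by simp
		then have "vcomp [int d1, int d2] k u = u" using inj_onD[OF inj _ vcomp_carrier u(1)] by blast
		then show "\<phi> r \<in> piece ?F k" using vcomp_piece[of "[int d1, int d2]" k u] \<phi>\<psi>[OF u(1)] u(2) by simp
	qed
	moreover have "bij_betw \<phi> (carrier (AR f)) (carrier ?F)"
		unfolding \<phi>_def by (rule bij_betw_the_inv_into) (use inj surj in \<open>simp add: bij_betw_def\<close>)
	ultimately show ?thesis unfolding free_arrangement_def graded_iso_def using \<open>d1 \<le> d2\<close> by blast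
qed

definition vec_fun :: "S^3 => nat => S" where
	"vec_fun r i = (if i = 0 then r $ 1 else if i = 1 then r $ 2 else if i = 2 then r $ 3 else 0)"

definition fun_vec :: "(nat => S) => S^3" where
	"fun_vec v = vector [v 0, v 1, v 2]"

lemma fun_vec_nth [simp]: "fun_vec v $ 1 = v 0" "fun_vec v $ 2 = v 1" "fun_vec v $ 3 = v 2"
	by (simp_all add: fun_vec_def)

lemma vec_fun_inverse: "\<forall>i\<ge>3. v i = 0 ==> vec_fun (fun_vec v) = v"
	by (auto simp: vec_fun_def fun_eq_iff)

lemma fun_vec_inverse: "fun_vec (vec_fun r) = r"
	by (simp add: vec3_eq_iff vec_fun_def)

lemma vec_fun_eq_0_iff: "vec_fun r = (\<lambda>_. 0) \<longleftrightarrow> r = 0"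
proof
	assume "vec_fun r = (\<lambda>_. 0)"
	then have "vec_fun r 0 = 0" "vec_fun r 1 = 0" "vec_fun r 2 = 0" by simp_all
	then show "r = 0" by (simp add: vec3_eq_iff vec_fun_def)
qed (auto simp: vec_fun_def)

definition partials :: "S => nat => S" where
	"partials f j = (if j = 0 then pd 1 f else if j = 1 then pd 2 f else pd 3 f)"

lemma partials_sum: "(\<Sum>j<3. v j * partials f j) = Der (fun_vec v) f"
	by (simp add: partials_def Der_def numeral_3_eq_3 lessThan_Suc numeral_2_eq_2 ac_simps)

lemma jac_partials: "jac f = {(\<Sum>j<3. v j * partials f j) | v. True}"
proof (intro subset_antisym subsetI)
	fix p assume "p \<in> jac f"
	then obtain u v w where p: "p = u * pd 1 f + v * pd 2 f + w * pd 3 f" unfolding jac_def by blast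
	let ?v = "\<lambda>j::nat. if j = 0 then u else if j = 1 then v else w"
	have "p = (\<Sum>j<3. ?v j * partials f j)" unfolding partials_sum p Der_def by simp
	then show "p \<in> {(\<Sum>j<3. v j * partials f j) | v. True}" by (intro CollectI exI[of _ ?v] conjI TrueI)
next
	fix p assume "p \<in> {(\<Sum>j<3. v j * partials f j) | v. True}"
	then obtain v where "p = (\<Sum>j<3. v j * partials f j)" by blast
	then show "p \<in> jac f" unfolding partials_sum Der_def using jacI by metis
qed

lemma vec_fun_piece:
	assumes "\<And>i. r $ i \<in> homog (k - b)" shows "vec_fun r \<in> piece (free_mod [b, b, b]) k"
	unfolding free_mod_piece using assms by (auto simp: vec_fun_def nth_Cons split: nat.splits)

lemma matrix_map_vec_fun: "matrix_map n (\<lambda>j. vec_fun (\<rho> j)) w = vec_fun (\<Sum>j<n. w j *s \<rho> j)"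
	by (auto simp: matrix_map_def vec_fun_def fun_eq_iff sum_component)

lemma free_resolution:
	assumes f: "f \<in> homog (int d)" and d: "2 \<le> d" and B: "AR_basis f d1 \<rho>1 d2 \<rho>2" and pos: "0 < d1" "0 < d2"
	shows "milnor_resolution f (int d) [int d - 1, int d - 1, int d - 1] [int d - 1 + int d1, int d - 1 + int d2] []
		(partials f) (\<lambda>j. vec_fun (if j = 0 then \<rho>1 else \<rho>2)) (\<lambda>_ _. 0)"
proof
	have hom: "\<rho>1 $ i \<in> homog (int d1)" "\<rho>2 $ i \<in> homog (int d2)" for i
		by (rule AR_basisD[OF B])+
	note gen = AR_basisD(3)[OF B] and ind = AR_basisD(4)[OF B]
	let ?b1 = "[int d - 1, int d - 1, int d - 1]" and ?b2 = "[int d - 1 + int d1, int d - 1 + int d2]"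
	let ?R = "\<lambda>j. vec_fun (if j = 0 then \<rho>1 else \<rho>2)"
	show "f \<in> homog (int d)" by (rule f)
	show "partials f j \<in> homog (?b1 ! j)" if "j < length ?b1" for j
		using that pd_homogeneous[OF f] by (auto simp: partials_def less_Suc_eq numeral_3_eq_3)
	show "jac f = {(\<Sum>j<length ?b1. v j * partials f j) | v. True}" using jac_partials[of f] by (simp add: numeral_3_eq_3)
	show "?R j \<in> piece (free_mod ?b1) (?b2 ! j)" if "j < length ?b2" for j
		using that hom by (auto intro!: vec_fun_piece simp: less_Suc_eq)
	have R: "matrix_map (length ?b2) ?R w = vec_fun (w 0 *s \<rho>1 + w 1 *s \<rho>2)" for w
		using matrix_map_vec_fun[of 2 "\<lambda>j. if j = 0 then \<rho>1 else \<rho>2" w] by (simp add: numeral_2_eq_2)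
	show "(\<Sum>j<length ?b1. v j * partials f j) = 0 \<longleftrightarrow> v \<in> matrix_map (length ?b2) ?R ` FM ?b2"
		if v: "v \<in> FM ?b1" for v
	proof -
		have v3: "vec_fun (fun_vec v) = v" using v by (intro vec_fun_inverse) (simp add: numeral_3_eq_3)
		have "(\<Sum>j<length ?b1. v j * partials f j) = 0 \<longleftrightarrow> Der (fun_vec v) f = 0"
			using partials_sum[of v f] by (simp add: numeral_3_eq_3)
		also have "\<dots> \<longleftrightarrow> (\<exists>p q. fun_vec v = p *s \<rho>1 + q *s \<rho>2)" by (rule gen)
		also have "\<dots> \<longleftrightarrow> (\<exists>w\<in>FM ?b2. v = matrix_map (length ?b2) ?R w)"
		proof
			assume "\<exists>p q. fun_vec v = p *s \<rho>1 + q *s \<rho>2"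
			then obtain p q where pq: "fun_vec v = p *s \<rho>1 + q *s \<rho>2" by blast
			let ?w = "\<lambda>j::nat. if j = 0 then p else if j = 1 then q else 0"
			have "?w \<in> FM ?b2" by simp
			moreover have "v = matrix_map (length ?b2) ?R ?w" unfolding R using v3 pq by simp
			ultimately show "\<exists>w\<in>FM ?b2. v = matrix_map (length ?b2) ?R w" by blast
		next
			assume "\<exists>w\<in>FM ?b2. v = matrix_map (length ?b2) ?R w"
			then obtain w where "v = matrix_map (length ?b2) ?R w" by blast
			then have "fun_vec v = w 0 *s \<rho>1 + w 1 *s \<rho>2" unfolding R by (simp only: fun_vec_inverse)
			then show "\<exists>p q. fun_vec v = p *s \<rho>1 + q *s \<rho>2" by blast
		qed
		finally show ?thesis by (auto simp: image_iff)
	qed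
	show "matrix_map (length ?b2) ?R v = (\<lambda>_. 0) \<longleftrightarrow>
			v \<in> matrix_map (length ([] :: int list)) (\<lambda>_ _. 0) ` FM []" if v: "v \<in> FM ?b2" for v
	proof -
		have "matrix_map (length ?b2) ?R v = (\<lambda>_. 0) \<longleftrightarrow> v 0 = 0 \<and> v 1 = 0"
			unfolding R vec_fun_eq_0_iff
		proof
			assume "v 0 *s \<rho>1 + v 1 *s \<rho>2 = 0"
			then show "v 0 = 0 \<and> v 1 = 0" by (rule ind)
		qed simp
		also have "\<dots> \<longleftrightarrow> v = (\<lambda>_. 0)"
		proof
			assume "v 0 = 0 \<and> v 1 = 0"
			moreover have "v i = 0" if "i \<ge> 2" for i using v that by simp
			ultimately show "v = (\<lambda>_. 0)" by (intro fun_eq_2) simp_all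
		qed simp
		finally show ?thesis by (auto simp: matrix_map_def)
	qed
qed (use d pos in auto)

text \<open>Three generators of degrees 2, 3, 3 with a single relation \<open>\<kappa>\<close>, that is, the nearly free case with
	exponents 2 and 3.\<close>

definition AR_near_basis :: "S => (nat => S^3) => (nat => S) => bool" where
	"AR_near_basis f \<rho> \<kappa> \<longleftrightarrow> (\<forall>i. \<rho> 0 $ i \<in> homog 2) \<and> (\<forall>i. \<rho> 1 $ i \<in> homog 3) \<and> (\<forall>i. \<rho> 2 $ i \<in> homog 3) \<and>
		 \<kappa> 0 \<in> homog 2 \<and> \<kappa> 1 \<in> homog 1 \<and> \<kappa> 2 \<in> homog 1 \<and> \<kappa> 1 \<noteq> 0 \<and>
		 (\<forall>r. Der r f = 0 \<longleftrightarrow> (\<exists>p q s. r = p *s \<rho> 0 + q *s \<rho> 1 + s *s \<rho> 2)) \<and>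
		 (\<forall>p q s. p *s \<rho> 0 + q *s \<rho> 1 + s *s \<rho> 2 = 0 \<longleftrightarrow> (\<exists>t. p = t * \<kappa> 0 \<and> q = t * \<kappa> 1 \<and> s = t * \<kappa> 2))"

lemma near_resolution:
	assumes f: "f \<in> homog 5" and B: "AR_near_basis f \<rho> \<kappa>"
	shows "milnor_resolution f 5 [4, 4, 4] [6, 7, 7] [8] (partials f) (\<lambda>j. vec_fun (\<rho> j))
		(\<lambda>_ i. if i < 3 then \<kappa> i else 0)"
proof
	have hom: "\<rho> 0 $ i \<in> homog 2" "\<rho> 1 $ i \<in> homog 3" "\<rho> 2 $ i \<in> homog 3"
		"\<kappa> 0 \<in> homog 2" "\<kappa> 1 \<in> homog 1" "\<kappa> 2 \<in> homog 1" "\<kappa> 1 \<noteq> 0" for i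
		using B by (simp_all add: AR_near_basis_def)
	note B' = B[unfolded AR_near_basis_def, THEN conjunct2, THEN conjunct2, THEN conjunct2, THEN conjunct2,
			THEN conjunct2, THEN conjunct2, THEN conjunct2]
	note gen = spec[OF conjunct1[OF B']] and rel = spec[OF spec[OF spec[OF conjunct2[OF B']]]]
	let ?b1 = "[4, 4, 4] :: int list" and ?b2 = "[6, 7, 7] :: int list" and ?b3 = "[8] :: int list"
	let ?R = "\<lambda>j. vec_fun (\<rho> j)" and ?K = "\<lambda>(_::nat) i. if i < 3 then \<kappa> i else 0"
	show "f \<in> homog 5" by (rule f)
	show "partials f j \<in> homog (?b1 ! j)" if "j < length ?b1" for j
		using that pd_homogeneous[OF f] by (auto simp: partials_def less_Suc_eq numeral_3_eq_3)
	show "jac f = {(\<Sum>j<length ?b1. v j * partials f j) | v. True}" using jac_partials[of f] by (simp add: numeral_3_eq_3)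
	show "?R j \<in> piece (free_mod ?b1) (?b2 ! j)" if "j < length ?b2" for j
	proof -
		have "j < 3" using that by simp
		then consider "j = 0" | "j = 1" | "j = 2" by linarith
		then show ?thesis by cases (use hom in \<open>auto intro!: vec_fun_piece\<close>)
	qed
	have lt3: "i < 3 \<longleftrightarrow> i = 0 \<or> i = 1 \<or> i = 2" for i :: nat by linarith
	show "?K j \<in> piece (free_mod ?b2) (?b3 ! j)" if "j < length ?b3" for j
		using that hom by (auto simp: free_mod_piece lt3)
	have R: "matrix_map (length ?b2) ?R w = vec_fun (w 0 *s \<rho> 0 + w 1 *s \<rho> 1 + w 2 *s \<rho> 2)" for w
		using matrix_map_vec_fun[of 3 \<rho> w] by (simp add: numeral_3_eq_3 numeral_2_eq_2)
	have K: "matrix_map (length ?b3) ?K w = (\<lambda>i. if i < 3 then w 0 * \<kappa> i else 0)" for w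
		by (auto simp: matrix_map_def)
	have len: "length ?b1 = 3" "length ?b2 = 3" by simp_all
	show "(\<Sum>j<length ?b1. v j * partials f j) = 0 \<longleftrightarrow> v \<in> matrix_map (length ?b2) ?R ` FM ?b2"
		if v: "v \<in> FM ?b1" for v
	proof -
		have v3: "vec_fun (fun_vec v) = v" using v by (intro vec_fun_inverse) (simp add: numeral_3_eq_3)
		have "(\<Sum>j<length ?b1. v j * partials f j) = 0 \<longleftrightarrow> Der (fun_vec v) f = 0"
			using partials_sum[of v f] unfolding len by simp
		also have "\<dots> \<longleftrightarrow> (\<exists>p q s. fun_vec v = p *s \<rho> 0 + q *s \<rho> 1 + s *s \<rho> 2)" by (rule gen)
		also have "\<dots> \<longleftrightarrow> (\<exists>w\<in>FM ?b2. v = matrix_map (length ?b2) ?R w)"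
		proof
			assume "\<exists>p q s. fun_vec v = p *s \<rho> 0 + q *s \<rho> 1 + s *s \<rho> 2"
			then obtain p q s where pq: "fun_vec v = p *s \<rho> 0 + q *s \<rho> 1 + s *s \<rho> 2" by blast
			let ?w = "\<lambda>j::nat. if j = 0 then p else if j = 1 then q else if j = 2 then s else 0"
			have "?w \<in> FM ?b2" by simp
			moreover have "v = matrix_map (length ?b2) ?R ?w" unfolding R using v3 pq by simp
			ultimately show "\<exists>w\<in>FM ?b2. v = matrix_map (length ?b2) ?R w" by blast
		next
			assume "\<exists>w\<in>FM ?b2. v = matrix_map (length ?b2) ?R w"
			then obtain w where "v = matrix_map (length ?b2) ?R w" by blast
			then have "fun_vec v = w 0 *s \<rho> 0 + w 1 *s \<rho> 1 + w 2 *s \<rho> 2" unfolding R by (simp only: fun_vec_inverse)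
			then show "\<exists>p q s. fun_vec v = p *s \<rho> 0 + q *s \<rho> 1 + s *s \<rho> 2" by blast
		qed
		finally show ?thesis by (auto simp: image_iff)
	qed
	show "matrix_map (length ?b2) ?R v = (\<lambda>_. 0) \<longleftrightarrow> v \<in> matrix_map (length ?b3) ?K ` FM ?b3"
		if v: "v \<in> FM ?b2" for v
	proof -
		have v3: "v i = 0" if "\<not> i < 3" for i using v that by simp
		have "matrix_map (length ?b2) ?R v = (\<lambda>_. 0) \<longleftrightarrow> (\<exists>t. v 0 = t * \<kappa> 0 \<and> v 1 = t * \<kappa> 1 \<and> v 2 = t * \<kappa> 2)"
			unfolding R vec_fun_eq_0_iff by (rule rel)
		also have "\<dots> \<longleftrightarrow> (\<exists>w\<in>FM ?b3. v = matrix_map (length ?b3) ?K w)"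
		proof
			assume "\<exists>t. v 0 = t * \<kappa> 0 \<and> v 1 = t * \<kappa> 1 \<and> v 2 = t * \<kappa> 2"
			then obtain t where t: "v 0 = t * \<kappa> 0" "v 1 = t * \<kappa> 1" "v 2 = t * \<kappa> 2" by blast
			have "v = matrix_map (length ?b3) ?K (single_vec 0 t)"
				unfolding K using t v3 lt3 by (auto simp: single_vec_def fun_eq_iff)
			moreover have "single_vec 0 t \<in> FM ?b3" by (simp add: single_vec_def)
			ultimately show "\<exists>w\<in>FM ?b3. v = matrix_map (length ?b3) ?K w" by blast
		next
			assume "\<exists>w\<in>FM ?b3. v = matrix_map (length ?b3) ?K w"
			then obtain w where "v = matrix_map (length ?b3) ?K w" by blast
			then show "\<exists>t. v 0 = t * \<kappa> 0 \<and> v 1 = t * \<kappa> 1 \<and> v 2 = t * \<kappa> 2" unfolding K by (intro exI[of _ "w 0"]) simp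
		qed
		finally show ?thesis by (auto simp: image_iff)
	qed
	show "v = (\<lambda>_. 0)" if v: "v \<in> FM ?b3" and z: "matrix_map (length ?b3) ?K v = (\<lambda>_. 0)" for v
	proof -
		have "v 0 * \<kappa> 1 = 0" using fun_cong[OF z, of 1] unfolding K by simp
		then have "v 0 = 0" using hom(7) by simp
		moreover have "v i = 0" if "i \<ge> 1" for i using v that by simp
		ultimately show ?thesis by (intro fun_eq_2) simp_all
	qed
qed auto

lemma near_free:
	assumes f: "f \<in> homog 5" and B: "AR_near_basis f \<rho> \<kappa>"
	shows "nearly_free_arrangement 5 2 3 f"
proof -
	interpret milnor_resolution f 5 "[4, 4, 4]" "[6, 7, 7]" "[8]" "partials f" "\<lambda>j. vec_fun (\<rho> j)"
		"\<lambda>_ i. if i < 3 then \<kappa> i else 0" by (rule near_resolution[OF f B])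
	have sh: "nearly_free_shifts (int 5) (int 2) (int 3) = res_shifts [4, 4, 4] [6, 7, 7] [8]"
		by (rule ext) (simp add: nearly_free_shifts_def res_shifts_def)
	have "maps 0 v 0 = v 0 * pd 1 f + v 1 * pd 2 f + v 2 * pd 3 f" for v
	proof -
		have "maps 0 v = single_vec 0 (\<Sum>j<3. v j * partials f j)"
		proof -
			have 3: "length [4, 4, 4 :: int] = 3" by simp
			show ?thesis unfolding maps_def using \<phi>0_eq[of v] unfolding 3 by (simp only: if_True refl)
		qed
		then show ?thesis unfolding partials_sum by (simp add: single_vec_def Der_def)
	qed
	then show ?thesis unfolding nearly_free_arrangement_def sh using minimal by auto
qed

section \<open>Syzygies of the four special types\<close>

lemma fifth: "5 * (Const (1/5) * x) = x" "Const (1/5) * (5 * x) = x"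
proof -
	have "Const (1/5) * 5 = 1" using Const_mult[of "1/5" 5] by (simp add: Const_numeral)
	then show "5 * (Const (1/5) * x) = x" "Const (1/5) * (5 * x) = x"
		by (metis mult.assoc mult.commute mult_1)+
qed

lemma Const_cancel:
	fixes x y :: S
	assumes "s \<noteq> 0" "Const s * x = Const s * y" shows "x = y"
	using assms by simp

text \<open>Three concurrent lines \<open>a\<close>, \<open>b\<close>, \<open>c\<close> and a derivation multiplying their forms by \<open>x\<close>, \<open>y\<close>, \<open>h\<close>:
	comparing coefficients in \<open>c = s a + t b\<close> and using that \<open>L a\<close> and \<open>L b\<close> are coprime shows that the
	differences of the factors are governed by a single polynomial \<open>q\<close>. Every multiple point is
	treated by this step.\<close>

lemma concurrent_syzygy:
	assumes ab: "cr a b \<noteq> 0" and st: "s \<noteq> 0" "t \<noteq> 0" and c: "c = s *s a + t *s b"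
		and eq: "L c * h = Const s * (L a * x) + Const t * (L b * y)"
	obtains q where "x - y = L c * q" "x - h = Const t * (L b * q)" "h - y = Const s * (L a * q)"
proof -
	have Lc: "L c = Const s * L a + Const t * L b" by (simp add: c L_add L_scale)
	have "L a * (Const s * (x - h)) = L b * (Const t * (h - y))"
		using eq unfolding Lc by (simp add: algebra_simps)
	then obtain w where w: "Const s * (x - h) = L b * w" "Const t * (h - y) = L a * w"
		using pair_syzygy[OF ab] by blast
	define q where "q = Const (1 / (s * t)) * w"
	have sq: "Const t * q = Const (1 / s) * w" "Const s * q = Const (1 / t) * w"
		using st by (simp_all add: q_def flip: mult.assoc Const_mult)
	have inv: "Const (1 / s) * (Const s * z) = z" "Const (1 / t) * (Const t * z) = z" for z
		using st by (simp_all flip: mult.assoc Const_mult)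
	have 1: "x - h = Const t * (L b * q)"
		using arg_cong[OF w(1), of "(*) (Const (1 / s))"] unfolding inv
		by (metis sq(1) mult.left_commute)
	have 2: "h - y = Const s * (L a * q)"
		using arg_cong[OF w(2), of "(*) (Const (1 / t))"] unfolding inv
		by (metis sq(2) mult.left_commute)
	have "x - y = (x - h) + (h - y)" by simp
	also have "\<dots> = L c * q" unfolding 1 2 Lc by (simp add: algebra_simps)
	finally show thesis using that 1 2 by blast
qed

lemma arrD: "arr d a ==> i < d ==> a i \<noteq> 0" "arr d a ==> i < d ==> j < d ==> i \<noteq> j ==> cr (a i) (a j) \<noteq> 0"
	by (auto simp: arr_def)

lemma hom_mult: "p \<in> homog i ==> q \<in> homog j ==> i + j = k ==> p * q \<in> homog k"
	using homogeneous_mult by blast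

lemma hom_LL: "L a * L b \<in> homog 2" and hom_LLL: "L a * L b * L c \<in> homog 3"
	by (rule hom_mult[of _ 1 _ 1], simp_all, rule hom_mult[of _ 2 _ 1], rule hom_mult[of _ 1 _ 1], simp_all)

lemma hom_L_mult: "p \<in> homog j ==> j + 1 = k ==> L a * p \<in> homog k"
	by (rule hom_mult[of _ 1 _ j]) simp_all

lemma comb_ldot: "c = s *s a + t *s b ==> ldot c r = Const s * ldot a r + Const t * ldot b r"
	by (simp add: ldot_linear)

lemma comb_L: "c = s *s a + t *s b ==> L c = Const s * L a + Const t * L b"
	by (simp add: L_add L_scale)

lemma comb_coeffs_nonzero:
	assumes "c = s *s a + t *s b" "cr c b \<noteq> 0" "cr c a \<noteq> 0" shows "s \<noteq> 0" "t \<noteq> 0"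
	using assms by (auto simp: vec3_eq_iff algebra_simps)

text \<open>Apply \<open>concurrent_syzygy\<close> at both triple points: the factors on all five lines are determined by that
	of the common line and two polynomials \<open>p\<close>, \<open>q\<close>. As the factors add up to zero, \<open>p\<close> and \<open>q\<close> determine the
	common one, and they are arbitrary: a basis of two quadratic syzygies.\<close>

lemma basis_two_triple_points:
	assumes a: "arr 5 a" and c: "c \<noteq> 0"
		and e1: "a 0 = s1 *s a 1 + t1 *s a 2" and e2: "a 0 = s2 *s a 3 + t2 *s a 4" and D: "tri a 1 2 3 \<noteq> 0"
	shows "\<exists>\<rho>1 \<rho>2. AR_basis (quintic c a) 2 \<rho>1 2 \<rho>2"
proof -
	note np = arrD(2)[OF a] and nz = arrD(1)[OF a]
	have st1: "s1 \<noteq> 0" "t1 \<noteq> 0" by (rule comb_coeffs_nonzero[OF e1]; rule np; simp)+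
	have st2: "s2 \<noteq> 0" "t2 \<noteq> 0" by (rule comb_coeffs_nonzero[OF e2]; rule np; simp)+
	let ?l0 = "L (a 0)" and ?l1 = "L (a 1)" and ?l2 = "L (a 2)" and ?l3 = "L (a 3)" and ?l4 = "L (a 4)"
	have lnz: "?l0 \<noteq> 0" "?l1 \<noteq> 0" "?l2 \<noteq> 0" "?l3 \<noteq> 0" "?l4 \<noteq> 0" using nz by simp_all
	note l1 = comb_L[OF e1] and l2 = comb_L[OF e2]
	\<comment> \<open>the factor of the common line, fixed by the condition that all five factors add up to zero\<close>
	define H where "H p q = Const (1/5) * ((Const s1 * ?l1 - Const t1 * ?l2) * p + (Const s2 * ?l3 - Const t2 * ?l4) * q)" for p q
	have H5: "5 * H p q = (Const s1 * ?l1 - Const t1 * ?l2) * p + (Const s2 * ?l3 - Const t2 * ?l4) * q" for p q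
		unfolding H_def fifth ..
	define T where "T p q = recon (a 1) (a 2) (a 3) (?l1 * (H p q + Const t1 * (?l2 * p)))
		(?l2 * (H p q - Const s1 * (?l1 * p))) (?l3 * (H p q + Const t2 * (?l4 * q)))" for p q
	have T_lin: "T p q = p *s T 1 0 + q *s T 0 1" for p q
		unfolding T_def recon_linear[symmetric] H_def by (simp add: algebra_simps)
	have ld: "ldot (a 1) (T p q) = ?l1 * (H p q + Const t1 * (?l2 * p))"
		"ldot (a 2) (T p q) = ?l2 * (H p q - Const s1 * (?l1 * p))"
		"ldot (a 3) (T p q) = ?l3 * (H p q + Const t2 * (?l4 * q))" for p q
		unfolding T_def by (rule ldot_recon[OF D])+
	have ld0: "ldot (a 0) (T p q) = ?l0 * H p q" for p q
		unfolding comb_ldot[OF e1] ld l1 by (simp add: algebra_simps)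
	have ld4: "ldot (a 4) (T p q) = ?l4 * (H p q - Const s2 * (?l3 * q))" for p q
	proof (rule Const_cancel[OF st2(2)])
		have "Const t2 * ldot (a 4) (T p q) = ?l0 * H p q - Const s2 * ldot (a 3) (T p q)"
			using comb_ldot[OF e2, of "T p q"] ld0[of p q] by (simp add: algebra_simps)
		also have "\<dots> = Const t2 * (?l4 * (H p q - Const s2 * (?l3 * q)))"
			unfolding ld l2 by (simp add: algebra_simps)
		finally show "Const t2 * ldot (a 4) (T p q) = Const t2 * (?l4 * (H p q - Const s2 * (?l3 * q)))" .
	qed
	have gen: "Der r (quintic c a) = 0 \<longleftrightarrow> (\<exists>p q. r = T p q)" for r
	proof
		assume "Der r (quintic c a) = 0"
		then obtain h0 h1 h2 h3 h4 where h: "ldot (a 0) r = ?l0 * h0" "ldot (a 1) r = ?l1 * h1"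
			"ldot (a 2) r = ?l2 * h2" "ldot (a 3) r = ?l3 * h3" "ldot (a 4) r = ?l4 * h4" "h0 + h1 + h2 + h3 + h4 = 0"
			unfolding Der_five_eq_0_iff[OF a c] by (elim exE conjE)
		have n: "cr (a 1) (a 2) \<noteq> 0" "cr (a 3) (a 4) \<noteq> 0" by (rule np; simp)+
		have "?l0 * h0 = Const s1 * (?l1 * h1) + Const t1 * (?l2 * h2)" using comb_ldot[OF e1, of r] unfolding h .
		from concurrent_syzygy[OF n(1) st1 e1 this] obtain p where
			p: "h1 - h0 = Const t1 * (?l2 * p)" "h0 - h2 = Const s1 * (?l1 * p)" .
		have "?l0 * h0 = Const s2 * (?l3 * h3) + Const t2 * (?l4 * h4)" using comb_ldot[OF e2, of r] unfolding h .
		from concurrent_syzygy[OF n(2) st2 e2 this] obtain q where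
			q: "h3 - h0 = Const t2 * (?l4 * q)" "h0 - h4 = Const s2 * (?l3 * q)" .
		have "5 * h0 = (h0 + h1 + h2 + h3 + h4) - (h1 - h0) + (h0 - h2) - (h3 - h0) + (h0 - h4)" by simp
		also have "\<dots> = (Const s1 * ?l1 - Const t1 * ?l2) * p + (Const s2 * ?l3 - Const t2 * ?l4) * q"
			unfolding h(6) p q by (simp add: algebra_simps)
		finally have h0: "h0 = H p q" unfolding H_def by (metis fifth(2))
		have "h1 = H p q + Const t1 * (?l2 * p)" "h2 = H p q - Const s1 * (?l1 * p)" "h3 = H p q + Const t2 * (?l4 * q)"
			using p q unfolding h0 by (simp_all add: algebra_simps)
		then have "r = T p q" using recon_ldot[OF D, of r] unfolding h T_def by simp
		then show "\<exists>p q. r = T p q" by blast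
	next
		assume "\<exists>p q. r = T p q"
		then obtain p q where r: "r = T p q" by blast
		have "H p q + (H p q + Const t1 * (?l2 * p)) + (H p q - Const s1 * (?l1 * p)) + (H p q + Const t2 * (?l4 * q))
				+ (H p q - Const s2 * (?l3 * q)) = 5 * H p q + Const t1 * (?l2 * p) - Const s1 * (?l1 * p) + Const t2 * (?l4 * q) - Const s2 * (?l3 * q)"
			by simp
		also have "\<dots> = 0" unfolding H5 by (simp add: algebra_simps)
		finally show "Der r (quintic c a) = 0"
			unfolding r Der_five_eq_0_iff[OF a c] using ld ld0 ld4 by blast
	qed
	have Hh: "H 1 0 \<in> homog 1" "H 0 1 \<in> homog 1"
		unfolding H_def by (simp_all add: homogeneous_Const_mult homogeneous_diff)
	have "AR_basis (quintic c a) 2 (T 1 0) 2 (T 0 1)"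
		unfolding AR_basis_def
	proof (intro conjI allI impI)
		fix i
		have t0: "?l1 * (H 1 0 + Const t1 * (?l2 * 1)) \<in> homog 2" "?l2 * (H 1 0 - Const s1 * (?l1 * 1)) \<in> homog 2"
			"?l3 * (H 1 0 + Const t2 * (?l4 * 0)) \<in> homog 2"
			by (rule hom_L_mult[where j = 1]; simp add: Hh homogeneous_add homogeneous_diff homogeneous_Const_mult)+
		show "T 1 0 $ i \<in> homog (int 2)" using recon_homogeneous[OF t0] by (simp add: T_def)
		have t1: "?l1 * (H 0 1 + Const t1 * (?l2 * 0)) \<in> homog 2" "?l2 * (H 0 1 - Const s1 * (?l1 * 0)) \<in> homog 2"
			"?l3 * (H 0 1 + Const t2 * (?l4 * 1)) \<in> homog 2"
			by (rule hom_L_mult[where j = 1]; simp add: Hh homogeneous_add homogeneous_diff homogeneous_Const_mult)+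
		show "T 0 1 $ i \<in> homog (int 2)" using recon_homogeneous[OF t1] by (simp add: T_def)
	next
		fix r
		show "Der r (quintic c a) = 0 \<longleftrightarrow> (\<exists>p q. r = p *s T 1 0 + q *s T 0 1)"
			unfolding gen by (subst T_lin) (rule refl)
	next
		fix p q assume "p *s T 1 0 + q *s T 0 1 = 0"
		then have z: "T p q = 0" by (simp only: T_lin[of p q])
		have "?l1 * (H p q + Const t1 * (?l2 * p)) = 0" "?l2 * (H p q - Const s1 * (?l1 * p)) = 0"
			"?l3 * (H p q + Const t2 * (?l4 * q)) = 0"
			using ld[of p q] unfolding z ldot_linear by simp_all
		then have e: "H p q + Const t1 * (?l2 * p) = 0" "H p q - Const s1 * (?l1 * p) = 0" "H p q + Const t2 * (?l4 * q) = 0"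
			using lnz by simp_all
		have "?l0 * p = (H p q + Const t1 * (?l2 * p)) - (H p q - Const s1 * (?l1 * p))"
			unfolding l1 by (simp add: algebra_simps)
		then have p: "p = 0" unfolding e using lnz(1) by simp
		then have "H p q = 0" using e(2) by simp
		then have "q = 0" using e(3) st2 lnz(5) by simp
		then show "p = 0" "q = 0" using p by simp_all
	qed
	then show ?thesis by blast
qed

text \<open>At the quadruple point the factors of \<open>a 1\<close>, \<open>a 2\<close>, \<open>a 3\<close>, \<open>a 4\<close> are given by one of them, \<open>u\<close>, and a
	polynomial \<open>w\<close>; the factor of the remaining line is minus their sum and meets no further condition.\<close>

lemma basis_quadruple_point:
	assumes a: "arr 5 a" and c: "c \<noteq> 0"
		and e3: "a 3 = s3 *s a 1 + t3 *s a 2" and e4: "a 4 = s4 *s a 1 + t4 *s a 2" and D: "tri a 1 2 0 \<noteq> 0"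
	shows "\<exists>\<rho>1 \<rho>2. AR_basis (quintic c a) 1 \<rho>1 3 \<rho>2"
proof -
	note np = arrD(2)[OF a] and nz = arrD(1)[OF a]
	have st3: "s3 \<noteq> 0" "t3 \<noteq> 0" by (rule comb_coeffs_nonzero[OF e3]; rule np; simp)+
	have st4: "s4 \<noteq> 0" "t4 \<noteq> 0" by (rule comb_coeffs_nonzero[OF e4]; rule np; simp)+
	let ?l0 = "L (a 0)" and ?l1 = "L (a 1)" and ?l2 = "L (a 2)" and ?l3 = "L (a 3)" and ?l4 = "L (a 4)"
	have lnz: "?l0 \<noteq> 0" "?l1 \<noteq> 0" "?l2 \<noteq> 0" "?l3 \<noteq> 0" "?l4 \<noteq> 0" using nz by simp_all
	note l3 = comb_L[OF e3] and l4 = comb_L[OF e4]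
	define Q where "Q = ?l3 * ?l4 + Const t3 * (?l2 * ?l4) + Const t4 * (?l2 * ?l3)"
	define T where "T u w = recon (a 1) (a 2) (a 0) (?l1 * u) (?l2 * (u - ?l3 * ?l4 * w)) (?l0 * (Q * w - 4 * u))" for u w
	have T_lin: "T p q = p *s T 1 0 + q *s T 0 1" for p q
		unfolding T_def recon_linear[symmetric] by (simp add: algebra_simps)
	have ld: "ldot (a 1) (T u w) = ?l1 * u" "ldot (a 2) (T u w) = ?l2 * (u - ?l3 * ?l4 * w)"
		"ldot (a 0) (T u w) = ?l0 * (Q * w - 4 * u)" for u w
		unfolding T_def by (rule ldot_recon[OF D])+
	have ld3: "ldot (a 3) (T u w) = ?l3 * (u - Const t3 * (?l2 * ?l4) * w)" for u w
		unfolding comb_ldot[OF e3] ld using l3 by (simp add: algebra_simps)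
	have ld4: "ldot (a 4) (T u w) = ?l4 * (u - Const t4 * (?l2 * ?l3) * w)" for u w
		unfolding comb_ldot[OF e4] ld using l4 by (simp add: algebra_simps)
	have gen: "Der r (quintic c a) = 0 \<longleftrightarrow> (\<exists>u w. r = T u w)" for r
	proof
		assume "Der r (quintic c a) = 0"
		then obtain h0 h1 h2 h3 h4 where h: "ldot (a 0) r = ?l0 * h0" "ldot (a 1) r = ?l1 * h1"
			"ldot (a 2) r = ?l2 * h2" "ldot (a 3) r = ?l3 * h3" "ldot (a 4) r = ?l4 * h4" "h0 + h1 + h2 + h3 + h4 = 0"
			unfolding Der_five_eq_0_iff[OF a c] by (elim exE conjE)
		have n12: "cr (a 1) (a 2) \<noteq> 0" "cr (a 3) (a 4) \<noteq> 0" by (rule np; simp)+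
		have "?l3 * h3 = Const s3 * (?l1 * h1) + Const t3 * (?l2 * h2)" using comb_ldot[OF e3, of r] unfolding h .
		from concurrent_syzygy[OF n12(1) st3 e3 this] obtain p where
			p: "h1 - h2 = ?l3 * p" "h1 - h3 = Const t3 * (?l2 * p)" .
		have "?l4 * h4 = Const s4 * (?l1 * h1) + Const t4 * (?l2 * h2)" using comb_ldot[OF e4, of r] unfolding h .
		from concurrent_syzygy[OF n12(1) st4 e4 this] obtain q where
			q: "h1 - h2 = ?l4 * q" "h1 - h4 = Const t4 * (?l2 * q)" .
		have "?l3 * p = ?l4 * q" using p(1) q(1) by simp
		from pair_syzygy[OF n12(2) this] obtain w where w: "p = ?l4 * w" "q = ?l3 * w" .
		have h2: "h2 = h1 - ?l3 * ?l4 * w" using p(1) unfolding w by (simp add: algebra_simps)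
		have h3: "h3 = h1 - Const t3 * (?l2 * ?l4) * w" using p(2) unfolding w by (simp add: algebra_simps)
		have h4: "h4 = h1 - Const t4 * (?l2 * ?l3) * w" using q(2) unfolding w by (simp add: algebra_simps)
		have "h0 = (h0 + h1 + h2 + h3 + h4) - h1 - h2 - h3 - h4" by simp
		also have "\<dots> = Q * w - 4 * h1" unfolding h(6) unfolding h2 h3 h4 Q_def by (simp add: algebra_simps)
		finally have "r = T h1 w" using recon_ldot[OF D, of r] unfolding h T_def h2 by simp
		then show "\<exists>u w. r = T u w" by blast
	next
		assume "\<exists>u w. r = T u w"
		then obtain u w where r: "r = T u w" by blast
		have "(Q * w - 4 * u) + u + (u - ?l3 * ?l4 * w) + (u - Const t3 * (?l2 * ?l4) * w) + (u - Const t4 * (?l2 * ?l3) * w) = 0"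
			unfolding Q_def by (simp add: algebra_simps)
		then show "Der r (quintic c a) = 0"
			unfolding r Der_five_eq_0_iff[OF a c] using ld ld3 ld4 by blast
	qed
	have Qh: "Q \<in> homog 2" unfolding Q_def by (intro homogeneous_add homogeneous_Const_mult hom_LL)
	have "AR_basis (quintic c a) 1 (T 1 0) 3 (T 0 1)"
		unfolding AR_basis_def
	proof (intro conjI allI impI)
		fix i
		have "1 \<in> (homog 0 :: S set)" "4 \<in> (homog 0 :: S set)"
			using homogeneous_Const[of 1] homogeneous_Const[of 4] by (simp_all add: Const_numeral)
		then show "T 1 0 $ i \<in> homog (int 1)"
			unfolding T_def by (intro recon_homogeneous hom_L_mult[where j = 0]) (simp_all add: homogeneous_uminus)
		show "T 0 1 $ i \<in> homog (int 3)"
			unfolding T_def by (intro recon_homogeneous hom_L_mult[where j = 2]) (simp_all add: homogeneous_uminus hom_LL Qh)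
	next
		fix r
		show "Der r (quintic c a) = 0 \<longleftrightarrow> (\<exists>p q. r = p *s T 1 0 + q *s T 0 1)"
			unfolding gen by (subst T_lin) (rule refl)
	next
		fix p q assume "p *s T 1 0 + q *s T 0 1 = 0"
		then have z: "T p q = 0" by (simp only: T_lin[of p q])
		have "?l1 * p = 0" "?l2 * (p - ?l3 * ?l4 * q) = 0"
			using ld[of p q] unfolding z ldot_linear by simp_all
		then show "p = 0" "q = 0" using lnz by simp_all
	qed
	then show ?thesis by blast
qed

text \<open>The value \<open>g\<close> on a form \<open>e\<close> outside the pencil is arbitrary, which gives the constant syzygy. The factors on
	the five lines are governed by one polynomial \<open>w\<close>, with the common part \<open>H w\<close> fixed by their sum.\<close>

lemma basis_pencil:
	assumes a: "arr 5 a" and c: "c \<noteq> 0" and e2: "a 2 = s2 *s a 0 + t2 *s a 1"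
		and e3: "a 3 = s3 *s a 0 + t3 *s a 1" and e4: "a 4 = s4 *s a 0 + t4 *s a 1" and D: "dt (a 0) (a 1) e \<noteq> 0"
	shows "\<exists>\<rho>2. AR_basis (quintic c a) 0 (recon (a 0) (a 1) e 0 0 1) 4 \<rho>2"
proof -
	note np = arrD(2)[OF a] and nz = arrD(1)[OF a]
	have st2: "s2 \<noteq> 0" "t2 \<noteq> 0" by (rule comb_coeffs_nonzero[OF e2]; rule np; simp)+
	have st3: "s3 \<noteq> 0" "t3 \<noteq> 0" by (rule comb_coeffs_nonzero[OF e3]; rule np; simp)+
	have st4: "s4 \<noteq> 0" "t4 \<noteq> 0" by (rule comb_coeffs_nonzero[OF e4]; rule np; simp)+
	let ?l0 = "L (a 0)" and ?l1 = "L (a 1)" and ?l2 = "L (a 2)" and ?l3 = "L (a 3)" and ?l4 = "L (a 4)"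
	have lnz: "?l0 \<noteq> 0" "?l1 \<noteq> 0" "?l2 \<noteq> 0" "?l3 \<noteq> 0" "?l4 \<noteq> 0" using nz by simp_all
	note l2 = comb_L[OF e2] and l3 = comb_L[OF e3] and l4 = comb_L[OF e4]
	define Q where "Q = ?l2 * ?l3 * ?l4 + Const t2 * (?l1 * ?l3 * ?l4) + Const t3 * (?l1 * ?l2 * ?l4) + Const t4 * (?l1 * ?l2 * ?l3)"
	define H where "H w = Const (1/5) * (Q * w)" for w
	have H5: "5 * H w = Q * w" for w unfolding H_def fifth ..
	define T where "T g w = recon (a 0) (a 1) e (?l0 * H w) (?l1 * (H w - ?l2 * ?l3 * ?l4 * w)) g" for g w
	have T_lin: "T p q = p *s T 1 0 + q *s T 0 1" for p q
		unfolding T_def recon_linear[symmetric] H_def by (simp add: algebra_simps)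
	have ld: "ldot (a 0) (T g w) = ?l0 * H w" "ldot (a 1) (T g w) = ?l1 * (H w - ?l2 * ?l3 * ?l4 * w)"
		"ldot e (T g w) = g" for g w
		unfolding T_def by (rule ldot_recon[OF D])+
	have ld2: "ldot (a 2) (T g w) = ?l2 * (H w - Const t2 * (?l1 * ?l3 * ?l4) * w)" for g w
		unfolding comb_ldot[OF e2] ld using l2 by (simp add: algebra_simps)
	have ld3: "ldot (a 3) (T g w) = ?l3 * (H w - Const t3 * (?l1 * ?l2 * ?l4) * w)" for g w
		unfolding comb_ldot[OF e3] ld using l3 by (simp add: algebra_simps)
	have ld4: "ldot (a 4) (T g w) = ?l4 * (H w - Const t4 * (?l1 * ?l2 * ?l3) * w)" for g w
		unfolding comb_ldot[OF e4] ld using l4 by (simp add: algebra_simps)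
	have gen: "Der r (quintic c a) = 0 \<longleftrightarrow> (\<exists>g w. r = T g w)" for r
	proof
		assume "Der r (quintic c a) = 0"
		then obtain h0 h1 h2 h3 h4 where h: "ldot (a 0) r = ?l0 * h0" "ldot (a 1) r = ?l1 * h1"
			"ldot (a 2) r = ?l2 * h2" "ldot (a 3) r = ?l3 * h3" "ldot (a 4) r = ?l4 * h4" "h0 + h1 + h2 + h3 + h4 = 0"
			unfolding Der_five_eq_0_iff[OF a c] by (elim exE conjE)
		have n: "cr (a 0) (a 1) \<noteq> 0" "cr (a 2) (a 3) \<noteq> 0" "cr (a 2) (a 4) \<noteq> 0" "cr (a 3) (a 4) \<noteq> 0" by (rule np; simp)+
		have "?l2 * h2 = Const s2 * (?l0 * h0) + Const t2 * (?l1 * h1)" using comb_ldot[OF e2, of r] unfolding h .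
		from concurrent_syzygy[OF n(1) st2 e2 this] obtain p where
			p: "h0 - h1 = ?l2 * p" "h0 - h2 = Const t2 * (?l1 * p)" .
		have "?l3 * h3 = Const s3 * (?l0 * h0) + Const t3 * (?l1 * h1)" using comb_ldot[OF e3, of r] unfolding h .
		from concurrent_syzygy[OF n(1) st3 e3 this] obtain q where
			q: "h0 - h1 = ?l3 * q" "h0 - h3 = Const t3 * (?l1 * q)" .
		have "?l4 * h4 = Const s4 * (?l0 * h0) + Const t4 * (?l1 * h1)" using comb_ldot[OF e4, of r] unfolding h .
		from concurrent_syzygy[OF n(1) st4 e4 this] obtain k where
			k: "h0 - h1 = ?l4 * k" "h0 - h4 = Const t4 * (?l1 * k)" .
		have "?l2 * p = ?l3 * q" using p(1) q(1) by simp
		from pair_syzygy[OF n(2) this] obtain w1 where w1: "p = ?l3 * w1" "q = ?l2 * w1" .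
		have "?l2 * (?l3 * w1) = ?l4 * k" using p(1) k(1) unfolding w1 by simp
		from pair_syzygy[OF n(3) this] obtain w2 where w2: "?l3 * w1 = ?l4 * w2" "k = ?l2 * w2" .
		from pair_syzygy[OF n(4) w2(1)] obtain w where w: "w1 = ?l4 * w" "w2 = ?l3 * w" .
		have h1: "h1 = h0 - ?l2 * ?l3 * ?l4 * w" using p(1) unfolding w1 w by (simp add: algebra_simps)
		have h2: "h2 = h0 - Const t2 * (?l1 * ?l3 * ?l4) * w" using p(2) unfolding w1 w by (simp add: algebra_simps)
		have h3: "h3 = h0 - Const t3 * (?l1 * ?l2 * ?l4) * w" using q(2) unfolding w1 w by (simp add: algebra_simps)
		have h4: "h4 = h0 - Const t4 * (?l1 * ?l2 * ?l3) * w" using k(2) unfolding w2 w by (simp add: algebra_simps)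
		have "5 * h0 = (h0 + h1 + h2 + h3 + h4) + (h0 - h1) + (h0 - h2) + (h0 - h3) + (h0 - h4)" by simp
		also have "\<dots> = Q * w" unfolding h(6) unfolding h1 h2 h3 h4 Q_def by (simp add: algebra_simps)
		finally have "h0 = H w" unfolding H_def by (metis fifth(2))
		then have "r = T (ldot e r) w" using recon_ldot[OF D, of r] unfolding h T_def h1 by simp
		then show "\<exists>g w. r = T g w" by blast
	next
		assume "\<exists>g w. r = T g w"
		then obtain g w where r: "r = T g w" by blast
		have "H w + (H w - ?l2 * ?l3 * ?l4 * w) + (H w - Const t2 * (?l1 * ?l3 * ?l4) * w) +
				(H w - Const t3 * (?l1 * ?l2 * ?l4) * w) + (H w - Const t4 * (?l1 * ?l2 * ?l3) * w) = 5 * H w - Q * w"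
			unfolding Q_def by (simp add: algebra_simps)
		also have "\<dots> = 0" unfolding H5 by simp
		finally show "Der r (quintic c a) = 0"
			unfolding r Der_five_eq_0_iff[OF a c] using ld ld2 ld3 ld4 by blast
	qed
	have Qh: "Q \<in> homog 3" unfolding Q_def by (intro homogeneous_add homogeneous_Const_mult hom_LLL)
	have T10: "T 1 0 = recon (a 0) (a 1) e 0 0 1" by (simp add: T_def H_def)
	have "AR_basis (quintic c a) 0 (T 1 0) 4 (T 0 1)"
		unfolding AR_basis_def
	proof (intro conjI allI impI)
		fix i
		have "1 \<in> (homog 0 :: S set)" using homogeneous_Const[of 1] by simp
		then show "T 1 0 $ i \<in> homog (int 0)"
			unfolding T10 by (intro recon_homogeneous) simp_all
		have "H 1 \<in> homog 3" unfolding H_def using Qh by (simp add: homogeneous_Const_mult)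
		then show "T 0 1 $ i \<in> homog (int 4)"
			unfolding T_def by (intro recon_homogeneous hom_L_mult[where j = 3]) (simp_all add: homogeneous_diff hom_LLL)
	next
		fix r
		show "Der r (quintic c a) = 0 \<longleftrightarrow> (\<exists>p q. r = p *s T 1 0 + q *s T 0 1)"
			unfolding gen by (subst T_lin) (rule refl)
	next
		fix p q assume "p *s T 1 0 + q *s T 0 1 = 0"
		then have z: "T p q = 0" by (simp only: T_lin[of p q])
		have "p = 0" "?l0 * H q = 0" "?l1 * (H q - ?l2 * ?l3 * ?l4 * q) = 0"
			using ld[where g = p and w = q] unfolding z ldot_linear by simp_all
		then show "p = 0" "q = 0" using lnz by simp_all
	qed
	then show ?thesis unfolding T10 by blast
qed

text \<open>The triple point expresses the factors on its lines through that of line 3 and a polynomial \<open>p\<close>. Lines 0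
	and 4 then require \<open>l1 l2 p\<close> to lie in the ideal of \<open>l0\<close> and \<open>l4\<close>; as their common point is on neither line 1
	nor line 2, this means \<open>p = l4 x + l0 y\<close>. Only \<open>p\<close> matters, so a multiple of \<open>(l0, - l4)\<close> may be added to
	\<open>(x, y)\<close> if the third parameter \<open>w\<close> compensates for it: three generators and one relation.\<close>

lemma near_basis_one_triple_point:
	assumes a: "arr 5 a" and c: "c \<noteq> 0"
		and e3: "a 3 = s *s a 1 + t *s a 2" and e0: "a 0 = \<alpha> *s a 1 + \<beta> *s a 2 + \<delta> *s a 4" and \<delta>: "\<delta> \<noteq> 0"
		and D: "tri a 1 2 4 \<noteq> 0" and D1: "tri a 4 0 1 \<noteq> 0" and D2: "tri a 4 0 2 \<noteq> 0"
		and D3: "tri a 0 3 4 \<noteq> 0"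
	shows "\<exists>\<rho> \<kappa>. AR_near_basis (quintic c a) \<rho> \<kappa>"
proof -
	note np = arrD(2)[OF a] and nz = arrD(1)[OF a]
	have st: "s \<noteq> 0" "t \<noteq> 0" by (rule comb_coeffs_nonzero[OF e3]; rule np; simp)+
	let ?l0 = "L (a 0)" and ?l1 = "L (a 1)" and ?l2 = "L (a 2)" and ?l3 = "L (a 3)" and ?l4 = "L (a 4)"
	have lnz: "?l0 \<noteq> 0" "?l1 \<noteq> 0" "?l2 \<noteq> 0" "?l3 \<noteq> 0" "?l4 \<noteq> 0" using nz by simp_all
	note l3 = comb_L[OF e3]
	have l0: "?l0 = Const \<alpha> * ?l1 + Const \<beta> * ?l2 + Const \<delta> * ?l4" unfolding e0 L_add L_scale ..
	have ldot0: "ldot (a 0) r = Const \<alpha> * ldot (a 1) r + Const \<beta> * ldot (a 2) r + Const \<delta> * ldot (a 4) r" for r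
		unfolding e0 ldot_linear ..
	define \<gamma> where "\<gamma> = \<alpha> * t - \<beta> * s"
	have "tri a 0 3 4 = \<gamma> * tri a 1 2 4"
		unfolding e0 e3 \<gamma>_def by (simp add: dt_expand algebra_simps)
	then have \<gamma>: "\<gamma> \<noteq> 0" using D3 by auto
	have C\<gamma>: "Const \<gamma> = Const \<alpha> * Const t - Const \<beta> * Const s" by (simp add: \<gamma>_def Const_diff Const_mult)
	have C\<delta>: "Const \<delta> * (Const (1 / \<delta>) * x) = x" "Const (1 / \<delta>) * (Const \<delta> * x) = x" for x
		using \<delta> by (simp_all flip: mult.assoc Const_mult)
	define P where "P x y = ?l4 * x + ?l0 * y" for x y
	define H where "H w x = Const (1 / \<delta>) * (?l0 * w - Const \<gamma> * (?l1 * ?l2 * x))" for w x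
	define K where "K w y = Const \<gamma> * (?l1 * ?l2 * y) + ?l4 * w" for w y
	define G where "G w x y = Const (1/5) * ((Const s * ?l1 - Const t * ?l2) * P x y - H w x - K w y)" for w x y
	have G5: "5 * G w x y = (Const s * ?l1 - Const t * ?l2) * P x y - H w x - K w y" for w x y
		unfolding G_def fifth ..
	define T where "T w x y = recon (a 1) (a 2) (a 4) (?l1 * (G w x y + Const t * (?l2 * P x y)))
		(?l2 * (G w x y - Const s * (?l1 * P x y))) (?l4 * (G w x y + H w x))" for w x y
	have T_lin: "T p q r = p *s T 1 0 0 + q *s T 0 1 0 + r *s T 0 0 1" for p q r
	proof -
		have z: "P 0 0 = 0" "H 0 0 = 0" "K 0 0 = 0" by (simp_all add: P_def H_def K_def)
		have P: "P q r = q * P 1 0 + r * P 0 1" unfolding P_def by (simp add: algebra_simps)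
		have H: "H p q = p * H 1 0 + q * H 0 1" unfolding H_def by (simp add: algebra_simps)
		have K: "K p r = p * K 1 0 + r * K 0 1" unfolding K_def by (simp add: algebra_simps)
		have G: "G p q r = p * G 1 0 0 + q * G 0 1 0 + r * G 0 0 1"
			unfolding G_def P H K z by (simp add: algebra_simps)
		show ?thesis
			unfolding T_def recon_linear3[symmetric] G P H z by (simp add: algebra_simps)
	qed
	have key: "Const \<delta> * (?l4 * H w x) + Const \<gamma> * (?l1 * ?l2 * P x y) = ?l0 * K w y" for w x y
	proof -
		have "Const \<delta> * (?l4 * H w x) = ?l4 * (?l0 * w - Const \<gamma> * (?l1 * ?l2 * x))"
			unfolding H_def mult.left_commute[of "Const \<delta>" ?l4] C\<delta> ..
		then show ?thesis unfolding K_def P_def by (simp add: algebra_simps)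
	qed
	have ld: "ldot (a 1) (T w x y) = ?l1 * (G w x y + Const t * (?l2 * P x y))"
		"ldot (a 2) (T w x y) = ?l2 * (G w x y - Const s * (?l1 * P x y))"
		"ldot (a 4) (T w x y) = ?l4 * (G w x y + H w x)" for w x y
		unfolding T_def by (rule ldot_recon[OF D])+
	have ld3: "ldot (a 3) (T w x y) = ?l3 * G w x y" for w x y
		unfolding comb_ldot[OF e3] ld l3 by (simp add: algebra_simps)
	have ld0: "ldot (a 0) (T w x y) = ?l0 * (G w x y + K w y)" for w x y
	proof -
		have "ldot (a 0) (T w x y) = ?l0 * G w x y + (Const \<delta> * (?l4 * H w x) + Const \<gamma> * (?l1 * ?l2 * P x y))"
		proof -
			have l0G: "?l0 * G w x y = (Const \<alpha> * ?l1 + Const \<beta> * ?l2 + Const \<delta> * ?l4) * G w x y" unfolding l0 ..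
			show ?thesis unfolding ldot0 ld C\<gamma> l0G by (simp add: algebra_simps)
		qed
		then show ?thesis unfolding key by (simp add: algebra_simps)
	qed
	have gen: "Der r (quintic c a) = 0 \<longleftrightarrow> (\<exists>w x y. r = T w x y)" for r
	proof
		assume "Der r (quintic c a) = 0"
		then obtain h0 h1 h2 h3 h4 where h: "ldot (a 0) r = ?l0 * h0" "ldot (a 1) r = ?l1 * h1"
			"ldot (a 2) r = ?l2 * h2" "ldot (a 3) r = ?l3 * h3" "ldot (a 4) r = ?l4 * h4" "h0 + h1 + h2 + h3 + h4 = 0"
			unfolding Der_five_eq_0_iff[OF a c] by (elim exE conjE)
		have n: "cr (a 1) (a 2) \<noteq> 0" "cr (a 4) (a 0) \<noteq> 0" by (rule np; simp)+
		have "?l3 * h3 = Const s * (?l1 * h1) + Const t * (?l2 * h2)" using comb_ldot[OF e3, of r] unfolding h .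
		from concurrent_syzygy[OF n(1) st e3 this] obtain p where
			p: "h1 - h3 = Const t * (?l2 * p)" "h3 - h2 = Const s * (?l1 * p)" .
		have h1: "h1 = h3 + Const t * (?l2 * p)" and h2: "h2 = h3 - Const s * (?l1 * p)"
			using p by (simp_all add: algebra_simps)
		have "?l0 * h0 = Const \<alpha> * (?l1 * h1) + Const \<beta> * (?l2 * h2) + Const \<delta> * (?l4 * h4)"
			using ldot0[of r] unfolding h .
		moreover have "?l0 * h3 = Const \<alpha> * (?l1 * h3) + Const \<beta> * (?l2 * h3) + Const \<delta> * (?l4 * h3)"
			unfolding l0 by (simp add: algebra_simps)
		ultimately have rel: "?l0 * (h0 - h3) = Const \<delta> * (?l4 * (h4 - h3)) + Const \<gamma> * (?l1 * (?l2 * p))"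
			unfolding h1 h2 C\<gamma> by (simp add: algebra_simps)
		have "?l1 * (?l2 * (Const \<gamma> * p)) = ?l4 * (- (Const \<delta> * (h4 - h3))) + ?l0 * (h0 - h3)"
			unfolding rel by (simp add: algebra_simps)
		from triple_syzygy[OF D1 this] obtain x1 y1 where "?l2 * (Const \<gamma> * p) = ?l4 * x1 + ?l0 * y1" .
		from triple_syzygy[OF D2 this] obtain x2 y2 where xy: "Const \<gamma> * p = ?l4 * x2 + ?l0 * y2" .
		define x y where "x = Const (1 / \<gamma>) * x2" and "y = Const (1 / \<gamma>) * y2"
		have C\<gamma>': "Const (1 / \<gamma>) * (Const \<gamma> * z) = z" "Const \<gamma> * (Const (1 / \<gamma>) * z) = z" for z
			using \<gamma> by (simp_all flip: mult.assoc Const_mult)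
		have "p = Const (1 / \<gamma>) * (?l4 * x2 + ?l0 * y2)" using C\<gamma>'(1)[of p] unfolding xy by simp
		then have pP: "p = P x y" unfolding P_def x_def y_def by (simp add: algebra_simps)
		have "?l4 * (Const \<delta> * (h4 - h3) + Const \<gamma> * (?l1 * ?l2 * x)) = ?l0 * ((h0 - h3) - Const \<gamma> * (?l1 * ?l2 * y))"
			using rel unfolding pP P_def by (simp add: algebra_simps)
		from pair_syzygy[OF n(2) this] obtain w where
			w: "Const \<delta> * (h4 - h3) + Const \<gamma> * (?l1 * ?l2 * x) = ?l0 * w" "(h0 - h3) - Const \<gamma> * (?l1 * ?l2 * y) = ?l4 * w" .
		have "Const \<delta> * (h4 - h3) = ?l0 * w - Const \<gamma> * (?l1 * ?l2 * x)" using w(1) by (simp add: algebra_simps)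
		then have hH: "h4 - h3 = H w x" using C\<delta>(2)[of "h4 - h3"] unfolding H_def by simp
		have hK: "h0 - h3 = K w y" using w(2) unfolding K_def by (simp add: algebra_simps)
		have "5 * h3 = (h0 + h1 + h2 + h3 + h4) - (h1 - h3) + (h3 - h2) - (h4 - h3) - (h0 - h3)" by simp
		also have "\<dots> = (Const s * ?l1 - Const t * ?l2) * P x y - H w x - K w y"
			unfolding h(6) p hH hK pP by (simp add: algebra_simps)
		finally have h3: "h3 = G w x y" using fifth(2)[of h3] unfolding G_def by simp
		have h4: "h4 = G w x y + H w x" using hH unfolding h3 by (simp add: algebra_simps)
		have "r = T w x y"
			using recon_ldot[OF D, of r] unfolding h T_def h1 h2 h4 unfolding h3 pP by simp
		then show "\<exists>w x y. r = T w x y" by blast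
	next
		assume "\<exists>w x y. r = T w x y"
		then obtain w x y where r: "r = T w x y" by blast
		have "(G w x y + K w y) + (G w x y + Const t * (?l2 * P x y)) + (G w x y - Const s * (?l1 * P x y)) + G w x y + (G w x y + H w x)
			= 5 * G w x y + K w y + Const t * (?l2 * P x y) - Const s * (?l1 * P x y) + H w x" by simp
		also have "\<dots> = 0" unfolding G5 by (simp add: algebra_simps)
		finally show "Der r (quintic c a) = 0"
			unfolding r Der_five_eq_0_iff[OF a c] using ld ld0 ld3 by blast
	qed
	define \<rho> where "\<rho> j = (if j = 0 then T 1 0 0 else if j = 1 then T 0 1 0 else T 0 0 1)" for j :: nat
	define \<kappa> where "\<kappa> j = (if j = 0 then Const \<gamma> * (?l1 * ?l2) else if j = 1 then ?l0 else - ?l4)" for j :: nat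
	have ker: "T w x y = 0 \<longleftrightarrow> (\<exists>z. w = z * \<kappa> 0 \<and> x = z * \<kappa> 1 \<and> y = z * \<kappa> 2)" for w x y
	proof
		assume z: "T w x y = 0"
		have "?l1 * (G w x y + Const t * (?l2 * P x y)) = 0" "?l2 * (G w x y - Const s * (?l1 * P x y)) = 0"
			"?l4 * (G w x y + H w x) = 0" "?l3 * G w x y = 0"
			using ld[of w x y] ld3[of w x y] unfolding z ldot_linear by simp_all
		then have e: "G w x y = 0" "G w x y + Const t * (?l2 * P x y) = 0" "G w x y + H w x = 0" using lnz by simp_all
		have P0: "P x y = 0" using e(1,2) st lnz(3) by simp
		have H0: "H w x = 0" using e(1,3) by simp
		have n: "cr (a 4) (a 0) \<noteq> 0" by (rule np; simp)
		have "?l4 * x = ?l0 * (- y)" using P0 unfolding P_def by (simp add: algebra_simps eq_neg_iff_add_eq_0)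
		from pair_syzygy[OF n this] obtain z where xy: "x = ?l0 * z" "- y = ?l4 * z" .
		have "?l0 * w - Const \<gamma> * (?l1 * ?l2 * x) = 0" using H0 \<delta> unfolding H_def by simp
		then have "?l0 * (w - Const \<gamma> * (?l1 * ?l2 * z)) = 0" unfolding xy by (simp add: algebra_simps)
		then have "w = Const \<gamma> * (?l1 * ?l2 * z)" using lnz(1) by simp
		then show "\<exists>z. w = z * \<kappa> 0 \<and> x = z * \<kappa> 1 \<and> y = z * \<kappa> 2"
			using xy by (intro exI[of _ z]) (simp add: \<kappa>_def algebra_simps minus_equation_iff[of y])
	next
		assume "\<exists>z. w = z * \<kappa> 0 \<and> x = z * \<kappa> 1 \<and> y = z * \<kappa> 2"
		then obtain z where z: "w = z * (Const \<gamma> * (?l1 * ?l2))" "x = z * ?l0" "y = - (z * ?l4)"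
			by (auto simp: \<kappa>_def)
		have "P x y = 0" "H w x = 0" "K w y = 0"
			unfolding P_def H_def K_def z by (simp_all add: algebra_simps)
		then show "T w x y = 0" unfolding T_def G_def by (simp add: recon_0)
	qed
	have one: "1 \<in> (homog 0 :: S set)" using homogeneous_Const[of 1] by simp
	have P: "P 0 0 = 0" "P 1 0 \<in> homog 1" "P 0 1 \<in> homog 1" by (simp_all add: P_def)
	have H: "H 1 0 \<in> homog 1" "H 0 1 \<in> homog 2" "H 0 0 = 0"
		by (simp_all add: H_def homogeneous_Const_mult homogeneous_uminus hom_LL)
	have K: "K 1 0 \<in> homog 1" "K 0 1 \<in> homog 2" "K 0 0 = 0"
		by (simp_all add: K_def homogeneous_Const_mult hom_LL)
	have sl: "(Const s * ?l1 - Const t * ?l2) * p \<in> homog 2" if "p \<in> homog 1" for p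
		by (rule hom_mult[of _ 1 _ 1]) (use that in \<open>auto intro!: homogeneous_diff homogeneous_Const_mult\<close>)
	have G: "G 1 0 0 \<in> homog 1" "G 0 1 0 \<in> homog 2" "G 0 0 1 \<in> homog 2"
		unfolding G_def P(1) H(3) K(3) mult_zero_right
		by (intro homogeneous_Const_mult homogeneous_diff homogeneous_0 sl P H K)+
	have "AR_near_basis (quintic c a) \<rho> \<kappa>"
		unfolding AR_near_basis_def
	proof (intro conjI allI)
		fix i
		have t0: "?l1 * (G 1 0 0 + Const t * (?l2 * P 0 0)) \<in> homog 2" "?l2 * (G 1 0 0 - Const s * (?l1 * P 0 0)) \<in> homog 2"
			"?l4 * (G 1 0 0 + H 1 0) \<in> homog 2"
			by (rule hom_L_mult[where j = 1]; simp add: P G H homogeneous_add)+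
		show "\<rho> 0 $ i \<in> homog 2" using recon_homogeneous[OF t0] by (simp add: \<rho>_def T_def)
		have t1: "?l1 * (G 0 1 0 + Const t * (?l2 * P 1 0)) \<in> homog 3" "?l2 * (G 0 1 0 - Const s * (?l1 * P 1 0)) \<in> homog 3"
			"?l4 * (G 0 1 0 + H 0 1) \<in> homog 3"
			by (rule hom_L_mult[where j = 2]; simp add: P G H homogeneous_add homogeneous_diff homogeneous_Const_mult hom_L_mult[OF P(2)])+
		show "\<rho> 1 $ i \<in> homog 3" using recon_homogeneous[OF t1] by (simp add: \<rho>_def T_def)
		have t2: "?l1 * (G 0 0 1 + Const t * (?l2 * P 0 1)) \<in> homog 3" "?l2 * (G 0 0 1 - Const s * (?l1 * P 0 1)) \<in> homog 3"
			"?l4 * (G 0 0 1 + H 0 0) \<in> homog 3"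
			by (rule hom_L_mult[where j = 2]; simp add: P G H homogeneous_add homogeneous_diff homogeneous_Const_mult hom_L_mult[OF P(3)])+
		show "\<rho> 2 $ i \<in> homog 3" using recon_homogeneous[OF t2] by (simp add: \<rho>_def T_def)
		show "\<kappa> 0 \<in> homog 2" "\<kappa> 1 \<in> homog 1" "\<kappa> 2 \<in> homog 1" "\<kappa> 1 \<noteq> 0"
			using lnz by (simp_all add: \<kappa>_def homogeneous_Const_mult hom_LL homogeneous_uminus)
	next
		fix r
		show "Der r (quintic c a) = 0 \<longleftrightarrow> (\<exists>p q s. r = p *s \<rho> 0 + q *s \<rho> 1 + s *s \<rho> 2)"
			unfolding gen by (subst T_lin) (simp add: \<rho>_def)
	next
		fix p q s
		show "p *s \<rho> 0 + q *s \<rho> 1 + s *s \<rho> 2 = 0 \<longleftrightarrow> (\<exists>t. p = t * \<kappa> 0 \<and> q = t * \<kappa> 1 \<and> s = t * \<kappa> 2)"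
			unfolding ker[symmetric] by (subst T_lin) (simp add: \<rho>_def)
	qed
	then show ?thesis by blast
qed

section \<open>Dimension and irreducibility of parametrized families of forms\<close>

subsection \<open>Polynomial maps\<close>

definition supp_deg :: "nat => nat => (nat \<Rightarrow>\<^sub>0 nat) set" where
	"supp_deg N D = {m. Poly_Mapping.keys m \<subseteq> {..<N} \<and> monom_degree m \<le> D}"

definition Pol :: "nat => nat => nat mpoly set" where
	"Pol N D = {p. Poly_Mapping.keys p \<subseteq> supp_deg N D}"

lemma supp_deg_mono: "D \<le> E ==> supp_deg N D \<subseteq> supp_deg N E"
	by (auto simp: supp_deg_def)

lemma Pol_mono: "D \<le> E ==> Pol N D \<subseteq> Pol N E"
	unfolding Pol_def using supp_deg_mono by blast

lemma Pol_Const: "Const c \<in> Pol N D"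
	unfolding Pol_def Const_def by (auto simp: supp_deg_def monom_degree_def split: if_splits)

lemma Pol_Var: "i < N ==> Var i \<in> Pol N 1"
	unfolding Pol_def Var_def by (auto simp: supp_deg_def monom_degree_def)

lemma Pol_add: "p \<in> Pol N D ==> q \<in> Pol N D ==> p + q \<in> Pol N D"
	unfolding Pol_def using Poly_Mapping.keys_add[of p q] by blast

lemma Pol_mult: "p \<in> Pol N D ==> q \<in> Pol N E ==> p * q \<in> Pol N (D + E)"
proof -
	assume p: "p \<in> Pol N D" and q: "q \<in> Pol N E"
	have "a + b \<in> supp_deg N (D + E)" if "a \<in> supp_deg N D" "b \<in> supp_deg N E" for a b
		using that Poly_Mapping.keys_add[of a b] by (auto simp: supp_deg_def monom_degree_add)
	then show ?thesis using p q keys_mult[of p q] unfolding Pol_def by blast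
qed

lemma Pol_power: "p \<in> Pol N D ==> p ^ k \<in> Pol N (k * D)"
proof (induction k)
	case 0
	then show ?case using Pol_Const[of 1] by simp
next
	case (Suc k)
	then show ?case using Pol_mult[of p N D "p ^ k" "k * D"] by (simp add: add.commute)
qed

lemma Pol_prod: "finite A ==> (\<And>i. i \<in> A ==> p i \<in> Pol N (D i)) ==> prod p A \<in> Pol N (sum D A)"
proof (induction A rule: finite_induct)
	case empty
	then show ?case using Pol_Const[of 1] by simp
next
	case (insert i A)
	then show ?case using Pol_mult[of "p i" N "D i" "prod p A" "sum D A"] by simp
qed

definition polymap :: "nat => ((nat => complex) => complex) => bool" where
	"polymap N g \<longleftrightarrow> (\<exists>D. \<exists>p\<in>Pol N D. \<forall>u. g u = mpoly_eval p u)"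

lemma polymap_const: "polymap N (\<lambda>_. c)"
	unfolding polymap_def using Pol_Const[of c N 0] by (intro exI[of _ 0] bexI[of _ "Const c"]) auto

lemma polymap_coord: "i < N ==> polymap N (\<lambda>u. u i)"
	unfolding polymap_def using Pol_Var[of i N] by (intro exI[of _ 1] bexI[of _ "Var i"]) auto

lemma polymap_add: "polymap N f ==> polymap N g ==> polymap N (\<lambda>u. f u + g u)"
proof -
	assume "polymap N f" "polymap N g"
	then obtain D E p q where *: "p \<in> Pol N D" "\<And>u. f u = mpoly_eval p u" "q \<in> Pol N E" "\<And>u. g u = mpoly_eval q u"
		unfolding polymap_def by blast
	have "p + q \<in> Pol N (max D E)"
		using *(1,3) Pol_mono[of D "max D E" N] Pol_mono[of E "max D E" N] by (intro Pol_add) auto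
	then show ?thesis unfolding polymap_def
		by (intro exI[of _ "max D E"] bexI[of _ "p + q"]) (simp_all add: * mpoly_eval_add)
qed

lemma polymap_mult: "polymap N f ==> polymap N g ==> polymap N (\<lambda>u. f u * g u)"
proof -
	assume "polymap N f" "polymap N g"
	then obtain D E p q where *: "p \<in> Pol N D" "\<And>u. f u = mpoly_eval p u" "q \<in> Pol N E" "\<And>u. g u = mpoly_eval q u"
		unfolding polymap_def by blast
	then show ?thesis unfolding polymap_def
		by (intro exI[of _ "D + E"] bexI[of _ "p * q"]) (simp_all add: mpoly_eval_mult Pol_mult)
qed

lemma polymap_diff: "polymap N f ==> polymap N g ==> polymap N (\<lambda>u. f u - g u)"
	using polymap_add[of N f "\<lambda>u. - 1 * g u"] polymap_mult[OF polymap_const[of N "- 1"]] by simp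

lemma polymap_power: "polymap N f ==> polymap N (\<lambda>u. f u ^ k)"
	by (induction k) (simp_all add: polymap_const polymap_mult)

lemma polymap_sum: "(\<And>i. i \<in> A ==> polymap N (f i)) ==> polymap N (\<lambda>u. \<Sum>i\<in>A. f i u)"
	by (induction A rule: infinite_finite_induct) (simp_all add: polymap_const polymap_add)

lemma polymap_prod: "(\<And>i. i \<in> A ==> polymap N (f i)) ==> polymap N (\<lambda>u. \<Prod>i\<in>A. f i u)"
	by (induction A rule: infinite_finite_induct) (simp_all add: polymap_const polymap_mult)

lemma polymap_compose: "(\<And>m. polymap N (\<lambda>u. g u m)) ==> polymap N (\<lambda>u. mpoly_eval F (g u))"
	unfolding mpoly_eval_def monom_eval_def
	by (intro polymap_sum polymap_mult polymap_const polymap_prod polymap_power)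

text \<open>Irreducibility is tested by restriction to lines in the parameter space: polynomials in one
	variable suffice for that.\<close>

definition seg :: "(nat => complex) => (nat => complex) => complex => nat => complex" where
	"seg u v t = (\<lambda>i. u i + t * (v i - u i))"

lemma seg_0 [simp]: "seg u v 0 = u" and seg_1 [simp]: "seg u v 1 = v"
	by (auto simp: seg_def)

definition linepoly :: "((nat => complex) => complex) => bool" where
	"linepoly g \<longleftrightarrow> (\<forall>u v. \<exists>q. \<forall>t. g (seg u v t) = poly q t)"

lemma polymap_linepoly: "polymap N g ==> linepoly g"
proof -
	assume "polymap N g"
	then obtain p where p: "\<And>u. g u = mpoly_eval p u" unfolding polymap_def by blast
	show ?thesis unfolding linepoly_def p seg_def by (intro allI) (rule mpoly_eval_line)
qed

lemma linepolyE:
	assumes "linepoly g" obtains q where "\<And>t. g (seg u v t) = poly q t"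
	using assms unfolding linepoly_def by blast

definition lineopen :: "(nat => complex) set => bool" where
	"lineopen \<Omega> \<longleftrightarrow> (\<forall>u\<in>\<Omega>. \<forall>v. finite {t. seg u v t \<notin> \<Omega>})"

lemma lineopen_nonzero: "linepoly g ==> lineopen {u. g u \<noteq> 0}"
	unfolding lineopen_def
proof (intro ballI allI)
	fix u v assume g: "linepoly g" and u: "u \<in> {u. g u \<noteq> 0}"
	obtain q where q: "\<And>t. g (seg u v t) = poly q t" using linepolyE[OF g] by blast
	have "q \<noteq> 0" using q[of 0] u by auto
	then show "finite {t. seg u v t \<notin> {u. g u \<noteq> 0}}" using poly_roots_finite q by simp
qed

lemma lineopen_Int: "lineopen A ==> lineopen B ==> lineopen (A \<inter> B)"
	unfolding lineopen_def
proof (intro ballI allI)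
	fix u v assume *: "\<forall>u\<in>A. \<forall>v. finite {t. seg u v t \<notin> A}" "\<forall>u\<in>B. \<forall>v. finite {t. seg u v t \<notin> B}" "u \<in> A \<inter> B"
	have "{t. seg u v t \<notin> A \<inter> B} = {t. seg u v t \<notin> A} \<union> {t. seg u v t \<notin> B}" by blast
	then show "finite {t. seg u v t \<notin> A \<inter> B}" using * by simp
qed

lemma lineopen_Un: "lineopen A ==> lineopen B ==> lineopen (A \<union> B)"
	unfolding lineopen_def
proof (intro ballI allI)
	fix u v assume *: "\<forall>u\<in>A. \<forall>v. finite {t. seg u v t \<notin> A}" "\<forall>u\<in>B. \<forall>v. finite {t. seg u v t \<notin> B}" "u \<in> A \<union> B"
	show "finite {t. seg u v t \<notin> A \<union> B}"
	proof (cases "u \<in> A")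
		case True
		then show ?thesis using *(1) by (auto intro: finite_subset[of _ "{t. seg u v t \<notin> A}"])
	next
		case False
		then show ?thesis using *(2,3) by (auto intro: finite_subset[of _ "{t. seg u v t \<notin> B}"])
	qed
qed

lemma lineopen_common_point:
	assumes \<Omega>: "lineopen \<Omega>" and u: "u \<in> \<Omega>" and g: "linepoly g" "g u \<noteq> 0" and h: "linepoly h" "h v \<noteq> 0"
	obtains w where "w \<in> \<Omega>" "g w \<noteq> 0" "h w \<noteq> 0"
proof -
	obtain p where p: "\<And>t. g (seg u v t) = poly p t" using linepolyE[OF g(1)] by blast
	obtain q where q: "\<And>t. h (seg u v t) = poly q t" using linepolyE[OF h(1)] by blast
	have "p \<noteq> 0" "q \<noteq> 0" using p[of 0] q[of 1] g(2) h(2) by auto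
	then have "finite {t. poly p t = 0}" "finite {t. poly q t = 0}" using poly_roots_finite by blast+
	moreover have "finite {t. seg u v t \<notin> \<Omega>}" using bspec[OF \<Omega>[unfolded lineopen_def] u] by (rule spec)
	ultimately have "finite ({t. poly p t = 0} \<union> {t. poly q t = 0} \<union> {t. seg u v t \<notin> \<Omega>})" by simp
	from ex_new_if_finite[OF infinite_UNIV_char_0 this]
	obtain t where t: "t \<notin> {t. poly p t = 0} \<union> {t. poly q t = 0} \<union> {t. seg u v t \<notin> \<Omega>}" ..
	show thesis by (rule that[of "seg u v t"]) (use p[of t] q[of t] t in simp_all)
qed

subsection \<open>Closed sets of forms\<close>

definition conefun :: "(S => complex) => bool" where
	"conefun g \<longleftrightarrow> (\<exists>G. \<forall>f. g f = mpoly_eval G (lk f))"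

lemma conefunI: "conefun (\<lambda>f. mpoly_eval G (lk f))"
	unfolding conefun_def by blast

lemma conefun_compose: "(\<And>i. conefun (\<lambda>f. F f i)) ==> conefun (\<lambda>f. mpoly_eval R (F f))"
proof (induction R rule: mpoly_induct)
	case (Const c)
	show ?case unfolding conefun_def by (rule exI[of _ "Const c"]) simp
next
	case (add p q)
	then obtain P Q where "\<forall>f. mpoly_eval p (F f) = mpoly_eval P (lk f)" "\<forall>f. mpoly_eval q (F f) = mpoly_eval Q (lk f)"
		unfolding conefun_def by blast
	then show ?case unfolding conefun_def by (intro exI[of _ "P + Q"]) (simp add: mpoly_eval_add)
next
	case (Var i p)
	then obtain P where "\<forall>f. mpoly_eval p (F f) = mpoly_eval P (lk f)" unfolding conefun_def by blast
	moreover obtain Q where "\<forall>f. F f i = mpoly_eval Q (lk f)" using Var(2) unfolding conefun_def by blast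
	ultimately show ?case unfolding conefun_def by (intro exI[of _ "Q * P"]) (simp add: mpoly_eval_mult)
qed

lemma proj_class_self: "f \<in> proj_class f"
	unfolding proj_class_def by (rule CollectI, rule exI[of _ 1]) simp

lemma proj_formsE:
	assumes "P \<in> proj_forms d" obtains f where "P = proj_class f" "f \<in> homog (int d)" "f \<noteq> 0"
	using assms unfolding proj_forms_def by blast

lemma proj_class_scale: "c \<noteq> 0 ==> f \<in> proj_class g ==> Const c * f \<in> proj_class g"
proof -
	assume c: "c \<noteq> 0" and "f \<in> proj_class g"
	then obtain e where "f = Const e * g" "e \<noteq> 0" unfolding proj_class_def by blast
	then have "Const c * f = Const (c * e) * g" "c * e \<noteq> 0" using c by (simp_all add: Const_mult mult.assoc)
	then show ?thesis unfolding proj_class_def by blast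
qed

lemma eval_hcomp_sum: "mpoly_eval G y = (\<Sum>k\<in>hdegs G. mpoly_eval (hcomp k G) y)"
proof -
	have "mpoly_eval G y = mpoly_eval (\<Sum>k\<in>hdegs G. hcomp k G) y"
		by (rule arg_cong[OF hcomp_sum[OF finite_hdegs order_refl]])
	then show ?thesis unfolding mpoly_eval_sum .
qed

lemma scale_zero_hcomp:
	assumes "\<And>c. c \<noteq> 0 ==> mpoly_eval G (\<lambda>m. c * x m) = 0"
	shows "mpoly_eval (hcomp k G) x = 0"
proof -
	define q where "q = (\<Sum>k\<in>hdegs G. Polynomial.monom (mpoly_eval (hcomp k G) x) (nat k))"
	have nonneg: "0 \<le> k" if "k \<in> hdegs G" for k using that by (auto simp: hdegs_def)
	have "poly q c = mpoly_eval G (\<lambda>m. c * x m)" for c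
	proof -
		have "mpoly_eval G (\<lambda>m. c * x m) = (\<Sum>k\<in>hdegs G. mpoly_eval (hcomp k G) (\<lambda>m. c * x m))"
			by (rule eval_hcomp_sum)
		then show ?thesis by (simp add: q_def poly_sum poly_monom mpoly_eval_scale[OF hcomp_homogeneous] mult.commute)
	qed
	then have "{c. poly q c = 0} \<supseteq> UNIV - {0}" using assms by auto
	then have "infinite {c. poly q c = 0}"
		by (rule infinite_super[OF _ infinite_remove[OF infinite_UNIV_char_0]])
	then have "q = 0" using poly_roots_finite by blast
	show ?thesis
	proof (cases "k \<in> hdegs G")
		case True
		have "Polynomial.coeff q (nat k) = (\<Sum>j\<in>hdegs G. if j = k then mpoly_eval (hcomp j G) x else 0)"
			unfolding q_def coeff_sum by (rule sum.cong) (use nonneg True in \<open>auto simp: nat_eq_iff\<close>)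
		then show ?thesis using True \<open>q = 0\<close> by simp
	next
		case False
		have "hcomp k G = 0"
			by (rule poly_mapping_eqI) (use False in \<open>auto simp: lookup_hcomp hdegs_def in_keys_iff\<close>)
		then show ?thesis by simp
	qed
qed

lemma closedin_zariski_conefun:
	assumes "conefun g"
	shows "closedin (zariski d) {P \<in> proj_forms d. \<forall>f\<in>P. g f = 0}"
proof -
	obtain G where G: "\<And>f. g f = mpoly_eval G (lk f)" using assms unfolding conefun_def by blast
	let ?T = "range (\<lambda>k. hcomp k G)"
	have eq: "{P \<in> proj_forms d. \<forall>f\<in>P. g f = 0} = zero_locus d ?T"
	proof (intro subset_antisym subsetI)
		fix P assume P: "P \<in> {P \<in> proj_forms d. \<forall>f\<in>P. g f = 0}"
		have "mpoly_eval (hcomp k G) (lk f) = 0" if f: "f \<in> P" for k f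
		proof (rule scale_zero_hcomp)
			fix c :: complex assume c: "c \<noteq> 0"
			have "Const c * f \<in> P" using P f c by (auto elim!: proj_formsE intro: proj_class_scale)
			then show "mpoly_eval G (\<lambda>m. c * lk f m) = 0" using P G by (simp flip: lookup_Const_mult)
		qed
		then show "P \<in> zero_locus d ?T" using P unfolding zero_locus_def by auto
	next
		fix P assume P: "P \<in> zero_locus d ?T"
		have "g f = 0" if f: "f \<in> P" for f
		proof -
			have "mpoly_eval (hcomp k G) (lk f) = 0" for k using P f unfolding zero_locus_def by auto
			moreover have "mpoly_eval G (lk f) = (\<Sum>k\<in>hdegs G. mpoly_eval (hcomp k G) (lk f))"
				by (rule eval_hcomp_sum)
			ultimately show ?thesis using G by simp
		qed
		then show "P \<in> {P \<in> proj_forms d. \<forall>f\<in>P. g f = 0}" using P unfolding zero_locus_def by auto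
	qed
	have T: "?T \<subseteq> (\<Union>n. homog n)" by auto
	have sub: "zero_locus d ?T \<subseteq> proj_forms d" unfolding zero_locus_def by blast
	have "openin (zariski d) (proj_forms d - zero_locus d ?T)"
		unfolding openin_zariski using T sub by (intro conjI exI[of _ ?T]) auto
	then show ?thesis unfolding eq closedin_def topspace_zariski using sub by simp
qed

lemma closedin_zariskiE:
	assumes "closedin (zariski d) A" "P \<in> proj_forms d" "P \<notin> A"
	shows "\<exists>F. (\<forall>Q\<in>A. \<forall>f\<in>Q. mpoly_eval F (lk f) = 0) \<and> (\<forall>f\<in>P. mpoly_eval F (lk f) \<noteq> 0) \<and>
		(\<exists>k. F \<in> homog k)"
proof -
	have "openin (zariski d) (proj_forms d - A)" using assms(1) unfolding closedin_def topspace_zariski by blast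
	then obtain T where T: "T \<subseteq> (\<Union>n. homog n)" "proj_forms d - (proj_forms d - A) = zero_locus d T"
		unfolding openin_zariski by blast
	have A: "A = zero_locus d T" using T(2) closedin_subset[OF assms(1)] unfolding topspace_zariski by blast
	then obtain F f where F: "F \<in> T" "f \<in> P" "mpoly_eval F (lk f) \<noteq> 0"
		using assms(2,3) unfolding zero_locus_def by blast
	obtain k where k: "F \<in> homog k" using F(1) T(1) by blast
	obtain g where g: "P = proj_class g" using proj_formsE[OF assms(2)] by blast
	have ng: "mpoly_eval F (lk g) \<noteq> 0" using mpoly_eval_proj_class[OF k, of g] F(2,3) unfolding g by blast
	have "mpoly_eval F (lk h) \<noteq> 0" if h: "h \<in> P" for h
	proof -
		obtain c where c: "h = Const c * g" "c \<noteq> 0" using h unfolding g proj_class_def by blast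
		then show ?thesis using mpoly_eval_scale[OF k, of c "lk g"] ng by (simp add: lookup_Const_mult)
	qed
	moreover have "\<forall>f\<in>Q. mpoly_eval F (lk f) = 0" if "Q \<in> A" for Q using that F(1) unfolding A zero_locus_def by blast
	ultimately show ?thesis using k by (intro exI[of _ F] conjI ballI exI[of _ k]) simp_all
qed

lemma irreducible_split:
	assumes irr: "irreducible_space (subtopology T Z)" and Z: "Z \<subseteq> topspace T"
		and A: "closedin T A" and B: "closedin T B" and AB: "Z \<subseteq> A \<union> B"
	shows "Z \<subseteq> A \<or> Z \<subseteq> B"
proof -
	have top: "topspace (subtopology T Z) = Z" using Z by auto
	have "closedin (subtopology T Z) (A \<inter> Z)" "closedin (subtopology T Z) (B \<inter> Z)"
		using A B closedin_subtopology by blast+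
	moreover have "A \<inter> Z \<union> B \<inter> Z = Z" using AB by blast
	ultimately have "A \<inter> Z = Z \<or> B \<inter> Z = Z" using irr unfolding irreducible_space_def top by blast
	then show ?thesis by blast
qed

lemma irreducible_closure:
	assumes irr: "irreducible_space (subtopology T Z)" and Z: "Z \<subseteq> topspace T"
	shows "irreducible_space (subtopology T (T closure_of Z))"
proof -
	let ?C = "T closure_of Z"
	have ZC: "Z \<subseteq> ?C" by (rule closure_of_subset[OF Z])
	have top: "topspace (subtopology T ?C) = ?C" using closure_of_subset_topspace[of T Z] by auto
	show ?thesis unfolding irreducible_space_def top
	proof (intro conjI allI impI)
		show "?C \<noteq> {}" using irr Z ZC unfolding irreducible_space_def by auto
		fix A B assume AB: "closedin (subtopology T ?C) A \<and> closedin (subtopology T ?C) B \<and> A \<union> B = ?C"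
		have cl: "closedin T A" "closedin T B"
			using AB closedin_closed_subtopology[OF closedin_closure_of[of T Z]] by blast+
		have "Z \<subseteq> A \<or> Z \<subseteq> B" by (rule irreducible_split[OF irr Z cl]) (use AB ZC in blast)
		then have "?C \<subseteq> A \<or> ?C \<subseteq> B" using closure_of_minimal cl by blast
		then show "A = ?C \<or> B = ?C" using AB by blast
	qed
qed

text \<open>If the image is covered by two closed sets, neither of which contains it, choose an equation of
	each and parameters where it does not vanish. On the line joining these parameters both are
	nonzero polynomials, so at a common point of the open set neither vanishes.\<close>

lemma irreducible_image:
	assumes \<Psi>: "\<And>m. linepoly (\<lambda>u. lk (\<Psi> u) m)" and F: "\<And>F. linepoly (\<lambda>u. mpoly_eval F (lk (\<Psi> u)))"
		and \<Omega>: "lineopen \<Omega>" "\<Omega> \<noteq> {}"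
		and hom: "\<And>u. u \<in> \<Omega> ==> \<Psi> u \<in> homog (int d) - {0}"
	shows "irreducible_space (zar d (proj_class ` \<Psi> ` \<Omega>))"
proof -
	let ?X = "proj_class ` \<Psi> ` \<Omega>"
	have X: "?X \<subseteq> proj_forms d" using hom unfolding proj_forms_def by blast
	have top: "topspace (zar d ?X) = ?X" using X by (auto simp: topspace_zariski)
	show ?thesis unfolding irreducible_space_def top
	proof (intro conjI allI impI)
		show "?X \<noteq> {}" using \<Omega>(2) by blast
		fix A B assume AB: "closedin (zar d ?X) A \<and> closedin (zar d ?X) B \<and> A \<union> B = ?X"
		obtain A' where A': "closedin (zariski d) A'" "A = A' \<inter> ?X"
			using conjunct1[OF AB] unfolding closedin_subtopology by (elim exE conjE)
		obtain B' where B': "closedin (zariski d) B'" "B = B' \<inter> ?X"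
			using conjunct1[OF conjunct2[OF AB]] unfolding closedin_subtopology by (elim exE conjE)
		have AB': "A \<union> B = ?X" using AB by (elim conjE)
		show "A = ?X \<or> B = ?X"
		proof (rule ccontr)
			assume "\<not> (A = ?X \<or> B = ?X)"
			then obtain u v where u: "u \<in> \<Omega>" "proj_class (\<Psi> u) \<notin> A'" and v: "v \<in> \<Omega>" "proj_class (\<Psi> v) \<notin> B'"
				using A'(2) B'(2) by blast
			have pu: "proj_class (\<Psi> u) \<in> proj_forms d" and pv: "proj_class (\<Psi> v) \<in> proj_forms d" using X u(1) v(1) by blast+
			from closedin_zariskiE[OF A'(1) pu u(2)] obtain F1 where F1':
				"(\<forall>Q\<in>A'. \<forall>f\<in>Q. mpoly_eval F1 (lk f) = 0) \<and> (\<forall>f\<in>proj_class (\<Psi> u). mpoly_eval F1 (lk f) \<noteq> 0) \<and>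
				(\<exists>k. F1 \<in> homog k)" ..
			note F1 = bspec[OF conjunct1[OF F1']] bspec[OF conjunct1[OF conjunct2[OF F1']]]
			from closedin_zariskiE[OF B'(1) pv v(2)] obtain F2 where F2':
				"(\<forall>Q\<in>B'. \<forall>f\<in>Q. mpoly_eval F2 (lk f) = 0) \<and> (\<forall>f\<in>proj_class (\<Psi> v). mpoly_eval F2 (lk f) \<noteq> 0) \<and>
				(\<exists>k. F2 \<in> homog k)" ..
			note F2 = bspec[OF conjunct1[OF F2']] bspec[OF conjunct1[OF conjunct2[OF F2']]]
			obtain w where w: "w \<in> \<Omega>" "mpoly_eval F1 (lk (\<Psi> w)) \<noteq> 0" "mpoly_eval F2 (lk (\<Psi> w)) \<noteq> 0"
				using lineopen_common_point[OF \<Omega>(1) u(1) F[of F1] F1(2)[OF proj_class_self] F[of F2] F2(2)[OF proj_class_self]] .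
			have "proj_class (\<Psi> w) \<notin> A'" "proj_class (\<Psi> w) \<notin> B'" using F1(1) F2(1) w(2,3) proj_class_self by blast+
			moreover have "proj_class (\<Psi> w) \<in> ?X" using w(1) by blast
			ultimately show False using AB' A'(2) B'(2) by blast
		qed
	qed
qed

subsection \<open>The lower bound for the dimension\<close>

definition eval_form :: "nat => complex^3 => (3 \<Rightarrow>\<^sub>0 nat) mpoly" where
	"eval_form d v = (\<Sum>m\<in>{m. monom_degree m = d}. Const (monom_eval m (($) v)) * Var m)"

lemma eval_form:
	assumes "f \<in> homog (int d)"
	shows "mpoly_eval (eval_form d v) (lk f) = mpoly_eval f (($) v)"
proof -
	have "mpoly_eval f (($) v) = (\<Sum>m\<in>{m. monom_degree m = d}. lk f m * monom_eval m (($) v))"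
		unfolding mpoly_eval_def
		by (rule sum.mono_neutral_left) (use assms card_monomials(1) in \<open>auto simp: homogeneous_def in_keys_iff\<close>)
	then show ?thesis by (simp add: eval_form_def mpoly_eval_sum mpoly_eval_mult mult.commute)
qed

text \<open>Release the parameters one at a time, starting from \<open>u0\<close>. The closures of the images of the coordinate
	subspaces are irreducible, and each is strictly larger than the one before, since all forms of the
	\<open>k\<close>-th vanish at the point \<open>p k\<close> and some form of the next does not.\<close>

lemma krull_dim_lower:
	assumes X: "X \<subseteq> proj_forms d"
		and F: "\<And>F. linepoly (\<lambda>u. mpoly_eval F (lk (\<xi> u)))"
		and \<Omega>: "lineopen \<Omega>" "u0 \<in> \<Omega>"
		and hom: "\<And>u. u \<in> \<Omega> ==> \<xi> u \<in> homog (int d) - {0}" and inX: "\<And>u. u \<in> \<Omega> ==> proj_class (\<xi> u) \<in> X"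
		and van: "\<And>k u. k < n ==> u \<in> \<Omega> ==> (\<And>j. k \<le> j ==> u j = u0 j) ==> mpoly_eval (\<xi> u) (($) (p k)) = 0"
		and nonvan: "\<And>k. k < n ==> \<exists>u\<in>\<Omega>. (\<forall>j>k. u j = u0 j) \<and> mpoly_eval (\<xi> u) (($) (p k)) \<noteq> 0"
	shows "enat n \<le> krull_dim (zar d X)"
proof -
	let ?T = "zar d X"
	define \<Omega>' where "\<Omega>' k = {u \<in> \<Omega>. \<forall>j\<ge>k. u j = u0 j}" for k
	define I where "I k = proj_class ` \<xi> ` \<Omega>' k" for k
	define Z where "Z k = ?T closure_of (I k)" for k
	have IX: "I k \<subseteq> X" for k using inX unfolding I_def \<Omega>'_def by blast
	have topT: "topspace ?T = X" using X by (auto simp: topspace_zariski)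
	have irrI: "irreducible_space (zar d (I k))" for k
	proof -
		define r where "r u j = (if j < k then u j else u0 j)" for u :: "nat => complex" and j
		have rs: "r (seg u v t) = seg (r u) (r v) t" for u v t by (auto simp: r_def seg_def)
		have lp: "linepoly (\<lambda>u. g (r u))" if "linepoly g" for g
			using that unfolding linepoly_def rs by blast
		have lo: "lineopen {u. r u \<in> \<Omega>}" using \<Omega>(1) unfolding lineopen_def by (simp add: rs)
		have ru0: "r u0 = u0" by (auto simp: r_def)
		have "I k = proj_class ` (\<lambda>u. \<xi> (r u)) ` {u. r u \<in> \<Omega>}"
		proof -
			have "\<Omega>' k = r ` {u. r u \<in> \<Omega>}"
			proof (intro subset_antisym subsetI)
				fix u assume "u \<in> \<Omega>' k"
				then have "r u = u" "u \<in> \<Omega>" by (auto simp: \<Omega>'_def r_def)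
				then show "u \<in> r ` {u. r u \<in> \<Omega>}" by (metis image_eqI mem_Collect_eq)
			qed (auto simp: \<Omega>'_def r_def)
			then show ?thesis unfolding I_def by (simp add: image_image)
		qed
		moreover have "irreducible_space (zar d (proj_class ` (\<lambda>u. \<xi> (r u)) ` {u. r u \<in> \<Omega>}))"
		proof (rule irreducible_image[OF _ _ lo])
			show "linepoly (\<lambda>u. lk (\<xi> (r u)) m)" for m
				using lp[OF F[of "Var m"]] by simp
			show "linepoly (\<lambda>u. mpoly_eval F (lk (\<xi> (r u))))" for F by (rule lp[OF F])
			have "u0 \<in> {u. r u \<in> \<Omega>}" using ru0 \<Omega>(2) by simp
			then show "{u. r u \<in> \<Omega>} \<noteq> {}" by blast
		qed (use hom in auto)
		ultimately show ?thesis by simp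
	qed
	have irrZ: "irreducible_space (subtopology ?T (Z k))" for k
	proof -
		have "subtopology ?T (I k) = zar d (I k)"
			using IX[of k] by (simp add: subtopology_subtopology Int_absorb1)
		then have "irreducible_space (subtopology ?T (I k))" using irrI by simp
		moreover have "I k \<subseteq> topspace ?T" unfolding topT by (rule IX)
		ultimately show ?thesis unfolding Z_def by (rule irreducible_closure)
	qed
	have strict: "Z k \<subset> Z (Suc k)" if k: "k < n" for k
	proof
		have "I k \<subseteq> I (Suc k)" unfolding I_def \<Omega>'_def by (intro image_mono) auto
		then show "Z k \<subseteq> Z (Suc k)" unfolding Z_def by (rule closure_of_mono)
		define V where "V = {P \<in> proj_forms d. \<forall>f\<in>P. mpoly_eval (eval_form d (p k)) (lk f) = 0}"
		have V: "closedin (zariski d) V" unfolding V_def by (rule closedin_zariski_conefun[OF conefunI])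
		have homP: "f \<in> homog (int d)" if "u \<in> \<Omega>" "f \<in> proj_class (\<xi> u)" for u f
			using that hom homogeneous_Const_mult unfolding proj_class_def by blast
		have "I k \<subseteq> V"
		proof
			fix P assume "P \<in> I k"
			then obtain u where u: "u \<in> \<Omega>" "\<And>j. k \<le> j ==> u j = u0 j" "P = proj_class (\<xi> u)" unfolding I_def \<Omega>'_def by blast
			have "mpoly_eval (eval_form d (p k)) (lk f) = 0" if f: "f \<in> P" for f
			proof -
				obtain c where "f = Const c * \<xi> u" using f unfolding u proj_class_def by blast
				then show ?thesis using eval_form[OF homP[OF u(1)], of f] f van[OF k u(1,2)] unfolding u(3) by (simp add: mpoly_eval_mult)
			qed
			then show "P \<in> V" using IX X \<open>P \<in> I k\<close> unfolding V_def by blast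
		qed
		then have ZV: "Z k \<subseteq> V" unfolding Z_def
			using closure_of_minimal[of "I k" "V \<inter> X" ?T] IX V closedin_subtopology by blast
		obtain u where u: "u \<in> \<Omega>" "\<forall>j>k. u j = u0 j" "mpoly_eval (\<xi> u) (($) (p k)) \<noteq> 0" using nonvan[OF k] by blast
		have "u \<in> \<Omega>' (Suc k)" using u by (simp add: \<Omega>'_def Suc_le_eq)
		then have "proj_class (\<xi> u) \<in> I (Suc k)" unfolding I_def by blast
		then have "proj_class (\<xi> u) \<in> Z (Suc k)" unfolding Z_def using closure_of_subset[of "I (Suc k)" ?T] IX topT by blast
		moreover have "proj_class (\<xi> u) \<notin> V"
		proof -
			have "mpoly_eval (eval_form d (p k)) (lk (\<xi> u)) \<noteq> 0"
				using eval_form[OF homP[OF u(1) proj_class_self], of "p k"] u(3) by simp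
			then show ?thesis unfolding V_def using proj_class_self[of "\<xi> u"] by blast
		qed
		ultimately show "Z k \<noteq> Z (Suc k)" using ZV by blast
	qed
	have "enat n \<in> {enat n | n. \<exists>Z :: nat => S set set.
		 (\<forall>i\<le>n. closedin ?T (Z i) \<and> irreducible_space (subtopology ?T (Z i))) \<and> (\<forall>i<n. Z i \<subset> Z (Suc i))}"
		using irrZ strict unfolding Z_def by (intro CollectI exI[of _ n] exI[of _ Z] conjI) (auto simp: Z_def)
	then show ?thesis unfolding krull_dim_def by (rule Sup_upper)
qed

subsection \<open>The upper bound for the dimension\<close>

lemma finite_supp_deg: "finite (supp_deg N D) \<and> card (supp_deg N D) \<le> (D + 1) ^ N"
proof -
	let ?A = "{..<N} \<rightarrow>\<^sub>E {..D}"
	let ?r = "\<lambda>m :: nat \<Rightarrow>\<^sub>0 nat. restrict (lk m) {..<N}"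
	have inj: "inj_on ?r (supp_deg N D)"
	proof (rule inj_onI)
		fix m n assume mn: "m \<in> supp_deg N D" "n \<in> supp_deg N D" "?r m = ?r n"
		have "lk m i = lk n i" for i
		proof (cases "i < N")
			case True
			then show ?thesis using fun_cong[OF mn(3), of i] by simp
		next
			case False
			then have "i \<notin> Poly_Mapping.keys m" "i \<notin> Poly_Mapping.keys n" using mn(1,2) by (auto simp: supp_deg_def)
			then show ?thesis by (simp add: in_keys_iff)
		qed
		then show "m = n" by (rule poly_mapping_eqI)
	qed
	have sub: "?r ` supp_deg N D \<subseteq> ?A"
	proof
		fix x assume "x \<in> ?r ` supp_deg N D"
		then obtain m where m: "m \<in> supp_deg N D" "x = ?r m" by blast
		have "lk m i \<le> D" for i
		proof (cases "i \<in> Poly_Mapping.keys m")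
			case True
			then have "lk m i \<le> (\<Sum>i\<in>Poly_Mapping.keys m. lk m i)" by (intro member_le_sum) auto
			then show ?thesis using m(1) by (simp add: supp_deg_def monom_degree_def)
		qed (simp add: in_keys_iff)
		then show "x \<in> ?A" unfolding m(2) by auto
	qed
	have fin: "finite ?A" by (intro finite_PiE) auto
	have "finite (supp_deg N D)" using inj finite_subset[OF sub fin] finite_imageD by blast
	moreover have "card (supp_deg N D) = card (?r ` supp_deg N D)" using card_image[OF inj] by simp
	moreover have "\<dots> \<le> card ?A" by (rule card_mono[OF fin sub])
	moreover have "card ?A = (D + 1) ^ N" by (simp add: card_PiE)
	ultimately show ?thesis by simp
qed

interpretation pv: vector_space "\<lambda>c (p :: nat mpoly). Const c * p"
	by unfold_locales (auto simp: distrib_left distrib_right Const_add Const_mult mult.assoc)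

text \<open>A counting argument: there are at most \<open>(D + 1)\<^sup>N\<close> monomials of degree at most \<open>D\<close> in \<open>N\<close> variables.\<close>

lemma Pol_dependent:
	assumes E: "finite E" and p: "\<And>e. e \<in> E ==> p e \<in> Pol N D" and card: "(D + 1) ^ N < card E"
	obtains c where "\<exists>e\<in>E. c e \<noteq> 0" "(\<Sum>e\<in>E. Const (c e) * p e) = 0"
proof -
	let ?B = "(\<lambda>m. psingle m (1::complex)) ` supp_deg N D"
	have B: "finite ?B" "card ?B \<le> (D + 1) ^ N"
		using finite_supp_deg[of N D] card_image_le[of "supp_deg N D" "\<lambda>m. psingle m (1::complex)"] by auto
	have span: "q \<in> pv.span ?B" if q: "q \<in> Pol N D" for q
	proof -
		have "q = (\<Sum>m\<in>Poly_Mapping.keys q. Const (lk q m) * psingle m 1)"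
			using mpoly_sum_monomials[of q] by (simp add: Const_def mult_single)
		moreover have "(\<Sum>m\<in>Poly_Mapping.keys q. Const (lk q m) * psingle m 1) \<in> pv.span ?B"
			by (intro pv.span_sum pv.span_scale pv.span_base imageI) (use q in \<open>auto simp: Pol_def\<close>)
		ultimately show ?thesis by simp
	qed
	show thesis
	proof (cases "inj_on p E")
		case True
		have "pv.dependent (p ` E)"
		proof (rule ccontr)
			assume ind: "\<not> pv.dependent (p ` E)"
			have "p ` E \<subseteq> pv.span ?B" using span p by blast
			then have "card (p ` E) \<le> card ?B" using pv.independent_span_bound[OF B(1) ind] by blast
			then show False using card_image[OF True] card B(2) by linarith
		qed
		then obtain u where u: "\<exists>v\<in>p ` E. u v \<noteq> 0" "(\<Sum>v\<in>p ` E. Const (u v) * v) = 0"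
			using pv.dependent_finite[of "p ` E"] E by auto
		have "(\<Sum>e\<in>E. Const (u (p e)) * p e) = 0" using u(2) by (simp add: sum.reindex[OF True])
		moreover have "\<exists>e\<in>E. u (p e) \<noteq> 0" using u(1) by blast
		ultimately show thesis using that[of "\<lambda>e. u (p e)"] by blast
	next
		case False
		then obtain x y where xy: "x \<in> E" "y \<in> E" "x \<noteq> y" "p x = p y" unfolding inj_on_def by blast
		define c :: "'a => complex" where "c e = (if e = x then 1 else if e = y then - 1 else 0)" for e
		have "(\<Sum>e\<in>E. Const (c e) * p e) = (\<Sum>e\<in>{x, y}. Const (c e) * p e)"
			by (rule sum.mono_neutral_right) (use E xy in \<open>auto simp: c_def\<close>)
		also have "\<dots> = 0" using xy by (simp add: c_def Const_uminus)
		finally have "(\<Sum>e\<in>E. Const (c e) * p e) = 0" .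
		moreover have "c x \<noteq> 0" by (simp add: c_def)
		then have "\<exists>e\<in>E. c e \<noteq> 0" using xy(1) by (rule bexI)
		ultimately show thesis using that[of c] by simp
	qed
qed

text \<open>Induction on the degree: if every monomial of \<open>R\<close> contains the last variable, divide by it. In
	\<open>chain_independent\<close> the power of the variable is cancelled by irreducibility, and the part \<open>R0\<close>
	free of it is passed to the next smaller set of the chain.\<close>

lemma split_variable:
	assumes "R \<in> Pol (Suc j) D" "R \<noteq> 0"
	shows "\<exists>k R0 R1. R = Var j ^ k * (R0 + Var j * R1) \<and> R0 \<in> Pol j D \<and> R0 \<noteq> 0"
	using assms
proof (induction D arbitrary: R rule: less_induct)
	case (less D)
	let ?K0 = "{m \<in> Poly_Mapping.keys R. lk m j = 0}" and ?K1 = "{m \<in> Poly_Mapping.keys R. lk m j \<noteq> 0}"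
	define R0 where "R0 = (\<Sum>m\<in>?K0. psingle m (lk R m))"
	define R1 where "R1 = (\<Sum>m\<in>?K1. psingle (m - psingle j 1) (lk R m))"
	have shift: "psingle j 1 + (m - psingle j 1) = m" if h: "lk m j \<noteq> 0" for m :: "nat \<Rightarrow>\<^sub>0 nat"
	proof -
		obtain n where n: "m = psingle j 1 + n" using iffD2[OF monom_split h] ..
		show ?thesis unfolding n add_diff_cancel_left' ..
	qed
	have "Var j * R1 = (\<Sum>m\<in>?K1. psingle m (lk R m))"
		unfolding R1_def sum_distrib_left Var_def mult_single
		by (rule sum.cong[OF refl]) (use shift in simp)
	moreover have "(\<Sum>m\<in>Poly_Mapping.keys R. psingle m (lk R m)) = R0 + (\<Sum>m\<in>?K1. psingle m (lk R m))"
		unfolding R0_def by (subst sum.union_disjoint[symmetric]) (auto intro!: sum.cong)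
	ultimately have R: "R = R0 + Var j * R1" using mpoly_sum_monomials[of R] by simp
	have keys_sum: "Poly_Mapping.keys (\<Sum>m\<in>A. psingle (g m) (b m)) \<subseteq> g ` A"
		if "finite A" for A and g :: "(nat \<Rightarrow>\<^sub>0 nat) => nat \<Rightarrow>\<^sub>0 nat" and b :: "(nat \<Rightarrow>\<^sub>0 nat) => complex"
		using that
	proof induction
		case (insert x A)
		have "Poly_Mapping.keys (psingle (g x) (b x) + (\<Sum>m\<in>A. psingle (g m) (b m)))
			 \<subseteq> Poly_Mapping.keys (psingle (g x) (b x)) \<union> Poly_Mapping.keys (\<Sum>m\<in>A. psingle (g m) (b m))"
			by (rule Poly_Mapping.keys_add)
		also have "\<dots> \<subseteq> g ` insert x A" using insert by (auto split: if_splits)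
		finally show ?case using insert by simp
	qed simp
	have keysR: "Poly_Mapping.keys R \<subseteq> supp_deg (Suc j) D" using less.prems(1) by (simp add: Pol_def)
	have R0: "R0 \<in> Pol j D"
	proof -
		have "?K0 \<subseteq> supp_deg j D"
		proof
			fix m assume m: "m \<in> ?K0"
			then have "m \<in> supp_deg (Suc j) D" "j \<notin> Poly_Mapping.keys m" using keysR by (auto simp: in_keys_iff)
			then show "m \<in> supp_deg j D" by (auto simp: supp_deg_def less_Suc_eq)
		qed
		moreover have "Poly_Mapping.keys R0 \<subseteq> id ` ?K0" using keys_sum[of ?K0 id "lk R"] by (simp add: R0_def)
		ultimately show ?thesis by (auto simp: Pol_def)
	qed
	show ?case
	proof (cases "R0 = 0")
		case False
		then show ?thesis using R R0 by (intro exI[of _ 0] exI[of _ R0] exI[of _ R1]) simp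
	next
		case True
		have R': "R = Var j * R1" using R True by simp
		have "R1 \<noteq> 0" using R' less.prems(2) by auto
		have deg: "\<exists>n. m = psingle j 1 + n \<and> monom_degree m = Suc (monom_degree n)" if h: "lk m j \<noteq> 0" for m
		proof -
			obtain n where n: "m = psingle j 1 + n" using iffD2[OF monom_split h] ..
			have "monom_degree (psingle j 1) = 1" by (simp add: monom_degree_def)
			then show ?thesis using n by (intro exI[of _ n]) (simp only: monom_degree_add, simp)
		qed
		have R1: "R1 \<in> Pol (Suc j) (D - 1)" and D: "0 < D"
		proof -
			have "(\<lambda>m. m - psingle j 1) ` ?K1 \<subseteq> supp_deg (Suc j) (D - 1)"
			proof (rule image_subsetI)
				fix m assume "m \<in> ?K1"
				then have m: "m \<in> Poly_Mapping.keys R" "lk m j \<noteq> 0" by auto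
				obtain n where n: "m = psingle j 1 + n" "monom_degree m = Suc (monom_degree n)" using deg[OF m(2)] by blast
				have "Poly_Mapping.keys n \<subseteq> Poly_Mapping.keys m" unfolding n(1) by (auto simp: in_keys_iff lookup_add)
				moreover have "m \<in> supp_deg (Suc j) D" using keysR m(1) by blast
				ultimately have "n \<in> supp_deg (Suc j) (D - 1)" using n(2) by (auto simp: supp_deg_def)
				then show "m - psingle j 1 \<in> supp_deg (Suc j) (D - 1)" unfolding n(1) add_diff_cancel_left' .
			qed
			moreover have "Poly_Mapping.keys R1 \<subseteq> (\<lambda>m. m - psingle j 1) ` ?K1"
				using keys_sum[of ?K1 "\<lambda>m. m - psingle j 1" "lk R"] by (simp add: R1_def)
			ultimately show "R1 \<in> Pol (Suc j) (D - 1)" unfolding Pol_def by blast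
			have "?K1 \<noteq> {}"
			proof
				assume "?K1 = {}"
				then have "R1 = 0" unfolding R1_def by (simp only: sum.empty)
				then show False using \<open>R1 \<noteq> 0\<close> by simp
			qed
			then obtain m where m: "m \<in> Poly_Mapping.keys R" "lk m j \<noteq> 0" by blast
			obtain n where "m = psingle j 1 + n" "monom_degree m = Suc (monom_degree n)" using deg[OF m(2)] by blast
			then have "0 < monom_degree m" by simp
			moreover have "m \<in> supp_deg (Suc j) D" using keysR m(1) by blast
			ultimately show "0 < D" by (auto simp: supp_deg_def)
		qed
		then obtain k Q0 Q1 where Q: "R1 = Var j ^ k * (Q0 + Var j * Q1)" "Q0 \<in> Pol j (D - 1)" "Q0 \<noteq> 0"
			using less.IH[OF _ R1 \<open>R1 \<noteq> 0\<close>] by auto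
		have "R = Var j ^ Suc k * (Q0 + Var j * Q1)" unfolding R' Q(1) by (simp add: mult.assoc)
		moreover have "Q0 \<in> Pol j D" using Q(2) Pol_mono[of "D - 1" D j] by auto
		ultimately show ?thesis using Q(3) by blast
	qed
qed

lemma cone_zero:
	assumes g: "conefun g" and z: "\<And>c. c \<noteq> 0 ==> g (Const c * f) = 0"
	shows "g 0 = 0"
proof -
	obtain G where G: "\<forall>f. g f = mpoly_eval G (lk f)" using g unfolding conefun_def ..
	obtain q where q: "\<forall>t. mpoly_eval G (\<lambda>i. 0 + t * lk f i) = poly q t"
		using mpoly_eval_line[of G "\<lambda>_. 0" "lk f"] ..
	have "poly q c = g (Const c * f)" for c using G q by (simp add: lookup_Const_mult)
	then have "UNIV - {0} \<subseteq> {c. poly q c = 0}" using z by auto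
	then have "infinite {c. poly q c = 0}" by (rule infinite_super[OF _ infinite_remove[OF infinite_UNIV_char_0]])
	then have "q = 0" using poly_roots_finite by blast
	then show ?thesis using spec[OF q, of 0] spec[OF G, of 0] by (simp add: zero_poly_mapping.rep_eq)
qed

text \<open>Let \<open>F i\<close> vanish on \<open>Z (i - 1)\<close> but not at some point of \<open>Z i\<close>. A relation \<open>R\<close> among the \<open>F i\<close> on the
	cone over the last member is trivial. Split \<open>R = y ^ k * (R0 + y * R1)\<close> with \<open>y\<close> the last variable.
	Since \<open>F j\<close> does not vanish identically on the irreducible set \<open>Z j\<close>, the other factor does; on
	\<open>Z (j - 1)\<close>, where \<open>F j\<close> vanishes, this leaves the relation \<open>R0\<close> in fewer variables. The vertex of the
	cone is carried along because it takes the place of \<open>Z (j - 1)\<close> when \<open>j = 0\<close>.\<close>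

lemma chain_independent:
	assumes X: "X \<subseteq> proj_forms d"
		and irr: "\<And>i. i < n ==> irreducible_space (zar d (Z i))" and ZX: "\<And>i. i < n ==> Z i \<subseteq> X"
		and chain: "\<And>i. Suc i < n ==> Z i \<subseteq> Z (Suc i)"
		and F0: "\<And>i. i < n ==> mpoly_eval (F i) (lk 0) = 0"
		and van: "\<And>i P f. Suc i < n ==> P \<in> Z i ==> f \<in> P ==> mpoly_eval (F (Suc i)) (lk f) = 0"
		and nonvan: "\<And>i. i < n ==> \<exists>P\<in>Z i. \<forall>f\<in>P. mpoly_eval (F i) (lk f) \<noteq> 0"
		and hom: "\<And>i. i < n ==> \<exists>k. F i \<in> homog k"
		and j: "j \<le> n" and R: "R \<in> Pol j D"
		and zero: "mpoly_eval R (\<lambda>i. mpoly_eval (F i) (lk 0)) = 0"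
			"\<And>P f. 0 < j ==> P \<in> Z (j - 1) ==> f \<in> P ==> mpoly_eval R (\<lambda>i. mpoly_eval (F i) (lk f)) = 0"
	shows "R = 0"
	using j R zero
proof (induction j arbitrary: R D)
	case 0
	have "m = 0" if "m \<in> Poly_Mapping.keys R" for m
	proof -
		have "Poly_Mapping.keys m = {}" using that 0(2) by (auto simp: Pol_def supp_deg_def)
		then show ?thesis by simp
	qed
	then have "lk R m = lk (Const (lk R 0)) m" for m by (auto simp: lookup_Const in_keys_iff)
	then have R: "R = Const (lk R 0)" by (rule poly_mapping_eqI)
	have "mpoly_eval R (\<lambda>i. mpoly_eval (F i) (lk 0)) = lk R 0" by (subst R) simp
	then show ?case using 0(3) R by simp
next
	case (Suc j)
	show ?case
	proof (rule ccontr)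
		assume "R \<noteq> 0"
		from split_variable[OF Suc.prems(2) this] obtain k R0 R1 where
			R: "R = Var j ^ k * (R0 + Var j * R1)" "R0 \<in> Pol j D" "R0 \<noteq> 0" by (elim exE conjE)
		have jn: "j < n" using Suc.prems(1) by simp
		define y where "y f i = mpoly_eval (F i) (lk f)" for f i
		define g where "g f = mpoly_eval (R0 + Var j * R1) (y f)" for f
		have cg: "conefun g" unfolding g_def y_def by (rule conefun_compose) (rule conefunI)
		have cF: "conefun (\<lambda>f. y f j)" unfolding y_def by (rule conefunI)
		let ?A = "{P \<in> proj_forms d. \<forall>f\<in>P. y f j = 0}" and ?B = "{P \<in> proj_forms d. \<forall>f\<in>P. g f = 0}"
		have Zj: "Z j \<subseteq> proj_forms d" using ZX[OF jn] X by blast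
		have "Z j \<subseteq> ?A \<union> ?B"
		proof
			fix P assume P: "P \<in> Z j"
			then have Pd: "P \<in> proj_forms d" using Zj by blast
			obtain f0 where f0: "P = proj_class f0" using proj_formsE[OF Pd] by blast
			obtain m where m: "F j \<in> homog m" using hom[OF jn] by blast
			have scale: "y f j = 0 \<longleftrightarrow> y f0 j = 0" if "f \<in> P" for f
			proof -
				obtain c where "f = Const c * f0" "c \<noteq> 0" using \<open>f \<in> P\<close> unfolding f0 proj_class_def by blast
				then show ?thesis unfolding y_def using mpoly_eval_scale[OF m, of c "lk f0"] by (simp add: lookup_Const_mult)
			qed
			have prod: "y f j ^ k * g f = 0" if f: "f \<in> P" for f
			proof -
				have "mpoly_eval R (y f) = 0" unfolding y_def by (rule Suc.prems(4)[OF _ _ f]) (use P in simp_all)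
				then show ?thesis unfolding R(1) g_def mpoly_eval_mult mpoly_eval_power mpoly_eval_Var .
			qed
			show "P \<in> ?A \<union> ?B"
			proof (cases "y f0 j = 0")
				case True
				then show ?thesis using scale Pd by simp
			next
				case False
				then have "g f = 0" if "f \<in> P" for f using scale[OF that] prod[OF that] by simp
				then show ?thesis using Pd by simp
			qed
		qed
		then have "Z j \<subseteq> ?A \<or> Z j \<subseteq> ?B"
			by (intro irreducible_split[OF irr[OF jn]] closedin_zariski_conefun cg cF) (simp_all add: topspace_zariski Zj)
		moreover have "\<not> Z j \<subseteq> ?A"
		proof
			assume A: "Z j \<subseteq> ?A"
			obtain P where P: "P \<in> Z j" "\<forall>f\<in>P. mpoly_eval (F j) (lk f) \<noteq> 0" using nonvan[OF jn] by blast
			obtain f where f: "P = proj_class f" using proj_formsE[OF subsetD[OF Zj P(1)]] by blast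
			have "f \<in> P" unfolding f by (rule proj_class_self)
			then show False using A P unfolding y_def by blast
		qed
		ultimately have ZB: "Z j \<subseteq> ?B" by blast
		have gz: "g f = 0" if P: "P \<in> Z j" "f \<in> P" for P f
		proof -
			have "P \<in> ?B" using ZB P(1) by (rule subsetD)
			then show ?thesis using P(2) by simp
		qed
		have R0z: "mpoly_eval R0 (y f) = 0" if "g f = 0" "y f j = 0" for f
			using that unfolding g_def by (simp add: mpoly_eval_add mpoly_eval_mult)
		have "R0 = 0"
		proof (rule Suc.IH[OF _ R(2)])
			show "j \<le> n" using jn by simp
			show "mpoly_eval R0 (\<lambda>i. mpoly_eval (F i) (lk f)) = 0" if j: "0 < j" and P: "P \<in> Z (j - 1)" "f \<in> P" for P f
			proof -
				have "y f j = 0" using van[of "j - 1" P f] j P jn unfolding y_def by simp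
				moreover have "g f = 0" by (rule gz[OF _ P(2)]) (use chain[of "j - 1"] j P(1) jn in auto)
				ultimately show ?thesis using R0z[of f] unfolding y_def by simp
			qed
			show "mpoly_eval R0 (\<lambda>i. mpoly_eval (F i) (lk 0)) = 0"
			proof -
				obtain P where P: "P \<in> Z j" using nonvan[OF jn] by blast
				obtain f where f: "P = proj_class f" using proj_formsE[OF subsetD[OF Zj P]] by blast
				have "g (Const c * f) = 0" if "c \<noteq> 0" for c
					by (rule gz[OF P]) (unfold f, rule proj_class_scale[OF that proj_class_self])
				then have "g 0 = 0" by (rule cone_zero[OF cg])
				moreover have "y 0 j = 0" using F0[OF jn] unfolding y_def .
				ultimately show ?thesis using R0z[of 0] unfolding y_def by simp
			qed
		qed
		then show False using R(3) by simp
	qed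
qed

text \<open>With \<open>C = Suc n * D + 1\<close> the left-hand side is at most \<open>(C (K + 1)) ^ N\<close>, so \<open>K = C ^ N\<close> will do.\<close>

lemma power_growth:
	assumes "N \<le> (n::nat)"
	obtains K where "(Suc n * (K * D) + 1) ^ N < (K + 1) ^ Suc n"
proof -
	define C where "C = Suc n * D + 1"
	define K where "K = C ^ N"
	have "Suc n * (K * D) + 1 \<le> C * (K + 1)" unfolding C_def by (simp add: algebra_simps)
	then have "(Suc n * (K * D) + 1) ^ N \<le> (C * (K + 1)) ^ N" by (rule power_mono) simp
	also have "\<dots> = K * (K + 1) ^ N" by (simp only: power_mult_distrib K_def)
	also have "\<dots> < (K + 1) * (K + 1) ^ N" by simp
	also have "\<dots> = (K + 1) ^ Suc N" by simp
	also have "\<dots> \<le> (K + 1) ^ Suc n" by (rule power_increasing) (use assms in auto)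
	finally show thesis using that by blast
qed

text \<open>A chain of \<open>N + 1\<close> sets would give \<open>N + 1\<close> polynomials that are algebraically independent on the
	cone over the family. Pulled back to the \<open>N\<close> parameters of the chart \<open>\<xi>\<close> they satisfy a relation: the
	number of monomials in them of exponents at most \<open>K\<close> grows like \<open>K\<close> to the power \<open>N + 1\<close>, the dimension
	of the space of polynomials of the corresponding degree only like \<open>K\<close> to the power \<open>N\<close>. The relation
	extends from the chart to the image of \<open>\<Psi>\<close>, as it holds where \<open>\<delta>\<close> is nonzero.\<close>

lemma krull_dim_upper:
	assumes X: "X \<subseteq> proj_forms d"
		and \<Psi>: "\<And>m. polymap M (\<lambda>w. lk (\<Psi> w) m)" and \<Psi>X: "\<And>P f. P \<in> X ==> f \<in> P ==> \<exists>w. f = \<Psi> w"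
		and \<xi>: "\<And>m. polymap N (\<lambda>u. lk (\<xi> u) m)"
		and \<delta>: "linepoly \<delta>" "\<delta> w0 \<noteq> 0" and chart: "\<And>w. \<delta> w \<noteq> 0 ==> \<exists>u. \<Psi> w = \<xi> u"
		and N: "0 < N"
	shows "krull_dim (zar d X) \<le> enat (N - 1)"
	unfolding krull_dim_def
proof (rule Sup_least)
	let ?T = "zar d X"
	fix k assume "k \<in> {enat n |n. \<exists>Z :: nat => S set set. (\<forall>i\<le>n. closedin ?T (Z i) \<and> irreducible_space (subtopology ?T (Z i))) \<and>
		(\<forall>i<n. Z i \<subset> Z (Suc i))}"
	then obtain n and Z :: "nat => S set set" where k: "k = enat n"
		and Z: "\<And>i. i \<le> n ==> closedin ?T (Z i)" "\<And>i. i \<le> n ==> irreducible_space (subtopology ?T (Z i))"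
		and strict: "\<And>i. i < n ==> Z i \<subset> Z (Suc i)" by blast
	have ZX: "Z i \<subseteq> X" if "i \<le> n" for i using closedin_subset[OF Z(1)[OF that]] by auto
	have irr: "irreducible_space (zar d (Z i))" if "i \<le> n" for i
		using Z(2)[OF that] ZX[OF that] by (simp add: subtopology_subtopology Int_absorb1)
	have "Suc n \<le> N"
	proof (rule ccontr)
		assume "\<not> Suc n \<le> N"
		then have Nn: "N \<le> n" by simp
		have "\<exists>F. (\<exists>k. F \<in> homog k) \<and> (\<exists>P\<in>Z i. \<forall>f\<in>P. mpoly_eval F (lk f) \<noteq> 0) \<and> mpoly_eval F (lk 0) = 0 \<and>
				(0 < i --> (\<forall>P\<in>Z (i - 1). \<forall>f\<in>P. mpoly_eval F (lk f) = 0))" if i: "i \<le> n" for i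
		proof (cases i)
			case 0
			have "topspace (zar d (Z 0)) \<noteq> {}" using irr[of 0] unfolding irreducible_space_def by simp
			then obtain P where P: "P \<in> Z 0" by auto
			obtain f where f: "P = proj_class f" "f \<noteq> 0" using proj_formsE[OF subsetD[OF X subsetD[OF ZX P]]] by blast
			have "\<exists>m. lk f m \<noteq> 0"
			proof (rule ccontr)
				assume "\<not> (\<exists>m. lk f m \<noteq> 0)"
				then have "f = 0" by (intro poly_mapping_eqI) simp
				then show False using f(2) by simp
			qed
			then obtain m where m: "lk f m \<noteq> 0" ..
			have "mpoly_eval (Var m) (lk h) \<noteq> 0" if h: "h \<in> P" for h
			proof -
				obtain c where "h = Const c * f" "c \<noteq> 0" using h unfolding f proj_class_def by blast
				then show ?thesis using m by (simp add: lookup_Const_mult)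
			qed
			then show ?thesis using P 0
				by (intro exI[of _ "Var m"] conjI exI[of _ 1]) (auto simp: zero_poly_mapping.rep_eq)
		next
			case (Suc l)
			have l: "l < n" "l \<le> n" using i Suc by simp_all
			obtain A where A: "closedin (zariski d) A" "Z l = A \<inter> X"
				using Z(1)[OF l(2)] unfolding closedin_subtopology by (elim exE conjE)
			obtain P where P: "P \<in> Z (Suc l)" "P \<notin> Z l" using strict[OF l(1)] by blast
			have PX: "P \<in> X" using ZX[OF i] P(1) Suc by blast
			then have "P \<notin> A" using P(2) A(2) by blast
			from closedin_zariskiE[OF A(1) subsetD[OF X PX] this] obtain F where
				F: "(\<forall>Q\<in>A. \<forall>f\<in>Q. mpoly_eval F (lk f) = 0) \<and> (\<forall>f\<in>P. mpoly_eval F (lk f) \<noteq> 0) \<and> (\<exists>k. F \<in> homog k)" ..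
			have "topspace (zar d (Z l)) \<noteq> {}" using irr[OF l(2)] unfolding irreducible_space_def by simp
			then obtain Q where Q: "Q \<in> Z l" by auto
			obtain f where f: "Q = proj_class f" using proj_formsE[OF subsetD[OF X subsetD[OF ZX[OF l(2)] Q]]] by blast
			have "mpoly_eval F (lk (Const c * f)) = 0" if "c \<noteq> 0" for c
			proof -
				have "Const c * f \<in> Q" unfolding f by (rule proj_class_scale[OF that proj_class_self])
				moreover have "Q \<in> A" using Q A(2) by blast
				ultimately show ?thesis using F by simp
			qed
			then have "mpoly_eval F (lk 0) = 0" by (rule cone_zero[OF conefunI])
			moreover have "\<forall>P\<in>Z l. \<forall>f\<in>P. mpoly_eval F (lk f) = 0" using conjunct1[OF F] unfolding A(2) by blast
			ultimately show ?thesis using F P(1) Suc by (intro exI[of _ F]) auto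
		qed
		then have "\<forall>i. \<exists>F. i \<le> n --> (\<exists>k. F \<in> homog k) \<and> (\<exists>P\<in>Z i. \<forall>f\<in>P. mpoly_eval F (lk f) \<noteq> 0) \<and>
				mpoly_eval F (lk 0) = 0 \<and> (0 < i --> (\<forall>P\<in>Z (i - 1). \<forall>f\<in>P. mpoly_eval F (lk f) = 0))" by (intro allI) auto
		from choice[OF this] obtain F where F: "\<forall>i. i \<le> n --> (\<exists>k. F i \<in> homog k) \<and> (\<exists>P\<in>Z i. \<forall>f\<in>P. mpoly_eval (F i) (lk f) \<noteq> 0) \<and>
				mpoly_eval (F i) (lk 0) = 0 \<and> (0 < i --> (\<forall>P\<in>Z (i - 1). \<forall>f\<in>P. mpoly_eval (F i) (lk f) = 0))" ..
		note F' = mp[OF spec[OF F]]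
		define Y where "Y f i = mpoly_eval (F i) (lk f)" for f i
		have "\<forall>i. \<exists>q. \<exists>D. q \<in> Pol N D \<and> (\<forall>u. Y (\<xi> u) i = mpoly_eval q u)"
		proof
			fix i
			have "polymap N (\<lambda>u. Y (\<xi> u) i)" unfolding Y_def by (rule polymap_compose) (rule \<xi>)
			then show "\<exists>q. \<exists>D. q \<in> Pol N D \<and> (\<forall>u. Y (\<xi> u) i = mpoly_eval q u)" unfolding polymap_def by blast
		qed
		from choice[OF this] obtain Q where "\<forall>i. \<exists>D. Q i \<in> Pol N D \<and> (\<forall>u. Y (\<xi> u) i = mpoly_eval (Q i) u)" ..
		from choice[OF this] obtain D where Q: "\<forall>i. Q i \<in> Pol N (D i) \<and> (\<forall>u. Y (\<xi> u) i = mpoly_eval (Q i) u)" ..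
		define Dm where "Dm = (\<Sum>i\<le>n. D i)"
		have QD: "Q i \<in> Pol N Dm" if "i \<le> n" for i
		proof -
			have "D i \<le> Dm" unfolding Dm_def by (rule member_le_sum) (use that in auto)
			then show ?thesis using Q Pol_mono by blast
		qed
		obtain K where K: "(Suc n * (K * Dm) + 1) ^ N < (K + 1) ^ Suc n" using power_growth[OF Nn] .
		define E where "E = ({..n} \<rightarrow>\<^sub>E {..K})"
		have finE: "finite E" unfolding E_def by (intro finite_PiE) auto
		have cardE: "card E = (K + 1) ^ Suc n" unfolding E_def by (simp add: card_PiE)
		define p where "p e = (\<Prod>i\<le>n. Q i ^ e i)" for e
		have "p e \<in> Pol N (Suc n * (K * Dm))" if e: "e \<in> E" for e
		proof -
			have "p e \<in> Pol N (\<Sum>i\<le>n. e i * Dm)" unfolding p_def by (rule Pol_prod) (auto intro: Pol_power QD)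
			moreover have "(\<Sum>i\<le>n. e i * Dm) \<le> Suc n * (K * Dm)"
			proof -
				have "e i * Dm \<le> K * Dm" if "i \<in> {..n}" for i using e that unfolding E_def by (auto simp: PiE_def Pi_def)
				then have "(\<Sum>i\<le>n. e i * Dm) \<le> of_nat (card {..n}) * (K * Dm)" by (rule sum_bounded_above)
				then show ?thesis by simp
			qed
			ultimately show ?thesis using Pol_mono by blast
		qed
		then obtain c where c: "\<exists>e\<in>E. c e \<noteq> 0" "(\<Sum>e\<in>E. Const (c e) * p e) = 0"
			using Pol_dependent[OF finE, of p N "Suc n * (K * Dm)"] K unfolding cardE by blast
		define mono where "mono e = (\<Sum>i\<le>n. psingle i (e i))" for e :: "nat => nat"
		have lk_mono: "lk (mono e) i = (if i \<le> n then e i else 0)" for e i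
			unfolding mono_def by (simp add: lookup_sum lookup_single when_def sum.delta)
		have keys_mono: "Poly_Mapping.keys (mono e) \<subseteq> {..n}" for e
			by (auto simp: in_keys_iff lk_mono split: if_splits)
		define R where "R = (\<Sum>e\<in>E. psingle (mono e) (c e))"
		have evR: "mpoly_eval R z = (\<Sum>e\<in>E. c e * (\<Prod>i\<le>n. z i ^ e i))" for z
		proof -
			have "monom_eval (mono e) z = (\<Prod>i\<le>n. z i ^ e i)" for e
				by (subst monom_eval_superset[OF _ keys_mono]) (simp_all add: lk_mono)
			then show ?thesis by (simp add: R_def mpoly_eval_sum mpoly_eval_single)
		qed
		have "R \<noteq> 0"
		proof
			assume "R = 0"
			obtain e0 where e0: "e0 \<in> E" "c e0 \<noteq> 0" using c(1) by blast
			have inj: "mono e = mono e0 \<longleftrightarrow> e = e0" if e: "e \<in> E" for e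
			proof
				assume m: "mono e = mono e0"
				have "e i = e0 i" for i
				proof (cases "i \<le> n")
					case True
					then show ?thesis using lk_mono[of e i] lk_mono[of e0 i] m by simp
				next
					case False
					then show ?thesis using e e0(1) unfolding E_def by (auto simp: PiE_def extensional_def)
				qed
				then show "e = e0" by (rule ext)
			qed simp
			have "lk R (mono e0) = (\<Sum>e\<in>E. if e = e0 then c e else 0)"
				unfolding R_def lookup_sum lookup_single when_def by (rule sum.cong[OF refl]) (simp add: inj)
			then show False using \<open>R = 0\<close> e0 finE by simp
		qed
		have RP: "R \<in> Pol (Suc n) (\<Sum>m\<in>Poly_Mapping.keys R. monom_degree m)"
		proof -
			have "m \<in> supp_deg (Suc n) (\<Sum>m\<in>Poly_Mapping.keys R. monom_degree m)" if m: "m \<in> Poly_Mapping.keys R" for m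
			proof -
				have "\<exists>e\<in>E. m = mono e"
				proof (rule ccontr)
					assume "\<not> (\<exists>e\<in>E. m = mono e)"
					then have "lk R m = 0" unfolding R_def lookup_sum lookup_single when_def by (intro sum.neutral) auto
					then show False using m by (simp add: in_keys_iff)
				qed
				then have "Poly_Mapping.keys m \<subseteq> {..<Suc n}" using keys_mono by (auto simp: lessThan_Suc_atMost)
				moreover have "monom_degree m \<le> (\<Sum>m\<in>Poly_Mapping.keys R. monom_degree m)" by (rule member_le_sum[OF m]) auto
				ultimately show ?thesis by (simp add: supp_deg_def)
			qed
			then show ?thesis unfolding Pol_def by blast
		qed
		have R\<xi>: "mpoly_eval R (Y (\<xi> u)) = 0" for u
		proof -
			have "mpoly_eval R (Y (\<xi> u)) = mpoly_eval (\<Sum>e\<in>E. Const (c e) * p e) u"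
				using Q by (simp add: evR p_def mpoly_eval_sum mpoly_eval_mult mpoly_eval_prod mpoly_eval_power)
			then show ?thesis unfolding c(2) by simp
		qed
		have lpR: "linepoly (\<lambda>w. mpoly_eval R (Y (\<Psi> w)))"
			unfolding Y_def by (rule polymap_linepoly[of M], rule polymap_compose, rule polymap_compose, rule \<Psi>)
		have R\<Psi>: "mpoly_eval R (Y (\<Psi> w)) = 0" for w
		proof (rule ccontr)
			assume nz: "mpoly_eval R (Y (\<Psi> w)) \<noteq> 0"
			have "lineopen UNIV" by (simp add: lineopen_def)
			from lineopen_common_point[OF this UNIV_I lpR nz \<delta>] obtain v where
				v: "mpoly_eval R (Y (\<Psi> v)) \<noteq> 0" "\<delta> v \<noteq> 0" .
			then show False using chart[OF v(2)] R\<xi> by auto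
		qed
		have cone: "mpoly_eval R (Y f) = 0" if "P \<in> X" "f \<in> P" for P f using \<Psi>X[OF that] R\<Psi> by auto
		have cR: "conefun (\<lambda>f. mpoly_eval R (Y f))" unfolding Y_def by (rule conefun_compose) (rule conefunI)
		have "R = 0"
		proof (rule chain_independent[of X d "Suc n" Z F "Suc n", OF X _ _ _ _ _ _ _ _ RP])
			show "irreducible_space (zar d (Z i))" if "i < Suc n" for i using irr that by simp
			show "Z i \<subseteq> X" if "i < Suc n" for i using ZX that by simp
			show "Z i \<subseteq> Z (Suc i)" if "Suc i < Suc n" for i using strict[of i] that by auto
			show "mpoly_eval (F i) (lk 0) = 0" if "i < Suc n" for i using F'[of i] that by simp
			show "mpoly_eval (F (Suc i)) (lk f) = 0" if "Suc i < Suc n" "P \<in> Z i" "f \<in> P" for i P f using F'[of "Suc i"] that by simp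
			show "\<exists>P\<in>Z i. \<forall>f\<in>P. mpoly_eval (F i) (lk f) \<noteq> 0" if "i < Suc n" for i using F'[of i] that by simp
			show "\<exists>k. F i \<in> homog k" if "i < Suc n" for i using F'[of i] that by simp
			show "mpoly_eval R (\<lambda>i. mpoly_eval (F i) (lk f)) = 0" if "0 < Suc n" "P \<in> Z (Suc n - 1)" "f \<in> P" for P f
				using cone[of P f] that ZX[of n] unfolding Y_def by auto
			show "mpoly_eval R (\<lambda>i. mpoly_eval (F i) (lk 0)) = 0"
			proof -
				obtain P where P: "P \<in> Z n" using F'[of n] by blast
				have PX: "P \<in> X" using ZX[of n] P by blast
				obtain f where f: "P = proj_class f" using proj_formsE[OF subsetD[OF X PX]] by blast
				have "mpoly_eval R (Y (Const c * f)) = 0" if "c \<noteq> 0" for c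
					by (rule cone[OF PX]) (unfold f, rule proj_class_scale[OF that proj_class_self])
				then have "mpoly_eval R (Y 0) = 0" by (rule cone_zero[OF cR])
				then show ?thesis unfolding Y_def .
			qed
		qed simp
		then show False using \<open>R \<noteq> 0\<close> by simp
	qed
	then show "k \<le> enat (N - 1)" unfolding k by simp
qed

section \<open>Generic arrangements are neither free nor nearly free\<close>

lemma point_with:
	assumes "dt a b c \<noteq> 0" obtains v where "ev a v = x" "ev b v = y" "ev c v = z"
proof -
	define D where "D = dt a b c"
	have 1: "ev a (cr b c) = D" "ev b (cr c a) = D" "ev c (cr a b) = D"
		unfolding D_def by (rule ev_cr, rule ev_cr', rule ev_cr)
	have 0: "ev a (cr c a) = 0" "ev a (cr a b) = 0" "ev b (cr b c) = 0" "ev b (cr a b) = 0" "ev c (cr b c) = 0" "ev c (cr c a) = 0"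
		by (rule ev_cr)+
	have "D \<noteq> 0" using assms by (simp add: D_def)
	then show thesis by (intro that[of "(1 / D) *s (x *s cr b c + y *s cr c a + z *s cr a b)"]) (simp_all add: ev_linear 1 0)
qed

text \<open>Any three of the five forms are independent, and the first three are scaled such that the
	fourth is their sum; then \<open>\<beta>0\<close>, \<open>\<beta>1\<close>, \<open>\<beta>2\<close> are nonzero and distinct.\<close>

definition generic :: "(nat => complex^3) => complex => complex => complex => bool" where
	"generic a \<beta>0 \<beta>1 \<beta>2 \<longleftrightarrow> arr 5 a \<and> tri a 0 1 2 \<noteq> 0 \<and> a 3 = a 0 + a 1 + a 2 \<and>
		 a 4 = \<beta>0 *s a 0 + \<beta>1 *s a 1 + \<beta>2 *s a 2 \<and> \<beta>0 \<noteq> 0 \<and> \<beta>1 \<noteq> 0 \<and> \<beta>2 \<noteq> 0 \<and> \<beta>0 \<noteq> \<beta>1 \<and> \<beta>1 \<noteq> \<beta>2 \<and> \<beta>0 \<noteq> \<beta>2"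

context
	fixes a :: "nat => complex^3" and \<beta>0 \<beta>1 \<beta>2 c :: complex and f :: S
	assumes g: "generic a \<beta>0 \<beta>1 \<beta>2" and c: "c \<noteq> 0" and f: "f = quintic c a"
begin

lemma generic_facts:
	shows arr: "arr 5 a" and D: "tri a 0 1 2 \<noteq> 0" and a3: "a 3 = a 0 + a 1 + a 2"
		and a4: "a 4 = \<beta>0 *s a 0 + \<beta>1 *s a 1 + \<beta>2 *s a 2"
		and \<beta>: "\<beta>0 \<noteq> 0" "\<beta>1 \<noteq> 0" "\<beta>2 \<noteq> 0" and \<beta>': "\<beta>0 - \<beta>1 \<noteq> 0" "\<beta>1 - \<beta>2 \<noteq> 0" "\<beta>2 - \<beta>0 \<noteq> 0"
	using g unfolding generic_def by auto

lemma L3: "L (a 3) = L (a 0) + L (a 1) + L (a 2)"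
	and L4: "L (a 4) = Const \<beta>0 * L (a 0) + Const \<beta>1 * L (a 1) + Const \<beta>2 * L (a 2)"
	unfolding a3 a4 by (simp_all add: L_add L_scale)

lemma ld3: "ldot (a 3) r = ldot (a 0) r + ldot (a 1) r + ldot (a 2) r"
	and ld4: "ldot (a 4) r = Const \<beta>0 * ldot (a 0) r + Const \<beta>1 * ldot (a 1) r + Const \<beta>2 * ldot (a 2) r"
	unfolding a3 a4 by (simp_all add: ldot_linear)

lemma Lnz: "L (a 0) \<noteq> 0" "L (a 1) \<noteq> 0" "L (a 2) \<noteq> 0" "L (a 3) \<noteq> 0" "L (a 4) \<noteq> 0"
	using arrD(1)[OF arr] by simp_all

lemma koszul_linear:
	assumes m: "m0 \<in> homog d" "m1 \<in> homog d" "m2 \<in> homog d" and d: "d \<le> 1"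
		and z: "L (a 0) * m0 + L (a 1) * m1 + L (a 2) * m2 = 0"
	obtains A B C where "m0 = Const C * L (a 1) - Const B * L (a 2)" "m1 = Const A * L (a 2) - Const C * L (a 0)"
		"m2 = Const B * L (a 0) - Const A * L (a 1)"
proof -
	have "L (a 2) * m2 = L (a 0) * (- m0) + L (a 1) * (- m1)"
		using z by (simp add: algebra_simps eq_neg_iff_add_eq_0)
	from triple_syzygy[OF D this] obtain u v where uv: "m2 = L (a 0) * u + L (a 1) * v" .
	have "L (a 0) * (m0 + L (a 2) * u) = L (a 1) * (- (m1 + L (a 2) * v))"
		using z unfolding uv by (simp add: algebra_simps eq_neg_iff_add_eq_0)
	from pair_syzygy[OF dt_cr(1)[OF D] this] obtain w where
		w: "m0 + L (a 2) * u = L (a 1) * w" "- (m1 + L (a 2) * v) = L (a 0) * w" .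
	have const: "\<exists>e. hcomp (d - 1) p = Const e" for p :: S
	proof (cases "d - 1 = 0")
		case True
		then show ?thesis using homogeneous_0_Const[of "hcomp 0 p"] hcomp_homogeneous[of 0 p] by (metis (no_types))
	next
		case False
		then have "hcomp (d - 1) p = Const 0" using homogeneous_neg[OF hcomp_homogeneous, of "d - 1" p] d by simp
		then show ?thesis ..
	qed
	obtain A where A: "hcomp (d - 1) v = Const A" using const ..
	obtain B where B: "hcomp (d - 1) u = Const B" using const ..
	obtain C where C: "hcomp (d - 1) w = Const C" using const ..
	have h: "hcomp d (L (a i) * p) = L (a i) * hcomp (d - 1) p" for i p by (rule hcomp_mult[OF L_homogeneous])
	have h0: "hcomp d m0 = m0" "hcomp d m1 = m1" "hcomp d m2 = m2" by (simp_all add: hcomp_of_homogeneous[OF m(1)] hcomp_of_homogeneous[OF m(2)] hcomp_of_homogeneous[OF m(3)])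
	have e0: "m0 + L (a 2) * Const B = L (a 1) * Const C"
		using arg_cong[OF w(1), of "hcomp d"] unfolding hcomp_add h h0 A B C .
	have "hcomp d (- (m1 + L (a 2) * v)) = - (m1 + L (a 2) * Const A)"
	proof -
		have "hcomp d (- (m1 + L (a 2) * v)) = hcomp d (Const (- 1) * (m1 + L (a 2) * v))" by (simp add: Const_uminus)
		also have "\<dots> = Const (- 1) * hcomp d (m1 + L (a 2) * v)" using hcomp_mult[OF homogeneous_Const, of d] by simp
		also have "\<dots> = - (m1 + L (a 2) * Const A)" unfolding hcomp_add h h0 A by (simp add: Const_uminus)
		finally show ?thesis .
	qed
	then have e1: "- (m1 + L (a 2) * Const A) = L (a 0) * Const C"
		using arg_cong[OF w(2), of "hcomp d"] unfolding h C by simp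
	have e2: "m2 = L (a 0) * Const B + L (a 1) * Const A"
		using arg_cong[OF uv, of "hcomp d"] unfolding hcomp_add h h0 A B .
	show thesis
	proof (rule that[of C B "- A"])
		have "m0 = (m0 + L (a 2) * Const B) - L (a 2) * Const B" by simp
		then show "m0 = Const C * L (a 1) - Const B * L (a 2)" unfolding e0 by (simp only: mult.commute)
		have "m1 = - (- (m1 + L (a 2) * Const A)) - L (a 2) * Const A" by simp
		then show "m1 = Const (- A) * L (a 2) - Const C * L (a 0)"
			unfolding e1 Const_uminus by (simp only: mult_minus_left mult_minus_right mult.commute diff_conv_add_uminus add.commute)
		show "m2 = Const B * L (a 0) - Const (- A) * L (a 1)" unfolding e2 Const_uminus
			by (simp only: mult_minus_left mult_minus_right diff_minus_eq_add mult.commute)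
	qed
qed

text \<open>Put \<open>m i = h i - h 3\<close>. The condition on line 3 makes \<open>m 0\<close>, \<open>m 1\<close>, \<open>m 2\<close> a relation of the first three forms,
	in low degree a Koszul relation with constants \<open>A\<close>, \<open>B\<close>, \<open>C\<close>. The condition on line 4 then says that a quadric
	vanishes on that line, and its values where line 4 meets the first three are multiples of the constants.\<close>

lemma generic_low:
	assumes k: "k \<le> 2" and r: "\<And>i. r $ i \<in> homog k" and z: "Der r f = 0"
	shows "r = 0"
proof -
	obtain h0 h1 h2 h3 h4 where h: "ldot (a 0) r = L (a 0) * h0" "ldot (a 1) r = L (a 1) * h1"
		"ldot (a 2) r = L (a 2) * h2" "ldot (a 3) r = L (a 3) * h3" "ldot (a 4) r = L (a 4) * h4" "h0 + h1 + h2 + h3 + h4 = 0"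
		using z unfolding f Der_five_eq_0_iff[OF arr c] by (elim exE conjE)
	have ld: "ldot b r \<in> homog k" for b
		unfolding ldot_def by (intro homogeneous_add homogeneous_Const_mult r)
	have hh: "h \<in> homog (k - 1)" if "ldot (a i) r = L (a i) * h" "L (a i) \<noteq> 0" for i h
		by (rule homogeneous_cancel[OF L_homogeneous that(2)]) (use ld[of "a i"] that(1) in simp)
	note hom = hh[OF h(1) Lnz(1)] hh[OF h(2) Lnz(2)] hh[OF h(3) Lnz(3)] hh[OF h(4) Lnz(4)]
	have s3: "L (a 0) * (h0 - h3) + L (a 1) * (h1 - h3) + L (a 2) * (h2 - h3) = 0"
		using ld3[of r] unfolding h L3 by (simp add: algebra_simps)
	have s4: "Const \<beta>0 * (L (a 0) * (h0 - h3)) + Const \<beta>1 * (L (a 1) * (h1 - h3)) + Const \<beta>2 * (L (a 2) * (h2 - h3)) = L (a 4) * (h4 - h3)"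
		using ld4[of r] unfolding h right_diff_distrib[of "L (a 4)"] by (simp add: L4 algebra_simps)
	obtain A B C where m: "h0 - h3 = Const C * L (a 1) - Const B * L (a 2)" "h1 - h3 = Const A * L (a 2) - Const C * L (a 0)"
		"h2 - h3 = Const B * L (a 0) - Const A * L (a 1)"
		by (rule koszul_linear[OF homogeneous_diff[OF hom(1,4)] homogeneous_diff[OF hom(2,4)] homogeneous_diff[OF hom(3,4)] _ s3])
			(use k in simp)
	have e: "\<beta>0 * (ev (a 0) v * (C * ev (a 1) v - B * ev (a 2) v)) + \<beta>1 * (ev (a 1) v * (A * ev (a 2) v - C * ev (a 0) v))
			+ \<beta>2 * (ev (a 2) v * (B * ev (a 0) v - A * ev (a 1) v)) = 0" if "ev (a 4) v = 0" for v
		using arg_cong[OF s4, of "\<lambda>p. mpoly_eval p (($) v)"] that unfolding m by (simp add: mpoly_eval_simps)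
	have ev4: "ev (a 4) v = \<beta>0 * ev (a 0) v + \<beta>1 * ev (a 1) v + \<beta>2 * ev (a 2) v" for v
		unfolding a4 by (simp add: ev_linear)
	have "C = 0"
	proof -
		obtain v where v: "ev (a 0) v = \<beta>1" "ev (a 1) v = - \<beta>0" "ev (a 2) v = 0" using point_with[OF D] .
		have "\<beta>0 * \<beta>1 * (\<beta>1 - \<beta>0) * C = 0" using e[of v] unfolding ev4 v by (simp add: algebra_simps)
		then show ?thesis using \<beta> \<beta>' by simp
	qed
	moreover have "A = 0"
	proof -
		obtain v where v: "ev (a 0) v = 0" "ev (a 1) v = \<beta>2" "ev (a 2) v = - \<beta>1" using point_with[OF D] .
		have "\<beta>1 * \<beta>2 * (\<beta>2 - \<beta>1) * A = 0" using e[of v] unfolding ev4 v by (simp add: algebra_simps)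
		then show ?thesis using \<beta> \<beta>' by simp
	qed
	moreover have "B = 0"
	proof -
		obtain v where v: "ev (a 0) v = \<beta>2" "ev (a 1) v = 0" "ev (a 2) v = - \<beta>0" using point_with[OF D] .
		have "\<beta>0 * \<beta>2 * (\<beta>0 - \<beta>2) * B = 0" using e[of v] unfolding ev4 v by (simp add: algebra_simps)
		then show ?thesis using \<beta> \<beta>' by simp
	qed
	ultimately have eq: "h0 - h3 = 0" "h1 - h3 = 0" "h2 - h3 = 0" using m by simp_all
	have "L (a 4) * (h4 - h3) = 0" using s4 unfolding eq by simp
	then have "h4 - h3 = 0" using Lnz(5) by simp
	then have "h0 = h3" "h1 = h3" "h2 = h3" "h4 = h3" using eq by simp_all
	then have "5 * h3 = 0" using h(6) by simp
	then have h3: "h3 = 0" using fifth(2)[of h3] by simp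
	have "ldot (a 0) r = 0" "ldot (a 1) r = 0" "ldot (a 2) r = 0"
		unfolding h(1-3) \<open>h0 = h3\<close> \<open>h1 = h3\<close> \<open>h2 = h3\<close> h3 by simp_all
	then show ?thesis using recon_ldot[OF D, of r] by (simp add: recon_0)
qed

text \<open>The proof of \<open>generic_low\<close> in one degree more: now \<open>A\<close>, \<open>B\<close>, \<open>C\<close> are linear forms, and the
	remaining condition is that a combination of \<open>l0 l1\<close>, \<open>l1 l2\<close>, \<open>l0 l2\<close> with these coefficients be
	divisible by \<open>l4\<close>. Multiples of \<open>l4\<close> as coefficients give three parameters, the Koszul relation
	\<open>l2 (l0 l1) - l0 (l1 l2) = 0\<close> a fourth.\<close>

lemma generic_cubics:
	obtains T :: "complex => complex => complex => complex => S^3"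
	where "\<And>c1 c2 c3 c4 i. T c1 c2 c3 c4 $ i \<in> homog 3" "\<And>c1 c2 c3 c4. Der (T c1 c2 c3 c4) f = 0"
		"\<And>c1 c2 c3 c4. T c1 c2 c3 c4 = 0 ==> c1 = 0 \<and> c2 = 0 \<and> c3 = 0 \<and> c4 = 0"
		"\<And>c1 c2 c3 c4. T c1 c2 c3 c4 = Const c1 *s T 1 0 0 0 + Const c2 *s T 0 1 0 0 + Const c3 *s T 0 0 1 0 + Const c4 *s T 0 0 0 1"
proof -
	let ?l0 = "L (a 0)" and ?l1 = "L (a 1)" and ?l2 = "L (a 2)" and ?l3 = "L (a 3)" and ?l4 = "L (a 4)"
	define C where "C c1 c4 = Const (1 / (\<beta>0 - \<beta>1)) * (Const c1 * ?l4 + Const c4 * ?l2)" for c1 c4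
	define A where "A c2 c4 = Const (1 / (\<beta>1 - \<beta>2)) * (Const c2 * ?l4 - Const c4 * ?l0)" for c2 c4
	define B where "B c3 = Const (1 / (\<beta>2 - \<beta>0)) * (Const c3 * ?l4)" for c3
	define k where "k c1 c2 c3 = Const c1 * (?l0 * ?l1) + Const c2 * (?l1 * ?l2) + Const c3 * (?l0 * ?l2)" for c1 c2 c3
	define m0 where "m0 c1 c3 c4 = ?l1 * C c1 c4 - ?l2 * B c3" for c1 c3 c4
	define m1 where "m1 c1 c2 c4 = ?l2 * A c2 c4 - ?l0 * C c1 c4" for c1 c2 c4
	define m2 where "m2 c2 c3 c4 = ?l0 * B c3 - ?l1 * A c2 c4" for c2 c3 c4
	\<comment> \<open>the factor of line 3, such that all five factors add up to zero\<close>
	define h where "h c1 c2 c3 c4 = Const (- 1/5) * (m0 c1 c3 c4 + m1 c1 c2 c4 + m2 c2 c3 c4 + k c1 c2 c3)" for c1 c2 c3 c4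
	define T where "T c1 c2 c3 c4 = recon (a 0) (a 1) (a 2) (?l0 * (h c1 c2 c3 c4 + m0 c1 c3 c4)) (?l1 * (h c1 c2 c3 c4 + m1 c1 c2 c4))
		(?l2 * (h c1 c2 c3 c4 + m2 c2 c3 c4))" for c1 c2 c3 c4
	have ld: "ldot (a 0) (T c1 c2 c3 c4) = ?l0 * (h c1 c2 c3 c4 + m0 c1 c3 c4)"
		"ldot (a 1) (T c1 c2 c3 c4) = ?l1 * (h c1 c2 c3 c4 + m1 c1 c2 c4)"
		"ldot (a 2) (T c1 c2 c3 c4) = ?l2 * (h c1 c2 c3 c4 + m2 c2 c3 c4)" for c1 c2 c3 c4
		unfolding T_def by (rule ldot_recon[OF D])+
	have ld_3: "ldot (a 3) (T c1 c2 c3 c4) = ?l3 * h c1 c2 c3 c4" for c1 c2 c3 c4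
		unfolding ld3 ld L3 m0_def m1_def m2_def by (simp add: algebra_simps)
	have C': "Const (\<beta>0 - \<beta>1) * C c1 c4 = Const c1 * ?l4 + Const c4 * ?l2" for c1 c4
		using \<beta>'(1) by (simp add: C_def flip: mult.assoc Const_mult)
	have A': "Const (\<beta>1 - \<beta>2) * A c2 c4 = Const c2 * ?l4 - Const c4 * ?l0" for c2 c4
		using \<beta>'(2) by (simp add: A_def flip: mult.assoc Const_mult)
	have B': "Const (\<beta>2 - \<beta>0) * B c3 = Const c3 * ?l4" for c3
		using \<beta>'(3) by (simp add: B_def flip: mult.assoc Const_mult)
	have s4: "Const \<beta>0 * (?l0 * m0 c1 c3 c4) + Const \<beta>1 * (?l1 * m1 c1 c2 c4) + Const \<beta>2 * (?l2 * m2 c2 c3 c4) = ?l4 * k c1 c2 c3" for c1 c2 c3 c4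
	proof -
		have "Const \<beta>0 * (?l0 * m0 c1 c3 c4) + Const \<beta>1 * (?l1 * m1 c1 c2 c4) + Const \<beta>2 * (?l2 * m2 c2 c3 c4)
			 = ?l0 * ?l1 * (Const (\<beta>0 - \<beta>1) * C c1 c4) + ?l1 * ?l2 * (Const (\<beta>1 - \<beta>2) * A c2 c4) + ?l0 * ?l2 * (Const (\<beta>2 - \<beta>0) * B c3)"
			unfolding m0_def m1_def m2_def Const_diff by (simp only: algebra_simps)
		also have "\<dots> = ?l4 * k c1 c2 c3" unfolding A' B' C' k_def by (simp add: algebra_simps)
		finally show ?thesis .
	qed
	have ld_4: "ldot (a 4) (T c1 c2 c3 c4) = ?l4 * (h c1 c2 c3 c4 + k c1 c2 c3)" for c1 c2 c3 c4
	proof -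
		have "ldot (a 4) (T c1 c2 c3 c4) = (Const \<beta>0 * ?l0 + Const \<beta>1 * ?l1 + Const \<beta>2 * ?l2) * h c1 c2 c3 c4
			+ (Const \<beta>0 * (?l0 * m0 c1 c3 c4) + Const \<beta>1 * (?l1 * m1 c1 c2 c4) + Const \<beta>2 * (?l2 * m2 c2 c3 c4))"
			unfolding ld4 ld by (simp add: algebra_simps)
		then show ?thesis unfolding s4 L4[symmetric] distrib_left .
	qed
	have hom: "C c1 c4 \<in> homog 1" "A c2 c4 \<in> homog 1" "B c3 \<in> homog 1" "k c1 c2 c3 \<in> homog 2" for c1 c2 c3 c4
		unfolding C_def A_def B_def k_def by (intro homogeneous_Const_mult homogeneous_add homogeneous_diff L_homogeneous hom_LL)+
	have hm: "m0 c1 c3 c4 \<in> homog 2" "m1 c1 c2 c4 \<in> homog 2" "m2 c2 c3 c4 \<in> homog 2" for c1 c2 c3 c4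
		unfolding m0_def m1_def m2_def by (intro homogeneous_diff hom_L_mult[where j = 1] hom; simp)+
	have hh: "h c1 c2 c3 c4 \<in> homog 2" for c1 c2 c3 c4
		unfolding h_def by (intro homogeneous_Const_mult homogeneous_add hm hom)
	show thesis
	proof (rule that[of T])
		show "T c1 c2 c3 c4 $ i \<in> homog 3" for c1 c2 c3 c4 i
			unfolding T_def by (intro recon_homogeneous hom_L_mult[where j = 2] homogeneous_add hh hm; simp)
		show "Der (T c1 c2 c3 c4) f = 0" for c1 c2 c3 c4
		proof -
			have "h c1 c2 c3 c4 + m0 c1 c3 c4 + (h c1 c2 c3 c4 + m1 c1 c2 c4) + (h c1 c2 c3 c4 + m2 c2 c3 c4) + h c1 c2 c3 c4 + (h c1 c2 c3 c4 + k c1 c2 c3)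
				= 5 * h c1 c2 c3 c4 + (m0 c1 c3 c4 + m1 c1 c2 c4 + m2 c2 c3 c4 + k c1 c2 c3)" by simp
			also have "\<dots> = 0"
			proof -
				have "Const (- 1/5) * x = - (Const (1/5) * x)" for x :: S by (simp add: Const_uminus)
				then show ?thesis unfolding h_def by (simp only: mult_minus_right fifth) simp
			qed
			finally have z: "h c1 c2 c3 c4 + m0 c1 c3 c4 + (h c1 c2 c3 c4 + m1 c1 c2 c4) + (h c1 c2 c3 c4 + m2 c2 c3 c4) + h c1 c2 c3 c4 + (h c1 c2 c3 c4 + k c1 c2 c3) = 0" .
			show ?thesis unfolding f Der_five_eq_0_iff[OF arr c] by (intro exI conjI) (rule ld, rule ld, rule ld, rule ld_3, rule ld_4, rule z)
		qed
		show "T c1 c2 c3 c4 = Const c1 *s T 1 0 0 0 + Const c2 *s T 0 1 0 0 + Const c3 *s T 0 0 1 0 + Const c4 *s T 0 0 0 1" for c1 c2 c3 c4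
		proof -
			have C1: "C c1 c4 = Const c1 * C 1 0 + Const c4 * C 0 1" and A1: "A c2 c4 = Const c2 * A 1 0 + Const c4 * A 0 1"
				and B1: "B c3 = Const c3 * B 1" and k1: "k c1 c2 c3 = Const c1 * k 1 0 0 + Const c2 * k 0 1 0 + Const c3 * k 0 0 1"
				unfolding C_def A_def B_def k_def by (simp_all add: algebra_simps)
			have z: "C 0 0 = 0" "A 0 0 = 0" "B 0 = 0" "k 0 0 0 = 0" unfolding C_def A_def B_def k_def by simp_all
			have m: "m0 c1 c3 c4 = Const c1 * m0 1 0 0 + Const c3 * m0 0 1 0 + Const c4 * m0 0 0 1"
				"m1 c1 c2 c4 = Const c1 * m1 1 0 0 + Const c2 * m1 0 1 0 + Const c4 * m1 0 0 1"
				"m2 c2 c3 c4 = Const c2 * m2 1 0 0 + Const c3 * m2 0 1 0 + Const c4 * m2 0 0 1"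
				unfolding m0_def m1_def m2_def C1 A1 B1 z by (simp_all add: algebra_simps)
			have mz: "m0 0 0 0 = 0" "m1 0 0 0 = 0" "m2 0 0 0 = 0" unfolding m0_def m1_def m2_def z by simp_all
			have h1: "h c1 c2 c3 c4 = Const c1 * h 1 0 0 0 + Const c2 * h 0 1 0 0 + Const c3 * h 0 0 1 0 + Const c4 * h 0 0 0 1"
				unfolding h_def m k1 z mz by (simp add: algebra_simps)
			have rl: "recon (a 0) (a 1) (a 2) (p * x1 + q * y1 + s * z1 + t * w1) (p * x2 + q * y2 + s * z2 + t * w2) (p * x3 + q * y3 + s * z3 + t * w3)
				= p *s recon (a 0) (a 1) (a 2) x1 x2 x3 + q *s recon (a 0) (a 1) (a 2) y1 y2 y3 + s *s recon (a 0) (a 1) (a 2) z1 z2 z3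
				 + t *s recon (a 0) (a 1) (a 2) w1 w2 w3" for p q s t x1 x2 x3 y1 y2 y3 z1 z2 z3 w1 w2 w3
				unfolding recon_def vec_eq_iff by (simp add: algebra_simps)
			have e: "?l0 * (h c1 c2 c3 c4 + m0 c1 c3 c4) = Const c1 * (?l0 * (h 1 0 0 0 + m0 1 0 0)) + Const c2 * (?l0 * (h 0 1 0 0 + m0 0 0 0))
					+ Const c3 * (?l0 * (h 0 0 1 0 + m0 0 1 0)) + Const c4 * (?l0 * (h 0 0 0 1 + m0 0 0 1))"
				"?l1 * (h c1 c2 c3 c4 + m1 c1 c2 c4) = Const c1 * (?l1 * (h 1 0 0 0 + m1 1 0 0)) + Const c2 * (?l1 * (h 0 1 0 0 + m1 0 1 0))
					+ Const c3 * (?l1 * (h 0 0 1 0 + m1 0 0 0)) + Const c4 * (?l1 * (h 0 0 0 1 + m1 0 0 1))"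
				"?l2 * (h c1 c2 c3 c4 + m2 c2 c3 c4) = Const c1 * (?l2 * (h 1 0 0 0 + m2 0 0 0)) + Const c2 * (?l2 * (h 0 1 0 0 + m2 1 0 0))
					+ Const c3 * (?l2 * (h 0 0 1 0 + m2 0 1 0)) + Const c4 * (?l2 * (h 0 0 0 1 + m2 0 0 1))"
				unfolding h1 m mz by (simp_all only: algebra_simps mult_zero_right add_0_right add_0_left)
			show ?thesis unfolding T_def e rl ..
		qed
		show "c1 = 0 \<and> c2 = 0 \<and> c3 = 0 \<and> c4 = 0" if z: "T c1 c2 c3 c4 = 0" for c1 c2 c3 c4
		proof -
			have "h c1 c2 c3 c4 + m0 c1 c3 c4 = 0" "h c1 c2 c3 c4 + m1 c1 c2 c4 = 0" "h c1 c2 c3 c4 = 0"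
				using ld[of c1 c2 c3 c4] ld_3[of c1 c2 c3 c4] Lnz unfolding z ldot_linear by simp_all
			then have m: "m0 c1 c3 c4 = 0" "m1 c1 c2 c4 = 0" by simp_all
			have e4: "ev (a 4) v = \<beta>0 * ev (a 0) v + \<beta>1 * ev (a 1) v + \<beta>2 * ev (a 2) v" for v
				unfolding a4 by (simp add: ev_linear)
			have E0: "ev (a 1) v * (1 / (\<beta>0 - \<beta>1) * (c1 * ev (a 4) v + c4 * ev (a 2) v)) = ev (a 2) v * (1 / (\<beta>2 - \<beta>0) * (c3 * ev (a 4) v))" for v
				using arg_cong[OF m(1), of "\<lambda>p. mpoly_eval p (($) v)"] unfolding m0_def C_def B_def by (simp add: mpoly_eval_simps)
			have E1: "ev (a 2) v * (1 / (\<beta>1 - \<beta>2) * (c2 * ev (a 4) v - c4 * ev (a 0) v)) = ev (a 0) v * (1 / (\<beta>0 - \<beta>1) * (c1 * ev (a 4) v + c4 * ev (a 2) v))" for v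
				using arg_cong[OF m(2), of "\<lambda>p. mpoly_eval p (($) v)"] unfolding m1_def C_def A_def by (simp add: mpoly_eval_simps)
			obtain v1 where v1: "ev (a 0) v1 = 0" "ev (a 1) v1 = 1" "ev (a 2) v1 = 0" using point_with[OF D] .
			obtain v2 where v2: "ev (a 0) v2 = 0" "ev (a 1) v2 = 0" "ev (a 2) v2 = 1" using point_with[OF D] .
			obtain v3 where v3: "ev (a 0) v3 = 0" "ev (a 1) v3 = 1" "ev (a 2) v3 = 1" using point_with[OF D] .
			have "c1 = 0" using E0[of v1] \<beta> \<beta>' unfolding e4 v1 by simp
			moreover have "c3 = 0" using E0[of v2] \<beta> \<beta>' unfolding e4 v2 by simp
			moreover have "c2 = 0" using E1[of v2] \<beta> \<beta>' unfolding e4 v2 by simp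
			moreover have "c4 = 0" using E0[of v3] \<beta> \<beta>' \<open>c1 = 0\<close> \<open>c3 = 0\<close> unfolding e4 v3 by simp
			ultimately show ?thesis by simp
		qed
	qed
qed

end


text \<open>If \<open>p\<close> starts in degree \<open>n\<close>, only the constant term of \<open>q\<close> contributes to degree \<open>n\<close> of \<open>q * p\<close>. So
	when a module of syzygies starts in degree three, its piece of that degree is spanned over the
	complex numbers by the leading components of any generators.\<close>

lemma hcomp_mult_low:
	assumes low: "\<And>k. k < n ==> hcomp k p = 0"
	shows "(\<forall>k<n. hcomp k (q * p) = 0) \<and> hcomp n (q * p) = Const (lk q 0) * hcomp n p"
proof (induction q rule: mpoly_induct)
	case (Const c)
	have "hcomp k (Const c * p) = Const c * hcomp k p" for k using hcomp_mult[OF homogeneous_Const, of k c p] by simp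
	then show ?case using low by (simp add: lookup_Const)
next
	case (add p q)
	then show ?case by (simp add: distrib_right hcomp_add lookup_add Const_add)
next
	case (Var i q)
	have "hcomp k (Var i * q * p) = Var i * hcomp (k - 1) (q * p)" for k
		unfolding mult.assoc by (rule hcomp_mult[OF homogeneous_Var])
	then show ?case using Var by (simp add: lookup_Var_mult)
qed

text \<open>Three equations in four unknowns, read as a relation among four polynomials of degree two in one
	variable.\<close>

lemma four_in_three:
	fixes \<mu> :: "nat => nat => complex"
	obtains c where "\<exists>i\<in>{..<4}. c i \<noteq> 0" "\<forall>j<3. (\<Sum>i<4. c i * \<mu> i j) = 0"
proof -
	define x where "x = (\<lambda>j. psingle (0::nat) (j::nat))"
	define p where "p i = (\<Sum>j<3. psingle (x j) (\<mu> i j))" for i :: nat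
	have xi: "x j = x k \<longleftrightarrow> j = k" for j k
	proof
		assume "x j = x k"
		then have "lk (x j) 0 = lk (x k) 0" by simp
		then show "j = k" by (simp add: x_def lookup_single)
	qed simp
	have lkp: "lk (p i) (x k) = \<mu> i k" if "k < 3" for i k
		using that by (simp add: p_def lookup_sum lookup_single when_def xi sum.delta)
	have "psingle (x j) (\<mu> i j) \<in> Pol 1 2" if "j < 3" for i j
		using that by (auto simp: Pol_def supp_deg_def x_def monom_degree_def split: if_splits)
	then have pP: "p i \<in> Pol 1 2" for i
		unfolding p_def numeral_3_eq_3 lessThan_Suc by (simp add: Pol_add Pol_Const[of 0, simplified])
	have card: "(2 + 1) ^ 1 < card {..<4::nat}" by simp
	from Pol_dependent[OF finite_lessThan pP card] obtain c where c: "\<exists>e\<in>{..<4::nat}. c e \<noteq> 0" "(\<Sum>e<4. Const (c e) * p e) = 0" .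
	show thesis
	proof (rule that[OF c(1)], intro allI impI)
		fix j :: nat assume j: "j < 3"
		have "(\<Sum>i<4. c i * \<mu> i j) = lk (\<Sum>e<4. Const (c e) * p e) (x j)" by (simp add: lookup_sum lookup_Const_mult lkp[OF j])
		then show "(\<Sum>i<4. c i * \<mu> i j) = 0" unfolding c(2) by simp
	qed
qed

lemma Der_hcomp:
	assumes f: "f \<in> homog d" and z: "Der r f = 0"
	shows "Der (\<chi> i. hcomp k (r $ i)) f = 0"
proof -
	have *: "hcomp (k + (d - 1)) (r $ i * pd j f) = hcomp k (r $ i) * pd j f" for i j
		using hcomp_mult_right[OF pd_homogeneous[OF f], of "k + (d - 1)" "r $ i" j] by simp
	have "Der (\<chi> i. hcomp k (r $ i)) f = hcomp (k + (d - 1)) (Der r f)"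
		unfolding Der_def vec_lambda_beta hcomp_add * ..
	then show ?thesis using z by simp
qed

context
	fixes a :: "nat => complex^3" and \<beta>0 \<beta>1 \<beta>2 c :: complex and f :: S
	assumes g: "generic a \<beta>0 \<beta>1 \<beta>2" and c: "c \<noteq> 0" and f: "f = quintic c a" and fh: "f \<in> homog 5"
begin

text \<open>The module starts in degree three, where it has dimension at least four, and three elements cannot
	span that piece.\<close>

lemma generic_not_generated:
	assumes \<rho>: "\<And>j. j < 3 ==> Der (\<rho> j) f = 0"
		and gen: "\<And>r. Der r f = 0 ==> \<exists>q :: nat => S. r = (\<Sum>j<3. q j *s \<rho> j)"
	shows False
proof -
	define H where "H k r = (\<chi> i. hcomp k (r $ i))" for k and r :: "S^3"
	have low: "H k (\<rho> j) = 0" if "k < 3" "j < 3" for k j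
		by (rule generic_low[OF g c f, of k]) (use that Der_hcomp[OF fh \<rho>, of j k] in \<open>simp_all add: H_def\<close>)
	have low': "hcomp k (\<rho> j $ i) = 0" if "k < 3" "j < 3" for k i j
		using low[OF that] by (simp add: H_def vec_eq_iff)
	have top: "r = (\<Sum>j<3. Const (lk (q j) 0) *s H 3 (\<rho> j))" if r: "r = (\<Sum>j<3. q j *s \<rho> j)" "\<And>i. r $ i \<in> homog 3" for r q
	proof -
		have "r $ i = (\<Sum>j<3. Const (lk (q j) 0) *s H 3 (\<rho> j)) $ i" for i
		proof -
			have t: "hcomp 3 (q j * \<rho> j $ i) = Const (lk (q j) 0) * hcomp 3 (\<rho> j $ i)" if "j < 3" for j
				using hcomp_mult_low[of 3 "\<rho> j $ i" "q j"] low'[OF _ that] by blast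
			have ri: "r $ i = (\<Sum>j<3. q j * \<rho> j $ i)" unfolding r(1) by (simp add: sum_component)
			have "r $ i = hcomp 3 (\<Sum>j<3. q j * \<rho> j $ i)" using hcomp_of_homogeneous[OF r(2), of 3 i] unfolding ri by simp
			also have "hcomp 3 (\<Sum>j<3. q j * \<rho> j $ i) = (\<Sum>j<3. hcomp 3 (q j * \<rho> j $ i))"
				by (simp add: numeral_3_eq_3 lessThan_Suc hcomp_add)
			also have "\<dots> = (\<Sum>j<3. Const (lk (q j) 0) * hcomp 3 (\<rho> j $ i))" by (rule sum.cong[OF refl]) (simp add: t)
			finally show ?thesis by (simp add: sum_component H_def)
		qed
		then show ?thesis unfolding vec_eq_iff by blast
	qed
	show False
	proof (rule generic_cubics[OF g c f])
	fix T :: "complex => complex => complex => complex => S^3"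
	assume T: "\<And>c1 c2 c3 c4 i. T c1 c2 c3 c4 $ i \<in> homog 3" "\<And>c1 c2 c3 c4. Der (T c1 c2 c3 c4) f = 0"
		"\<And>c1 c2 c3 c4. T c1 c2 c3 c4 = 0 ==> c1 = 0 \<and> c2 = 0 \<and> c3 = 0 \<and> c4 = 0"
		"\<And>c1 c2 c3 c4. T c1 c2 c3 c4 = Const c1 *s T 1 0 0 0 + Const c2 *s T 0 1 0 0 + Const c3 *s T 0 0 1 0 + Const c4 *s T 0 0 0 1"
	define t where "t i = T (if i = 0 then 1 else 0) (if i = 1 then 1 else 0) (if i = 2 then 1 else 0) (if i = 3 then 1 else 0)" for i :: nat
	have "\<exists>\<mu>. t i = (\<Sum>j<3. Const (\<mu> j) *s H 3 (\<rho> j))" for i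
	proof -
		have ti: "Der (t i) f = 0" "\<And>k. t i $ k \<in> homog 3" unfolding t_def by (rule T(2), rule T(1))
		from gen[OF ti(1)] obtain q where q: "t i = (\<Sum>j<3. q j *s \<rho> j)" ..
		have "t i = (\<Sum>j<3. Const (lk (q j) 0) *s H 3 (\<rho> j))" by (rule top[OF q ti(2)])
		then show ?thesis by (rule exI[of _ "\<lambda>j. lk (q j) 0"])
	qed
	then have "\<forall>i. \<exists>\<mu>. t i = (\<Sum>j<3. Const (\<mu> j) *s H 3 (\<rho> j))" ..
	from choice[OF this] obtain \<mu> where \<mu>: "\<forall>i. t i = (\<Sum>j<3. Const (\<mu> i j) *s H 3 (\<rho> j))" ..
	obtain e where e: "\<exists>i\<in>{..<4}. e i \<noteq> 0" "\<forall>j<3. (\<Sum>i<4. e i * \<mu> i j) = 0"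
		using four_in_three[of \<mu>] .
	have four: "{..<4::nat} = {0, 1, 2, 3}" by auto
	have "T (e 0) (e 1) (e 2) (e 3) = Const (e 0) *s t 0 + Const (e 1) *s t 1 + Const (e 2) *s t 2 + Const (e 3) *s t 3"
		unfolding T(4)[of "e 0" "e 1" "e 2" "e 3"] by (simp add: t_def)
	also have "\<dots> = (\<Sum>j<3. Const (\<Sum>i<4. e i * \<mu> i j) *s H 3 (\<rho> j))"
		unfolding spec[OF \<mu>] four by (simp add: vec_eq_iff sum_component numeral_3_eq_3 lessThan_Suc Const_add Const_mult algebra_simps)
	also have "\<dots> = 0" by (rule sum.neutral) (simp add: e(2))
	finally have "e 0 = 0 \<and> e 1 = 0 \<and> e 2 = 0 \<and> e 3 = 0" by (rule T(3))
	then show False using e(1) unfolding four by simp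
	qed
qed

lemma generic_not_free: "\<not> free_arrangement d1 d2 f"
proof
	assume "free_arrangement d1 d2 f"
	then obtain \<phi> where \<phi>: "\<phi> \<in> graded_hom (AR f) (free_mod [int d1, int d2])"
		and bij: "bij_betw \<phi> (carrier (AR f)) (FM [int d1, int d2])"
		unfolding free_arrangement_def graded_iso_def by (elim conjE bexE exE)
	have car: "FM [int d1, int d2] = {v. \<forall>i\<ge>2. v i = 0}" by (simp add: numeral_2_eq_2)
	have ex: "\<exists>r. Der r f = 0 \<and> \<phi> r = v" if "\<forall>i\<ge>2. v i = 0" for v
	proof -
		have "v \<in> \<phi> ` carrier (AR f)" using bij that unfolding bij_betw_def car by simp
		then show ?thesis unfolding AR_carrier by (elim imageE) auto
	qed
	have add: "\<phi> (r + s) = (\<lambda>i. \<phi> r i + \<phi> s i)" if "Der r f = 0" "Der s f = 0" for r s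
		using graded_homD(2)[OF \<phi>, of r s] that unfolding AR_carrier by (simp add: AR_def)
	have sm: "\<phi> (p *s r) = (\<lambda>i. p * \<phi> r i)" if "Der r f = 0" for r p
		using graded_homD(3)[OF \<phi>, of r p] that unfolding AR_carrier by (simp add: AR_def)
	obtain r0 where r0: "Der r0 f = 0" "\<phi> r0 = single_vec 0 1" using ex[of "single_vec 0 1"] by (auto simp: single_vec_def)
	obtain r1 where r1: "Der r1 f = 0" "\<phi> r1 = single_vec 1 1" using ex[of "single_vec 1 1"] by (auto simp: single_vec_def)
	have Dl: "Der (p *s r + q *s s) f = p * Der r f + q * Der s f" for p q r s by (simp add: Der_def algebra_simps)
	show False
	proof (rule generic_not_generated[of "\<lambda>j. if j = 0 then r0 else if j = 1 then r1 else 0"])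
		fix r assume r: "Der r f = 0"
		define s where "s = \<phi> r 0 *s r0 + \<phi> r 1 *s r1"
		have s: "Der s f = 0" unfolding s_def Dl using r0 r1 by simp
		have D0: "Der (p *s r0) f = 0" "Der (p *s r1) f = 0" for p using Dl[of p r0 0 r0] Dl[of p r1 0 r1] r0 r1 by simp_all
		have \<phi>r: "\<phi> r i = 0" if "2 \<le> i" for i using graded_homD(1)[OF \<phi>, of r] r that unfolding AR_carrier car by simp
		have "\<phi> s = \<phi> r"
		proof (rule fun_eq_2)
			have *: "\<phi> s i = \<phi> r 0 * single_vec 0 1 i + \<phi> r 1 * single_vec 1 1 i" for i
				unfolding s_def add[OF D0] sm[OF r0(1)] sm[OF r1(1)] r0(2) r1(2) ..
			show "\<phi> s 0 = \<phi> r 0" "\<phi> s 1 = \<phi> r 1" unfolding * by (simp_all add: single_vec_def)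
			show "\<phi> s i = \<phi> r i" if "2 \<le> i" for i unfolding * using that \<phi>r[OF that] by (simp add: single_vec_def)
		qed
		then have "s = r" using bij r s unfolding bij_betw_def AR_carrier inj_on_def by simp
		then show "\<exists>q :: nat => S. r = (\<Sum>j<3. q j *s (if j = 0 then r0 else if j = 1 then r1 else 0))"
			unfolding s_def by (intro exI[of _ "\<phi> r"]) (simp add: numeral_3_eq_3 lessThan_Suc add.commute)
	qed (use r0 r1 in \<open>auto simp: Der_def\<close>)
qed

lemma generic_not_nearly_free: "\<not> nearly_free_arrangement 5 d1 d2 f"
proof
	let ?F = "nearly_free_shifts (int 5) (int d1) (int d2)"
	assume "nearly_free_arrangement 5 d1 d2 f"
	then obtain \<phi> where res: "minimal_resolution (milnor f) ?F \<phi> (\<lambda>v. milnor_proj f (v 0))"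
		and row: "\<forall>v\<in>FM [int 5 - 1, int 5 - 1, int 5 - 1]. \<phi> 0 v 0 = v 0 * pd 1 f + v 1 * pd 2 f + v 2 * pd 3 f"
		unfolding nearly_free_arrangement_def by (elim conjE exE)
	have r: "\<And>i. \<phi> i \<in> graded_hom (free_mod (?F (Suc i))) (free_mod (?F i))"
		"\<And>i. {v \<in> FM (?F (Suc i)). \<phi> i v = \<zero>\<^bsub>free_mod (?F i)\<^esub>} = \<phi> (Suc i) ` carrier (free_mod (?F (Suc (Suc i))))"
		using res unfolding minimal_resolution_def graded_free_resolution_def by blast+
	have F: "?F 0 = [0]" "?F (Suc 0) = [int 5 - 1, int 5 - 1, int 5 - 1]" "length (?F (Suc (Suc 0))) = 3"
		by (simp_all add: nearly_free_shifts_def)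
	have car1: "FM (?F (Suc 0)) = {v. \<forall>i\<ge>3. v i = 0}" unfolding F by (simp add: numeral_3_eq_3)
	have car2: "carrier (free_mod (?F (Suc (Suc 0)))) = {v. \<forall>i\<ge>3. v i = 0}" using F(3) by simp
	have ker: "Der (fun_vec v) f = 0 \<longleftrightarrow> v \<in> \<phi> 1 ` {v. \<forall>i\<ge>3. v i = 0}" if v: "\<forall>i\<ge>3. v i = 0" for v
	proof -
		have vc: "v \<in> FM (?F (Suc 0))" using v unfolding car1 by simp
		have "\<phi> 0 v \<in> FM (?F 0)" by (rule graded_homD(1)[OF r(1) vc])
		then have "\<phi> 0 v i = 0" if "1 \<le> i" for i using that unfolding F by simp
		then have "\<phi> 0 v = (\<lambda>_. 0) \<longleftrightarrow> \<phi> 0 v 0 = 0" by (metis One_nat_def Suc_leI neq0_conv)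
		moreover have "\<phi> 0 v 0 = Der (fun_vec v) f" using bspec[OF row, of v] vc unfolding F Der_def by simp
		ultimately have "Der (fun_vec v) f = 0 \<longleftrightarrow> v \<in> {v \<in> FM (?F (Suc 0)). \<phi> 0 v = \<zero>\<^bsub>free_mod (?F 0)\<^esub>}"
			using vc by simp
		then show ?thesis unfolding r(2) car2 by simp
	qed
	have hom1: "\<phi> 1 (\<lambda>i. u i + v i) = (\<lambda>i. \<phi> 1 u i + \<phi> 1 v i)" "\<phi> 1 (\<lambda>i. p * u i) = (\<lambda>i. p * \<phi> 1 u i)"
		if "\<forall>i\<ge>3. u i = 0" "\<forall>i\<ge>3. v i = 0" for u v p
		using graded_homD(2)[OF r(1)[of "Suc 0"], of u v] graded_homD(3)[OF r(1)[of "Suc 0"], of u p] that unfolding car2 by simp_all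
	have sv: "\<forall>i\<ge>3. single_vec j p i = 0" if "j < 3" for j p using that by (simp add: single_vec_def)
	have v3: "v i = 0" if "v \<in> \<phi> 1 ` {v. \<forall>i\<ge>3. v i = 0}" "i \<ge> 3" for v i
		using that r(2)[of 0] unfolding car1 car2 by auto
	show False
	proof (rule generic_not_generated[of "\<lambda>j. fun_vec (\<phi> 1 (single_vec j 1))"])
		fix j :: nat assume j: "j < 3"
		have "\<phi> 1 (single_vec j 1) \<in> \<phi> 1 ` {v. \<forall>i\<ge>3. v i = 0}" using sv[OF j] by (intro imageI) simp
		then show "Der (fun_vec (\<phi> 1 (single_vec j 1))) f = 0" using ker[of "\<phi> 1 (single_vec j 1)"] v3 by blast
	next
		fix s assume "Der s f = 0"
		then have "vec_fun s \<in> \<phi> 1 ` {v. \<forall>i\<ge>3. v i = 0}" using ker[of "vec_fun s"] unfolding fun_vec_inverse by (simp add: vec_fun_def)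
		then obtain w where w: "vec_fun s = \<phi> 1 w" "\<forall>i\<ge>3. w i = 0" by blast
		define e where "e j = (\<lambda>i. w j * single_vec j 1 i)" for j
		have e0: "\<forall>i\<ge>3. e j i = 0" if "j < 3" for j using sv[OF that] by (simp add: e_def)
		have we: "w = (\<lambda>i. (e 0 i + e 1 i) + e 2 i)"
		proof
			fix i :: nat
			consider "i = 0" | "i = 1" | "i = 2" | "3 \<le> i" by linarith
			then show "w i = (e 0 i + e 1 i) + e 2 i" using w(2) by cases (auto simp: e_def single_vec_def)
		qed
		have pe: "\<phi> 1 (e j) = (\<lambda>i. w j * \<phi> 1 (single_vec j 1) i)" if "j < 3" for j
			unfolding e_def by (rule hom1(2)[OF sv sv]) (use that in simp_all)
		have pw: "\<phi> 1 w = (\<lambda>i. (\<phi> 1 (e 0) i + \<phi> 1 (e 1) i) + \<phi> 1 (e 2) i)"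
		proof -
			have "\<phi> 1 w = \<phi> 1 (\<lambda>i. (e 0 i + e 1 i) + e 2 i)" using we by (rule arg_cong)
			also have "\<dots> = (\<lambda>i. \<phi> 1 (\<lambda>i. e 0 i + e 1 i) i + \<phi> 1 (e 2) i)"
				by (rule hom1(1)) (use e0[of 0] e0[of 1] e0[of 2] in simp_all)
			also have "\<phi> 1 (\<lambda>i. e 0 i + e 1 i) = (\<lambda>i. \<phi> 1 (e 0) i + \<phi> 1 (e 1) i)"
				by (rule hom1(1)) (use e0[of 0] e0[of 1] in simp_all)
			finally show ?thesis .
		qed
		have "s = fun_vec (\<lambda>i. (w 0 * \<phi> 1 (single_vec 0 1) i + w 1 * \<phi> 1 (single_vec 1 1) i) + w 2 * \<phi> 1 (single_vec 2 1) i)"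

		proof -
			have p: "\<phi> 1 (e 0) = (\<lambda>i. w 0 * \<phi> 1 (single_vec 0 1) i)" "\<phi> 1 (e 1) = (\<lambda>i. w 1 * \<phi> 1 (single_vec 1 1) i)"
				"\<phi> 1 (e 2) = (\<lambda>i. w 2 * \<phi> 1 (single_vec 2 1) i)" by (rule pe; simp)+
			have "s = fun_vec (\<phi> 1 w)" unfolding w(1)[symmetric] fun_vec_inverse ..
			then show ?thesis unfolding pw p .
		qed
		then show "\<exists>q :: nat => S. s = (\<Sum>j<3. q j *s fun_vec (\<phi> 1 (single_vec j 1)))"
			by (intro exI[of _ w]) (simp add: vec3_eq_iff numeral_3_eq_3 numeral_2_eq_2 lessThan_Suc)
	qed
qed

end

section \<open>Regularity and stability threshold\<close>

lemma hilb_values: "hilb 0 = 1" "hilb 1 = 3" "hilb 3 = 10" "hilb 4 = 15" "hilb 5 = 21" "k < 0 ==> hilb k = 0"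
	using hilb_double[of 0] hilb_double[of 1] hilb_double[of 3] hilb_double[of 4] hilb_double[of 5] by (simp_all add: hilb_def)

lemma invariants_12:
	assumes f: "f \<in> homog 5" and B: "AR_basis f 2 \<rho>1 2 \<rho>2" and \<tau>: "tjurina f = 12"
	shows "milnor_st f = 4" "milnor_reg f = 4"
proof -
	interpret R: milnor_resolution f "int 5" "[int 5 - 1, int 5 - 1, int 5 - 1]" "[int 5 - 1 + int 2, int 5 - 1 + int 2]" "[]"
		"partials f" "\<lambda>j. vec_fun (if j = 0 then \<rho>1 else \<rho>2)" "\<lambda>_ _. 0"
		by (rule free_resolution[OF _ _ B]) (use f in simp_all)
	have h: "R.hdim k = int (hilb k) - 3 * int (hilb (k - 4)) + 2 * int (hilb (k - 6))" for k unfolding R.hdim_def by simp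
	show "milnor_reg f = 4" unfolding R.regularity by simp
	show "milnor_st f = 4"
	proof (rule R.st_eq)
		fix k :: int assume k: "int 4 \<le> k"
		have "2 * R.hdim k = 24" unfolding h using hilb_double[of k] hilb_double[of "k - 4"] hilb_double[of "k - 6"] k
			by (simp add: algebra_simps)
		then show "R.hdim k = int (tjurina f)" using \<tau> by simp
	next
		have v: "R.hdim (int 4 - 1) = 10" unfolding h by (simp add: hilb_values)
		show "R.hdim (int 4 - 1) \<noteq> int (tjurina f)" "0 \<le> R.hdim (int 4 - 1)" unfolding v using \<tau> by simp_all
	qed simp
qed

lemma invariants_13:
	assumes f: "f \<in> homog 5" and B: "AR_basis f 1 \<rho>1 3 \<rho>2" and \<tau>: "tjurina f = 13"
	shows "milnor_st f = 5" "milnor_reg f = 5"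
proof -
	interpret R: milnor_resolution f "int 5" "[int 5 - 1, int 5 - 1, int 5 - 1]" "[int 5 - 1 + int 1, int 5 - 1 + int 3]" "[]"
		"partials f" "\<lambda>j. vec_fun (if j = 0 then \<rho>1 else \<rho>2)" "\<lambda>_ _. 0"
		by (rule free_resolution[OF _ _ B]) (use f in simp_all)
	have h: "R.hdim k = int (hilb k) - 3 * int (hilb (k - 4)) + int (hilb (k - 5)) + int (hilb (k - 7))" for k unfolding R.hdim_def by simp
	show "milnor_reg f = 5" unfolding R.regularity by simp
	show "milnor_st f = 5"
	proof (rule R.st_eq)
		fix k :: int assume k: "int 5 \<le> k"
		have "2 * R.hdim k = 26" unfolding h
			using hilb_double[of k] hilb_double[of "k - 4"] hilb_double[of "k - 5"] hilb_double[of "k - 7"] k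
			by (simp add: algebra_simps)
		then show "R.hdim k = int (tjurina f)" using \<tau> by simp
	next
		have v: "R.hdim (int 5 - 1) = 12" unfolding h by (simp add: hilb_values)
		show "R.hdim (int 5 - 1) \<noteq> int (tjurina f)" "0 \<le> R.hdim (int 5 - 1)" unfolding v using \<tau> by simp_all
	qed simp
qed

lemma invariants_11:
	assumes f: "f \<in> homog 5" and B: "AR_near_basis f \<rho> \<kappa>" and \<tau>: "tjurina f = 11"
	shows "milnor_st f = 6" "milnor_reg f = 5"
proof -
	interpret R: milnor_resolution f 5 "[4, 4, 4]" "[6, 7, 7]" "[8]" "partials f" "\<lambda>j. vec_fun (\<rho> j)"
		"\<lambda>_ i. if i < 3 then \<kappa> i else 0" by (rule near_resolution[OF f B])
	have h: "R.hdim k = int (hilb k) - 3 * int (hilb (k - 4)) + int (hilb (k - 6)) + 2 * int (hilb (k - 7)) - int (hilb (k - 8))" for k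
		unfolding R.hdim_def by simp
	show "milnor_reg f = 5" unfolding R.regularity by simp
	show "milnor_st f = 6"
	proof (rule R.st_eq)
		fix k :: int assume k: "int 6 \<le> k"
		have "2 * R.hdim k = 22" unfolding h
			using hilb_double[of k] hilb_double[of "k - 4"] hilb_double[of "k - 6"] hilb_double[of "k - 7"] hilb_double[of "k - 8"] k
			by (simp add: algebra_simps)
		then show "R.hdim k = int (tjurina f)" using \<tau> by simp
	next
		have v: "R.hdim (int 6 - 1) = 12" unfolding h by (simp add: hilb_values)
		show "R.hdim (int 6 - 1) \<noteq> int (tjurina f)" "0 \<le> R.hdim (int 6 - 1)" unfolding v using \<tau> by simp_all
	qed simp
qed

text \<open>A pencil has a constant syzygy, so the partial derivatives are not minimal generators of the
	Jacobian ideal: it is a complete intersection of two quartics.\<close>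

lemma Der_add: "Der (r + s) f = Der r f + Der s f" and Der_scale: "Der (p *s r) f = p * Der r f"
	by (simp_all add: Der_def algebra_simps)

lemma pencil_resolution:
	assumes f: "f \<in> homog 5" and D: "dt a b e \<noteq> 0" and B: "AR_basis f 0 (recon a b e 0 0 1) 4 \<rho>"
	shows "milnor_resolution f 5 [4, 4] [8] [] (\<lambda>j. if j = 0 then Der (recon a b e 1 0 0) f else Der (recon a b e 0 1 0) f)
		(\<lambda>_ i. if i = 0 then ldot a \<rho> else if i = 1 then ldot b \<rho> else 0) (\<lambda>_ _. 0)"
proof
	let ?e0 = "recon a b e 1 0 0" and ?e1 = "recon a b e 0 1 0" and ?e2 = "recon a b e 0 0 1"
	let ?g = "\<lambda>j::nat. if j = 0 then Der ?e0 f else Der ?e1 f"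
	let ?R = "\<lambda>(_::nat) i::nat. if i = 0 then ldot a \<rho> else if i = 1 then ldot b \<rho> else 0"
	let ?b1 = "[4, 4] :: int list" and ?b2 = "[8] :: int list"
	note gen = AR_basisD(3)[OF B] and ind = AR_basisD(4)[OF B]
	have \<rho>h: "\<rho> $ i \<in> homog 4" for i using AR_basisD(2)[OF B] by simp
	have "1 *s ?e2 + 0 *s \<rho> = ?e2" by simp
	then have e2: "Der ?e2 f = 0" unfolding gen by (intro exI) (rule sym)
	have split: "recon a b e g1 g2 g3 = g1 *s ?e0 + g2 *s ?e1 + g3 *s ?e2" for g1 g2 g3
		using recon_linear3[of a b e g1 1 g2 0 g3 0 0 1 0 0 0 1] by simp
	have Der_split: "Der (recon a b e g1 g2 g3) f = g1 * Der ?e0 f + g2 * Der ?e1 f" for g1 g2 g3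
		unfolding split[of g1 g2 g3] Der_add Der_scale e2 by simp
	have Dhom: "Der (recon a b e g1 g2 g3) f \<in> homog 4" if "g1 \<in> homog 0" "g2 \<in> homog 0" "g3 \<in> homog 0" for g1 g2 g3
		unfolding Der_def using recon_homogeneous[OF that] pd_homogeneous[OF f]
		by (intro homogeneous_add hom_mult[of _ 0 _ 4]) auto
	have one: "(1 :: S) \<in> homog 0" using homogeneous_Const[of 1] by simp
	show "f \<in> homog 5" by (rule f)
	show "?g j \<in> homog (?b1 ! j)" if "j < length ?b1" for j
		using that one by (auto simp: less_Suc_eq Dhom)
	show "jac f = {(\<Sum>j<length ?b1. v j * ?g j) | v. True}"
	proof (intro subset_antisym subsetI)
		fix p assume "p \<in> jac f"
		then obtain v where v: "p = Der (fun_vec v) f" unfolding jac_partials partials_sum by (elim CollectE exE conjE)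
		have "p = ldot a (fun_vec v) * Der ?e0 f + ldot b (fun_vec v) * Der ?e1 f"
			unfolding v using Der_split[of "ldot a (fun_vec v)" "ldot b (fun_vec v)" "ldot e (fun_vec v)"] unfolding recon_ldot[OF D] .
		then have "p = (\<Sum>j<length ?b1. (if j = 0 then ldot a (fun_vec v) else ldot b (fun_vec v)) * ?g j)" by simp
		then show "p \<in> {(\<Sum>j<length ?b1. v j * ?g j) | v. True}" by (intro CollectI exI conjI TrueI)
	next
		fix p assume "p \<in> {(\<Sum>j<length ?b1. v j * ?g j) | v. True}"
		then obtain v where v: "p = (\<Sum>j<length ?b1. v j * ?g j)" by (elim CollectE exE conjE)
		have "p = Der (recon a b e (v 0) (v 1) 0) f" unfolding v Der_split[of "v 0" "v 1" 0] by simp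
		then have "p = (\<Sum>j<3. vec_fun (recon a b e (v 0) (v 1) 0) j * partials f j)" unfolding partials_sum fun_vec_inverse .
		then show "p \<in> jac f" unfolding jac_partials by (intro CollectI exI conjI TrueI)
	qed
	have ldh: "ldot x \<rho> \<in> homog 4" for x unfolding ldot_def by (intro homogeneous_add homogeneous_Const_mult \<rho>h)
	show "?R j \<in> piece (free_mod ?b1) (?b2 ! j)" if "j < length ?b2" for j
		using that ldh by (auto simp: free_mod_piece less_Suc_eq)
	have R: "matrix_map (length ?b2) ?R w = (\<lambda>i. w 0 * ?R 0 i)" for w by (auto simp: matrix_map_def)
	have z0: "ldot a ?e2 = 0" "ldot b ?e2 = 0" using ldot_recon[OF D] by simp_all
	show "(\<Sum>j<length ?b1. v j * ?g j) = 0 \<longleftrightarrow> v \<in> matrix_map (length ?b2) ?R ` FM ?b2"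
		if v: "v \<in> FM ?b1" for v
	proof
		assume "(\<Sum>j<length ?b1. v j * ?g j) = 0"
		then have "Der (recon a b e (v 0) (v 1) 0) f = 0" unfolding Der_split[of "v 0" "v 1" 0] by simp
		then obtain p q where pq: "recon a b e (v 0) (v 1) 0 = p *s ?e2 + q *s \<rho>" unfolding gen by (elim exE)
		have 0: "v 0 = q * ldot a \<rho>" using arg_cong[OF pq, of "ldot a"] unfolding ldot_recon[OF D] ldot_linear z0 by simp
		have 1: "v 1 = q * ldot b \<rho>" using arg_cong[OF pq, of "ldot b"] unfolding ldot_recon[OF D] ldot_linear z0 by simp
		have "v = matrix_map (length ?b2) ?R (single_vec 0 q)"
		proof (rule fun_eq_2)
			show "v 0 = matrix_map (length ?b2) ?R (single_vec 0 q) 0" "v 1 = matrix_map (length ?b2) ?R (single_vec 0 q) 1"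
				unfolding R 0 1 by (simp_all add: single_vec_def)
			show "v i = matrix_map (length ?b2) ?R (single_vec 0 q) i" if "2 \<le> i" for i
				unfolding R using v that by simp
		qed
		moreover have "single_vec 0 q \<in> FM ?b2" by (simp add: single_vec_def)
		ultimately show "v \<in> matrix_map (length ?b2) ?R ` FM ?b2" by (rule image_eqI)
	next
		assume "v \<in> matrix_map (length ?b2) ?R ` FM ?b2"
		then obtain w where w: "v = (\<lambda>i. w 0 * ?R 0 i)" unfolding R by (elim imageE)
		have "(\<Sum>j<length ?b1. v j * ?g j) = Der (recon a b e (v 0) (v 1) (w 0 * ldot e \<rho>)) f"
			unfolding Der_split[of "v 0" "v 1" "w 0 * ldot e \<rho>"] by simp
		also have "recon a b e (v 0) (v 1) (w 0 * ldot e \<rho>) = w 0 *s recon a b e (ldot a \<rho>) (ldot b \<rho>) (ldot e \<rho>)"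
			unfolding w recon_def vec_eq_iff by (simp add: algebra_simps)
		also have "\<dots> = 0 *s ?e2 + w 0 *s \<rho>" unfolding recon_ldot[OF D] by simp
		also have "Der \<dots> f = 0" unfolding gen by (intro exI) (rule refl)
		finally show "(\<Sum>j<length ?b1. v j * ?g j) = 0" .
	qed
	show "matrix_map (length ?b2) ?R v = (\<lambda>_. 0) \<longleftrightarrow>
			v \<in> matrix_map (length ([] :: int list)) (\<lambda>_ _. 0) ` FM []" if v: "v \<in> FM ?b2" for v
	proof -
		have "v = (\<lambda>_. 0)" if z: "matrix_map (length ?b2) ?R v = (\<lambda>_. 0)"
		proof -
			have v0: "v 0 * ldot a \<rho> = 0" "v 0 * ldot b \<rho> = 0"
				using fun_cong[OF z, of 0] fun_cong[OF z, of 1] unfolding R by simp_all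
			have "v 0 *s \<rho> = recon a b e (v 0 * ldot a \<rho>) (v 0 * ldot b \<rho>) (v 0 * ldot e \<rho>)"
				using recon_ldot[OF D, of "v 0 *s \<rho>"] unfolding ldot_linear by (rule sym)
			also have "\<dots> = (v 0 * ldot e \<rho>) *s ?e2" unfolding v0 split[of 0 0 "v 0 * ldot e \<rho>"] by simp
			finally have "(- (v 0 * ldot e \<rho>)) *s ?e2 + v 0 *s \<rho> = 0" by (simp add: vec_eq_iff)
			then have "v 0 = 0" using ind by blast
			moreover have "v i = 0" if "1 \<le> i" for i using v that by simp
			ultimately show ?thesis by (intro fun_eq_2) simp_all
		qed
		moreover have "matrix_map (length ?b2) ?R (\<lambda>_. 0) = (\<lambda>_. 0)" unfolding R by simp
		ultimately show ?thesis by (auto simp: matrix_map_def)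
	qed
qed auto

lemma invariants_16:
	assumes f: "f \<in> homog 5" and D: "dt a b e \<noteq> 0" and B: "AR_basis f 0 (recon a b e 0 0 1) 4 \<rho>" and \<tau>: "tjurina f = 16"
	shows "milnor_st f = 6" "milnor_reg f = 6"
proof -
	interpret R: milnor_resolution f 5 "[4, 4]" "[8]" "[]" "\<lambda>j. if j = 0 then Der (recon a b e 1 0 0) f else Der (recon a b e 0 1 0) f"
		"\<lambda>_ i. if i = 0 then ldot a \<rho> else if i = 1 then ldot b \<rho> else 0" "\<lambda>_ _. 0" by (rule pencil_resolution[OF f D B])
	have h: "R.hdim k = int (hilb k) - 2 * int (hilb (k - 4)) + int (hilb (k - 8))" for k
		unfolding R.hdim_def by simp
	show "milnor_reg f = 6" unfolding R.regularity by simp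
	show "milnor_st f = 6"
	proof (rule R.st_eq)
		fix k :: int assume k: "int 6 \<le> k"
		have "2 * R.hdim k = 32" unfolding h
			using hilb_double[of k] hilb_double[of "k - 4"] hilb_double[of "k - 8"] k
			by (simp add: algebra_simps)
		then show "R.hdim k = int (tjurina f)" using \<tau> by simp
	next
		have v: "R.hdim (int 6 - 1) = 15" unfolding h by (simp add: hilb_values)
		show "R.hdim (int 6 - 1) \<noteq> int (tjurina f)" "0 \<le> R.hdim (int 6 - 1)" unfolding v using \<tau> by simp_all
	qed simp
qed

section \<open>The combinatorial types of five lines\<close>

lemma dt_zero_perm: "dt x z y = 0 \<longleftrightarrow> dt x y z = 0" "dt y z x = 0 \<longleftrightarrow> dt x y z = 0"
	using dt_perm[of x y z] by auto

lemma tri_perm: "tri a i k j = 0 \<longleftrightarrow> tri a i j k = 0" "tri a j k i = 0 \<longleftrightarrow> tri a i j k = 0"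
	by (rule dt_zero_perm)+

text \<open>Two distinct lines through the node of \<open>x\<close> and \<open>y\<close> meet in that node, so whether \<open>w\<close> passes
	through it can be tested on either pair.\<close>

lemma dt_same_node:
	assumes xy: "cr x y \<noteq> 0" and uv: "cr u v \<noteq> 0" and u: "dt x y u = 0" and v: "dt x y v = 0"
	shows "dt u v w = 0 \<longleftrightarrow> dt x y w = 0"
proof -
	obtain s t where s: "u = s *s x + t *s y" using dependent_span[OF xy u] .
	obtain s' t' where s': "v = s' *s x + t' *s y" using dependent_span[OF xy v] .
	have c: "cr u v = (s * t' - s' * t) *s cr x y" unfolding s s' by (simp add: vec3_eq_iff algebra_simps)
	then have "s * t' - s' * t \<noteq> 0" using uv by auto
	moreover have "dt u v w = (s * t' - s' * t) * dt x y w" unfolding s s' dt_expand by (simp add: algebra_simps)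
	ultimately show ?thesis by simp
qed

definition zbit :: "complex => nat" where "zbit z = (if z = 0 then 1 else 0)"

lemma zbitI: "z = 0 ==> zbit z = 1" "z \<noteq> 0 ==> zbit z = 0"
	by (simp_all add: zbit_def)

lemma card_on_node: "card (on_node 5 a i j) = (\<Sum>k<5. zbit (tri a i j k))"
proof -
	have "on_node 5 a i j = {k \<in> {..<5}. tri a i j k = 0}" by (auto simp: on_node_def)
	then show ?thesis by (simp add: zbit_def sum.If_cases Int_def)
qed

lemma zbit_perm: "zbit (dt x z y) = zbit (dt x y z)" "zbit (dt y z x) = zbit (dt x y z)" "zbit 0 = 1"
	unfolding zbit_def dt_zero_perm(1)[of x z y] dt_zero_perm(2)[of y z x] by simp_all

text \<open>Each pair of lines contributes the weight of its node, whose multiplicity is two plus the number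
	of further lines concurrent with the pair.\<close>

lemma tjurina_five:
	assumes "arr 5 a" "c \<noteq> 0"
	shows "real (tjurina (quintic c a)) =
		node_weight (2 + zbit (tri a 0 1 2) + zbit (tri a 0 1 3) + zbit (tri a 0 1 4)) +
		node_weight (2 + zbit (tri a 0 1 2) + zbit (tri a 0 2 3) + zbit (tri a 0 2 4)) +
		node_weight (2 + zbit (tri a 0 1 3) + zbit (tri a 0 2 3) + zbit (tri a 0 3 4)) +
		node_weight (2 + zbit (tri a 0 1 4) + zbit (tri a 0 2 4) + zbit (tri a 0 3 4)) +
		node_weight (2 + zbit (tri a 0 1 2) + zbit (tri a 1 2 3) + zbit (tri a 1 2 4)) +
		node_weight (2 + zbit (tri a 0 1 3) + zbit (tri a 1 2 3) + zbit (tri a 1 3 4)) +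
		node_weight (2 + zbit (tri a 0 1 4) + zbit (tri a 1 2 4) + zbit (tri a 1 3 4)) +
		node_weight (2 + zbit (tri a 0 2 3) + zbit (tri a 1 2 3) + zbit (tri a 2 3 4)) +
		node_weight (2 + zbit (tri a 0 2 4) + zbit (tri a 1 2 4) + zbit (tri a 2 3 4)) +
		node_weight (2 + zbit (tri a 0 3 4) + zbit (tri a 1 3 4) + zbit (tri a 2 3 4))"
proof -
	have P: "pairs {..<5} = {(0, 1), (0, 2), (0, 3), (0, 4), (1, 2), (1, 3), (1, 4), (2, 3), (2, 4), (3, 4)}"
	proof (intro subset_antisym subsetI)
		fix x assume "x \<in> pairs {..<5}"
		then obtain i j where x: "x = (i, j)" "i < j" "j < 5" unfolding pairs_def by auto
		from x(3) consider "j = 0" | "j = 1" | "j = 2" | "j = 3" | "j = 4" by linarith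
		then show "x \<in> {(0, 1), (0, 2), (0, 3), (0, 4), (1, 2), (1, 3), (1, 4), (2, 3), (2, 4), (3, 4)}"
			by cases (use x(2) in \<open>auto simp: x(1) less_Suc_eq numeral_eq_Suc\<close>)
	qed (auto simp: pairs_def)
	have n01: "card (on_node 5 a 0 1) = 2 + zbit (tri a 0 1 2) + zbit (tri a 0 1 3) + zbit (tri a 0 1 4)"
		unfolding card_on_node lessThan_5 by (simp add: zbit_perm(3) del: One_nat_def)
	have n02: "card (on_node 5 a 0 2) = 2 + zbit (tri a 0 1 2) + zbit (tri a 0 2 3) + zbit (tri a 0 2 4)"
		unfolding card_on_node lessThan_5 by (simp add: zbit_perm(3) zbit_perm(1)[of "a 0" "a 2" "a 1"] del: One_nat_def)
	have n03: "card (on_node 5 a 0 3) = 2 + zbit (tri a 0 1 3) + zbit (tri a 0 2 3) + zbit (tri a 0 3 4)"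
		unfolding card_on_node lessThan_5 by (simp add: zbit_perm(3) zbit_perm(1)[of "a 0" "a 3" "a 1"] zbit_perm(1)[of "a 0" "a 3" "a 2"] del: One_nat_def)
	have n04: "card (on_node 5 a 0 4) = 2 + zbit (tri a 0 1 4) + zbit (tri a 0 2 4) + zbit (tri a 0 3 4)"
		unfolding card_on_node lessThan_5 by (simp add: zbit_perm(3) zbit_perm(1)[of "a 0" "a 4" "a 1"] zbit_perm(1)[of "a 0" "a 4" "a 2"] zbit_perm(1)[of "a 0" "a 4" "a 3"] del: One_nat_def)
	have n12: "card (on_node 5 a 1 2) = 2 + zbit (tri a 0 1 2) + zbit (tri a 1 2 3) + zbit (tri a 1 2 4)"
		unfolding card_on_node lessThan_5 by (simp add: zbit_perm(3) zbit_perm(2)[of "a 1" "a 2" "a 0"] del: One_nat_def)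
	have n13: "card (on_node 5 a 1 3) = 2 + zbit (tri a 0 1 3) + zbit (tri a 1 2 3) + zbit (tri a 1 3 4)"
		unfolding card_on_node lessThan_5 by (simp add: zbit_perm(3) zbit_perm(2)[of "a 1" "a 3" "a 0"] zbit_perm(1)[of "a 1" "a 3" "a 2"] del: One_nat_def)
	have n14: "card (on_node 5 a 1 4) = 2 + zbit (tri a 0 1 4) + zbit (tri a 1 2 4) + zbit (tri a 1 3 4)"
		unfolding card_on_node lessThan_5 by (simp add: zbit_perm(3) zbit_perm(2)[of "a 1" "a 4" "a 0"] zbit_perm(1)[of "a 1" "a 4" "a 2"] zbit_perm(1)[of "a 1" "a 4" "a 3"] del: One_nat_def)
	have n23: "card (on_node 5 a 2 3) = 2 + zbit (tri a 0 2 3) + zbit (tri a 1 2 3) + zbit (tri a 2 3 4)"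
		unfolding card_on_node lessThan_5 by (simp add: zbit_perm(3) zbit_perm(2)[of "a 2" "a 3" "a 0"] zbit_perm(2)[of "a 2" "a 3" "a 1"] del: One_nat_def)
	have n24: "card (on_node 5 a 2 4) = 2 + zbit (tri a 0 2 4) + zbit (tri a 1 2 4) + zbit (tri a 2 3 4)"
		unfolding card_on_node lessThan_5 by (simp add: zbit_perm(3) zbit_perm(2)[of "a 2" "a 4" "a 0"] zbit_perm(2)[of "a 2" "a 4" "a 1"] zbit_perm(1)[of "a 2" "a 4" "a 3"] del: One_nat_def)
	have n34: "card (on_node 5 a 3 4) = 2 + zbit (tri a 0 3 4) + zbit (tri a 1 3 4) + zbit (tri a 2 3 4)"
		unfolding card_on_node lessThan_5 by (simp add: zbit_perm(3) zbit_perm(2)[of "a 3" "a 4" "a 0"] zbit_perm(2)[of "a 3" "a 4" "a 1"] zbit_perm(2)[of "a 3" "a 4" "a 2"] del: One_nat_def)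
	show ?thesis unfolding tjurina_prod[OF assms] P
		by (simp add: n01 n02 n03 n04 n12 n13 n14 n23 n24 n34 del: One_nat_def)
qed

lemma node_weights: "node_weight 2 = 1" "node_weight (Suc (Suc 0)) = 1" "node_weight (Suc (Suc (Suc 0))) = 4 / 3"
	"node_weight (Suc (Suc (Suc (Suc 0)))) = 3 / 2" "node_weight (Suc (Suc (Suc (Suc (Suc 0))))) = 8 / 5" "node_weight 3 = 4 / 3" "node_weight 4 = 3 / 2" "node_weight 5 = 8 / 5"
	by (simp_all add: node_weight_def numeral_eq_Suc binomial_Suc_n)

text \<open>The five combinatorial types, each with a fixed numbering of its lines: one quintuple point; a
	quadruple point on lines 1, 2, 3, 4; two triple points on the common line 0; one triple point on lines
	1, 2, 3; double points only. Concurrences that follow from the listed ones are left out.\<close>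

definition pencil :: "(nat => complex^3) => bool" where
	"pencil a \<longleftrightarrow> arr 5 a \<and> tri a 0 1 2 = 0 \<and> tri a 0 1 3 = 0 \<and> tri a 0 1 4 = 0"

definition near_pencil :: "(nat => complex^3) => bool" where
	"near_pencil a \<longleftrightarrow> arr 5 a \<and> tri a 1 2 3 = 0 \<and> tri a 1 2 4 = 0 \<and> tri a 0 1 2 \<noteq> 0"

definition two_triple :: "(nat => complex^3) => bool" where
	"two_triple a \<longleftrightarrow> arr 5 a \<and> tri a 0 1 2 = 0 \<and> tri a 0 3 4 = 0 \<and> tri a 1 2 3 \<noteq> 0"

definition one_triple :: "(nat => complex^3) => bool" where
	"one_triple a \<longleftrightarrow> arr 5 a \<and> tri a 1 2 3 = 0 \<and> tri a 0 1 2 \<noteq> 0 \<and> tri a 1 2 4 \<noteq> 0 \<and>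
		 tri a 0 1 4 \<noteq> 0 \<and> tri a 0 2 4 \<noteq> 0 \<and> tri a 0 3 4 \<noteq> 0"

definition no_triple :: "(nat => complex^3) => bool" where
	"no_triple a \<longleftrightarrow> arr 5 a \<and> tri a 0 1 2 \<noteq> 0 \<and> tri a 0 1 3 \<noteq> 0 \<and> tri a 0 1 4 \<noteq> 0 \<and> tri a 0 2 3 \<noteq> 0 \<and> tri a 0 2 4 \<noteq> 0 \<and> tri a 0 3 4 \<noteq> 0 \<and> tri a 1 2 3 \<noteq> 0 \<and> tri a 1 2 4 \<noteq> 0 \<and> tri a 1 3 4 \<noteq> 0 \<and> tri a 2 3 4 \<noteq> 0"

lemma pencil_triples:
	assumes a: "pencil a"
	shows "tri a 0 1 2 = 0" "tri a 0 1 3 = 0" "tri a 0 1 4 = 0" "tri a 0 2 3 = 0" "tri a 0 2 4 = 0" "tri a 0 3 4 = 0" "tri a 1 2 3 = 0" "tri a 1 2 4 = 0" "tri a 1 3 4 = 0" "tri a 2 3 4 = 0"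
proof -
	note A = a[unfolded pencil_def]
	have arr: "arr 5 a" using A ..
	note np = arrD(2)[OF arr]
	have d012: "tri a 0 1 2 = 0" using A by simp
	have d013: "tri a 0 1 3 = 0" using A by simp
	have d014: "tri a 0 1 4 = 0" using A by simp
	have zp0: "tri a 0 1 0 = 0" by simp
	have zp1: "tri a 0 1 1 = 0" by simp
	have zp2: "tri a 0 1 2 = 0" using A tri_perm(1)[of a 0 1 2] tri_perm(2)[of a 0 1 2] by simp
	have zp3: "tri a 0 1 3 = 0" using A tri_perm(1)[of a 0 1 3] tri_perm(2)[of a 0 1 3] by simp
	have zp4: "tri a 0 1 4 = 0" using A tri_perm(1)[of a 0 1 4] tri_perm(2)[of a 0 1 4] by simp
	have np02: "dt (a 0) (a 2) w = 0 \<longleftrightarrow> dt (a 0) (a 1) w = 0" for w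
		by (rule dt_same_node[OF np np zp0 zp2]) simp_all
	have np03: "dt (a 0) (a 3) w = 0 \<longleftrightarrow> dt (a 0) (a 1) w = 0" for w
		by (rule dt_same_node[OF np np zp0 zp3]) simp_all
	have np04: "dt (a 0) (a 4) w = 0 \<longleftrightarrow> dt (a 0) (a 1) w = 0" for w
		by (rule dt_same_node[OF np np zp0 zp4]) simp_all
	have np12: "dt (a 1) (a 2) w = 0 \<longleftrightarrow> dt (a 0) (a 1) w = 0" for w
		by (rule dt_same_node[OF np np zp1 zp2]) simp_all
	have np13: "dt (a 1) (a 3) w = 0 \<longleftrightarrow> dt (a 0) (a 1) w = 0" for w
		by (rule dt_same_node[OF np np zp1 zp3]) simp_all
	have np14: "dt (a 1) (a 4) w = 0 \<longleftrightarrow> dt (a 0) (a 1) w = 0" for w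
		by (rule dt_same_node[OF np np zp1 zp4]) simp_all
	have np23: "dt (a 2) (a 3) w = 0 \<longleftrightarrow> dt (a 0) (a 1) w = 0" for w
		by (rule dt_same_node[OF np np zp2 zp3]) simp_all
	have np24: "dt (a 2) (a 4) w = 0 \<longleftrightarrow> dt (a 0) (a 1) w = 0" for w
		by (rule dt_same_node[OF np np zp2 zp4]) simp_all
	have np34: "dt (a 3) (a 4) w = 0 \<longleftrightarrow> dt (a 0) (a 1) w = 0" for w
		by (rule dt_same_node[OF np np zp3 zp4]) simp_all
	have d023: "tri a 0 2 3 = 0"
		using np02[of "a 3"] d013  by simp
	have d024: "tri a 0 2 4 = 0"
		using np02[of "a 4"] d014  by simp
	have d034: "tri a 0 3 4 = 0"
		using np03[of "a 4"] d014  by simp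
	have d123: "tri a 1 2 3 = 0"
		using np12[of "a 3"] d013  by simp
	have d124: "tri a 1 2 4 = 0"
		using np12[of "a 4"] d014  by simp
	have d134: "tri a 1 3 4 = 0"
		using np13[of "a 4"] d014  by simp
	have d234: "tri a 2 3 4 = 0"
		using np23[of "a 4"] d014  by simp
	show "tri a 0 1 2 = 0" "tri a 0 1 3 = 0" "tri a 0 1 4 = 0" "tri a 0 2 3 = 0" "tri a 0 2 4 = 0" "tri a 0 3 4 = 0" "tri a 1 2 3 = 0" "tri a 1 2 4 = 0" "tri a 1 3 4 = 0" "tri a 2 3 4 = 0"
		by (fact d012 d013 d014 d023 d024 d034 d123 d124 d134 d234)+
qed

lemma tjurina_pencil:
	assumes a: "pencil a" and c: "c \<noteq> 0"
	shows "tjurina (quintic c a) = 16"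
proof -
	have arr: "arr 5 a" using a by (simp add: pencil_def)
	note T = pencil_triples[OF a]
	have "real (tjurina (quintic c a)) = 16"
		unfolding tjurina_five[OF arr c] zbitI(1)[OF T(1)] zbitI(1)[OF T(2)] zbitI(1)[OF T(3)] zbitI(1)[OF T(4)] zbitI(1)[OF T(5)] zbitI(1)[OF T(6)] zbitI(1)[OF T(7)] zbitI(1)[OF T(8)] zbitI(1)[OF T(9)] zbitI(1)[OF T(10)]
		by (simp add: node_weights)
	then show ?thesis by linarith
qed

lemma near_pencil_triples:
	assumes a: "near_pencil a"
	shows "tri a 0 1 2 \<noteq> 0" "tri a 0 1 3 \<noteq> 0" "tri a 0 1 4 \<noteq> 0" "tri a 0 2 3 \<noteq> 0" "tri a 0 2 4 \<noteq> 0" "tri a 0 3 4 \<noteq> 0" "tri a 1 2 3 = 0" "tri a 1 2 4 = 0" "tri a 1 3 4 = 0" "tri a 2 3 4 = 0"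
proof -
	note A = a[unfolded near_pencil_def]
	have arr: "arr 5 a" using A ..
	note np = arrD(2)[OF arr]
	have d123: "tri a 1 2 3 = 0" using A by simp
	have d124: "tri a 1 2 4 = 0" using A by simp
	have d012: "tri a 0 1 2 \<noteq> 0" using A by simp
	have zp1: "tri a 1 2 1 = 0" by simp
	have zp2: "tri a 1 2 2 = 0" by simp
	have zp3: "tri a 1 2 3 = 0" using A tri_perm(1)[of a 1 2 3] tri_perm(2)[of a 1 2 3] by simp
	have zp4: "tri a 1 2 4 = 0" using A tri_perm(1)[of a 1 2 4] tri_perm(2)[of a 1 2 4] by simp
	have np13: "dt (a 1) (a 3) w = 0 \<longleftrightarrow> dt (a 1) (a 2) w = 0" for w
		by (rule dt_same_node[OF np np zp1 zp3]) simp_all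
	have np14: "dt (a 1) (a 4) w = 0 \<longleftrightarrow> dt (a 1) (a 2) w = 0" for w
		by (rule dt_same_node[OF np np zp1 zp4]) simp_all
	have np23: "dt (a 2) (a 3) w = 0 \<longleftrightarrow> dt (a 1) (a 2) w = 0" for w
		by (rule dt_same_node[OF np np zp2 zp3]) simp_all
	have np24: "dt (a 2) (a 4) w = 0 \<longleftrightarrow> dt (a 1) (a 2) w = 0" for w
		by (rule dt_same_node[OF np np zp2 zp4]) simp_all
	have np34: "dt (a 3) (a 4) w = 0 \<longleftrightarrow> dt (a 1) (a 2) w = 0" for w
		by (rule dt_same_node[OF np np zp3 zp4]) simp_all
	have d134: "tri a 1 3 4 = 0"
		using np13[of "a 4"] d124  by simp
	have d234: "tri a 2 3 4 = 0"
		using np23[of "a 4"] d124  by simp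
	have d013: "tri a 0 1 3 \<noteq> 0"
		using np13[of "a 0"] d012 tri_perm(2)[of a 1 3 0] tri_perm(2)[of a 1 2 0] by simp
	have d014: "tri a 0 1 4 \<noteq> 0"
		using np14[of "a 0"] d012 tri_perm(2)[of a 1 4 0] tri_perm(2)[of a 1 2 0] by simp
	have d023: "tri a 0 2 3 \<noteq> 0"
		using np23[of "a 0"] d012 tri_perm(2)[of a 2 3 0] tri_perm(2)[of a 1 2 0] by simp
	have d024: "tri a 0 2 4 \<noteq> 0"
		using np24[of "a 0"] d012 tri_perm(2)[of a 2 4 0] tri_perm(2)[of a 1 2 0] by simp
	have d034: "tri a 0 3 4 \<noteq> 0"
		using np34[of "a 0"] d012 tri_perm(2)[of a 3 4 0] tri_perm(2)[of a 1 2 0] by simp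
	show "tri a 0 1 2 \<noteq> 0" "tri a 0 1 3 \<noteq> 0" "tri a 0 1 4 \<noteq> 0" "tri a 0 2 3 \<noteq> 0" "tri a 0 2 4 \<noteq> 0" "tri a 0 3 4 \<noteq> 0" "tri a 1 2 3 = 0" "tri a 1 2 4 = 0" "tri a 1 3 4 = 0" "tri a 2 3 4 = 0"
		by (fact d012 d013 d014 d023 d024 d034 d123 d124 d134 d234)+
qed

lemma tjurina_near_pencil:
	assumes a: "near_pencil a" and c: "c \<noteq> 0"
	shows "tjurina (quintic c a) = 13"
proof -
	have arr: "arr 5 a" using a by (simp add: near_pencil_def)
	note T = near_pencil_triples[OF a]
	have "real (tjurina (quintic c a)) = 13"
		unfolding tjurina_five[OF arr c] zbitI(2)[OF T(1)] zbitI(2)[OF T(2)] zbitI(2)[OF T(3)] zbitI(2)[OF T(4)] zbitI(2)[OF T(5)] zbitI(2)[OF T(6)] zbitI(1)[OF T(7)] zbitI(1)[OF T(8)] zbitI(1)[OF T(9)] zbitI(1)[OF T(10)]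
		by (simp add: node_weights)
	then show ?thesis by linarith
qed

lemma two_triple_triples:
	assumes a: "two_triple a"
	shows "tri a 0 1 2 = 0" "tri a 0 1 3 \<noteq> 0" "tri a 0 1 4 \<noteq> 0" "tri a 0 2 3 \<noteq> 0" "tri a 0 2 4 \<noteq> 0" "tri a 0 3 4 = 0" "tri a 1 2 3 \<noteq> 0" "tri a 1 2 4 \<noteq> 0" "tri a 1 3 4 \<noteq> 0" "tri a 2 3 4 \<noteq> 0"
proof -
	note A = a[unfolded two_triple_def]
	have arr: "arr 5 a" using A ..
	note np = arrD(2)[OF arr]
	have d012: "tri a 0 1 2 = 0" using A by simp
	have d034: "tri a 0 3 4 = 0" using A by simp
	have d123: "tri a 1 2 3 \<noteq> 0" using A by simp
	have zp0: "tri a 1 2 0 = 0" using A tri_perm(1)[of a 1 2 0] tri_perm(2)[of a 1 2 0] by simp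
	have zp1: "tri a 1 2 1 = 0" by simp
	have zp2: "tri a 1 2 2 = 0" by simp
	have np01: "dt (a 0) (a 1) w = 0 \<longleftrightarrow> dt (a 1) (a 2) w = 0" for w
		by (rule dt_same_node[OF np np zp0 zp1]) simp_all
	have np02: "dt (a 0) (a 2) w = 0 \<longleftrightarrow> dt (a 1) (a 2) w = 0" for w
		by (rule dt_same_node[OF np np zp0 zp2]) simp_all
	have zq0: "tri a 0 3 0 = 0" by simp
	have zq3: "tri a 0 3 3 = 0" by simp
	have zq4: "tri a 0 3 4 = 0" using A tri_perm(1)[of a 0 3 4] tri_perm(2)[of a 0 3 4] by simp
	have nq04: "dt (a 0) (a 4) w = 0 \<longleftrightarrow> dt (a 0) (a 3) w = 0" for w
		by (rule dt_same_node[OF np np zq0 zq4]) simp_all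
	have nq34: "dt (a 3) (a 4) w = 0 \<longleftrightarrow> dt (a 0) (a 3) w = 0" for w
		by (rule dt_same_node[OF np np zq3 zq4]) simp_all
	have d013: "tri a 0 1 3 \<noteq> 0"
		using np01[of "a 3"] d123  by simp
	have d023: "tri a 0 2 3 \<noteq> 0"
		using np02[of "a 3"] d123  by simp
	have d014: "tri a 0 1 4 \<noteq> 0"
		using nq04[of "a 1"] d013 tri_perm(1)[of a 0 4 1] tri_perm(1)[of a 0 3 1] by simp
	have d024: "tri a 0 2 4 \<noteq> 0"
		using nq04[of "a 2"] d023 tri_perm(1)[of a 0 4 2] tri_perm(1)[of a 0 3 2] by simp
	have d134: "tri a 1 3 4 \<noteq> 0"
		using nq34[of "a 1"] d013 tri_perm(2)[of a 3 4 1] tri_perm(1)[of a 0 3 1] by simp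
	have d234: "tri a 2 3 4 \<noteq> 0"
		using nq34[of "a 2"] d023 tri_perm(2)[of a 3 4 2] tri_perm(1)[of a 0 3 2] by simp
	have d124: "tri a 1 2 4 \<noteq> 0"
		using np01[of "a 4"] d014 by simp
	show "tri a 0 1 2 = 0" "tri a 0 1 3 \<noteq> 0" "tri a 0 1 4 \<noteq> 0" "tri a 0 2 3 \<noteq> 0" "tri a 0 2 4 \<noteq> 0" "tri a 0 3 4 = 0" "tri a 1 2 3 \<noteq> 0" "tri a 1 2 4 \<noteq> 0" "tri a 1 3 4 \<noteq> 0" "tri a 2 3 4 \<noteq> 0"
		by (fact d012 d013 d014 d023 d024 d034 d123 d124 d134 d234)+
qed

lemma tjurina_two_triple:
	assumes a: "two_triple a" and c: "c \<noteq> 0"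
	shows "tjurina (quintic c a) = 12"
proof -
	have arr: "arr 5 a" using a by (simp add: two_triple_def)
	note T = two_triple_triples[OF a]
	have "real (tjurina (quintic c a)) = 12"
		unfolding tjurina_five[OF arr c] zbitI(1)[OF T(1)] zbitI(2)[OF T(2)] zbitI(2)[OF T(3)] zbitI(2)[OF T(4)] zbitI(2)[OF T(5)] zbitI(1)[OF T(6)] zbitI(2)[OF T(7)] zbitI(2)[OF T(8)] zbitI(2)[OF T(9)] zbitI(2)[OF T(10)]
		by (simp add: node_weights)
	then show ?thesis by linarith
qed

lemma one_triple_triples:
	assumes a: "one_triple a"
	shows "tri a 0 1 2 \<noteq> 0" "tri a 0 1 3 \<noteq> 0" "tri a 0 1 4 \<noteq> 0" "tri a 0 2 3 \<noteq> 0" "tri a 0 2 4 \<noteq> 0" "tri a 0 3 4 \<noteq> 0" "tri a 1 2 3 = 0" "tri a 1 2 4 \<noteq> 0" "tri a 1 3 4 \<noteq> 0" "tri a 2 3 4 \<noteq> 0"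
proof -
	note A = a[unfolded one_triple_def]
	have arr: "arr 5 a" using A ..
	note np = arrD(2)[OF arr]
	have d123: "tri a 1 2 3 = 0" using A by simp
	have d012: "tri a 0 1 2 \<noteq> 0" using A by simp
	have d124: "tri a 1 2 4 \<noteq> 0" using A by simp
	have d014: "tri a 0 1 4 \<noteq> 0" using A by simp
	have d024: "tri a 0 2 4 \<noteq> 0" using A by simp
	have d034: "tri a 0 3 4 \<noteq> 0" using A by simp
	have zp1: "tri a 1 2 1 = 0" by simp
	have zp2: "tri a 1 2 2 = 0" by simp
	have zp3: "tri a 1 2 3 = 0" using A tri_perm(1)[of a 1 2 3] tri_perm(2)[of a 1 2 3] by simp
	have np13: "dt (a 1) (a 3) w = 0 \<longleftrightarrow> dt (a 1) (a 2) w = 0" for w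
		by (rule dt_same_node[OF np np zp1 zp3]) simp_all
	have np23: "dt (a 2) (a 3) w = 0 \<longleftrightarrow> dt (a 1) (a 2) w = 0" for w
		by (rule dt_same_node[OF np np zp2 zp3]) simp_all
	have d013: "tri a 0 1 3 \<noteq> 0"
		using np13[of "a 0"] d012 tri_perm(2)[of a 1 3 0] tri_perm(2)[of a 1 2 0] by simp
	have d023: "tri a 0 2 3 \<noteq> 0"
		using np23[of "a 0"] d012 tri_perm(2)[of a 2 3 0] tri_perm(2)[of a 1 2 0] by simp
	have d134: "tri a 1 3 4 \<noteq> 0"
		using np13[of "a 4"] d124  by simp
	have d234: "tri a 2 3 4 \<noteq> 0"
		using np23[of "a 4"] d124  by simp
	show "tri a 0 1 2 \<noteq> 0" "tri a 0 1 3 \<noteq> 0" "tri a 0 1 4 \<noteq> 0" "tri a 0 2 3 \<noteq> 0" "tri a 0 2 4 \<noteq> 0" "tri a 0 3 4 \<noteq> 0" "tri a 1 2 3 = 0" "tri a 1 2 4 \<noteq> 0" "tri a 1 3 4 \<noteq> 0" "tri a 2 3 4 \<noteq> 0"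
		by (fact d012 d013 d014 d023 d024 d034 d123 d124 d134 d234)+
qed

lemma tjurina_one_triple:
	assumes a: "one_triple a" and c: "c \<noteq> 0"
	shows "tjurina (quintic c a) = 11"
proof -
	have arr: "arr 5 a" using a by (simp add: one_triple_def)
	note T = one_triple_triples[OF a]
	have "real (tjurina (quintic c a)) = 11"
		unfolding tjurina_five[OF arr c] zbitI(2)[OF T(1)] zbitI(2)[OF T(2)] zbitI(2)[OF T(3)] zbitI(2)[OF T(4)] zbitI(2)[OF T(5)] zbitI(2)[OF T(6)] zbitI(1)[OF T(7)] zbitI(2)[OF T(8)] zbitI(2)[OF T(9)] zbitI(2)[OF T(10)]
		by (simp add: node_weights)
	then show ?thesis by linarith
qed

lemma no_triple_triples:
	assumes a: "no_triple a"
	shows "tri a 0 1 2 \<noteq> 0" "tri a 0 1 3 \<noteq> 0" "tri a 0 1 4 \<noteq> 0" "tri a 0 2 3 \<noteq> 0" "tri a 0 2 4 \<noteq> 0" "tri a 0 3 4 \<noteq> 0" "tri a 1 2 3 \<noteq> 0" "tri a 1 2 4 \<noteq> 0" "tri a 1 3 4 \<noteq> 0" "tri a 2 3 4 \<noteq> 0"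
proof -
	note A = a[unfolded no_triple_def]
	have arr: "arr 5 a" using A ..
	note np = arrD(2)[OF arr]
	have d012: "tri a 0 1 2 \<noteq> 0" using A by simp
	have d013: "tri a 0 1 3 \<noteq> 0" using A by simp
	have d014: "tri a 0 1 4 \<noteq> 0" using A by simp
	have d023: "tri a 0 2 3 \<noteq> 0" using A by simp
	have d024: "tri a 0 2 4 \<noteq> 0" using A by simp
	have d034: "tri a 0 3 4 \<noteq> 0" using A by simp
	have d123: "tri a 1 2 3 \<noteq> 0" using A by simp
	have d124: "tri a 1 2 4 \<noteq> 0" using A by simp
	have d134: "tri a 1 3 4 \<noteq> 0" using A by simp
	have d234: "tri a 2 3 4 \<noteq> 0" using A by simp
	show "tri a 0 1 2 \<noteq> 0" "tri a 0 1 3 \<noteq> 0" "tri a 0 1 4 \<noteq> 0" "tri a 0 2 3 \<noteq> 0" "tri a 0 2 4 \<noteq> 0" "tri a 0 3 4 \<noteq> 0" "tri a 1 2 3 \<noteq> 0" "tri a 1 2 4 \<noteq> 0" "tri a 1 3 4 \<noteq> 0" "tri a 2 3 4 \<noteq> 0"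
		by (fact d012 d013 d014 d023 d024 d034 d123 d124 d134 d234)+
qed

lemma tjurina_no_triple:
	assumes a: "no_triple a" and c: "c \<noteq> 0"
	shows "tjurina (quintic c a) = 10"
proof -
	have arr: "arr 5 a" using a by (simp add: no_triple_def)
	note T = no_triple_triples[OF a]
	have "real (tjurina (quintic c a)) = 10"
		unfolding tjurina_five[OF arr c] zbitI(2)[OF T(1)] zbitI(2)[OF T(2)] zbitI(2)[OF T(3)] zbitI(2)[OF T(4)] zbitI(2)[OF T(5)] zbitI(2)[OF T(6)] zbitI(2)[OF T(7)] zbitI(2)[OF T(8)] zbitI(2)[OF T(9)] zbitI(2)[OF T(10)]
		by (simp add: node_weights)
	then show ?thesis by linarith
qed

section \<open>Classification\<close>

lemma relabel:
	assumes a: "arr 5 a" and xs: "distinct xs" "set xs = {..<5}" "length xs = 5"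
	shows "arr 5 (\<lambda>i. a (xs ! i)) \<and> (\<Prod>i<5. L (a (xs ! i))) = (\<Prod>i<5. L (a i))"
proof -
	have bij: "bij_betw ((!) xs) {..<5} {..<5}" by (rule bij_betw_nth) (use xs in simp_all)
	have lt: "xs ! i < 5" if "i < 5" for i using bij_betwE[OF bij] that by simp
	have inj: "xs ! i \<noteq> xs ! j" if "i < 5" "j < 5" "i \<noteq> j" for i j using that xs by (simp add: nth_eq_iff_index_eq)
	have "arr 5 (\<lambda>i. a (xs ! i))" unfolding arr_def using arrD[OF a] lt inj by simp
	moreover have "(\<Prod>i<5. L (a (xs ! i))) = (\<Prod>i<5. L (a i))" by (rule prod.reindex_bij_betw[OF bij])
	ultimately show ?thesis ..
qed

text \<open>Renumber such that a given concurrent triple becomes 1, 2, 3.\<close>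

lemma triple_first:
	assumes a: "arr 5 a" "\<not> no_triple a"
	shows "\<exists>b. arr 5 b \<and> (\<Prod>i<5. L (b i)) = (\<Prod>i<5. L (a i)) \<and> tri b 1 2 3 = 0" (is ?Q)
proof -
	define Q where "Q \<longleftrightarrow> ?Q"
	have h: Q if "tri a i j k = 0" "distinct [x, i, j, k, y]" "set [x, i, j, k, y] = {..<5}" for i j k x y
		unfolding Q_def
		by (rule exI[of _ "\<lambda>n. a ([x, i, j, k, y] ! n)"])
			(use relabel[OF a(1) that(2,3)] that(1) in \<open>simp add: numeral_3_eq_3 numeral_2_eq_2 del: distinct.simps set_simps\<close>)
	have c012: "tri a 0 1 2 = 0 ==> Q" by (rule h[of 0 1 2 3 4]) auto
	have c013: "tri a 0 1 3 = 0 ==> Q" by (rule h[of 0 1 3 2 4]) auto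
	have c014: "tri a 0 1 4 = 0 ==> Q" by (rule h[of 0 1 4 2 3]) auto
	have c023: "tri a 0 2 3 = 0 ==> Q" by (rule h[of 0 2 3 1 4]) auto
	have c024: "tri a 0 2 4 = 0 ==> Q" by (rule h[of 0 2 4 1 3]) auto
	have c034: "tri a 0 3 4 = 0 ==> Q" by (rule h[of 0 3 4 1 2]) auto
	have c123: "tri a 1 2 3 = 0 ==> Q" by (rule h[of 1 2 3 0 4]) auto
	have c124: "tri a 1 2 4 = 0 ==> Q" by (rule h[of 1 2 4 0 3]) auto
	have c134: "tri a 1 3 4 = 0 ==> Q" by (rule h[of 1 3 4 0 2]) auto
	have c234: "tri a 2 3 4 = 0 ==> Q" by (rule h[of 2 3 4 0 1]) auto
	have Q using a c012 c013 c014 c023 c024 c034 c123 c124 c134 c234 unfolding no_triple_def by blast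
	then show ?thesis unfolding Q_def .
qed

text \<open>Start with a concurrent triple 1, 2, 3. If line 4 or line 0 passes through its point, the type is a
	pencil or a near pencil. Otherwise the only further triple point possible is that of 0, 4 and one of
	1, 2, 3, which becomes the common line.\<close>

lemma classification:
	assumes "arr 5 a"
	shows "\<exists>b. (\<Prod>i<5. L (b i)) = (\<Prod>i<5. L (a i)) \<and> (pencil b \<or> near_pencil b \<or> two_triple b \<or> one_triple b \<or> no_triple b)"
		(is "\<exists>b. ?same b \<and> ?type b")
proof (cases "no_triple a")
	case True
	then show ?thesis by (intro exI[of _ a]) simp
next
	case False
	from triple_first[OF assms False] obtain b where b: "arr 5 b" "?same b" and t: "tri b 1 2 3 = 0" by (elim exE conjE)
	note np = arrD(2)[OF b(1)]
	have re: ?thesis if "distinct xs" "set xs = {..<5}" "length xs = 5" "arr 5 (\<lambda>i. b (xs ! i)) ==> ?type (\<lambda>i. b (xs ! i))" for xs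
		by (rule exI[of _ "\<lambda>i. b (xs ! i)"]) (use relabel[OF b(1) that(1-3)] that(4) b(2) in simp)
	have z: "tri b 1 2 1 = 0" "tri b 1 2 2 = 0" by simp_all
	have n12: "dt (b u) (b v) w = 0 \<longleftrightarrow> dt (b 1) (b 2) w = 0"
		if "tri b 1 2 u = 0" "tri b 1 2 v = 0" "u < 5" "v < 5" "u \<noteq> v" for u v w
		by (rule dt_same_node[OF np np that(1,2)]) (use that in simp_all)
	note n23 = n12[OF z(2) t, simplified] and n13 = n12[OF z(1) t, simplified]
	note p0 = tri_perm(2)[of b 1 2 0]
	show ?thesis
	proof (cases "tri b 1 2 4 = 0")
		case True
		show ?thesis
		proof (cases "tri b 0 1 2 = 0")
			case 0: True
			have z0: "tri b 1 2 0 = 0" using 0 p0 by simp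
			note n01 = n12[OF z0 z(1), simplified]
			have "pencil b" unfolding pencil_def using b(1) 0 n01[of "b 3"] n01[of "b 4"] t True by simp
			then show ?thesis using b(2) by blast
		next
			case False
			then have "near_pencil b" unfolding near_pencil_def using b(1) t True by simp
			then show ?thesis using b(2) by blast
		qed
	next
		case 4: False
		show ?thesis
		proof (cases "tri b 0 1 2 = 0")
			case True
			show ?thesis
			proof (rule re[of "[4, 1, 2, 3, 0]"])
				assume "arr 5 (\<lambda>i. b ([4, 1, 2, 3, 0] ! i))"
				then have "near_pencil (\<lambda>i. b ([4, 1, 2, 3, 0] ! i))" unfolding near_pencil_def
					using t True 4 p0 tri_perm(2)[of b 1 2 4] by (simp add: numeral_3_eq_3 numeral_2_eq_2)
				then show "?type (\<lambda>i. b ([4, 1, 2, 3, 0] ! i))" by blast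
			qed auto
		next
			case 0: False
			have d0: "tri b 1 2 0 \<noteq> 0" using 0 p0 by simp
			show ?thesis
			proof (cases "tri b 0 1 4 = 0 \<or> tri b 0 2 4 = 0 \<or> tri b 0 3 4 = 0")
				case False
				then have "one_triple b" unfolding one_triple_def using b(1) t 0 4 by simp
				then show ?thesis using b(2) by blast
			next
				case True
				have sw: "tri b 0 i 4 = 0 ==> tri b i 0 4 = 0" for i using dt_perm(1)[of "b i" "b 0" "b 4"] by simp
				have d: "tri b 1 3 0 \<noteq> 0" "tri b 2 3 0 \<noteq> 0" using d0 n13[of "b 0"] n23[of "b 0"] by simp_all
				have t': "tri b 2 1 3 = 0" "tri b 3 1 2 = 0"
					using t dt_perm[of "b 1" "b 2" "b 3"] by simp_all
				from True consider "tri b 0 1 4 = 0" | "tri b 0 2 4 = 0" | "tri b 0 3 4 = 0" by blast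
				then show ?thesis
				proof cases
					case 1
					show ?thesis
					proof (rule re[of "[1, 2, 3, 0, 4]"])
						assume "arr 5 (\<lambda>i. b ([1, 2, 3, 0, 4] ! i))"
						then have "two_triple (\<lambda>i. b ([1, 2, 3, 0, 4] ! i))" unfolding two_triple_def
							using t sw[OF 1] d by (simp add: numeral_3_eq_3 numeral_2_eq_2)
						then show "?type (\<lambda>i. b ([1, 2, 3, 0, 4] ! i))" by blast
					qed auto
				next
					case 2
					show ?thesis
					proof (rule re[of "[2, 1, 3, 0, 4]"])
						assume "arr 5 (\<lambda>i. b ([2, 1, 3, 0, 4] ! i))"
						then have "two_triple (\<lambda>i. b ([2, 1, 3, 0, 4] ! i))" unfolding two_triple_def
							using t' sw[OF 2] d by (simp add: numeral_3_eq_3 numeral_2_eq_2)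
						then show "?type (\<lambda>i. b ([2, 1, 3, 0, 4] ! i))" by blast
					qed auto
				next
					case 3
					show ?thesis
					proof (rule re[of "[3, 1, 2, 0, 4]"])
						assume "arr 5 (\<lambda>i. b ([3, 1, 2, 0, 4] ! i))"
						then have "two_triple (\<lambda>i. b ([3, 1, 2, 0, 4] ! i))" unfolding two_triple_def
							using t' sw[OF 3] d0 by (simp add: numeral_3_eq_3 numeral_2_eq_2)
						then show "?type (\<lambda>i. b ([3, 1, 2, 0, 4] ! i))" by blast
					qed auto
				qed
			qed
		qed
	qed
qed

lemma prod_L_homogeneous: "(\<Prod>i<n::nat. L (a i)) \<in> homog (int n)"
proof (induction n)
	case 0
	then show ?case using homogeneous_Const[of 1] by simp
next
	case (Suc n)
	have "(\<Prod>i<n. L (a i)) * L (a n) \<in> homog (int (Suc n))" by (rule hom_mult[OF Suc L_homogeneous]) simp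
	then show ?case by simp
qed

lemma five_homogeneous: "quintic c a \<in> homog 5"
	using homogeneous_Const_mult[OF prod_L_homogeneous[of a 5]] by simp

lemma pencil_invariants:
	assumes a: "pencil a" and c: "c \<noteq> 0" and f: "f = quintic c a"
	shows "tjurina f = 16 \<and> free_arrangement 0 4 f \<and> milnor_st f = 6 \<and> milnor_reg f = 6"
proof -
	note A = a[unfolded pencil_def]
	have arr: "arr 5 a" using A ..
	note np = arrD(2)[OF arr]
	have n: "cr (a 0) (a 1) \<noteq> 0" by (rule np) simp_all
	obtain e where e: "dt (a 0) (a 1) e \<noteq> 0" using dt_completion[OF n] .
	have "tri a 0 1 2 = 0" "tri a 0 1 3 = 0" "tri a 0 1 4 = 0" using A by simp_all
	then obtain s2 t2 s3 t3 s4 t4 where st: "a 2 = s2 *s a 0 + t2 *s a 1" "a 3 = s3 *s a 0 + t3 *s a 1" "a 4 = s4 *s a 0 + t4 *s a 1"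
		using dependent_span[OF n] by metis
	obtain \<rho> where B: "AR_basis f 0 (recon (a 0) (a 1) e 0 0 1) 4 \<rho>" using basis_pencil[OF arr c st e] unfolding f ..
	have t: "tjurina f = 16" unfolding f by (rule tjurina_pencil[OF a c])
	have h: "f \<in> homog 5" unfolding f by (rule five_homogeneous)
	show ?thesis using t AR_basis_free[OF B] invariants_16[OF h e B t] by simp
qed

lemma near_pencil_invariants:
	assumes a: "near_pencil a" and c: "c \<noteq> 0" and f: "f = quintic c a"
	shows "tjurina f = 13 \<and> free_arrangement 1 3 f \<and> milnor_st f = 5 \<and> milnor_reg f = 5"
proof -
	note A = a[unfolded near_pencil_def]
	have arr: "arr 5 a" using A ..
	note np = arrD(2)[OF arr]
	have n: "cr (a 1) (a 2) \<noteq> 0" by (rule np) simp_all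
	have z: "tri a 1 2 3 = 0" "tri a 1 2 4 = 0" "tri a 1 2 0 \<noteq> 0"
		using A tri_perm(2)[of a 1 2 0] by simp_all
	obtain s3 t3 where s3: "a 3 = s3 *s a 1 + t3 *s a 2" using dependent_span[OF n z(1)] .
	obtain s4 t4 where s4: "a 4 = s4 *s a 1 + t4 *s a 2" using dependent_span[OF n z(2)] .
	obtain \<rho>1 \<rho>2 where B: "AR_basis f 1 \<rho>1 3 \<rho>2" using basis_quadruple_point[OF arr c s3 s4 z(3)] unfolding f by (elim exE)
	have t: "tjurina f = 13" unfolding f by (rule tjurina_near_pencil[OF a c])
	have h: "f \<in> homog 5" unfolding f by (rule five_homogeneous)
	show ?thesis using t AR_basis_free[OF B] invariants_13[OF h B t] by simp
qed

lemma two_triple_invariants: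
	assumes a: "two_triple a" and c: "c \<noteq> 0" and f: "f = quintic c a"
	shows "tjurina f = 12 \<and> free_arrangement 2 2 f \<and> milnor_st f = 4 \<and> milnor_reg f = 4"
proof -
	note A = a[unfolded two_triple_def]
	have arr: "arr 5 a" using A ..
	note np = arrD(2)[OF arr]
	have n: "cr (a 1) (a 2) \<noteq> 0" "cr (a 3) (a 4) \<noteq> 0" by (rule np; simp)+
	have z: "tri a 1 2 0 = 0" "tri a 3 4 0 = 0" "tri a 1 2 3 \<noteq> 0"
		using A tri_perm(2)[of a 1 2 0] tri_perm(2)[of a 3 4 0] by simp_all
	obtain s1 t1 where s1: "a 0 = s1 *s a 1 + t1 *s a 2" using dependent_span[OF n(1) z(1)] .
	obtain s2 t2 where s2: "a 0 = s2 *s a 3 + t2 *s a 4" using dependent_span[OF n(2) z(2)] .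
	obtain \<rho>1 \<rho>2 where B: "AR_basis f 2 \<rho>1 2 \<rho>2" using basis_two_triple_points[OF arr c s1 s2 z(3)] unfolding f by (elim exE)
	have t: "tjurina f = 12" unfolding f by (rule tjurina_two_triple[OF a c])
	have h: "f \<in> homog 5" unfolding f by (rule five_homogeneous)
	show ?thesis using t AR_basis_free[OF B] invariants_12[OF h B t] by simp
qed

lemma one_triple_invariants:
	assumes a: "one_triple a" and c: "c \<noteq> 0" and f: "f = quintic c a"
	shows "tjurina f = 11 \<and> nearly_free_arrangement 5 2 3 f \<and> milnor_st f = 6 \<and> milnor_reg f = 5"
proof -
	note A = a[unfolded one_triple_def]
	have arr: "arr 5 a" using A ..
	note np = arrD(2)[OF arr]
	have n: "cr (a 1) (a 2) \<noteq> 0" by (rule np; simp)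
	have z: "tri a 1 2 3 = 0" "tri a 1 2 4 \<noteq> 0" using A by simp_all
	obtain s t where s: "a 3 = s *s a 1 + t *s a 2" using dependent_span[OF n z(1)] .
	define D where "D = tri a 1 2 4"
	have D: "D \<noteq> 0" using z(2) by (simp add: D_def)
	have "(1 / D) *s (D *s a 0) = (1 / D) *s (tri a 0 2 4 *s a 1 + tri a 1 0 4 *s a 2 + tri a 1 2 0 *s a 4)"
		unfolding D_def by (rule arg_cong[OF cramer_dual])
	then have e: "a 0 = (tri a 0 2 4 / D) *s a 1 + (tri a 1 0 4 / D) *s a 2 + (tri a 1 2 0 / D) *s a 4"
		using D by (simp add: vec_eq_iff field_simps)
	have \<delta>: "tri a 1 2 0 / D \<noteq> 0" using A D tri_perm(2)[of a 1 2 0] by simp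
	have m: "tri a 4 0 1 \<noteq> 0" "tri a 4 0 2 \<noteq> 0" "tri a 0 3 4 \<noteq> 0"
		using A dt_perm(4)[where a = "a 0" and b = "a 1" and c = "a 4"] dt_perm(4)[where a = "a 0" and b = "a 2" and c = "a 4"] by simp_all
	obtain \<rho> \<kappa> where B: "AR_near_basis f \<rho> \<kappa>"
		using near_basis_one_triple_point[OF arr c s e \<delta> z(2) m] unfolding f by (elim exE)
	have t: "tjurina f = 11" unfolding f by (rule tjurina_one_triple[OF a c])
	have h: "f \<in> homog 5" unfolding f by (rule five_homogeneous)
	show ?thesis using t near_free[OF h B] invariants_11[OF h B t] by simp
qed

lemma scale_arr:
	assumes a: "arr d a" and s: "\<And>i. s i \<noteq> 0"
	shows "arr d (\<lambda>i. s i *s a i)" "(\<Prod>i<d. L (s i *s a i)) = Const (\<Prod>i<d. s i) * (\<Prod>i<d. L (a i))"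
proof -
	have "cr (s i *s a i) (s j *s a j) = (s i * s j) *s cr (a i) (a j)" for i j
		by (simp add: vec3_eq_iff algebra_simps)
	then show "arr d (\<lambda>i. s i *s a i)" using a s by (simp add: arr_def)
	show "(\<Prod>i<d. L (s i *s a i)) = Const (\<Prod>i<d. s i) * (\<Prod>i<d. L (a i))"
		by (induction d) (simp_all add: L_scale Const_mult ac_simps)
qed

lemma generic_normal_form:
	assumes a: "no_triple a" and c: "c \<noteq> 0"
	obtains b e \<beta>0 \<beta>1 \<beta>2 where "generic b \<beta>0 \<beta>1 \<beta>2" "e \<noteq> 0" "quintic c a = quintic e b"
proof -
	note A = a[unfolded no_triple_def]
	have arr: "arr 5 a" using A ..
	define D where "D = tri a 0 1 2"
	have D: "D \<noteq> 0" using A by (simp add: D_def)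
	have sp: "x = (dt x (a 1) (a 2) / D) *s a 0 + (dt (a 0) x (a 2) / D) *s a 1 + (dt (a 0) (a 1) x / D) *s a 2" for x
	proof -
		have "(1 / D) *s (D *s x) = (1 / D) *s (dt x (a 1) (a 2) *s a 0 + dt (a 0) x (a 2) *s a 1 + dt (a 0) (a 1) x *s a 2)"
			unfolding D_def by (rule arg_cong[OF cramer_dual])
		then show ?thesis using D by (simp add: vec_eq_iff field_simps)
	qed
	have nz: "tri a 3 1 2 \<noteq> 0" "tri a 0 3 2 \<noteq> 0" "tri a 0 1 3 \<noteq> 0"
		"tri a 4 1 2 \<noteq> 0" "tri a 0 4 2 \<noteq> 0" "tri a 0 1 4 \<noteq> 0"
		using A dt_perm(4)[where a = "a 1" and b = "a 2" and c = "a 3"] dt_perm(4)[where a = "a 1" and b = "a 2" and c = "a 4"] dt_perm(2)[of "a 0" "a 2" "a 3"] dt_perm(2)[of "a 0" "a 2" "a 4"]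
		by simp_all
	define \<sigma> where "\<sigma> i = (if i = 0 then tri a 3 1 2 / D else if i = 1 then tri a 0 3 2 / D
		else if i = 2 then tri a 0 1 3 / D else 1)" for i :: nat
	have \<sigma>: "\<sigma> i \<noteq> 0" for i using nz D by (simp add: \<sigma>_def)
	define b where "b i = \<sigma> i *s a i" for i
	define \<beta>0 where "\<beta>0 = tri a 4 1 2 / D / \<sigma> 0"
	define \<beta>1 where "\<beta>1 = tri a 0 4 2 / D / \<sigma> 1"
	define \<beta>2 where "\<beta>2 = tri a 0 1 4 / D / \<sigma> 2"
	have b34: "b 3 = a 3" "b 4 = a 4" by (simp_all add: b_def \<sigma>_def)
	have b3: "b 3 = b 0 + b 1 + b 2" unfolding b34 by (subst sp[of "a 3"]) (simp add: b_def \<sigma>_def)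
	have b4: "b 4 = \<beta>0 *s b 0 + \<beta>1 *s b 1 + \<beta>2 *s b 2"
		unfolding b34 by (subst sp[of "a 4"]) (use \<sigma>[of 0] \<sigma>[of 1] \<sigma>[of 2] in \<open>simp add: b_def \<beta>0_def \<beta>1_def \<beta>2_def\<close>)
	have dtb: "tri b i j k = \<sigma> i * \<sigma> j * \<sigma> k * tri a i j k" for i j k
		unfolding b_def dt_expand by (simp add: algebra_simps)
	have "tri b 0 3 4 \<noteq> 0" "tri b 1 3 4 \<noteq> 0" "tri b 2 3 4 \<noteq> 0"
		unfolding dtb using A \<sigma> by simp_all
	then have "\<beta>2 - \<beta>1 \<noteq> 0" "\<beta>0 - \<beta>2 \<noteq> 0" "\<beta>1 - \<beta>0 \<noteq> 0"
	proof -
		have "tri b 0 3 4 = (\<beta>2 - \<beta>1) * tri b 0 1 2" "tri b 1 3 4 = (\<beta>0 - \<beta>2) * tri b 0 1 2"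
			"tri b 2 3 4 = (\<beta>1 - \<beta>0) * tri b 0 1 2"
			unfolding b3 b4 dt_expand by (simp_all add: algebra_simps)
		moreover assume "tri b 0 3 4 \<noteq> 0" "tri b 1 3 4 \<noteq> 0" "tri b 2 3 4 \<noteq> 0"
		ultimately show "\<beta>2 - \<beta>1 \<noteq> 0" "\<beta>0 - \<beta>2 \<noteq> 0" "\<beta>1 - \<beta>0 \<noteq> 0" by auto
	qed
	moreover have "\<beta>0 \<noteq> 0" "\<beta>1 \<noteq> 0" "\<beta>2 \<noteq> 0" unfolding \<beta>0_def \<beta>1_def \<beta>2_def using nz D \<sigma> by simp_all
	moreover have "tri b 0 1 2 \<noteq> 0" unfolding dtb using A \<sigma> by simp
	moreover have "arr 5 b" unfolding b_def by (rule scale_arr[OF arr \<sigma>])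
	ultimately have g: "generic b \<beta>0 \<beta>1 \<beta>2" unfolding generic_def using b3 b4 by simp
	define e where "e = (\<Prod>i<5. \<sigma> i)"
	have e: "e \<noteq> 0" using \<sigma> by (simp add: e_def)
	have "quintic (c / e) b = quintic (c / e * e) a"
		unfolding b_def scale_arr(2)[OF arr \<sigma>] e_def[symmetric] Const_mult by (simp add: mult.assoc)
	then have "quintic c a = quintic (c / e) b" using e by simp
	then show thesis using that[OF g, of "c / e"] c e by simp
qed

lemma no_triple_invariants:
	assumes a: "no_triple a" and c: "c \<noteq> 0" and f: "f = quintic c a"
	shows "tjurina f = 10 \<and> \<not> free_arrangement d1 d2 f \<and> \<not> nearly_free_arrangement 5 d1 d2 f"
proof -
	obtain b e \<beta>0 \<beta>1 \<beta>2 where b: "generic b \<beta>0 \<beta>1 \<beta>2" "e \<noteq> 0" "f = quintic e b"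
		using generic_normal_form[OF a c] unfolding f .
	have h: "f \<in> homog 5" unfolding f by (rule five_homogeneous)
	show ?thesis using tjurina_no_triple[OF a c] generic_not_free[OF b h] generic_not_nearly_free[OF b h] unfolding f by blast
qed

lemma arrangement_poly_iff: "arrangement_poly 5 f \<longleftrightarrow> (\<exists>a c. arr 5 a \<and> c \<noteq> 0 \<and> f = quintic c a)"
proof
	assume "arrangement_poly 5 f"
	then obtain a :: "nat => complex^3" where a: "f = (\<Prod>i<5. L (a i))" "\<forall>i<5. a i \<noteq> 0" "\<forall>i<5. \<forall>j<5. i \<noteq> j --> (\<forall>c. a i \<noteq> c *s a j)"
		unfolding arrangement_poly_def by (elim exE conjE)
	have "arr 5 a" unfolding arr_def cr_0_iff using a(2,3) by simp
	then show "\<exists>a c. arr 5 a \<and> c \<noteq> 0 \<and> f = quintic c a"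
		using a(1) by (intro exI[of _ a] exI[of _ 1]) simp
next
	assume "\<exists>a c. arr 5 a \<and> c \<noteq> 0 \<and> f = quintic c a"
	then obtain a c where a: "arr 5 a" and c: "c \<noteq> 0" and f: "f = quintic c a" by (elim exE conjE)
	define s where "s i = (if i = 0 then c else 1)" for i :: nat
	have s: "s i \<noteq> 0" for i using c by (simp add: s_def)
	have "(\<Prod>i<5. s i) = c" unfolding lessThan_5 by (simp add: s_def)
	then have f': "f = (\<Prod>i<5. L (s i *s a i))" unfolding scale_arr(2)[OF a s] f by simp
	have a': "arr 5 (\<lambda>i. s i *s a i)" by (rule scale_arr[OF a s])
	have 0: "\<forall>i<5. s i *s a i \<noteq> 0" using arrD(1)[OF a'] by simp
	have "cr (s i *s a i) (s j *s a j) \<noteq> 0" if "i < 5" "j < 5" "i \<noteq> j" for i j using arrD(2)[OF a' that] by simp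
	then have 1: "\<forall>i<5. \<forall>j<5. i \<noteq> j --> (\<forall>c. s i *s a i \<noteq> c *s (s j *s a j))" unfolding cr_0_iff by blast
	show "arrangement_poly 5 f" unfolding arrangement_poly_def
		by (rule exI[of _ "\<lambda>i. s i *s a i"]) (use f' 0 1 in simp)
qed

lemma proj_class_arrangements: "proj_class f \<in> arrangements 5 \<longleftrightarrow> arrangement_poly 5 f"
	and proj_class_arrangements_tau: "proj_class f \<in> arrangements_tau 5 \<tau> \<longleftrightarrow> arrangement_poly 5 f \<and> tjurina f = \<tau>"
proof -
	have *: "arrangement_poly 5 f \<and> tjurina f = tjurina g" if fg: "proj_class f = proj_class g" and g: "arrangement_poly 5 g" for g
	proof -
		obtain a c where a: "arr 5 a" and c: "c \<noteq> 0" and g: "g = quintic c a"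
			using g unfolding arrangement_poly_iff by (elim exE conjE)
		have "f \<in> proj_class g" using proj_class_self[of f] unfolding fg .
		then obtain e where e: "f = Const e * g" "e \<noteq> 0" unfolding proj_class_def by blast
		have f: "f = quintic (e * c) a" unfolding e(1) g Const_mult by (simp only: mult.assoc)
		have "arrangement_poly 5 f" unfolding arrangement_poly_iff using a c e(2) f by (intro exI[of _ a] exI[of _ "e * c"]) simp
		moreover have "real (tjurina f) = real (tjurina g)" unfolding f g using tjurina_prod[OF a] c e(2) by simp
		ultimately show ?thesis by simp
	qed
	show "proj_class f \<in> arrangements 5 \<longleftrightarrow> arrangement_poly 5 f" unfolding arrangements_def using * by blast
	show "proj_class f \<in> arrangements_tau 5 \<tau> \<longleftrightarrow> arrangement_poly 5 f \<and> tjurina f = \<tau>"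
		unfolding arrangements_tau_def using * by blast
qed

definition shaped :: "((nat => complex^3) => bool) => S => bool" where
	"shaped T f \<longleftrightarrow> (\<exists>a c. T a \<and> c \<noteq> 0 \<and> f = quintic c a)"

lemma arrangement_shapes:
	"arrangement_poly 5 f \<longleftrightarrow> shaped pencil f \<or> shaped near_pencil f \<or> shaped two_triple f \<or> shaped one_triple f \<or> shaped no_triple f"
proof
	assume "arrangement_poly 5 f"
	then obtain a c where a: "arr 5 a" and c: "c \<noteq> 0" and f: "f = quintic c a"
		unfolding arrangement_poly_iff by (elim exE conjE)
	from classification[OF a] obtain b where b: "(\<Prod>i<5. L (b i)) = (\<Prod>i<5. L (a i))"
		"pencil b \<or> near_pencil b \<or> two_triple b \<or> one_triple b \<or> no_triple b" by (elim exE conjE)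
	have "shaped T f" if "T b" for T unfolding shaped_def f b(1)[symmetric] using that c by (intro exI conjI) auto
	then show "shaped pencil f \<or> shaped near_pencil f \<or> shaped two_triple f \<or> shaped one_triple f \<or> shaped no_triple f"
		using b(2) by blast
next
	have "arrangement_poly 5 f" if sh: "shaped T f" and T: "\<And>a. T a ==> arr 5 a" for T
	proof -
		obtain a c where "T a" "c \<noteq> 0" "f = quintic c a" using sh unfolding shaped_def by (elim exE conjE)
		then show ?thesis unfolding arrangement_poly_iff using T by (intro exI[of _ a] exI[of _ c]) simp
	qed
	note * = this
	assume "shaped pencil f \<or> shaped near_pencil f \<or> shaped two_triple f \<or> shaped one_triple f \<or> shaped no_triple f"
	then show "arrangement_poly 5 f"
		by (elim disjE) (erule *, simp add: pencil_def near_pencil_def two_triple_def one_triple_def no_triple_def)+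
qed

lemma shaped_invariants:
	"shaped pencil f ==> tjurina f = 16 \<and> free_arrangement 0 4 f \<and> milnor_st f = 6 \<and> milnor_reg f = 6"
	"shaped near_pencil f ==> tjurina f = 13 \<and> free_arrangement 1 3 f \<and> milnor_st f = 5 \<and> milnor_reg f = 5"
	"shaped two_triple f ==> tjurina f = 12 \<and> free_arrangement 2 2 f \<and> milnor_st f = 4 \<and> milnor_reg f = 4"
	"shaped one_triple f ==> tjurina f = 11 \<and> nearly_free_arrangement 5 2 3 f \<and> milnor_st f = 6 \<and> milnor_reg f = 5"
	"shaped no_triple f ==> tjurina f = 10 \<and> \<not> free_arrangement d1 d2 f \<and> \<not> nearly_free_arrangement 5 d1 d2 f"
	unfolding shaped_def
	by (elim exE conjE, rule pencil_invariants near_pencil_invariants two_triple_invariants one_triple_invariants no_triple_invariants; assumption)+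

lemma arrangements_tau_shapes:
	"proj_class f \<in> arrangements_tau 5 16 \<longleftrightarrow> shaped pencil f"
	"proj_class f \<in> arrangements_tau 5 13 \<longleftrightarrow> shaped near_pencil f"
	"proj_class f \<in> arrangements_tau 5 12 \<longleftrightarrow> shaped two_triple f"
	"proj_class f \<in> arrangements_tau 5 11 \<longleftrightarrow> shaped one_triple f"
proof -
	note t = shaped_invariants[THEN conjunct1]
	have t': "shaped pencil f --> tjurina f = 16" "shaped near_pencil f --> tjurina f = 13" "shaped two_triple f --> tjurina f = 12"
		"shaped one_triple f --> tjurina f = 11" "shaped no_triple f --> tjurina f = 10" using t by simp_all
	show "proj_class f \<in> arrangements_tau 5 16 \<longleftrightarrow> shaped pencil f" "proj_class f \<in> arrangements_tau 5 13 \<longleftrightarrow> shaped near_pencil f"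
		"proj_class f \<in> arrangements_tau 5 12 \<longleftrightarrow> shaped two_triple f" "proj_class f \<in> arrangements_tau 5 11 \<longleftrightarrow> shaped one_triple f"
		unfolding proj_class_arrangements_tau arrangement_shapes using t' by auto
qed

section \<open>Irreducibility and dimension of a family of arrangements\<close>

definition vec3 :: "complex => complex => complex => complex^3" where
	"vec3 x y z = vector [x, y, z]"

lemma vec3_nth [simp]: "vec3 x y z $ 1 = x" "vec3 x y z $ 2 = y" "vec3 x y z $ 3 = z"
	by (simp_all add: vec3_def)

lemma vec3_nth_eq: "vec3 (v $ 1) (v $ 2) (v $ 3) = v"
	by (simp add: vec3_eq_iff)

definition five :: "'a => 'a => 'a => 'a => 'a => nat => 'a" where
	"five a b c d e = (!) [a, b, c, d, e]"

lemma five [simp]: "five a b c d e 0 = a" "five a b c d e 1 = b" "five a b c d e (Suc 0) = b" "five a b c d e 2 = c"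
	"five a b c d e 3 = d" "five a b c d e 4 = e"
	by (simp_all add: five_def numeral_eq_Suc)

lemma all5: "(\<forall>i<5::nat. P i) \<longleftrightarrow> P 0 \<and> P 1 \<and> P 2 \<and> P 3 \<and> P 4"
proof -
	have "(\<forall>i<5::nat. P i) \<longleftrightarrow> (\<forall>i\<in>{..<5::nat}. P i)" by auto
	then show ?thesis unfolding lessThan_5 by simp
qed

lemma dt_comb: "dt x y (s *s x + t *s y) = 0"
	by (simp add: dt_expand algebra_simps)

lemma dt_scale: "dt (s *s x) (t *s y) (r *s z) = s * t * r * dt x y z"
	by (simp add: dt_expand algebra_simps)

definition polyvec :: "nat => ((nat => complex) => complex^3) => bool" where
	"polyvec N x \<longleftrightarrow> (\<forall>j. polymap N (\<lambda>u. x u $ j))"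

lemma polyvecD: "polyvec N x ==> polymap N (\<lambda>u. x u $ j)"
	by (simp add: polyvec_def)

lemma polyvec_vec3: "polymap N x ==> polymap N y ==> polymap N z ==> polyvec N (\<lambda>u. vec3 (x u) (y u) (z u))"
	unfolding polyvec_def forall_3 by simp

lemma polyvec_comb: "polymap N s ==> polymap N t ==> polyvec N x ==> polyvec N y ==> polyvec N (\<lambda>u. s u *s x u + t u *s y u)"
	unfolding polyvec_def by (simp add: polymap_add polymap_mult)

lemma polyvec_five:
	assumes "i < 5" "polyvec N a" "polyvec N b" "polyvec N c" "polyvec N d" "polyvec N e"
	shows "polyvec N (\<lambda>u. five (a u) (b u) (c u) (d u) (e u) i)"
proof -
	have "\<forall>i<5. polyvec N (\<lambda>u. five (a u) (b u) (c u) (d u) (e u) i)" unfolding all5 using assms by simp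
	then show ?thesis using assms(1) by blast
qed

lemma lineopen_polymap: "polymap N g ==> lineopen {u. g u \<noteq> 0}"
	by (rule lineopen_nonzero[OF polymap_linepoly])

lemma lineopen_dt:
	assumes "polyvec N x" "polyvec N y" "polyvec N z" shows "lineopen {u. dt (x u) (y u) (z u) \<noteq> 0}"
	unfolding dt_expand by (intro lineopen_polymap[of N] polymap_add polymap_mult polymap_diff polyvecD assms)

lemma lineopen_cr:
	assumes "polyvec N x" "polyvec N y" shows "lineopen {u. cr (x u) (y u) \<noteq> 0}"
proof -
	have "{u. cr (x u) (y u) \<noteq> 0} = {u. cr (x u) (y u) $ 1 \<noteq> 0} \<union> ({u. cr (x u) (y u) $ 2 \<noteq> 0} \<union> {u. cr (x u) (y u) $ 3 \<noteq> 0})"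
		by (auto simp: vec3_eq_iff)
	moreover have "lineopen \<dots>" unfolding cr_nth
		by (intro lineopen_Un lineopen_polymap[of N] polymap_mult polymap_diff polyvecD assms)
	ultimately show ?thesis by simp
qed

lemma lineopen_INT: "finite I ==> (\<And>i. i \<in> I ==> lineopen {u. P i u}) ==> lineopen {u. \<forall>i\<in>I. P i u}"
proof (induction I rule: finite_induct)
	case (insert i I)
	have "{u. \<forall>i\<in>insert i I. P i u} = {u. P i u} \<inter> {u. \<forall>i\<in>I. P i u}" by auto
	then show ?case using lineopen_Int insert by simp
qed (simp add: lineopen_def)

lemma arr_iff_cr: "2 \<le> d ==> arr d a \<longleftrightarrow> (\<forall>(i, j)\<in>{(i, j). i < d \<and> j < d \<and> i \<noteq> j}. cr (a i) (a j) \<noteq> 0)"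
proof
	assume d: "2 \<le> d" and *: "\<forall>(i, j)\<in>{(i, j). i < d \<and> j < d \<and> i \<noteq> j}. cr (a i) (a j) \<noteq> 0"
	have "a i \<noteq> 0" if "i < d" for i
	proof -
		have "\<exists>j<d. i \<noteq> j" using d by (intro exI[of _ "if i = 0 then 1 else 0"]) auto
		then obtain j where "j < d" "i \<noteq> j" by blast
		then have "cr (a i) (a j) \<noteq> 0" using * that by blast
		then show ?thesis using cr_nonzero(1) by blast
	qed
	then show "arr d a" unfolding arr_def using * by blast
qed (auto simp: arr_def)

lemma lineopen_arr:
	assumes "\<And>i. i < 5 ==> polyvec N (\<lambda>u. A u i)" shows "lineopen {u. arr 5 (A u)}"
proof -
	have fin: "finite {(i, j). i < (5::nat) \<and> j < (5::nat) \<and> i \<noteq> j}"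
		by (rule finite_subset[of _ "{..<5} \<times> {..<5}"]) auto
	have "lineopen {u. \<forall>x\<in>{(i, j). i < 5 \<and> j < 5 \<and> i \<noteq> j}. (case x of (i, j) => cr (A u i) (A u j) \<noteq> 0)}"
		by (rule lineopen_INT[OF fin]) (auto intro!: lineopen_cr[of N] assms)
	then show ?thesis by (simp add: arr_iff_cr)
qed

lemma lineopen_on_line:
	assumes \<Omega>: "lineopen \<Omega>" and u: "u \<in> \<Omega>" and h: "linepoly h" "h v \<noteq> 0"
	obtains t where "seg u v t \<in> \<Omega>" "h (seg u v t) \<noteq> 0"
proof -
	obtain q where q: "\<And>t. h (seg u v t) = poly q t" using linepolyE[OF h(1)] by blast
	have "q \<noteq> 0" using q[of 1] h(2) by auto
	then have "finite {t. poly q t = 0}" by (rule poly_roots_finite)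
	moreover have "finite {t. seg u v t \<notin> \<Omega>}" using bspec[OF \<Omega>[unfolded lineopen_def] u] by (rule spec)
	ultimately have "finite ({t. poly q t = 0} \<union> {t. seg u v t \<notin> \<Omega>})" by simp
	from ex_new_if_finite[OF infinite_UNIV_char_0 this]
	obtain t where t: "t \<notin> {t. poly q t = 0} \<union> {t. seg u v t \<notin> \<Omega>}" ..
	show thesis by (rule that[of t]) (use q[of t] t in simp_all)
qed

lemma polymap_L_mult:
	assumes "polyvec N x" "\<And>m. polymap N (\<lambda>u. lk (\<Phi> u) m)"
	shows "polymap N (\<lambda>u. lk (L (x u) * \<Phi> u) m)"
proof -
	have "lk (L (x u) * \<Phi> u) m = x u $ 1 * (if lk m 1 = 0 then 0 else lk (\<Phi> u) (m - psingle 1 1))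
		 + x u $ 2 * (if lk m 2 = 0 then 0 else lk (\<Phi> u) (m - psingle 2 1))
		 + x u $ 3 * (if lk m 3 = 0 then 0 else lk (\<Phi> u) (m - psingle 3 1))" for u
		unfolding L_expand distrib_right lookup_add mult.assoc lookup_Const_mult lookup_Var_mult ..
	moreover have "polymap N (\<lambda>u. if lk m i = 0 then 0 else lk (\<Phi> u) (m - psingle i 1))" for i
		using assms(2) polymap_const[of N 0] by (cases "lk m i = 0") simp_all
	ultimately show ?thesis using assms(1) by (simp add: polymap_add polymap_mult polyvecD)
qed

lemma polymap_product:
	assumes A: "\<And>i. i < n ==> polyvec N (\<lambda>u. A u i)" and c: "polymap N c"
	shows "polymap N (\<lambda>u. lk (Const (c u) * (\<Prod>i<n::nat. L (A u i))) m)"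
	using A
proof (induction n arbitrary: m)
	case 0
	have "lk (Const (c u) * (\<Prod>i<0. L (A u i))) m = (if m = 0 then c u else 0)" for u by (simp add: lookup_Const)
	then show ?case using c polymap_const[of N 0] by (cases "m = 0") simp_all
next
	case (Suc n)
	have eq: "Const (c u) * (\<Prod>i<Suc n. L (A u i)) = L (A u n) * (Const (c u) * (\<Prod>i<n. L (A u i)))" for u
		by (simp add: ac_simps)
	show ?case unfolding eq by (rule polymap_L_mult) (use Suc in simp_all)
qed

text \<open>Let \<open>A\<close> parametrise all arrangements of type \<open>T\<close> by covectors and coefficients of dependent ones. Its
	image is irreducible. Almost all of it is covered by the chart \<open>B\<close>, where first coordinates are one, so
	that \<open>n\<close> affine parameters and the scalar factor remain; this bounds the dimension by \<open>n\<close>. Conversely, if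
	\<open>p k\<close> always lies on one of the lines until the \<open>k\<close>-th parameter is released, the chart contains a chain
	of length \<open>n\<close>.\<close>

lemma family_dimension:
	assumes X: "\<And>f. proj_class f \<in> X \<longleftrightarrow> shaped T f" and Xc: "X \<subseteq> range proj_class"
		and T_arr: "\<And>a. T a ==> arr 5 a"
		and T_scale: "\<And>a s. T a ==> (\<And>i. s i \<noteq> 0) ==> T (\<lambda>i. s i *s a i)"
		and T_cong: "\<And>a b. T a ==> (\<And>i. i < 5 ==> a i = b i) ==> T b"
		and A: "\<And>i. i < 5 ==> polyvec M (\<lambda>w. A w i)"
		and B: "\<And>i. i < 5 ==> polyvec (Suc n) (\<lambda>u. B u i)"
		and A_open: "lineopen {w. T (A w)}" and B_open: "lineopen {u. T (B u)}"
		and onto: "\<And>a. T a ==> \<exists>w. \<forall>i<5. A w i = a i"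
		and chart: "\<And>w. (\<And>i. i < 5 ==> A w i $ 1 \<noteq> 0) ==> \<exists>u. \<forall>i<5. A w i = (A w i $ 1) *s B u i"
		and B_n: "\<And>u x i. B (u(n := x)) i = B u i"
		and w0: "\<And>i. i < 5 ==> A w0 i $ 1 \<noteq> 0"
		and u0: "T (B u0)" "u0 n \<noteq> 0"
		and van: "\<And>k u. k < n ==> (\<And>j. k \<le> j ==> u j = u0 j) ==> \<exists>i<5. ev (B u i) (p k) = 0"
		and nonvan: "\<And>k. k < n ==> \<exists>x. \<forall>i<5. ev (B (u0(k := x)) i) (p k) \<noteq> 0"
	shows "irreducible_space (zar 5 X) \<and> krull_dim (zar 5 X) = enat n"
proof -
	define \<Psi> where "\<Psi> w = Const 1 * (\<Prod>i<5. L (A w i))" for w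
	define \<xi> where "\<xi> u = Const (u n) * (\<Prod>i<5. L (B u i))" for u
	have \<Psi>p: "polymap M (\<lambda>w. lk (\<Psi> w) m)" for m unfolding \<Psi>_def by (rule polymap_product[OF A polymap_const])
	have \<xi>p: "polymap (Suc n) (\<lambda>u. lk (\<xi> u) m)" for m unfolding \<xi>_def by (rule polymap_product[OF B polymap_coord]) simp_all
	have prod_nz: "quintic c a \<in> homog (int 5) - {0}" if "T a" "c \<noteq> 0" for a c
		using five_homogeneous[of c a] arrD(1)[OF T_arr[OF that(1)]] that(2) by simp
	have rep: "\<exists>w. T (A w) \<and> f = \<Psi> w" if sh: "shaped T f" for f
	proof -
		obtain a c where a: "T a" and c: "c \<noteq> 0" and f: "f = quintic c a" using sh unfolding shaped_def by (elim exE conjE)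
		\<comment> \<open>the constant factor is absorbed by line 0\<close>
		define s where "s i = (if i = 0 then c else 1)" for i :: nat
		have s: "s i \<noteq> 0" for i using c by (simp add: s_def)
		have "(\<Prod>i<5. s i) = c" unfolding lessThan_5 by (simp add: s_def)
		then have f': "f = (\<Prod>i<5. L (s i *s a i))" unfolding scale_arr(2)[OF T_arr[OF a] s] f by simp
		have Ta: "T (\<lambda>i. s i *s a i)" by (rule T_scale[OF a s])
		obtain w where w: "\<forall>i<5. A w i = s i *s a i" using onto[OF Ta] ..
		have "T (A w)" by (rule T_cong[OF Ta]) (use w in simp)
		moreover have "(\<Prod>i<5. L (A w i)) = (\<Prod>i<5. L (s i *s a i))" by (rule prod.cong[OF refl]) (use w in simp)
		ultimately show ?thesis unfolding f' \<Psi>_def by (intro exI[of _ w]) simp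
	qed
	have Xim: "X = proj_class ` \<Psi> ` {w. T (A w)}"
	proof (intro subset_antisym subsetI)
		fix P assume P: "P \<in> X"
		obtain f where f: "P = proj_class f" using subsetD[OF Xc P] ..
		have "shaped T f" using P unfolding f X .
		from rep[OF this] obtain w where "T (A w)" "f = \<Psi> w" by (elim exE conjE)
		then show "P \<in> proj_class ` \<Psi> ` {w. T (A w)}" unfolding f by simp
	next
		fix P assume "P \<in> proj_class ` \<Psi> ` {w. T (A w)}"
		then obtain w where w: "P = proj_class (\<Psi> w)" "T (A w)" by blast
		then have "shaped T (\<Psi> w)" unfolding shaped_def \<Psi>_def by (intro exI[of _ "A w"] exI[of _ 1]) simp
		then show "P \<in> X" unfolding w(1) X .
	qed
	have Xp: "X \<subseteq> proj_forms 5"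
		unfolding Xim proj_forms_def \<Psi>_def by (intro image_mono image_subsetI prod_nz) simp_all
	have lin\<Psi>: "linepoly (\<lambda>w. mpoly_eval F (lk (\<Psi> w)))" for F by (rule polymap_linepoly[OF polymap_compose[OF \<Psi>p]])
	have lin\<xi>: "linepoly (\<lambda>u. mpoly_eval F (lk (\<xi> u)))" for F by (rule polymap_linepoly[OF polymap_compose[OF \<xi>p]])
	\<comment> \<open>a point of the chart lifts to a point of the family because all configurations are parametrised\<close>
	have ne: "{w. T (A w)} \<noteq> {}"
	proof -
		have "shaped T (\<xi> u0)" unfolding shaped_def \<xi>_def using u0 by (intro exI[of _ "B u0"] exI[of _ "u0 n"]) simp
		then show ?thesis using rep by blast
	qed
	have irr: "irreducible_space (zar 5 X)"
		unfolding Xim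
	proof (rule irreducible_image)
		show "linepoly (\<lambda>u. lk (\<Psi> u) m)" for m by (rule polymap_linepoly[OF \<Psi>p])
		show "\<Psi> u \<in> homog (int 5) - {0}" if "u \<in> {w. T (A w)}" for u unfolding \<Psi>_def using that by (intro prod_nz) simp_all
	qed (fact lin\<Psi> A_open ne)+
	have "krull_dim (zar 5 X) \<le> enat (Suc n - 1)"
	proof (rule krull_dim_upper[OF Xp \<Psi>p _ \<xi>p, where \<delta> = "\<lambda>w. \<Prod>i<5. A w i $ 1" and ?w0.0 = w0])
		show "\<exists>w. f = \<Psi> w" if P: "P \<in> X" "f \<in> P" for P f
		proof -
			obtain g where g: "P = proj_class g" using subsetD[OF Xc P(1)] ..
			have "shaped T g" using P(1) unfolding g X .
			then obtain a c where a: "T a" "c \<noteq> 0" "g = quintic c a" unfolding shaped_def by (elim exE conjE)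
			obtain e where e: "f = Const e * g" "e \<noteq> 0" using P(2) unfolding g proj_class_def by blast
			have "f = quintic (e * c) a" unfolding e(1) a(3) Const_mult by (simp only: mult.assoc)
			then have "shaped T f" unfolding shaped_def using a e by (intro exI[of _ a] exI[of _ "e * c"]) simp
			from rep[OF this] show ?thesis by blast
		qed
		show "linepoly (\<lambda>w. \<Prod>i<5. A w i $ 1)" by (rule polymap_linepoly[of M]) (intro polymap_prod polyvecD A, simp)
		show "(\<Prod>i<5. A w0 i $ 1) \<noteq> 0" using w0 by simp
		show "\<exists>u. \<Psi> w = \<xi> u" if d: "(\<Prod>i<5. A w i $ 1) \<noteq> 0" for w
		proof -
			have "A w i $ 1 \<noteq> 0" if "i < 5" for i using d that by simp
			from chart[OF this] obtain u where u: "\<forall>i<5. A w i = (A w i $ 1) *s B u i" by blast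
			define s where "s = (\<Prod>i<5. A w i $ 1)"
			have "(\<Prod>i<5. L (A w i)) = (\<Prod>i<5. Const (A w i $ 1) * L (B u i))"
				by (rule prod.cong[OF refl]) (metis u lessThan_iff L_scale)
			also have "\<dots> = Const s * (\<Prod>i<5. L (B u i))" unfolding s_def lessThan_5 by (simp add: Const_mult ac_simps)
			finally have "\<Psi> w = \<xi> (u(n := s))" unfolding \<Psi>_def \<xi>_def B_n by simp
			then show ?thesis by (rule exI[of _ "u(n := s)"])
		qed
	qed simp
	moreover have "enat n \<le> krull_dim (zar 5 X)"
	proof (rule krull_dim_lower[OF Xp lin\<xi>, where \<Omega> = "{u. T (B u)} \<inter> {u. u n \<noteq> 0}" and ?u0.0 = u0 and p = p])
		show op: "lineopen ({u. T (B u)} \<inter> {u. u n \<noteq> 0})"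
			by (intro lineopen_Int B_open lineopen_polymap[of "Suc n"] polymap_coord) simp
		show mem: "u0 \<in> {u. T (B u)} \<inter> {u. u n \<noteq> 0}" using u0 by simp
		show "\<xi> u \<in> homog (int 5) - {0}" if "u \<in> {u. T (B u)} \<inter> {u. u n \<noteq> 0}" for u
			unfolding \<xi>_def by (rule prod_nz) (use that in simp_all)
		show "proj_class (\<xi> u) \<in> X" if "u \<in> {u. T (B u)} \<inter> {u. u n \<noteq> 0}" for u
			unfolding X shaped_def \<xi>_def using that by (intro exI[of _ "B u"] exI[of _ "u n"]) simp
		have ev\<xi>: "mpoly_eval (\<xi> u) (($) v) = u n * (\<Prod>i<5. ev (B u i) v)" for u v
			by (simp add: \<xi>_def mpoly_eval_mult mpoly_eval_prod)
		show "mpoly_eval (\<xi> u) (($) (p k)) = 0" if k: "k < n" and e: "\<And>j. k \<le> j ==> u j = u0 j" for k u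
		proof -
			have "\<exists>i<5. ev (B u i) (p k) = 0" by (rule van[OF k]) (rule e)
			then show ?thesis unfolding ev\<xi> by auto
		qed
		show "\<exists>u\<in>{u. T (B u)} \<inter> {u. u n \<noteq> 0}. (\<forall>j>k. u j = u0 j) \<and> mpoly_eval (\<xi> u) (($) (p k)) \<noteq> 0" if k: "k < n" for k
		proof -
			obtain x where x: "\<forall>i<5. ev (B (u0(k := x)) i) (p k) \<noteq> 0" using nonvan[OF k] ..
			have nz: "mpoly_eval (\<xi> (u0(k := x))) (($) (p k)) \<noteq> 0" unfolding ev\<xi> using x u0(2) k by simp
			have lin: "linepoly (\<lambda>u. mpoly_eval (\<xi> u) (($) (p k)))"
				unfolding ev\<xi> ev_def by (rule polymap_linepoly[of "Suc n"])
					(intro polymap_mult polymap_coord polymap_prod polymap_add polymap_const polyvecD B; simp)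
			obtain t where t: "seg u0 (u0(k := x)) t \<in> {u. T (B u)} \<inter> {u. u n \<noteq> 0}"
				"mpoly_eval (\<xi> (seg u0 (u0(k := x)) t)) (($) (p k)) \<noteq> 0"
				using lineopen_on_line[OF op mem lin nz] by blast
			have "seg u0 (u0(k := x)) t j = u0 j" if "k < j" for j using that by (simp add: seg_def)
			then show ?thesis using t by (intro bexI[of _ "seg u0 (u0(k := x)) t"]) simp_all
		qed
	qed
	ultimately show ?thesis using irr by (simp add: order_antisym)
qed

lemma chart_base: "x \<noteq> 0 ==> vec3 x y z = x *s vec3 1 (y / x) (z / x)"
	by (simp add: vec3_eq_iff)

text \<open>Normalising first coordinates to one turns a linear combination of covectors into an affine
	combination of the normalised ones.\<close>

lemma chart_comb:
	assumes "x \<noteq> 0" "x' \<noteq> 0" "s * x + t * x' \<noteq> 0"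
	shows "s *s vec3 x y z + t *s vec3 x' y' z' = (s * x + t * x') *s
		((1 - t * x' / (s * x + t * x')) *s vec3 1 (y / x) (z / x) + (t * x' / (s * x + t * x')) *s vec3 1 (y' / x') (z' / x'))"
proof -
	define D where "D = s * x + t * x'"
	have D: "D * (1 - t * x' / D) = s * x" "D * (t * x' / D) = t * x'"
		using assms(3) by (simp_all add: D_def right_diff_distrib)
	have e: "D *s ((1 - t * x' / D) *s X + (t * x' / D) *s Y) = (D * (1 - t * x' / D)) *s X + (D * (t * x' / D)) *s Y" for X Y :: "complex^3"
		by (simp only: vector_add_ldistrib vector_smult_assoc)
	show ?thesis unfolding D_def[symmetric] e D using assms(1,2) by (simp add: vec3_eq_iff)
qed

subsection \<open>One triple point\<close>

text \<open>The parameters of the chart are numbered in the order of their release: first the position of each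
	line through a prescribed node, then the coordinates of the free lines. The \<open>k\<close>-th point is
	\<open>(U, -1, 0)\<close> on a line \<open>(1, U, V)\<close> whose coordinate \<open>U\<close> is constant until the \<open>k\<close>-th parameter is released, or
	\<open>(V, 0, -1)\<close> in the case of \<open>V\<close>. The numbers of the start are a general choice.\<close>

definition one_triple_forms :: "(nat => complex) => nat => complex^3" where
	"one_triple_forms w = five (vec3 (w 0) (w 1) (w 2))
		(vec3 (w 3) (w 4) (w 5))
		(vec3 (w 6) (w 7) (w 8))
		(w 12 *s (vec3 (w 3) (w 4) (w 5)) + w 13 *s (vec3 (w 6) (w 7) (w 8)))
		(vec3 (w 9) (w 10) (w 11))"

definition one_triple_chart :: "(nat => complex) => nat => complex^3" where
	"one_triple_chart u = five (vec3 1 (u 5) (u 6))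
		(vec3 1 (u 3) (u 4))
		(vec3 1 (u 1) (u 2))
		((1 - u 0) *s (vec3 1 (u 3) (u 4)) + u 0 *s (vec3 1 (u 1) (u 2)))
		(vec3 1 (u 7) (u 8))"

definition one_triple_start :: "nat => complex" where
	"one_triple_start = (!) [4, - 3, 3, - 2, 5, 2, 2, 3, - 2, 1]"

definition one_triple_points :: "nat => complex^3" where
	"one_triple_points = (!) [vec3 (- 6) (- 1) (0), vec3 (- 3) (- 1) (0), vec3 (3) (0) (- 1), vec3 (- 2) (- 1) (0), vec3 (5) (0) (- 1), vec3 (2) (- 1) (0), vec3 (2) (0) (- 1), vec3 (3) (- 1) (0), vec3 (- 2) (0) (- 1)]"

lemma one_triple_open:
	assumes P: "\<And>i. i < 5 ==> polyvec N (\<lambda>u. A u i)"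
		and Z: "\<And>u. dt (A u 1) (A u 2) (A u 3) = 0"
	shows "lineopen {u. one_triple (A u)}"
proof -
	have "{u. one_triple (A u)} = {u. arr 5 (A u)} \<inter> {u. dt (A u 0) (A u 1) (A u 2) \<noteq> 0} \<inter> {u. dt (A u 1) (A u 2) (A u 4) \<noteq> 0} \<inter> {u. dt (A u 0) (A u 1) (A u 4) \<noteq> 0} \<inter> {u. dt (A u 0) (A u 2) (A u 4) \<noteq> 0} \<inter> {u. dt (A u 0) (A u 3) (A u 4) \<noteq> 0}" unfolding one_triple_def Z by auto
	moreover have "lineopen ({u. arr 5 (A u)} \<inter> {u. dt (A u 0) (A u 1) (A u 2) \<noteq> 0} \<inter> {u. dt (A u 1) (A u 2) (A u 4) \<noteq> 0} \<inter> {u. dt (A u 0) (A u 1) (A u 4) \<noteq> 0} \<inter> {u. dt (A u 0) (A u 2) (A u 4) \<noteq> 0} \<inter> {u. dt (A u 0) (A u 3) (A u 4) \<noteq> 0})"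
		by (intro lineopen_Int lineopen_arr[OF P] lineopen_dt[OF P P P]) simp_all
	ultimately show ?thesis by simp
qed

lemma one_triple_family: "irreducible_space (zar 5 (arrangements_tau 5 11)) \<and>
		krull_dim (zar 5 (arrangements_tau 5 11)) = 9"
proof -
	have "irreducible_space (zar 5 (arrangements_tau 5 11)) \<and>
		krull_dim (zar 5 (arrangements_tau 5 11)) = enat 9"
	proof (rule family_dimension[where T = one_triple and M = 14 and A = one_triple_forms and ?w0.0 = "\<lambda>_. 1" and n = 9 and B = one_triple_chart
				and ?u0.0 = one_triple_start and p = one_triple_points])
		show "proj_class f \<in> arrangements_tau 5 11 \<longleftrightarrow> shaped one_triple f" for f by (rule arrangements_tau_shapes)
		show "arrangements_tau 5 11 \<subseteq> range proj_class" unfolding arrangements_tau_def by blast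
		show "arr 5 a" if "one_triple a" for a using that by (simp add: one_triple_def)
		show "one_triple (\<lambda>i. s i *s a i)" if "one_triple a" "\<And>i. s i \<noteq> 0" for a s
			using that scale_arr(1)[of 5 a s] by (simp add: one_triple_def dt_scale)
		show "one_triple b" if "one_triple a" "\<And>i. i < 5 ==> a i = b i" for a b
			using that by (simp add: one_triple_def arr_def)
		show A: "polyvec 14 (\<lambda>w. one_triple_forms w i)" if "i < 5" for i
			unfolding one_triple_forms_def using that by (intro polyvec_five polyvec_comb polyvec_vec3 polymap_coord) simp_all
		show B: "polyvec (Suc 9) (\<lambda>u. one_triple_chart u i)" if "i < 5" for i
			unfolding one_triple_chart_def using that by (intro polyvec_five polyvec_comb polyvec_vec3 polymap_diff polymap_const polymap_coord) simp_all
		show "lineopen {w. one_triple (one_triple_forms w)}" by (rule one_triple_open[OF A]) (simp_all only: one_triple_forms_def five dt_comb)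
		show "lineopen {u. one_triple (one_triple_chart u)}" by (rule one_triple_open[OF B]) (simp_all only: one_triple_chart_def five dt_comb)
		show "\<exists>w. \<forall>i<5. one_triple_forms w i = a i" if a: "one_triple a" for a
		proof -
			note np = arrD(2)[OF a[unfolded one_triple_def, THEN conjunct1]]
			obtain s3 t3 where c3: "a 3 = s3 *s a 1 + t3 *s a 2"
				by (rule dependent_span[of "a 1" "a 2" "a 3"]) (use a in \<open>simp_all add: np one_triple_def\<close>)
			show ?thesis
				by (rule exI[of _ "(!) [a 0 $ 1, a 0 $ 2, a 0 $ 3, a 1 $ 1, a 1 $ 2, a 1 $ 3, a 2 $ 1, a 2 $ 2, a 2 $ 3, a 4 $ 1, a 4 $ 2, a 4 $ 3, s3, t3]"])
					(unfold all5 one_triple_forms_def, simp add: five vec3_nth_eq c3)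
		qed
		show "\<exists>u. \<forall>i<5. one_triple_forms w i = (one_triple_forms w i $ 1) *s one_triple_chart u i" if nz: "\<And>i. i < 5 ==> one_triple_forms w i $ 1 \<noteq> 0" for w
		proof -
			have n: "one_triple_forms w 0 $ 1 \<noteq> 0" "one_triple_forms w 1 $ 1 \<noteq> 0" "one_triple_forms w 2 $ 1 \<noteq> 0" "one_triple_forms w 3 $ 1 \<noteq> 0" "one_triple_forms w 4 $ 1 \<noteq> 0" by (rule nz; simp)+
			define u where "u = (!) [w 13 * w 6 / (w 12 * w 3 + w 13 * w 6), w 7 / w 6, w 8 / w 6, w 4 / w 3, w 5 / w 3, w 1 / w 0, w 2 / w 0, w 10 / w 9, w 11 / w 9]"
			have us: "u 0 = w 13 * w 6 / (w 12 * w 3 + w 13 * w 6)" "u 1 = w 7 / w 6" "u 2 = w 8 / w 6" "u 3 = w 4 / w 3" "u 4 = w 5 / w 3" "u 5 = w 1 / w 0" "u 6 = w 2 / w 0" "u 7 = w 10 / w 9" "u 8 = w 11 / w 9" by (simp_all add: u_def)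
			have "\<forall>i<5. one_triple_forms w i = (one_triple_forms w i $ 1) *s one_triple_chart u i"
				unfolding all5 one_triple_forms_def one_triple_chart_def five vec3_nth vector_add_component vector_smult_component us
				by (intro conjI chart_base chart_comb) (use n in \<open>simp_all add: five one_triple_forms_def\<close>)
			then show ?thesis by (rule exI[of _ u])
		qed
		show "one_triple_chart (u(9 := x)) i = one_triple_chart u i" for u x i by (simp add: one_triple_chart_def)
		show "one_triple_forms (\<lambda>_. 1) i $ 1 \<noteq> 0" if "i < 5" for i
		proof -
			have "\<forall>i<5. one_triple_forms (\<lambda>_. 1) i $ 1 \<noteq> 0" unfolding all5 by (simp add: five one_triple_forms_def)
			then show ?thesis using that by blast
		qed
		show "one_triple (one_triple_chart one_triple_start)" unfolding one_triple_def arr_def all5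
			by (simp add: five one_triple_chart_def one_triple_start_def vec3_eq_iff dt_expand)
		show "one_triple_start 9 \<noteq> 0" by (simp add: one_triple_start_def)
		fix k :: nat assume k: "k < 9"
		from k consider "k = 0" | "k = 1" | "k = 2" | "k = 3" | "k = 4" | "k = 5" | "k = 6" | "k = 7" | "k = 8" by linarith
		note cases = this
		show "\<exists>i<5. ev (one_triple_chart u i) (one_triple_points k) = 0" if e: "\<And>j. k \<le> j ==> u j = one_triple_start j" for u
			using cases by cases (rule exI[of _ "[3, 2, 2, 1, 1, 0, 0, 4, 4] ! k"],
				use e[of 0] e[of 1] e[of 2] e[of 3] e[of 4] e[of 5] e[of 6] e[of 7] e[of 8] in \<open>simp add: one_triple_chart_def one_triple_points_def one_triple_start_def ev_def\<close>)+
		show "\<exists>x. \<forall>i<5. ev (one_triple_chart (one_triple_start(k := x)) i) (one_triple_points k) \<noteq> 0"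
			unfolding all5
			using cases by cases (rule exI[of _ "[- 9, - 9, - 9, - 9, - 9, - 9, - 9, - 9, - 9] ! k"], simp add: one_triple_chart_def one_triple_points_def one_triple_start_def ev_def)+
	qed
	then show ?thesis by (simp add: numeral_eq_enat)
qed

subsection \<open>Two triple points\<close>

definition two_triple_forms :: "(nat => complex) => nat => complex^3" where
	"two_triple_forms w = five (vec3 (w 0) (w 1) (w 2))
		(vec3 (w 3) (w 4) (w 5))
		(w 9 *s (vec3 (w 0) (w 1) (w 2)) + w 10 *s (vec3 (w 3) (w 4) (w 5)))
		(vec3 (w 6) (w 7) (w 8))
		(w 11 *s (vec3 (w 0) (w 1) (w 2)) + w 12 *s (vec3 (w 6) (w 7) (w 8)))"

definition two_triple_chart :: "(nat => complex) => nat => complex^3" where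
	"two_triple_chart u = five (vec3 1 (u 6) (u 7))
		(vec3 1 (u 4) (u 5))
		((1 - u 0) *s (vec3 1 (u 6) (u 7)) + u 0 *s (vec3 1 (u 4) (u 5)))
		(vec3 1 (u 2) (u 3))
		((1 - u 1) *s (vec3 1 (u 6) (u 7)) + u 1 *s (vec3 1 (u 2) (u 3)))"

definition two_triple_start :: "nat => complex" where
	"two_triple_start = (!) [- 1, - 2, 4, - 2, 5, 2, - 1, - 3, 1]"

definition two_triple_points :: "nat => complex^3" where
	"two_triple_points = (!) [vec3 (- 7) (- 1) (0), vec3 (- 11) (- 1) (0), vec3 (4) (- 1) (0), vec3 (- 2) (0) (- 1), vec3 (5) (- 1) (0), vec3 (2) (0) (- 1), vec3 (- 1) (- 1) (0), vec3 (- 3) (0) (- 1)]"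

lemma two_triple_open:
	assumes P: "\<And>i. i < 5 ==> polyvec N (\<lambda>u. A u i)"
		and Z: "\<And>u. dt (A u 0) (A u 1) (A u 2) = 0" "\<And>u. dt (A u 0) (A u 3) (A u 4) = 0"
	shows "lineopen {u. two_triple (A u)}"
proof -
	have "{u. two_triple (A u)} = {u. arr 5 (A u)} \<inter> {u. dt (A u 1) (A u 2) (A u 3) \<noteq> 0}" unfolding two_triple_def Z by auto
	moreover have "lineopen ({u. arr 5 (A u)} \<inter> {u. dt (A u 1) (A u 2) (A u 3) \<noteq> 0})"
		by (intro lineopen_Int lineopen_arr[OF P] lineopen_dt[OF P P P]) simp_all
	ultimately show ?thesis by simp
qed

lemma two_triple_family: "irreducible_space (zar 5 (arrangements_tau 5 12)) \<and>
		krull_dim (zar 5 (arrangements_tau 5 12)) = 8"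
proof -
	have "irreducible_space (zar 5 (arrangements_tau 5 12)) \<and>
		krull_dim (zar 5 (arrangements_tau 5 12)) = enat 8"
	proof (rule family_dimension[where T = two_triple and M = 13 and A = two_triple_forms and ?w0.0 = "\<lambda>_. 1" and n = 8 and B = two_triple_chart
				and ?u0.0 = two_triple_start and p = two_triple_points])
		show "proj_class f \<in> arrangements_tau 5 12 \<longleftrightarrow> shaped two_triple f" for f by (rule arrangements_tau_shapes)
		show "arrangements_tau 5 12 \<subseteq> range proj_class" unfolding arrangements_tau_def by blast
		show "arr 5 a" if "two_triple a" for a using that by (simp add: two_triple_def)
		show "two_triple (\<lambda>i. s i *s a i)" if "two_triple a" "\<And>i. s i \<noteq> 0" for a s
			using that scale_arr(1)[of 5 a s] by (simp add: two_triple_def dt_scale)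
		show "two_triple b" if "two_triple a" "\<And>i. i < 5 ==> a i = b i" for a b
			using that by (simp add: two_triple_def arr_def)
		show A: "polyvec 13 (\<lambda>w. two_triple_forms w i)" if "i < 5" for i
			unfolding two_triple_forms_def using that by (intro polyvec_five polyvec_comb polyvec_vec3 polymap_coord) simp_all
		show B: "polyvec (Suc 8) (\<lambda>u. two_triple_chart u i)" if "i < 5" for i
			unfolding two_triple_chart_def using that by (intro polyvec_five polyvec_comb polyvec_vec3 polymap_diff polymap_const polymap_coord) simp_all
		show "lineopen {w. two_triple (two_triple_forms w)}" by (rule two_triple_open[OF A]) (simp_all only: two_triple_forms_def five dt_comb)
		show "lineopen {u. two_triple (two_triple_chart u)}" by (rule two_triple_open[OF B]) (simp_all only: two_triple_chart_def five dt_comb)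
		show "\<exists>w. \<forall>i<5. two_triple_forms w i = a i" if a: "two_triple a" for a
		proof -
			note np = arrD(2)[OF a[unfolded two_triple_def, THEN conjunct1]]
			obtain s2 t2 where c2: "a 2 = s2 *s a 0 + t2 *s a 1"
				by (rule dependent_span[of "a 0" "a 1" "a 2"]) (use a in \<open>simp_all add: np two_triple_def\<close>)
			obtain s4 t4 where c4: "a 4 = s4 *s a 0 + t4 *s a 3"
				by (rule dependent_span[of "a 0" "a 3" "a 4"]) (use a in \<open>simp_all add: np two_triple_def\<close>)
			show ?thesis
				by (rule exI[of _ "(!) [a 0 $ 1, a 0 $ 2, a 0 $ 3, a 1 $ 1, a 1 $ 2, a 1 $ 3, a 3 $ 1, a 3 $ 2, a 3 $ 3, s2, t2, s4, t4]"])
					(unfold all5 two_triple_forms_def, simp add: five vec3_nth_eq c2 c4)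
		qed
		show "\<exists>u. \<forall>i<5. two_triple_forms w i = (two_triple_forms w i $ 1) *s two_triple_chart u i" if nz: "\<And>i. i < 5 ==> two_triple_forms w i $ 1 \<noteq> 0" for w
		proof -
			have n: "two_triple_forms w 0 $ 1 \<noteq> 0" "two_triple_forms w 1 $ 1 \<noteq> 0" "two_triple_forms w 2 $ 1 \<noteq> 0" "two_triple_forms w 3 $ 1 \<noteq> 0" "two_triple_forms w 4 $ 1 \<noteq> 0" by (rule nz; simp)+
			define u where "u = (!) [w 10 * w 3 / (w 9 * w 0 + w 10 * w 3), w 12 * w 6 / (w 11 * w 0 + w 12 * w 6), w 7 / w 6, w 8 / w 6, w 4 / w 3, w 5 / w 3, w 1 / w 0, w 2 / w 0]"
			have us: "u 0 = w 10 * w 3 / (w 9 * w 0 + w 10 * w 3)" "u 1 = w 12 * w 6 / (w 11 * w 0 + w 12 * w 6)" "u 2 = w 7 / w 6" "u 3 = w 8 / w 6" "u 4 = w 4 / w 3" "u 5 = w 5 / w 3" "u 6 = w 1 / w 0" "u 7 = w 2 / w 0" by (simp_all add: u_def)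
			have "\<forall>i<5. two_triple_forms w i = (two_triple_forms w i $ 1) *s two_triple_chart u i"
				unfolding all5 two_triple_forms_def two_triple_chart_def five vec3_nth vector_add_component vector_smult_component us
				by (intro conjI chart_base chart_comb) (use n in \<open>simp_all add: five two_triple_forms_def\<close>)
			then show ?thesis by (rule exI[of _ u])
		qed
		show "two_triple_chart (u(8 := x)) i = two_triple_chart u i" for u x i by (simp add: two_triple_chart_def)
		show "two_triple_forms (\<lambda>_. 1) i $ 1 \<noteq> 0" if "i < 5" for i
		proof -
			have "\<forall>i<5. two_triple_forms (\<lambda>_. 1) i $ 1 \<noteq> 0" unfolding all5 by (simp add: five two_triple_forms_def)
			then show ?thesis using that by blast
		qed
		show "two_triple (two_triple_chart two_triple_start)" unfolding two_triple_def arr_def all5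
			by (simp add: five two_triple_chart_def two_triple_start_def vec3_eq_iff dt_expand)
		show "two_triple_start 8 \<noteq> 0" by (simp add: two_triple_start_def)
		fix k :: nat assume k: "k < 8"
		from k consider "k = 0" | "k = 1" | "k = 2" | "k = 3" | "k = 4" | "k = 5" | "k = 6" | "k = 7" by linarith
		note cases = this
		show "\<exists>i<5. ev (two_triple_chart u i) (two_triple_points k) = 0" if e: "\<And>j. k \<le> j ==> u j = two_triple_start j" for u
			using cases by cases (rule exI[of _ "[2, 4, 3, 3, 1, 1, 0, 0] ! k"],
				use e[of 0] e[of 1] e[of 2] e[of 3] e[of 4] e[of 5] e[of 6] e[of 7] in \<open>simp add: two_triple_chart_def two_triple_points_def two_triple_start_def ev_def\<close>)+
		show "\<exists>x. \<forall>i<5. ev (two_triple_chart (two_triple_start(k := x)) i) (two_triple_points k) \<noteq> 0"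
			unfolding all5
			using cases by cases (rule exI[of _ "[- 9, - 9, - 9, - 9, - 9, - 9, - 9, - 9] ! k"], simp add: two_triple_chart_def two_triple_points_def two_triple_start_def ev_def)+
	qed
	then show ?thesis by (simp add: numeral_eq_enat)
qed

subsection \<open>Near pencils\<close>

definition near_pencil_forms :: "(nat => complex) => nat => complex^3" where
	"near_pencil_forms w = five (vec3 (w 0) (w 1) (w 2))
		(vec3 (w 3) (w 4) (w 5))
		(vec3 (w 6) (w 7) (w 8))
		(w 9 *s (vec3 (w 3) (w 4) (w 5)) + w 10 *s (vec3 (w 6) (w 7) (w 8)))
		(w 11 *s (vec3 (w 3) (w 4) (w 5)) + w 12 *s (vec3 (w 6) (w 7) (w 8)))"

definition near_pencil_chart :: "(nat => complex) => nat => complex^3" where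
	"near_pencil_chart u = five (vec3 1 (u 6) (u 7))
		(vec3 1 (u 4) (u 5))
		(vec3 1 (u 2) (u 3))
		((1 - u 0) *s (vec3 1 (u 4) (u 5)) + u 0 *s (vec3 1 (u 2) (u 3)))
		((1 - u 1) *s (vec3 1 (u 4) (u 5)) + u 1 *s (vec3 1 (u 2) (u 3)))"

definition near_pencil_start :: "nat => complex" where
	"near_pencil_start = (!) [2, 3, 5, 4, - 2, - 1, - 1, 3, 1]"

definition near_pencil_points :: "nat => complex^3" where
	"near_pencil_points = (!) [vec3 (12) (- 1) (0), vec3 (19) (- 1) (0), vec3 (5) (- 1) (0), vec3 (4) (0) (- 1), vec3 (- 2) (- 1) (0), vec3 (- 1) (0) (- 1), vec3 (- 1) (- 1) (0), vec3 (3) (0) (- 1)]"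

lemma near_pencil_open:
	assumes P: "\<And>i. i < 5 ==> polyvec N (\<lambda>u. A u i)"
		and Z: "\<And>u. dt (A u 1) (A u 2) (A u 3) = 0" "\<And>u. dt (A u 1) (A u 2) (A u 4) = 0"
	shows "lineopen {u. near_pencil (A u)}"
proof -
	have "{u. near_pencil (A u)} = {u. arr 5 (A u)} \<inter> {u. dt (A u 0) (A u 1) (A u 2) \<noteq> 0}" unfolding near_pencil_def Z by auto
	moreover have "lineopen ({u. arr 5 (A u)} \<inter> {u. dt (A u 0) (A u 1) (A u 2) \<noteq> 0})"
		by (intro lineopen_Int lineopen_arr[OF P] lineopen_dt[OF P P P]) simp_all
	ultimately show ?thesis by simp
qed

lemma near_pencil_family: "irreducible_space (zar 5 (arrangements_tau 5 13)) \<and>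
		krull_dim (zar 5 (arrangements_tau 5 13)) = 8"
proof -
	have "irreducible_space (zar 5 (arrangements_tau 5 13)) \<and>
		krull_dim (zar 5 (arrangements_tau 5 13)) = enat 8"
	proof (rule family_dimension[where T = near_pencil and M = 13 and A = near_pencil_forms and ?w0.0 = "\<lambda>_. 1" and n = 8 and B = near_pencil_chart
				and ?u0.0 = near_pencil_start and p = near_pencil_points])
		show "proj_class f \<in> arrangements_tau 5 13 \<longleftrightarrow> shaped near_pencil f" for f by (rule arrangements_tau_shapes)
		show "arrangements_tau 5 13 \<subseteq> range proj_class" unfolding arrangements_tau_def by blast
		show "arr 5 a" if "near_pencil a" for a using that by (simp add: near_pencil_def)
		show "near_pencil (\<lambda>i. s i *s a i)" if "near_pencil a" "\<And>i. s i \<noteq> 0" for a s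
			using that scale_arr(1)[of 5 a s] by (simp add: near_pencil_def dt_scale)
		show "near_pencil b" if "near_pencil a" "\<And>i. i < 5 ==> a i = b i" for a b
			using that by (simp add: near_pencil_def arr_def)
		show A: "polyvec 13 (\<lambda>w. near_pencil_forms w i)" if "i < 5" for i
			unfolding near_pencil_forms_def using that by (intro polyvec_five polyvec_comb polyvec_vec3 polymap_coord) simp_all
		show B: "polyvec (Suc 8) (\<lambda>u. near_pencil_chart u i)" if "i < 5" for i
			unfolding near_pencil_chart_def using that by (intro polyvec_five polyvec_comb polyvec_vec3 polymap_diff polymap_const polymap_coord) simp_all
		show "lineopen {w. near_pencil (near_pencil_forms w)}" by (rule near_pencil_open[OF A]) (simp_all only: near_pencil_forms_def five dt_comb)
		show "lineopen {u. near_pencil (near_pencil_chart u)}" by (rule near_pencil_open[OF B]) (simp_all only: near_pencil_chart_def five dt_comb)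
		show "\<exists>w. \<forall>i<5. near_pencil_forms w i = a i" if a: "near_pencil a" for a
		proof -
			note np = arrD(2)[OF a[unfolded near_pencil_def, THEN conjunct1]]
			obtain s3 t3 where c3: "a 3 = s3 *s a 1 + t3 *s a 2"
				by (rule dependent_span[of "a 1" "a 2" "a 3"]) (use a in \<open>simp_all add: np near_pencil_def\<close>)
			obtain s4 t4 where c4: "a 4 = s4 *s a 1 + t4 *s a 2"
				by (rule dependent_span[of "a 1" "a 2" "a 4"]) (use a in \<open>simp_all add: np near_pencil_def\<close>)
			show ?thesis
				by (rule exI[of _ "(!) [a 0 $ 1, a 0 $ 2, a 0 $ 3, a 1 $ 1, a 1 $ 2, a 1 $ 3, a 2 $ 1, a 2 $ 2, a 2 $ 3, s3, t3, s4, t4]"])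
					(unfold all5 near_pencil_forms_def, simp add: five vec3_nth_eq c3 c4)
		qed
		show "\<exists>u. \<forall>i<5. near_pencil_forms w i = (near_pencil_forms w i $ 1) *s near_pencil_chart u i" if nz: "\<And>i. i < 5 ==> near_pencil_forms w i $ 1 \<noteq> 0" for w
		proof -
			have n: "near_pencil_forms w 0 $ 1 \<noteq> 0" "near_pencil_forms w 1 $ 1 \<noteq> 0" "near_pencil_forms w 2 $ 1 \<noteq> 0" "near_pencil_forms w 3 $ 1 \<noteq> 0" "near_pencil_forms w 4 $ 1 \<noteq> 0" by (rule nz; simp)+
			define u where "u = (!) [w 10 * w 6 / (w 9 * w 3 + w 10 * w 6), w 12 * w 6 / (w 11 * w 3 + w 12 * w 6), w 7 / w 6, w 8 / w 6, w 4 / w 3, w 5 / w 3, w 1 / w 0, w 2 / w 0]"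
			have us: "u 0 = w 10 * w 6 / (w 9 * w 3 + w 10 * w 6)" "u 1 = w 12 * w 6 / (w 11 * w 3 + w 12 * w 6)" "u 2 = w 7 / w 6" "u 3 = w 8 / w 6" "u 4 = w 4 / w 3" "u 5 = w 5 / w 3" "u 6 = w 1 / w 0" "u 7 = w 2 / w 0" by (simp_all add: u_def)
			have "\<forall>i<5. near_pencil_forms w i = (near_pencil_forms w i $ 1) *s near_pencil_chart u i"
				unfolding all5 near_pencil_forms_def near_pencil_chart_def five vec3_nth vector_add_component vector_smult_component us
				by (intro conjI chart_base chart_comb) (use n in \<open>simp_all add: five near_pencil_forms_def\<close>)
			then show ?thesis by (rule exI[of _ u])
		qed
		show "near_pencil_chart (u(8 := x)) i = near_pencil_chart u i" for u x i by (simp add: near_pencil_chart_def)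
		show "near_pencil_forms (\<lambda>_. 1) i $ 1 \<noteq> 0" if "i < 5" for i
		proof -
			have "\<forall>i<5. near_pencil_forms (\<lambda>_. 1) i $ 1 \<noteq> 0" unfolding all5 by (simp add: five near_pencil_forms_def)
			then show ?thesis using that by blast
		qed
		show "near_pencil (near_pencil_chart near_pencil_start)" unfolding near_pencil_def arr_def all5
			by (simp add: five near_pencil_chart_def near_pencil_start_def vec3_eq_iff dt_expand)
		show "near_pencil_start 8 \<noteq> 0" by (simp add: near_pencil_start_def)
		fix k :: nat assume k: "k < 8"
		from k consider "k = 0" | "k = 1" | "k = 2" | "k = 3" | "k = 4" | "k = 5" | "k = 6" | "k = 7" by linarith
		note cases = this
		show "\<exists>i<5. ev (near_pencil_chart u i) (near_pencil_points k) = 0" if e: "\<And>j. k \<le> j ==> u j = near_pencil_start j" for u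
			using cases by cases (rule exI[of _ "[3, 4, 2, 2, 1, 1, 0, 0] ! k"],
				use e[of 0] e[of 1] e[of 2] e[of 3] e[of 4] e[of 5] e[of 6] e[of 7] in \<open>simp add: near_pencil_chart_def near_pencil_points_def near_pencil_start_def ev_def\<close>)+
		show "\<exists>x. \<forall>i<5. ev (near_pencil_chart (near_pencil_start(k := x)) i) (near_pencil_points k) \<noteq> 0"
			unfolding all5
			using cases by cases (rule exI[of _ "[- 9, - 9, - 9, - 9, - 9, - 9, - 9, - 9] ! k"], simp add: near_pencil_chart_def near_pencil_points_def near_pencil_start_def ev_def)+
	qed
	then show ?thesis by (simp add: numeral_eq_enat)
qed

subsection \<open>Pencils\<close>

definition pencil_forms :: "(nat => complex) => nat => complex^3" where
	"pencil_forms w = five (vec3 (w 0) (w 1) (w 2))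
		(vec3 (w 3) (w 4) (w 5))
		(w 6 *s (vec3 (w 0) (w 1) (w 2)) + w 7 *s (vec3 (w 3) (w 4) (w 5)))
		(w 8 *s (vec3 (w 0) (w 1) (w 2)) + w 9 *s (vec3 (w 3) (w 4) (w 5)))
		(w 10 *s (vec3 (w 0) (w 1) (w 2)) + w 11 *s (vec3 (w 3) (w 4) (w 5)))"

definition pencil_chart :: "(nat => complex) => nat => complex^3" where
	"pencil_chart u = five (vec3 1 (u 5) (u 6))
		(vec3 1 (u 3) (u 4))
		((1 - u 0) *s (vec3 1 (u 5) (u 6)) + u 0 *s (vec3 1 (u 3) (u 4)))
		((1 - u 1) *s (vec3 1 (u 5) (u 6)) + u 1 *s (vec3 1 (u 3) (u 4)))
		((1 - u 2) *s (vec3 1 (u 5) (u 6)) + u 2 *s (vec3 1 (u 3) (u 4)))"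

definition pencil_start :: "nat => complex" where
	"pencil_start = (!) [2, 5, 3, 2, 3, 5, - 3, 1]"

definition pencil_points :: "nat => complex^3" where
	"pencil_points = (!) [vec3 (- 1) (- 1) (0), vec3 (- 10) (- 1) (0), vec3 (- 4) (- 1) (0), vec3 (2) (- 1) (0), vec3 (3) (0) (- 1), vec3 (5) (- 1) (0), vec3 (- 3) (0) (- 1)]"

lemma pencil_open:
	assumes P: "\<And>i. i < 5 ==> polyvec N (\<lambda>u. A u i)"
		and Z: "\<And>u. dt (A u 0) (A u 1) (A u 2) = 0" "\<And>u. dt (A u 0) (A u 1) (A u 3) = 0" "\<And>u. dt (A u 0) (A u 1) (A u 4) = 0"
	shows "lineopen {u. pencil (A u)}"
proof -
	have "{u. pencil (A u)} = {u. arr 5 (A u)}" unfolding pencil_def Z by auto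
	moreover have "lineopen ({u. arr 5 (A u)})"
		by (intro lineopen_Int lineopen_arr[OF P] lineopen_dt[OF P P P]) simp_all
	ultimately show ?thesis by simp
qed

lemma pencil_family: "irreducible_space (zar 5 (arrangements_tau 5 16)) \<and>
		krull_dim (zar 5 (arrangements_tau 5 16)) = 7"
proof -
	have "irreducible_space (zar 5 (arrangements_tau 5 16)) \<and>
		krull_dim (zar 5 (arrangements_tau 5 16)) = enat 7"
	proof (rule family_dimension[where T = pencil and M = 12 and A = pencil_forms and ?w0.0 = "\<lambda>_. 1" and n = 7 and B = pencil_chart
				and ?u0.0 = pencil_start and p = pencil_points])
		show "proj_class f \<in> arrangements_tau 5 16 \<longleftrightarrow> shaped pencil f" for f by (rule arrangements_tau_shapes)
		show "arrangements_tau 5 16 \<subseteq> range proj_class" unfolding arrangements_tau_def by blast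
		show "arr 5 a" if "pencil a" for a using that by (simp add: pencil_def)
		show "pencil (\<lambda>i. s i *s a i)" if "pencil a" "\<And>i. s i \<noteq> 0" for a s
			using that scale_arr(1)[of 5 a s] by (simp add: pencil_def dt_scale)
		show "pencil b" if "pencil a" "\<And>i. i < 5 ==> a i = b i" for a b
			using that by (simp add: pencil_def arr_def)
		show A: "polyvec 12 (\<lambda>w. pencil_forms w i)" if "i < 5" for i
			unfolding pencil_forms_def using that by (intro polyvec_five polyvec_comb polyvec_vec3 polymap_coord) simp_all
		show B: "polyvec (Suc 7) (\<lambda>u. pencil_chart u i)" if "i < 5" for i
			unfolding pencil_chart_def using that by (intro polyvec_five polyvec_comb polyvec_vec3 polymap_diff polymap_const polymap_coord) simp_all
		show "lineopen {w. pencil (pencil_forms w)}" by (rule pencil_open[OF A]) (simp_all only: pencil_forms_def five dt_comb)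
		show "lineopen {u. pencil (pencil_chart u)}" by (rule pencil_open[OF B]) (simp_all only: pencil_chart_def five dt_comb)
		show "\<exists>w. \<forall>i<5. pencil_forms w i = a i" if a: "pencil a" for a
		proof -
			note np = arrD(2)[OF a[unfolded pencil_def, THEN conjunct1]]
			obtain s2 t2 where c2: "a 2 = s2 *s a 0 + t2 *s a 1"
				by (rule dependent_span[of "a 0" "a 1" "a 2"]) (use a in \<open>simp_all add: np pencil_def\<close>)
			obtain s3 t3 where c3: "a 3 = s3 *s a 0 + t3 *s a 1"
				by (rule dependent_span[of "a 0" "a 1" "a 3"]) (use a in \<open>simp_all add: np pencil_def\<close>)
			obtain s4 t4 where c4: "a 4 = s4 *s a 0 + t4 *s a 1"
				by (rule dependent_span[of "a 0" "a 1" "a 4"]) (use a in \<open>simp_all add: np pencil_def\<close>)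
			show ?thesis
				by (rule exI[of _ "(!) [a 0 $ 1, a 0 $ 2, a 0 $ 3, a 1 $ 1, a 1 $ 2, a 1 $ 3, s2, t2, s3, t3, s4, t4]"])
					(unfold all5 pencil_forms_def, simp add: five vec3_nth_eq c2 c3 c4)
		qed
		show "\<exists>u. \<forall>i<5. pencil_forms w i = (pencil_forms w i $ 1) *s pencil_chart u i" if nz: "\<And>i. i < 5 ==> pencil_forms w i $ 1 \<noteq> 0" for w
		proof -
			have n: "pencil_forms w 0 $ 1 \<noteq> 0" "pencil_forms w 1 $ 1 \<noteq> 0" "pencil_forms w 2 $ 1 \<noteq> 0" "pencil_forms w 3 $ 1 \<noteq> 0" "pencil_forms w 4 $ 1 \<noteq> 0" by (rule nz; simp)+
			define u where "u = (!) [w 7 * w 3 / (w 6 * w 0 + w 7 * w 3), w 9 * w 3 / (w 8 * w 0 + w 9 * w 3), w 11 * w 3 / (w 10 * w 0 + w 11 * w 3), w 4 / w 3, w 5 / w 3, w 1 / w 0, w 2 / w 0]"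
			have us: "u 0 = w 7 * w 3 / (w 6 * w 0 + w 7 * w 3)" "u 1 = w 9 * w 3 / (w 8 * w 0 + w 9 * w 3)" "u 2 = w 11 * w 3 / (w 10 * w 0 + w 11 * w 3)" "u 3 = w 4 / w 3" "u 4 = w 5 / w 3" "u 5 = w 1 / w 0" "u 6 = w 2 / w 0" by (simp_all add: u_def)
			have "\<forall>i<5. pencil_forms w i = (pencil_forms w i $ 1) *s pencil_chart u i"
				unfolding all5 pencil_forms_def pencil_chart_def five vec3_nth vector_add_component vector_smult_component us
				by (intro conjI chart_base chart_comb) (use n in \<open>simp_all add: five pencil_forms_def\<close>)
			then show ?thesis by (rule exI[of _ u])
		qed
		show "pencil_chart (u(7 := x)) i = pencil_chart u i" for u x i by (simp add: pencil_chart_def)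
		show "pencil_forms (\<lambda>_. 1) i $ 1 \<noteq> 0" if "i < 5" for i
		proof -
			have "\<forall>i<5. pencil_forms (\<lambda>_. 1) i $ 1 \<noteq> 0" unfolding all5 by (simp add: five pencil_forms_def)
			then show ?thesis using that by blast
		qed
		show "pencil (pencil_chart pencil_start)" unfolding pencil_def arr_def all5
			by (simp add: five pencil_chart_def pencil_start_def vec3_eq_iff dt_expand)
		show "pencil_start 7 \<noteq> 0" by (simp add: pencil_start_def)
		fix k :: nat assume k: "k < 7"
		from k consider "k = 0" | "k = 1" | "k = 2" | "k = 3" | "k = 4" | "k = 5" | "k = 6" by linarith
		note cases = this
		show "\<exists>i<5. ev (pencil_chart u i) (pencil_points k) = 0" if e: "\<And>j. k \<le> j ==> u j = pencil_start j" for u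
			using cases by cases (rule exI[of _ "[2, 3, 4, 1, 1, 0, 0] ! k"],
				use e[of 0] e[of 1] e[of 2] e[of 3] e[of 4] e[of 5] e[of 6] in \<open>simp add: pencil_chart_def pencil_points_def pencil_start_def ev_def\<close>)+
		show "\<exists>x. \<forall>i<5. ev (pencil_chart (pencil_start(k := x)) i) (pencil_points k) \<noteq> 0"
			unfolding all5
			using cases by cases (rule exI[of _ "[- 9, - 9, - 9, - 9, - 9, - 9, - 9] ! k"], simp add: pencil_chart_def pencil_points_def pencil_start_def ev_def)+
	qed
	then show ?thesis by (simp add: numeral_eq_enat)
qed

section \<open>The classification theorem\<close>

theorem proposition5p4:
	shows
		"\<comment> \<open>the list is complete\<close>
		 (\<forall>f. proj_class f \<in> arrangements 5 \<and>
				((\<exists>d1 d2. free_arrangement d1 d2 f) \<or> (\<exists>d1 d2. nearly_free_arrangement 5 d1 d2 f)) -->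
				proj_class f \<in> arrangements_tau 5 11 \<union> arrangements_tau 5 12 \<union> arrangements_tau 5 13 \<union> arrangements_tau 5 16) \<and>
		 \<comment> \<open>(1)\<close>
		 (irreducible_space (subtopology (zariski 5) (arrangements_tau 5 11)) \<and>
			krull_dim (subtopology (zariski 5) (arrangements_tau 5 11)) = 9 \<and>
			(\<forall>f. proj_class f \<in> arrangements_tau 5 11 -->
				 nearly_free_arrangement 5 2 3 f \<and> milnor_st f = 6 \<and> milnor_reg f = 5)) \<and>
		 \<comment> \<open>(2)\<close>
		 (irreducible_space (subtopology (zariski 5) (arrangements_tau 5 12)) \<and>
			krull_dim (subtopology (zariski 5) (arrangements_tau 5 12)) = 8 \<and>
			(\<forall>f. proj_class f \<in> arrangements_tau 5 12 -->
				 free_arrangement 2 2 f \<and> milnor_st f = 4 \<and> milnor_reg f = 4)) \<and>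
		 \<comment> \<open>(3)\<close>
		 (irreducible_space (subtopology (zariski 5) (arrangements_tau 5 13)) \<and>
			krull_dim (subtopology (zariski 5) (arrangements_tau 5 13)) = 8 \<and>
			(\<forall>f. proj_class f \<in> arrangements_tau 5 13 -->
				 free_arrangement 1 3 f \<and> milnor_st f = 5 \<and> milnor_reg f = 5)) \<and>
		 \<comment> \<open>(4)\<close>
		 (irreducible_space (subtopology (zariski 5) (arrangements_tau 5 16)) \<and>
			krull_dim (subtopology (zariski 5) (arrangements_tau 5 16)) = 7 \<and>
			(\<forall>f. proj_class f \<in> arrangements_tau 5 16 -->
				 free_arrangement 0 4 f \<and> milnor_st f = 6 \<and> milnor_reg f = 6))"
proof -
	have list: "proj_class f \<in> arrangements_tau 5 11 \<union> arrangements_tau 5 12 \<union> arrangements_tau 5 13 \<union> arrangements_tau 5 16"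
		if "proj_class f \<in> arrangements 5" "(\<exists>d1 d2. free_arrangement d1 d2 f) \<or> (\<exists>d1 d2. nearly_free_arrangement 5 d1 d2 f)" for f
	proof -
		have "\<not> shaped no_triple f" using that(2) shaped_invariants(5)[of f] by blast
		then show ?thesis
			using that(1) unfolding proj_class_arrangements arrangement_shapes Un_iff arrangements_tau_shapes by blast
	qed
	show ?thesis
		using list one_triple_family two_triple_family near_pencil_family pencil_family
			shaped_invariants(1-4) arrangements_tau_shapes by simp
qed

end
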